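(* Let $Q$ be a connected linear algebraic group over $\mathbb C$ with Lie algebra $\mathfrak q$. Suppose that $\mathfrak q=\mathfrak q(0)\ltimes\mathfrak a$ is a semi-direct product of an Abelian ideal $\mathfrak a$ consisting of nilpotent elements and a Lie subalgebra $\mathfrak q(0)$. Assume further that the centre of $\mathfrak q$ consists of semisimple elements. Let $Q(0)$ be the connected subgroup of $Q$ with Lie algebra $\mathfrak q(0)$. Then $\mathfrak q$ is quasi-reductive if and only if the action of $Q(0)$ on $\mathfrak a^*$ has an open orbit and, for generic $\gamma\in\mathfrak a^*$, the stabiliser $\mathfrak q(0)_\gamma$ is strongly quasi-reductive. Moreover, if $\mathfrak q$ is quasi-reductive, then $M_*(\mathfrak q)$ coincides with $M_*(\mathfrak q(0)_\gamma)$ (for generic $\gamma$).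
   Context: Let $Z$ be the centre of $Q$. For $\beta\in\mathfrak q^*$ let $Q_\beta$, $\mathfrak q_\beta$ be the stabilisers for the coadjoint action. $\beta$ is of reductive type if $Q_\beta/Z$ is a reductive subgroup of $GL(\mathfrak q)$, and of nilpotent type if $\beta(\mathfrak q_\beta)=0$. $\mathfrak q$ is quasi-reductive if it has a linear form of reductive type, and strongly quasi-reductive if in addition $\mathrm{Lie}\,Z$ consists of semisimple elements. If $\mathfrak q$ is strongly quasi-reductive, the linear forms that are both of reductive and of nilpotent type form one single coadjoint orbit $Q\beta$; the Lie algebra $\mathfrak q_\beta$ of such a stabiliser (the "maximal reductive stabiliser"), defined up to conjugation by $Q$, is denoted $M_*(\mathfrak q)$. $\mathfrak q(0)_\gamma$ is the stabiliser of $\gamma\in\mathfrak a^*$ for the natural action of $\mathfrak q(0)$ on $\mathfrak a^*$. "Coincides" means: as conjugacy classes up to the ambient group, i.e. a representative of $M_*(\mathfrak q(0)_\gamma)\subset\mathfrak q(0)_\gamma$ is, up to conjugation (and isomorphism of Lie algebras), a representative of $M_*(\mathfrak q)$. *)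

theory Defs
  imports "HOL-Analysis.Analysis" "HOL-Algebra.Coset"
begin

section \<open>Zariski topologies\<close>

inductive_set polys :: "('x \<Rightarrow> complex) set \<Rightarrow> ('x \<Rightarrow> complex) set"
  for F :: "('x \<Rightarrow> complex) set" where
  polys_const: "(\<lambda>_. c) \<in> polys F"
| polys_coord: "f \<in> F \<Longrightarrow> f \<in> polys F"
| polys_add: "p \<in> polys F \<Longrightarrow> q \<in> polys F \<Longrightarrow> (\<lambda>x. p x + q x) \<in> polys F"
| polys_mult: "p \<in> polys F \<Longrightarrow> q \<in> polys F \<Longrightarrow> (\<lambda>x. p x * q x) \<in> polys F"

text \<open>The topology on \<open>S\<close> whose closed sets are the loci in \<open>S\<close> of common zeros of
  polynomials in the coordinate functions \<open>F\<close>.\<close>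

definition zariski :: "'x set \<Rightarrow> ('x \<Rightarrow> complex) set \<Rightarrow> 'x topology" where
  "zariski S F = topology (\<lambda>U. \<exists>P \<subseteq> polys F. U = {x \<in> S. \<exists>p\<in>P. p x \<noteq> 0})"

lemma istopology_zariski:
  "istopology (\<lambda>U. \<exists>P \<subseteq> polys F. U = {x \<in> S. \<exists>p\<in>P. p x \<noteq> 0})"
  unfolding istopology_def
proof (intro conjI allI impI)
  fix U V
  assume "\<exists>P \<subseteq> polys F. U = {x \<in> S. \<exists>p\<in>P. p x \<noteq> 0}"
    and "\<exists>P \<subseteq> polys F. V = {x \<in> S. \<exists>p\<in>P. p x \<noteq> 0}"
  then obtain P P' where P: "P \<subseteq> polys F" "U = {x \<in> S. \<exists>p\<in>P. p x \<noteq> 0}"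
    and P': "P' \<subseteq> polys F" "V = {x \<in> S. \<exists>p\<in>P'. p x \<noteq> 0}"
    by blast
  let ?R = "{(\<lambda>x. p x * q x) | p q. p \<in> P \<and> q \<in> P'}"
  have "?R \<subseteq> polys F" using P(1) P'(1) by (auto intro: polys_mult)
  moreover have "U \<inter> V = {x \<in> S. \<exists>r\<in>?R. r x \<noteq> 0}"
    unfolding P(2) P'(2) by fastforce
  ultimately show "\<exists>P \<subseteq> polys F. U \<inter> V = {x \<in> S. \<exists>p\<in>P. p x \<noteq> 0}" by blast
next
  fix \<U>
  assume *: "\<forall>U\<in>\<U>. \<exists>P \<subseteq> polys F. U = {x \<in> S. \<exists>p\<in>P. p x \<noteq> 0}"
  let ?P = "{p \<in> polys F. \<forall>x\<in>S. p x \<noteq> 0 \<longrightarrow> x \<in> \<Union>\<U>}"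
  have "x \<in> S \<and> (\<exists>p\<in>?P. p x \<noteq> 0)" if "x \<in> \<Union>\<U>" for x
  proof -
    from that obtain U where U: "U \<in> \<U>" "x \<in> U" by blast
    with * obtain P where P: "P \<subseteq> polys F" "U = {x \<in> S. \<exists>p\<in>P. p x \<noteq> 0}" by blast
    with U obtain p where p: "x \<in> S" "p \<in> P" "p x \<noteq> 0" by blast
    have "y \<in> \<Union>\<U>" if "y \<in> S" "p y \<noteq> 0" for y
      using that U(1) P(2) p(2) by blast
    with p P(1) show ?thesis by blast
  qed
  then have "\<Union>\<U> = {x \<in> S. \<exists>p\<in>?P. p x \<noteq> 0}" by blast
  then show "\<exists>P \<subseteq> polys F. \<Union>\<U> = {x \<in> S. \<exists>p\<in>P. p x \<noteq> 0}"
    by (intro exI[of _ ?P] conjI) (blast, assumption)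
qed

lemma openin_zariski:
  "openin (zariski S F) U \<longleftrightarrow> (\<exists>P \<subseteq> polys F. U = {x \<in> S. \<exists>p\<in>P. p x \<noteq> 0})"
  by (simp add: zariski_def istopology_zariski topology_inverse')


section \<open>Complex matrices and subspaces of them\<close>

definition cscale :: "complex \<Rightarrow> complex^'n^'n \<Rightarrow> complex^'n^'n" where
  "cscale c A = (\<chi> i j. c * A $ i $ j)"

interpretation cmat: vector_space "cscale :: complex \<Rightarrow> complex^'n^'n \<Rightarrow> complex^'n^'n"
  by unfold_locales (simp_all add: cscale_def vec_eq_iff algebra_simps)

definition nilpotent_mat :: "complex^'n^'n \<Rightarrow> bool" where
  "nilpotent_mat X \<longleftrightarrow> (\<exists>k. (((**) X) ^^ k) (mat 1) = 0)"

definition semisimple_mat :: "complex^'n^'n \<Rightarrow> bool" where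
  "semisimple_mat X \<longleftrightarrow>
     (\<exists>P::complex^'n^'n. invertible P \<and> (\<forall>i j. i \<noteq> j \<longrightarrow> (matrix_inv P ** X ** P) $ i $ j = 0))"

text \<open>Maps defined on a subspace \<open>V\<close> are represented by functions that are \<open>0\<close> outside \<open>V\<close>,
  so that two of them are equal iff they agree on \<open>V\<close>.\<close>

definition zero_ext :: "(complex^'n^'n) set \<Rightarrow> (complex^'n^'n \<Rightarrow> 'b::zero) \<Rightarrow> complex^'n^'n \<Rightarrow> 'b" where
  "zero_ext V f = (\<lambda>X. if X \<in> V then f X else 0)"

definition clinear_on ::
  "(complex^'n^'n) set \<Rightarrow> (complex \<Rightarrow> 'b \<Rightarrow> 'b) \<Rightarrow> (complex^'n^'n \<Rightarrow> 'b::ab_group_add) \<Rightarrow> bool" where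
  "clinear_on V sc f \<longleftrightarrow>
     (\<forall>X\<in>V. \<forall>Y\<in>V. f (X + Y) = f X + f Y) \<and> (\<forall>c. \<forall>X\<in>V. f (cscale c X) = sc c (f X))"

definition dual :: "(complex^'n^'n) set \<Rightarrow> (complex^'n^'n \<Rightarrow> complex) set" where
  "dual V = {\<beta>. clinear_on V (*) \<beta> \<and> zero_ext V \<beta> = \<beta>}"

definition zariski_dual :: "(complex^'n^'n) set \<Rightarrow> (complex^'n^'n \<Rightarrow> complex) topology" where
  "zariski_dual V = zariski (dual V) ((\<lambda>X \<gamma>. \<gamma> X) ` V)"

text \<open>A property holds for generic points of \<open>V\<^sup>*\<close> if it holds on a nonempty (hence dense)
  Zariski open subset.\<close>

definition generic_in_dual ::
  "(complex^'n^'n) set \<Rightarrow> ((complex^'n^'n \<Rightarrow> complex) \<Rightarrow> bool) \<Rightarrow> bool" where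
  "generic_in_dual V P \<longleftrightarrow> (\<exists>U. openin (zariski_dual V) U \<and> U \<noteq> {} \<and> (\<forall>\<gamma>\<in>U. P \<gamma>))"


section \<open>Linear algebraic groups and their Lie algebras\<close>

definition GLn :: "(complex^'n^'n) monoid" where
  "GLn = \<lparr>carrier = {A. invertible A}, mult = (**), one = mat 1\<rparr>"

lemma group_GLn: "group (GLn :: (complex^'n^'n) monoid)"
proof (rule groupI)
  fix A :: "complex^'n^'n" assume "A \<in> carrier GLn"
  then show "\<exists>B\<in>carrier GLn. B \<otimes>\<^bsub>GLn\<^esub> A = \<one>\<^bsub>GLn\<^esub>"
    unfolding GLn_def invertible_def by auto
next
  have "invertible (mat 1 :: complex^'n^'n)"
    unfolding invertible_def by (rule exI[of _ "mat 1"]) simp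
  then show "\<one>\<^bsub>GLn\<^esub> \<in> carrier (GLn :: (complex^'n^'n) monoid)"
    by (simp add: GLn_def)
qed (simp_all add: GLn_def invertible_mult matrix_mul_assoc)

definition entries :: "(complex^'n^'n \<Rightarrow> complex) set" where
  "entries = {(\<lambda>A. A $ i $ j) | i j. True}"

definition zariski_GLn :: "(complex^'n^'n) topology" where
  "zariski_GLn = zariski (carrier GLn) entries"

text \<open>A linear algebraic group is a Zariski closed subgroup of \<open>GL\<^sub>n\<close>.\<close>

definition connected_algebraic_group :: "(complex^'n^'n) set \<Rightarrow> bool" where
  "connected_algebraic_group Q \<longleftrightarrow>
     subgroup Q GLn \<and> closedin zariski_GLn Q \<and> connectedin zariski_GLn Q"

text \<open>The tangent space at the identity: all \<open>X\<close> such that the derivative at the identity, in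
  direction \<open>X\<close>, of every polynomial vanishing on \<open>G\<close> is zero.\<close>

definition lie_algebra :: "(complex^'n^'n) set \<Rightarrow> (complex^'n^'n) set" where
  "lie_algebra G = {X. \<forall>p\<in>polys entries. (\<forall>A\<in>G. p A = 0) \<longrightarrow>
     ((\<lambda>t. p (mat 1 + cscale t X)) has_field_derivative 0) (at 0)}"

definition bracket :: "complex^'n^'n \<Rightarrow> complex^'n^'n \<Rightarrow> complex^'n^'n" where
  "bracket X Y = X ** Y - Y ** X"

definition lie_subalgebra :: "(complex^'n^'n) set \<Rightarrow> (complex^'n^'n) set \<Rightarrow> bool" where
  "lie_subalgebra \<hh> \<qq> \<longleftrightarrow> cmat.subspace \<hh> \<and> \<hh> \<subseteq> \<qq> \<and> (\<forall>X\<in>\<hh>. \<forall>Y\<in>\<hh>. bracket X Y \<in> \<hh>)"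

definition abelian_ideal :: "(complex^'n^'n) set \<Rightarrow> (complex^'n^'n) set \<Rightarrow> bool" where
  "abelian_ideal \<aa> \<qq> \<longleftrightarrow> cmat.subspace \<aa> \<and> \<aa> \<subseteq> \<qq> \<and>
     (\<forall>X\<in>\<qq>. \<forall>Y\<in>\<aa>. bracket X Y \<in> \<aa>) \<and> (\<forall>X\<in>\<aa>. \<forall>Y\<in>\<aa>. bracket X Y = 0)"

definition semidirect :: "(complex^'n^'n) set \<Rightarrow> (complex^'n^'n) set \<Rightarrow> (complex^'n^'n) set \<Rightarrow> bool" where
  "semidirect \<qq> \<hh> \<aa> \<longleftrightarrow> lie_subalgebra \<hh> \<qq> \<and> abelian_ideal \<aa> \<qq> \<and>
     \<hh> \<inter> \<aa> = {0} \<and> \<qq> = {X + Y | X Y. X \<in> \<hh> \<and> Y \<in> \<aa>}"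

definition lie_centre :: "(complex^'n^'n) set \<Rightarrow> (complex^'n^'n) set" where
  "lie_centre \<qq> = {X \<in> \<qq>. \<forall>Y\<in>\<qq>. bracket X Y = 0}"

definition group_centre :: "(complex^'n^'n) set \<Rightarrow> (complex^'n^'n) set" where
  "group_centre Q = {z \<in> Q. \<forall>g\<in>Q. z ** g = g ** z}"


section \<open>Actions on dual spaces\<close>

definition Ad :: "complex^'n^'n \<Rightarrow> complex^'n^'n \<Rightarrow> complex^'n^'n" where
  "Ad g X = g ** X ** matrix_inv g"

text \<open>The contragredient action on \<open>V\<^sup>*\<close> of a group normalising \<open>V\<close>: the coadjoint action if \<open>V\<close>
  is the Lie algebra of the group.\<close>

definition dual_act ::
  "(complex^'n^'n) set \<Rightarrow> complex^'n^'n \<Rightarrow> (complex^'n^'n \<Rightarrow> complex) \<Rightarrow> complex^'n^'n \<Rightarrow> complex" where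
  "dual_act V g \<beta> = zero_ext V (\<lambda>X. \<beta> (Ad (matrix_inv g) X))"

definition dual_orbit ::
  "(complex^'n^'n) set \<Rightarrow> (complex^'n^'n) set \<Rightarrow> (complex^'n^'n \<Rightarrow> complex) \<Rightarrow> (complex^'n^'n \<Rightarrow> complex) set" where
  "dual_orbit H V \<beta> = (\<lambda>g. dual_act V g \<beta>) ` H"

definition group_stab ::
  "(complex^'n^'n) set \<Rightarrow> (complex^'n^'n) set \<Rightarrow> (complex^'n^'n \<Rightarrow> complex) \<Rightarrow> (complex^'n^'n) set" where
  "group_stab H V \<beta> = {g \<in> H. dual_act V g \<beta> = \<beta>}"

definition lie_stab ::
  "(complex^'n^'n) set \<Rightarrow> (complex^'n^'n) set \<Rightarrow> (complex^'n^'n \<Rightarrow> complex) \<Rightarrow> (complex^'n^'n) set" where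
  "lie_stab \<hh> V \<beta> = {X \<in> \<hh>. \<forall>Y\<in>V. \<beta> (bracket X Y) = 0}"


section \<open>Reductive subgroups of \<open>GL(V)\<close>\<close>

definition GL :: "(complex^'n^'n) set \<Rightarrow> (complex^'n^'n \<Rightarrow> complex^'n^'n) monoid" where
  "GL V = \<lparr>carrier = {\<phi>. clinear_on V cscale \<phi> \<and> bij_betw \<phi> V V \<and> zero_ext V \<phi> = \<phi>},
           mult = (\<circ>), one = zero_ext V id\<rparr>"

lemma group_GL:
  fixes V :: "(complex^'n^'n) set"
  assumes V: "cmat.subspace V"
  shows "group (GL V)"
proof (rule groupI)
  note sub = cmat.subspace_add[OF V] cmat.subspace_scale[OF V] cmat.subspace_0[OF V]
  show "\<one>\<^bsub>GL V\<^esub> \<in> carrier (GL V)"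
    using sub by (auto simp: GL_def clinear_on_def zero_ext_def bij_betw_def inj_on_def)
  fix \<phi> assume "\<phi> \<in> carrier (GL V)"
  then have lin: "clinear_on V cscale \<phi>" and bij: "bij_betw \<phi> V V" and ext: "\<And>x. x \<notin> V \<Longrightarrow> \<phi> x = 0"
    by (simp_all add: GL_def zero_ext_def fun_eq_iff) metis
  have im: "\<And>x. x \<in> V \<Longrightarrow> \<phi> x \<in> V" using bij by (auto simp: bij_betw_def)
  have \<phi>0: "\<phi> 0 = 0"
  proof -
    have "\<phi> (0 + 0) = \<phi> 0 + \<phi> 0" using lin sub(3) unfolding clinear_on_def by blast
    then show ?thesis by simp
  qed
  show "\<one>\<^bsub>GL V\<^esub> \<otimes>\<^bsub>GL V\<^esub> \<phi> = \<phi>"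
    using im ext sub(3) by (auto simp: GL_def zero_ext_def fun_eq_iff)
  {
    fix \<psi> assume "\<psi> \<in> carrier (GL V)"
    then have lin': "clinear_on V cscale \<psi>" and bij': "bij_betw \<psi> V V"
      and ext': "\<And>x. x \<notin> V \<Longrightarrow> \<psi> x = 0"
      by (simp_all add: GL_def zero_ext_def fun_eq_iff) metis
    have im': "\<And>x. x \<in> V \<Longrightarrow> \<psi> x \<in> V" using bij' by (auto simp: bij_betw_def)
    show "\<phi> \<otimes>\<^bsub>GL V\<^esub> \<psi> \<in> carrier (GL V)"
      using lin lin' im' ext' \<phi>0 bij_betw_trans[OF bij' bij]
      by (auto simp: GL_def zero_ext_def fun_eq_iff clinear_on_def)
  }
  let ?\<psi> = "zero_ext V (inv_into V \<phi>)"
  have inv: "\<And>x. x \<in> V \<Longrightarrow> inv_into V \<phi> x \<in> V" "\<And>x. x \<in> V \<Longrightarrow> \<phi> (inv_into V \<phi> x) = x"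
    using bij by (auto simp: bij_betw_def inv_into_into f_inv_into_f)
  have inv': "\<And>x. x \<in> V \<Longrightarrow> inv_into V \<phi> (\<phi> x) = x"
    using bij by (auto simp: bij_betw_def)
  have add: "inv_into V \<phi> (x + y) = inv_into V \<phi> x + inv_into V \<phi> y" if "x \<in> V" "y \<in> V" for x y
  proof -
    have "\<phi> (inv_into V \<phi> x + inv_into V \<phi> y) = x + y"
      using lin inv that by (simp add: clinear_on_def)
    then show ?thesis using inv'[of "inv_into V \<phi> x + inv_into V \<phi> y"] sub(1) inv(1) that by simp
  qed
  have scale: "inv_into V \<phi> (cscale c x) = cscale c (inv_into V \<phi> x)" if "x \<in> V" for x c
  proof -
    have "\<phi> (cscale c (inv_into V \<phi> x)) = cscale c x"
      using lin inv that by (simp add: clinear_on_def)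
    then show ?thesis using inv'[of "cscale c (inv_into V \<phi> x)"] sub(2) inv(1) that by simp
  qed
  have bij2: "bij_betw ?\<psi> V V"
    using bij_betw_inv_into[OF bij] by (rule bij_betw_cong[THEN iffD1, rotated]) (simp add: zero_ext_def)
  have "?\<psi> \<in> carrier (GL V)"
    using add scale bij2 sub by (auto simp: GL_def clinear_on_def zero_ext_def)
  moreover have "?\<psi> \<otimes>\<^bsub>GL V\<^esub> \<phi> = \<one>\<^bsub>GL V\<^esub>"
    using inv' im ext inv'[OF sub(3)] \<phi>0 sub(3) by (auto simp: GL_def zero_ext_def fun_eq_iff)
  ultimately show "\<exists>\<psi>\<in>carrier (GL V). \<psi> \<otimes>\<^bsub>GL V\<^esub> \<phi> = \<one>\<^bsub>GL V\<^esub>" by blast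
qed (auto simp: GL_def)

definition zariski_GL :: "(complex^'n^'n) set \<Rightarrow> (complex^'n^'n \<Rightarrow> complex^'n^'n) topology" where
  "zariski_GL V = zariski (carrier (GL V)) {(\<lambda>\<phi>. f (\<phi> v)) | f v. f \<in> dual V \<and> v \<in> V}"

definition unipotent_on :: "(complex^'n^'n) set \<Rightarrow> (complex^'n^'n \<Rightarrow> complex^'n^'n) \<Rightarrow> bool" where
  "unipotent_on V \<phi> \<longleftrightarrow> (\<exists>k. \<forall>v\<in>V. ((\<lambda>x. \<phi> x - x) ^^ k) v = 0)"

text \<open>Reductive means trivial unipotent radical; the group need not be connected.\<close>

definition reductive_subgroup ::
  "(complex^'n^'n) set \<Rightarrow> (complex^'n^'n \<Rightarrow> complex^'n^'n) set \<Rightarrow> bool" where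
  "reductive_subgroup V H \<longleftrightarrow> subgroup H (GL V) \<and> closedin (zariski_GL V) H \<and>
     (\<forall>N. N \<lhd> (GL V)\<lparr>carrier := H\<rparr> \<and> closedin (zariski_GL V) N \<and> connectedin (zariski_GL V) N \<and>
          (\<forall>\<phi>\<in>N. unipotent_on V \<phi>) \<longrightarrow> N = {\<one>\<^bsub>GL V\<^esub>})"


section \<open>Quasi-reductive Lie algebras\<close>

text \<open>The kernel of the adjoint representation of a connected group \<open>Q\<close> on its Lie algebra \<open>\<qq>\<close> is
  the centre \<open>Z\<close> of \<open>Q\<close>. The subgroup \<open>Q\<^sub>\<beta>/Z\<close> of \<open>GL(\<qq>)\<close> is the image of \<open>Q\<^sub>\<beta>\<close> under that
  representation.\<close>

definition reductive_type :: "(complex^'n^'n) set \<Rightarrow> (complex^'n^'n \<Rightarrow> complex) \<Rightarrow> bool" where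
  "reductive_type Q \<beta> \<longleftrightarrow> \<beta> \<in> dual (lie_algebra Q) \<and>
     reductive_subgroup (lie_algebra Q)
       ((\<lambda>g. zero_ext (lie_algebra Q) (Ad g)) ` group_stab Q (lie_algebra Q) \<beta>)"

definition nilpotent_type :: "(complex^'n^'n) set \<Rightarrow> (complex^'n^'n \<Rightarrow> complex) \<Rightarrow> bool" where
  "nilpotent_type \<qq> \<beta> \<longleftrightarrow> \<beta> \<in> dual \<qq> \<and> (\<forall>X \<in> lie_stab \<qq> \<qq> \<beta>. \<beta> X = 0)"

text \<open>The notions below are properties of the Lie algebra of a connected linear algebraic group:
  that group is determined by its Lie algebra as a subalgebra of \<open>\<gg>\<ll>\<^sub>n\<close>, so the quantified \<open>Q\<close>
  is unique when it exists.\<close>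

definition group_of :: "(complex^'n^'n) set \<Rightarrow> (complex^'n^'n) set \<Rightarrow> bool" where
  "group_of \<qq> Q \<longleftrightarrow> connected_algebraic_group Q \<and> lie_algebra Q = \<qq>"

definition quasi_reductive :: "(complex^'n^'n) set \<Rightarrow> bool" where
  "quasi_reductive \<qq> \<longleftrightarrow> (\<exists>Q. group_of \<qq> Q \<and> (\<exists>\<beta>. reductive_type Q \<beta>))"

definition strongly_quasi_reductive :: "(complex^'n^'n) set \<Rightarrow> bool" where
  "strongly_quasi_reductive \<qq> \<longleftrightarrow> (\<exists>Q. group_of \<qq> Q \<and> (\<exists>\<beta>. reductive_type Q \<beta>) \<and>
     (\<forall>X \<in> lie_algebra (group_centre Q). semisimple_mat X))"

text \<open>\<open>M\<^sub>*(\<qq>)\<close> as the set of all its representatives, the stabilisers in \<open>\<qq>\<close> of the linear forms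
  both of reductive and of nilpotent type.\<close>

definition max_red_stab :: "(complex^'n^'n) set \<Rightarrow> (complex^'n^'n) set set" where
  "max_red_stab \<qq> = {lie_stab \<qq> \<qq> \<beta> | \<beta> Q. group_of \<qq> Q \<and> reductive_type Q \<beta> \<and> nilpotent_type \<qq> \<beta>}"

end

theory Submission
  imports Defs "HOL-Complex_Analysis.Complex_Analysis" "HOL-Computational_Algebra.Computational_Algebra"
    "HOL-Computational_Algebra.Field_as_Ring"
begin

text \<open>A linear form on a subspace of matrices is the restriction of \<open>X \<mapsto> trace (M ** X)\<close>
 for some matrix \<open>M\<close>. If the centre of \<open>q\<close> consists of semisimple elements, then the form is
 of reductive type iff the trace form is nondegenerate on its stabiliser (\<open>RED\<close>): the radical of the
 trace form on the Lie algebra of an algebraic group consists of nilpotent elements, because it contains with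
 \<open>X\<close> its replica with conjugate eigenvalues.

 Let \<open>M\<close> be a form on \<open>q = q0 + a\<close> whose stabiliser satisfies \<open>RED\<close>. The
 elements of \<open>a\<close> that stabilise \<open>M\<close> form a nil ideal of this stabiliser, so they vanish and
 the \<open>Q0\<close>-orbit of the restriction \<open>\<gamma>\<close> of \<open>M\<close> to \<open>a\<close> is
 open. Projection to \<open>q0\<close> maps the stabiliser of \<open>M\<close> isometrically onto the stabiliser in
 \<open>q0\<^sub>\<gamma>\<close> of a form on \<open>q0\<^sub>\<gamma>\<close>. Conversely, let the orbit of
 \<open>\<gamma>\<close> be open and let a form on \<open>q0\<^sub>\<gamma>\<close> have a stabiliser \<open>c\<close>
 with \<open>RED c\<close>. A Casimir element of \<open>c\<close> shows that the form extends to \<open>q0\<close>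
 with value zero on \<open>[c, q0]\<close>; together with \<open>\<gamma>\<close> this gives a form on
 \<open>q\<close> with stabiliser \<open>c\<close>, and any other form on \<open>q\<close> with the same restrictions
 to \<open>a\<close> and \<open>q0\<^sub>\<gamma>\<close> is conjugate to it by a unipotent element.\<close>

text \<open>The definitions ask for Zariski closed subgroups of \<open>GL V\<close> and for groups
  recovered from their Lie algebras, so much of the development supplies these two links. Images of
  algebraic groups are closed because they are constructible. The passage between groups and Lie
  algebras is analytic: \<open>mexp\<close> stays in the group, and groups with the same Lie algebra
  agree near the identity. Everything reductive goes through the trace form instead of Levi
  decompositions. The driving force is positivity: the trace of an element against its replica with
  conjugate eigenvalues is a sum of squared absolute values times ranks. The same sum on a
  subquotient \<open>A / B\<close> shows that invariants meet the image of the action trivially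
  (\<open>coinvariants\<close>), which takes the place of complete reducibility. A further obstacle
  is that \<open>max_red_stab\<close> asks for forms of reductive and of nilpotent type at once.
  Their existence is obtained in \<open>exists_nilpotent_reductive_form\<close> from a stabiliser
  chain of minimal dimension, along which the radical of the trace form is peeled off.\<close>

no_notation fps_nth (infixl \<open>$\<close> 75)

section \<open>Polynomial functions, ideals and Hilbert's basis theorem\<close>

lemma polys_sum: "(!!i. i : A ==> f i : polys F) ==> (%x. \<Sum>i\<in>A. f i x) : polys F"
 by (induction A rule: infinite_finite_induct) (auto intro: polys_const polys_add)

lemma polys_prod: "(!!i. i : A ==> f i : polys F) ==> (%x. \<Prod>i\<in>A. f i x) : polys F"
 by (induction A rule: infinite_finite_induct) (auto intro: polys_const polys_mult)

lemma polys_power: "f : polys F ==> (%x. f x ^ n) : polys F"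
 by (induction n) (auto intro: polys_const polys_mult)

lemma polys_cmult: "f : polys F ==> (%x. c * f x) : polys F"
 by (intro polys_mult polys_const)

lemma polys_diff: "f : polys F ==> g : polys F ==> (%x. f x - g x) : polys F"
 using polys_add[OF _ polys_cmult[of g F "-1"], of f] by simp

lemma polys_subst:
 "p : polys F ==> (!!f. f : F ==> (%x. f (h x)) : polys G) ==> (%x. p (h x)) : polys G"
 by (induction rule: polys.induct) (auto intro: polys.intros)

lemma polys_polys: "p : polys F ==> F \<subseteq> polys G ==> p : polys G"
 using polys_subst[of p F "%x. x" G] by blast

lemma polys_mono: "F \<subseteq> G ==> polys F \<subseteq> polys G"
 by (auto intro: polys_polys polys_coord)

text \<open>For a ring \<open>R\<close> of functions these sums of products are the ideal generated
  by \<open>S\<close>. Closure under multiplication by \<open>R\<close> is not a rule but follows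
  from closure of \<open>R\<close> under products, see \<open>idl_cmult\<close>.\<close>

inductive_set idl :: "('x => complex) set => ('x => complex) set => ('x => complex) set" for R S where
 idl_0: "(%_. 0) : idl R S"
| idl_add: "p : idl R S ==> q : idl R S ==> (%x. p x + q x) : idl R S"
| idl_mult: "r : R ==> s : S ==> (%x. r x * s x) : idl R S"

lemma idl_cmult: "p : idl (polys F) S ==> r : polys F ==> (%x. r x * p x) : idl (polys F) S"
proof (induction rule: idl.induct)
 case (idl_mult a s)
 then show ?case using idl.idl_mult[OF polys_mult[of r F a], of s S] by (simp add: mult.assoc)
qed (auto simp: ring_distribs intro: idl.intros)

lemma idl_base: "s : S ==> s : idl (polys F) S"
 using idl_mult[OF polys_const[of 1], of s S F] by simp

lemma idl_idl: "p : idl (polys F) T ==> T \<subseteq> idl (polys F) S ==> p : idl (polys F) S"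
 by (induction rule: idl.induct) (auto intro: idl.intros idl_cmult)

lemma idl_diff: "p : idl (polys F) S ==> q : idl (polys F) S ==> (%x. p x - q x) : idl (polys F) S"
 using idl_add[OF _ idl_cmult[OF _ polys_const[of "-1"]], of p F S q] by simp

lemma idl_finite: "p : idl R S ==> EX S0. finite S0 & S0 \<subseteq> S & p : idl R S0"
proof (induction rule: idl.induct)
 case idl_0
 then show ?case by (auto intro: idl.idl_0)
next
 case (idl_add p q)
 then obtain S1 S2 where S: "finite S1" "S1 \<subseteq> S" "p : idl R S1" "finite S2" "S2 \<subseteq> S" "q : idl R S2"
  by blast
 have mono: "r : idl R A ==> A \<subseteq> B ==> r : idl R B" for r A B
  by (induction rule: idl.induct) (auto intro: idl.intros)
 show ?case using S mono[OF S(3), of "S1 \<union> S2"] mono[OF S(6), of "S1 \<union> S2"]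
  by (intro exI[of _ "S1 \<union> S2"]) (auto intro: idl.idl_add)
next
 case (idl_mult r s)
 then show ?case by (intro exI[of _ "{s}"]) (auto intro: idl.intros)
qed

lemma idl_zero: "p : idl R S ==> (!!s. s : S ==> s x = 0) ==> p x = 0"
 by (induction rule: idl.induct) auto

text \<open>The finite generating set is sought inside \<open>S\<close> itself and \<open>S\<close>
  need not be an ideal. In this form the property replaces an infinite system of equations by
  finitely many of its members.\<close>

definition noetherian :: "('x => complex) set => bool" where
 "noetherian R \<longleftrightarrow> (ALL S<=R. EX S0. finite S0 & S0 \<subseteq> S & S \<subseteq> idl R S0)"

text \<open>Since \<open>g\<close> need not be transcendental over \<open>R\<close>, neither the coefficients nor the degree \<open>d\<close> of
 a representation are determined by \<open>p\<close>.\<close>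

definition poly_rep :: "('x => complex) set => ('x => complex) => nat => (nat => 'x => complex) => ('x => complex) => bool" where
 "poly_rep R g d a p \<longleftrightarrow> (ALL k. a k : R) & (ALL k>d. a k = (%_. 0)) & p = (%x. \<Sum>k\<le>d. a k x * g x ^ k)"

lemma poly_rep_mono: "poly_rep R g d a p ==> d \<le> e ==> poly_rep R g e a p"
proof -
 assume p: "poly_rep R g d a p" and "d \<le> e"
 have "(\<Sum>k\<le>e. a k x * g x ^ k) = (\<Sum>k\<le>d. a k x * g x ^ k)" for x
  using p \<open>d \<le> e\<close> by (intro sum.mono_neutral_right) (auto simp: poly_rep_def)
 with p \<open>d \<le> e\<close> show ?thesis by (auto simp: poly_rep_def)
qed

lemma poly_rep_add:
 assumes "poly_rep (polys F) g d a p" "poly_rep (polys F) g d b q"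
 shows "poly_rep (polys F) g d (%k x. a k x + b k x) (%x. p x + q x)"
 using assms unfolding poly_rep_def by (auto intro: polys_add simp: sum.distrib ring_distribs)

lemma poly_rep_diff:
 assumes "poly_rep (polys F) g d a p" "poly_rep (polys F) g d b q"
 shows "poly_rep (polys F) g d (%k x. a k x - b k x) (%x. p x - q x)"
 using assms unfolding poly_rep_def by (auto intro: polys_diff simp: sum_subtractf ring_distribs)

lemma poly_rep_cmult:
 assumes "poly_rep (polys F) g d a p" "r : polys F"
 shows "poly_rep (polys F) g d (%k x. r x * a k x) (%x. r x * p x)"
 using assms unfolding poly_rep_def by (auto intro: polys_mult simp: sum_distrib_left mult.assoc)

lemma poly_rep_shift:
 assumes "poly_rep (polys F) g d a p"
 shows "poly_rep (polys F) g (d + e) (%k. if k < e then (%_. 0) else a (k - e)) (%x. g x ^ e * p x)"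
proof -
 have "(\<Sum>k\<le>d + e. (if k < e then (%_. 0) else a (k - e)) x * g x ^ k) = g x ^ e * (\<Sum>k\<le>d. a k x * g x ^ k)" for x
 proof -
  have "(\<Sum>k\<le>d + e. (if k < e then (%_. 0) else a (k - e)) x * g x ^ k)
    = (\<Sum>k\<in>{e..d + e}. a (k - e) x * g x ^ k)" by (intro sum.mono_neutral_cong_right) auto
  also have "\<dots> = (\<Sum>k\<le>d. a k x * g x ^ (k + e))"
   by (rule sum.reindex_bij_witness[of _ "%k. k + e" "%k. k - e"]) auto
  finally show ?thesis by (simp add: sum_distrib_left power_add mult_ac)
 qed
 with assms show ?thesis unfolding poly_rep_def by (auto intro: polys_const)
qed

lemma poly_rep_mult:
 assumes p: "poly_rep (polys F) g d a p" and q: "poly_rep (polys F) g e b q"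
 shows "EX c. poly_rep (polys F) g (d + e) c (%x. p x * q x)"
proof -
 have "EX c. poly_rep (polys F) g (d + e) c (%x. (\<Sum>k\<in>K. a k x * g x ^ k) * q x)" if "finite K" "K \<subseteq> {..d}" for K
  using that
 proof (induction K rule: finite_induct)
  case empty
  show ?case by (intro exI[of _ "%_ _. 0"]) (simp add: poly_rep_def polys_const)
 next
  case (insert k K)
  then obtain c where c: "poly_rep (polys F) g (d + e) c (%x. (\<Sum>k\<in>K. a k x * g x ^ k) * q x)" by blast
  have "a k : polys F" using p by (simp add: poly_rep_def)
  from poly_rep_shift[OF poly_rep_cmult[OF q this], of k] insert.prems
  obtain c' where "poly_rep (polys F) g (d + e) c' (%x. g x ^ k * (a k x * q x))"
   using poly_rep_mono by (metis (no_types, lifting) add.commute add_le_cancel_left atMost_iff insert_subset)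
  from poly_rep_add[OF this c] insert.hyps show ?case by (auto simp: ring_distribs mult_ac)
 qed
 from this[of "{..d}"] p show ?thesis by (simp add: poly_rep_def)
qed

lemma polys_insert_rep: "p : polys (insert g F) ==> EX d a. poly_rep (polys F) g d a p"
proof (induction rule: polys.induct)
 case (polys_const c)
 show ?case by (intro exI[of _ 0] exI[of _ "%k _. if k = 0 then c else 0"])
   (auto simp: poly_rep_def intro: polys.polys_const)
next
 case (polys_coord f)
 show ?case
 proof (cases "f = g")
  case True
  then show ?thesis by (intro exI[of _ 1] exI[of _ "%k _. if k = 1 then 1 else 0"])
    (auto simp: poly_rep_def fun_eq_iff intro: polys.polys_const)
 next
  case False
  with polys_coord show ?thesis
   by (fastforce simp: poly_rep_def intro: polys.polys_coord polys.polys_const exI[of _ 0] exI[of _ "%k. if k = 0 then f else (%_. 0)"])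
 qed
next
 case (polys_add p q)
 then obtain d a e b where "poly_rep (polys F) g d a p" "poly_rep (polys F) g e b q" by blast
 then have "poly_rep (polys F) g (max d e) a p" "poly_rep (polys F) g (max d e) b q" by (auto elim: poly_rep_mono)
 from poly_rep_add[OF this] show ?case by blast
next
 case (polys_mult p q)
 then show ?case using poly_rep_mult by blast
qed

text \<open>Hilbert's argument with top coefficients: \<open>T\<close> generates those of all
  degrees together, \<open>X d\<close> those of each degree \<open>d < N\<close>, and
  \<open>Y\<close> collects ideal elements realising them. From degree \<open>N\<close> on, the
  elements for \<open>T\<close> are multiplied by powers of \<open>g\<close>.\<close>

lemma noetherian_insert:
 assumes R: "noetherian (polys F)" shows "noetherian (polys (insert g F))" unfolding noetherian_def
proof (intro allI impI)
 let ?R = "polys F" and ?Rg = "polys (insert g F)"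
 fix S assume S: "S \<subseteq> ?Rg"
 have sub: "?R \<subseteq> ?Rg" by (intro polys_mono) auto
 have gpow: "(%x. g x ^ k) : ?Rg" for k by (intro polys_power polys_coord) simp
 \<comment> \<open>Top coefficients may vanish, and one function may contribute several of them
   since representations are not unique; only the formal index \<open>d\<close> matters.\<close>
 define L where "L d = {a d | a p. p : idl ?Rg S & poly_rep ?R g d a p}" for d
 have L_R: "L d \<subseteq> ?R" for d by (auto simp: L_def poly_rep_def)
 have fg: "EX T. finite T & T \<subseteq> X & X \<subseteq> idl ?R T" if "X \<subseteq> ?R" for X
  using R that unfolding noetherian_def by blast
 from fg[of "\<Union>d. L d"] L_R obtain T where T: "finite T" "T \<subseteq> (\<Union>d. L d)" "(\<Union>d. L d) \<subseteq> idl ?R T" by blast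
 from T(2) have "ALL t:T. EX d p a. p : idl ?Rg S & poly_rep ?R g d a p & a d = t" unfolding L_def by blast
 then obtain D P A where DPA: "!!t. t : T ==> P t : idl ?Rg S & poly_rep ?R g (D t) (A t) (P t) & A t (D t) = t"
  by metis
 obtain X where X: "!!d. finite (X d)" "!!d. X d \<subseteq> L d" "!!d. L d \<subseteq> idl ?R (X d)"
  by (metis fg[OF L_R])
 from X(2) have "ALL d. ALL t:X d. EX p a. p : idl ?Rg S & poly_rep ?R g d a p & a d = t" unfolding L_def by blast
 then obtain P' A' where PA': "!!d t. t : X d ==> P' d t : idl ?Rg S & poly_rep ?R g d (A' d t) (P' d t) & A' d t d = t"
  by metis
 define N where "N = Max (insert 0 (D ` T))"
 have N: "D t \<le> N" if "t : T" for t unfolding N_def using T(1) that by simp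
 define Y where "Y = P ` T \<union> (\<Union>d<N. P' d ` X d)"
 have finY: "finite Y" unfolding Y_def using T(1) X(1) by auto
 have Y: "Y \<subseteq> idl ?Rg S" unfolding Y_def using DPA PA' by auto
 have lift: "EX q b. q : idl ?Rg Y & poly_rep ?R g d b q & b d = t"
  if "t : idl ?R Z" and Z: "!!z. z : Z ==> EX q b. q : idl ?Rg Y & poly_rep ?R g d b q & b d = z" for t Z d
  using that(1)
 proof (induction rule: idl.induct)
  case idl_0
  show ?case by (intro exI[of _ "%_. 0"] exI[of _ "%_ _. 0"]) (auto simp: poly_rep_def intro: idl.idl_0 polys_const)
 next
  case (idl_add s t)
  then obtain q b q' b' where "q : idl ?Rg Y" "poly_rep ?R g d b q" "b d = s"
   "q' : idl ?Rg Y" "poly_rep ?R g d b' q'" "b' d = t" by blast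
  then show ?case using poly_rep_add[of F g d b q b' q'] idl.idl_add[of q ?Rg Y q'] by fastforce
 next
  case (idl_mult r z)
  from Z[OF idl_mult(2)] obtain q b where "q : idl ?Rg Y" "poly_rep ?R g d b q" "b d = z" by blast
  then show ?case using poly_rep_cmult[of F g d b q r] idl_cmult[of q "insert g F" Y r] sub idl_mult(1) by fastforce
 qed
 have top: "EX q b. q : idl ?Rg Y & poly_rep ?R g d b q & b d = t" if "t : L d" for d t
 proof (cases "d < N")
  case True
  show ?thesis
  proof (rule lift[of t "X d"])
   show "t : idl ?R (X d)" using X(3) that by blast
   fix z assume z: "z : X d"
   then show "EX q b. q : idl ?Rg Y & poly_rep ?R g d b q & b d = z"
    using True PA'[OF z] idl_base[of "P' d z" Y "insert g F"] by (auto simp: Y_def)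
  qed
 next
  case False
  show ?thesis
  proof (rule lift[of t T])
   show "t : idl ?R T" using T(3) that by blast
   fix z assume z: "z : T"
   then have "P z : Y" by (auto simp: Y_def)
   then have 1: "(%x. g x ^ (d - D z) * P z x) : idl ?Rg Y" by (intro idl_cmult idl_base gpow)
   have 2: "poly_rep ?R g d (%k. if k < d - D z then (%_. 0) else A z (k - (d - D z))) (%x. g x ^ (d - D z) * P z x)"
    using N[OF z] False poly_rep_shift[of F g "D z" "A z" "P z" "d - D z"] DPA[OF z] by simp
   have "(if d < d - D z then (%_. 0) else A z (d - (d - D z))) = z" using N[OF z] False DPA[OF z] by auto
   with 1 2 show "EX q b. q : idl ?Rg Y & poly_rep ?R g d b q & b d = z" by blast
  qed
 qed
 \<comment> \<open>Induction on the formal degree: subtracting an element of the ideal of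
   \<open>Y\<close> with the same \<open>d\<close>-th coefficient leaves a representation of smaller
   formal degree.\<close>
 have main: "p : idl ?Rg Y" if "p : idl ?Rg S" "poly_rep ?R g d a p" for p d a using that
 proof (induction d arbitrary: p a)
  case 0
  then have "a 0 : L 0" unfolding L_def by blast
  from top[OF this] obtain q b where q: "q : idl ?Rg Y" "poly_rep ?R g 0 b q" "b 0 = a 0" by blast
  then have "q = p" using 0 by (simp add: poly_rep_def)
  with q show ?case by simp
 next
  case (Suc d)
  then have "a (Suc d) : L (Suc d)" unfolding L_def by blast
  from top[OF this] obtain q b where q: "q : idl ?Rg Y" "poly_rep ?R g (Suc d) b q" "b (Suc d) = a (Suc d)" by blast
  have 1: "(%x. p x - q x) : idl ?Rg S" using Suc.prems(1) idl_idl[OF q(1) Y] by (rule idl_diff)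
  have 2: "poly_rep ?R g d (%k x. a k x - b k x) (%x. p x - q x)"
  proof -
   note D = poly_rep_diff[OF Suc.prems(2) q(2)]
   have "(%x. a k x - b k x) = (%_. 0)" if "k > d" for k
    using D q(3) that Suc_lessI[of d k] by (cases "k = Suc d") (auto simp: poly_rep_def)
   then show ?thesis using D q(3) by (simp add: poly_rep_def)
  qed
  from idl_add[OF Suc.IH[OF 1 2] q(1)] show ?case by simp
 qed
 have SY: "S \<subseteq> idl ?Rg Y"
 proof
  fix p assume p: "p : S"
  with S polys_insert_rep[of p g F] obtain d a where "poly_rep ?R g d a p" by blast
  then show "p : idl ?Rg Y" using main idl_base[OF p] by blast
 qed
 \<comment> \<open>\<open>Y\<close> consists of elements of the ideal; each involves finitely many
   members of \<open>S\<close>, which gives generators inside \<open>S\<close>.\<close>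
 have "ALL y:Y. EX S0. finite S0 & S0 \<subseteq> S & y : idl ?Rg S0" using Y idl_finite by blast
 then obtain G where G: "!!y. y : Y ==> finite (G y) & G y \<subseteq> S & y : idl ?Rg (G y)" by metis
 have "Y \<subseteq> idl ?Rg (\<Union>y\<in>Y. G y)"
 proof
  fix y assume y: "y : Y"
  show "y : idl ?Rg (\<Union>y\<in>Y. G y)" using G[OF y] y by (blast intro: idl_base idl_idl)
 qed
 then have "S \<subseteq> idl ?Rg (\<Union>y\<in>Y. G y)" using SY idl_idl by (metis subset_eq)
 then show "EX S0. finite S0 & S0 \<subseteq> S & S \<subseteq> idl ?Rg S0"
  using finY G by (intro exI[of _ "\<Union>y\<in>Y. G y"]) auto
qed

lemma polys_empty: "p : polys {} ==> EX c. p = (%_. c)"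
 by (induction rule: polys.induct) auto

theorem Hilbert_basis: "finite F ==> noetherian (polys F)"
proof (induction F rule: finite_induct)
 case empty
 show ?case unfolding noetherian_def
 proof (intro allI impI)
  fix S :: "('a => complex) set" assume S: "S \<subseteq> polys {}"
  show "EX S0. finite S0 & S0 \<subseteq> S & S \<subseteq> idl (polys {}) S0"
  proof (cases "S \<subseteq> {%_. 0}")
   case True
   then show ?thesis by (intro exI[of _ "{}"]) (auto intro: idl_0)
  next
   case False
   with S polys_empty obtain c where c: "(%_. c) : S" "c \<noteq> 0" by blast
   have "p : idl (polys {}) {%_. c}" if "p : S" for p
   proof -
    obtain b where "p = (%_. b)" using S \<open>p : S\<close> polys_empty by blast
    with c idl_mult[OF polys_const[of "b / c"], of "%_. c" "{%_. c}" "{}"] show ?thesis by simp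
   qed
   with c show ?thesis by (intro exI[of _ "{%_. c}"]) auto
  qed
 qed
qed (rule noetherian_insert)

corollary finite_equations: assumes "finite F" "P \<subseteq> polys F"
 obtains P0 where "finite P0" "P0 \<subseteq> P" "!!x. (ALL p:P. p x = 0) \<longleftrightarrow> (ALL p:P0. p x = 0)"
proof -
 obtain P0 where P0: "finite P0" "P0 \<subseteq> P" "P \<subseteq> idl (polys F) P0"
  using Hilbert_basis[OF assms(1), unfolded noetherian_def, rule_format, OF assms(2)] by (elim exE conjE)
 show ?thesis
 proof (rule that[OF P0(1,2)])
  show "(ALL p:P. p x = 0) \<longleftrightarrow> (ALL p:P0. p x = 0)" for x
   using P0(2,3) idl_zero[of _ "polys F" P0 x] by auto
 qed
qed

section \<open>Rational functions and constructible sets\<close>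

inductive_set rats :: "('x => complex) set => ('x => complex) set" for F :: "('x => complex) set" where
 rats_const: "(%_. c) : rats F"
| rats_coord: "f : F ==> f : rats F"
| rats_add: "p : rats F ==> q : rats F ==> (%x. p x + q x) : rats F"
| rats_mult: "p : rats F ==> q : rats F ==> (%x. p x * q x) : rats F"
| rats_inverse: "p : rats F ==> (%x. inverse (p x)) : rats F"

lemma polys_rats: "p : polys F ==> p : rats F"
 by (induction rule: polys.induct) (auto intro: rats.intros)

lemma rats_diff: "f : rats F ==> g : rats F ==> (%x. f x - g x) : rats F"
 using rats_add[OF _ rats_mult[OF rats_const[of "-1"]], of f F g] by simp

lemma rats_sum: "(!!i. i : A ==> f i : rats F) ==> (%x. \<Sum>i\<in>A. f i x) : rats F"
 by (induction A rule: infinite_finite_induct) (auto intro: rats_const rats_add)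

lemma rats_subst:
 "p : rats F ==> (!!f. f : F ==> (%x. f (h x)) : rats G) ==> (%x. p (h x)) : rats G"
 by (induction rule: rats.induct) (auto intro: rats.intros)

text \<open>\<open>rats\<close> is closed under pointwise inversion, hence under case distinctions
  (\<open>rats_if\<close>), so indicator functions suffice to encode Boolean combinations of
  polynomial equations. The usual description is recovered in
  \<open>constructible_locally_closed\<close>.\<close>

definition constructible :: "('x => complex) set => 'x set set" where
 "constructible F = {S. (%x. of_bool (x : S)) : rats F}"

text \<open>Since \<^term>\<open>inverse 0 = (0::complex)\<close>, the function \<open>1 - f / f\<close> is the indicator function of the
 zeros of \<open>f\<close>.\<close>

lemma constructible_zero: "f : rats F ==> {x. f x = 0} : constructible F"
proof -
 assume "f : rats F"
 then have "(%x. 1 - f x * inverse (f x)) : rats F" by (intro rats_diff rats_mult rats_inverse rats_const)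
 also have "(%x. 1 - f x * inverse (f x)) = (%x. of_bool (x : {x. f x = 0}))" by auto
 finally show ?thesis by (simp add: constructible_def)
qed

lemma constructible_compl: "S : constructible F ==> - S : constructible F"
proof -
 assume "S : constructible F"
 then have "(%x. 1 - of_bool (x : S)) : rats F" by (auto simp: constructible_def intro: rats_diff rats_const)
 also have "(%x. 1 - of_bool (x : S)) = (%x. of_bool (x : - S) :: complex)" by auto
 finally show ?thesis by (simp add: constructible_def)
qed

lemma constructible_Int: "S : constructible F ==> T : constructible F ==> S \<inter> T : constructible F"
proof -
 assume "S : constructible F" "T : constructible F"
 then have "(%x. of_bool (x : S) * of_bool (x : T)) : rats F" by (auto simp: constructible_def intro: rats_mult)
 also have "(%x. of_bool (x : S) * of_bool (x : T)) = (%x. of_bool (x : S \<inter> T) :: complex)" by auto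
 finally show ?thesis by (simp add: constructible_def)
qed

lemma constructible_UNIV: "UNIV : constructible F" and constructible_empty: "{} : constructible F"
 by (auto simp: constructible_def intro: rats_const)

lemma constructible_Un: "S : constructible F ==> T : constructible F ==> S \<union> T : constructible F"
 using constructible_compl[OF constructible_Int[OF constructible_compl constructible_compl], of S F T] by simp

lemma constructible_UN: "finite A ==> (!!a. a : A ==> S a : constructible F) ==> (\<Union>a\<in>A. S a) : constructible F"
 by (induction A rule: finite_induct) (auto intro: constructible_empty constructible_Un)

lemma constructible_INT: "finite A ==> (!!a. a : A ==> S a : constructible F) ==> (\<Inter>a\<in>A. S a) : constructible F"
 by (induction A rule: finite_induct) (auto intro: constructible_UNIV constructible_Int)

lemma constructible_all: "finite A ==> (!!a. a : A ==> {x. Q a x} : constructible F) ==> {x. ALL a:A. Q a x} : constructible F"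
 using constructible_INT[of A "%a. {x. Q a x}" F] by (simp add: Collect_ball_eq)

lemma constructible_ex: "finite A ==> (!!a. a : A ==> {x. Q a x} : constructible F) ==> {x. EX a:A. Q a x} : constructible F"
 using constructible_UN[of A "%a. {x. Q a x}" F] by (simp add: Collect_bex_eq)

lemma constructible_conj:
 "{x. Q x} : constructible F ==> {x. R x} : constructible F ==> {x. Q x & R x} : constructible F"
 using constructible_Int[of "{x. Q x}" F "{x. R x}"] by (simp add: Collect_conj_eq)

lemma constructible_not: "{x. Q x} : constructible F ==> {x. \<not> Q x} : constructible F"
 using constructible_compl[of "{x. Q x}" F] by (simp add: Collect_neg_eq)

lemma constructible_disj:
 "{x. Q x} : constructible F ==> {x. R x} : constructible F ==> {x. Q x \<or> R x} : constructible F"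
 using constructible_Un[of "{x. Q x}" F "{x. R x}"] by (simp add: Collect_disj_eq)

lemma constructible_vimage:
 assumes "S : constructible F" "!!f. f : F ==> (%x. f (h x)) : rats G" shows "{x. h x : S} : constructible G"
 using rats_subst[OF _ assms(2), of "%x. of_bool (x : S)"] assms(1) by (simp add: constructible_def)

lemma rats_if:
 assumes "{x. Q x} : constructible F" "f : rats F" "g : rats F" shows "(%x. if Q x then f x else g x) : rats F"
proof -
 have "(%x. of_bool (x : {x. Q x}) * (f x - g x) + g x) : rats F"
  using assms by (intro rats_add rats_mult rats_diff) (auto simp: constructible_def)
 also have "(%x. of_bool (x : {x. Q x}) * (f x - g x) + g x) = (%x. if Q x then f x else g x)" by auto
 finally show ?thesis .
qed

section \<open>Locally closed pieces and piecewise quotients of polynomials\<close>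

definition locally_closed :: "('x => complex) set => 'x set => bool" where
 "locally_closed F B \<longleftrightarrow> (EX P q. finite P & P \<subseteq> polys F & q : polys F & B = {x. (ALL p:P. p x = 0) & q x \<noteq> 0})"

lemma locally_closed_UNIV: "locally_closed F UNIV"
 unfolding locally_closed_def by (intro exI[of _ "{}"] exI[of _ "%_. 1"]) (auto intro: polys_const)

lemma locally_closed_Int: "locally_closed F A ==> locally_closed F B ==> locally_closed F (A \<inter> B)"
 unfolding locally_closed_def
proof (elim exE conjE)
 fix P q P' q'
 assume *: "finite P" "P \<subseteq> polys F" "q : polys F" "A = {x. (ALL p:P. p x = 0) & q x \<noteq> 0}"
  "finite P'" "P' \<subseteq> polys F" "q' : polys F" "B = {x. (ALL p:P'. p x = 0) & q' x \<noteq> 0}"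
 then show "EX P q. finite P & P \<subseteq> polys F & q : polys F & A \<inter> B = {x. (ALL p:P. p x = 0) & q x \<noteq> 0}"
  by (intro exI[of _ "P \<union> P'"] exI[of _ "%x. q x * q' x"]) (auto intro: polys_mult)
qed

lemma locally_closed_zero: "a : polys F ==> locally_closed F {x. a x = 0}"
 unfolding locally_closed_def by (intro exI[of _ "{a}"] exI[of _ "%_. 1"]) (auto intro: polys_const)

lemma locally_closed_nonzero: "a : polys F ==> locally_closed F {x. a x \<noteq> 0}"
 unfolding locally_closed_def by (intro exI[of _ "{}"] exI[of _ a]) auto

definition quot_on :: "('x => complex) set => ('x => complex) => 'x set => bool" where
 "quot_on F f B \<longleftrightarrow> (EX a:polys F. EX b:polys F. ALL x:B. b x \<noteq> 0 & f x = a x / b x)"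

lemma quot_on_polys: "a : polys F ==> quot_on F a B"
 unfolding quot_on_def by (rule bexI[of _ a], rule bexI[of _ "%_. 1"]) (auto intro: polys_const)

lemma quot_on_add: "quot_on F f A ==> quot_on F g B ==> quot_on F (%x. f x + g x) (A \<inter> B)"
 unfolding quot_on_def
proof (elim bexE)
 fix a b c d assume "a : polys F" "b : polys F" "ALL x:A. b x \<noteq> 0 & f x = a x / b x"
  "c : polys F" "d : polys F" "ALL x:B. d x \<noteq> 0 & g x = c x / d x"
 then show "EX a:polys F. EX b:polys F. ALL x:A \<inter> B. b x \<noteq> 0 & f x + g x = a x / b x"
  by (intro bexI[of _ "%x. a x * d x + c x * b x"] bexI[of _ "%x. b x * d x"] polys_add polys_mult)
   (simp_all add: add_frac_eq)
qed

lemma quot_on_mult: "quot_on F f A ==> quot_on F g B ==> quot_on F (%x. f x * g x) (A \<inter> B)"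
 unfolding quot_on_def
proof (elim bexE)
 fix a b c d assume "a : polys F" "b : polys F" "ALL x:A. b x \<noteq> 0 & f x = a x / b x"
  "c : polys F" "d : polys F" "ALL x:B. d x \<noteq> 0 & g x = c x / d x"
 then show "EX a:polys F. EX b:polys F. ALL x:A \<inter> B. b x \<noteq> 0 & f x * g x = a x / b x"
  by (intro bexI[of _ "%x. a x * c x"] bexI[of _ "%x. b x * d x"] polys_mult) simp_all
qed

definition piecewise :: "('x => complex) set => ('x => complex) => bool" where
 "piecewise F f \<longleftrightarrow> (EX a. finite a & \<Union>a = UNIV & (ALL B:a. locally_closed F B & quot_on F f B))"

lemma piecewise_polys: "f : polys F ==> piecewise F f"
 unfolding piecewise_def by (intro exI[of _ "{UNIV}"]) (simp add: locally_closed_UNIV quot_on_polys)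

lemma piecewise_binary:
 assumes "piecewise F f" "piecewise F g" and h: "!!A B. quot_on F f A ==> quot_on F g B ==> quot_on F h (A \<inter> B)"
 shows "piecewise F h"
proof -
 obtain b a where A: "finite b" "\<Union>b = UNIV" "ALL A:b. locally_closed F A & quot_on F f A"
  and B: "finite a" "\<Union>a = UNIV" "ALL B:a. locally_closed F B & quot_on F g B"
  using assms(1,2) unfolding piecewise_def by (elim exE conjE)
 have "\<Union>((%(A, B). A \<inter> B) ` (b \<times> a)) = UNIV" using A(2) B(2) by fastforce
 then show ?thesis unfolding piecewise_def using A(1,3) B(1,3)
  by (intro exI[of _ "(%(A, B). A \<inter> B) ` (b \<times> a)"]) (auto intro!: h locally_closed_Int)
qed

text \<open>Sums and products are treated on intersections of pieces. For the inverse, a piece with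
  \<open>f = a / b\<close> is cut by the zeros of \<open>a\<close>: there the value is 0 by the
  convention on \<open>inverse\<close>, elsewhere it is \<open>b / a\<close>.\<close>

lemma rats_piecewise: "f : rats F ==> piecewise F f"
proof (induction rule: rats.induct)
 case (rats_add f g)
 then show ?case by (intro piecewise_binary[OF rats_add.IH] quot_on_add)
next
 case (rats_mult f g)
 then show ?case by (intro piecewise_binary[OF rats_mult.IH] quot_on_mult)
next
 case (rats_inverse f)
 from rats_inverse.IH obtain c where B: "finite c" "\<Union>c = UNIV" "ALL B:c. locally_closed F B & quot_on F f B"
  unfolding piecewise_def by (elim exE conjE)
 obtain a b where ab: "!!B. B : c ==> a B : polys F & b B : polys F & (ALL x:B. b B x \<noteq> 0 & f x = a B x / b B x)"
  using B(3) unfolding quot_on_def by metis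
 have q0: "quot_on F (%x. inverse (f x)) (B \<inter> {x. a B x = 0})" if "B : c" for B
  unfolding quot_on_def using ab[OF that] by (intro bexI[of _ "%_. 0"] bexI[of _ "%_. 1"]) (auto intro: polys_const)
 have q1: "quot_on F (%x. inverse (f x)) (B \<inter> {x. a B x \<noteq> 0})" if "B : c" for B
  unfolding quot_on_def using ab[OF that] by (intro bexI[of _ "b B"] bexI[of _ "a B"]) auto
 let ?C = "(%B. B \<inter> {x. a B x = 0}) ` c \<union> (%B. B \<inter> {x. a B x \<noteq> 0}) ` c"
 show ?case unfolding piecewise_def
 proof (intro exI[of _ ?C] conjI)
  show "finite ?C" using B by auto
  show "\<Union>?C = UNIV"
  proof (rule UNIV_eq_I[symmetric])
   fix x
   obtain B where "B : c" "x : B" using B(2) by (metis UNIV_I UnionE)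
   then show "x : \<Union>?C" by (cases "a B x = 0") auto
  qed
  show "ALL C:?C. locally_closed F C & quot_on F (%x. inverse (f x)) C"
   using B(3) q0 q1 ab by (auto intro!: locally_closed_Int locally_closed_zero locally_closed_nonzero)
 qed
qed (auto intro: piecewise_polys polys.intros)

text \<open>On a piece where the indicator function is \<open>a / b\<close>, membership in
  \<open>S\<close> means \<open>a x \<noteq> 0\<close>, so \<open>S\<close> is the union of the
  pieces cut by this inequality.\<close>

lemma constructible_locally_closed:
 assumes "S : constructible F"
 obtains b where "finite b" "S = \<Union>b" "!!B. B : b ==> locally_closed F B"
proof -
 let ?f = "%x. of_bool (x : S) :: complex"
 obtain b where B: "finite b" "\<Union>b = UNIV" "ALL B:b. locally_closed F B & quot_on F ?f B"
  using rats_piecewise[of ?f F] assms by (auto simp: constructible_def piecewise_def)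
 then have "ALL B:b. EX a:polys F. ALL x:B. x : S \<longleftrightarrow> a x \<noteq> 0"
  unfolding quot_on_def by (metis divide_eq_0_iff of_bool_eq_0_iff)
 then obtain a where a: "!!B. B : b ==> a B : polys F & (ALL x:B. x : S \<longleftrightarrow> a B x \<noteq> 0)" by metis
 show ?thesis
 proof (rule that[of "(%B. B \<inter> {x. a B x \<noteq> 0}) ` b"])
  show "S = \<Union>((%B. B \<inter> {x. a B x \<noteq> 0}) ` b)"
  proof (rule equalityI; rule subsetI)
   fix x assume "x : S"
   moreover obtain B where "B : b" "x : B" using B(2) by (metis UNIV_I UnionE)
   ultimately show "x : \<Union>((%B. B \<inter> {x. a B x \<noteq> 0}) ` b)" using a by auto
  next
   fix x assume "x : \<Union>((%B. B \<inter> {x. a B x \<noteq> 0}) ` b)"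
   then show "x : S" using a by auto
  qed
 qed (use B a in \<open>auto intro!: locally_closed_Int locally_closed_nonzero\<close>)
qed

section \<open>Univariate polynomials with parameters: division, common roots, elimination\<close>

definition rfam :: "('x => complex) set => ('x => complex poly) => bool" where
 "rfam F P \<longleftrightarrow> (EX d. ALL x. degree (P x) \<le> d) & (ALL k. (%x. coeff (P x) k) : rats F)"

lemma rfam_coeff: "rfam F P ==> (%x. coeff (P x) k) : rats F"
 by (simp add: rfam_def)

lemma rfam_const: "rfam F (%_. p)"
 by (auto simp: rfam_def intro: rats_const)

lemma rfam_if:
 assumes "{x. Q x} : constructible F" "rfam F P" "rfam F R" shows "rfam F (%x. if Q x then P x else R x)"
proof -
 obtain d e where "!!x. degree (P x) \<le> d" "!!x. degree (R x) \<le> e" using assms(2,3) unfolding rfam_def by blast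
 then have "ALL x. degree (if Q x then P x else R x) \<le> max d e" by (auto simp: le_max_iff_disj)
 moreover have "(%x. coeff (if Q x then P x else R x) k) : rats F" for k
  using rats_if[OF assms(1) rfam_coeff[OF assms(2), of k] rfam_coeff[OF assms(3), of k]] by (simp add: if_distrib if_distribR cong: if_cong)
 ultimately show ?thesis unfolding rfam_def by blast
qed

lemma rfam_diff:
 assumes "rfam F P" "rfam F R" shows "rfam F (%x. P x - R x)"
proof -
 obtain d e where "!!x. degree (P x) \<le> d" "!!x. degree (R x) \<le> e" using assms unfolding rfam_def by blast
 then have "degree (P x - R x) \<le> max d e" for x by (meson degree_diff_le_max le_trans max.mono)
 moreover have "(%x. coeff (P x - R x) k) : rats F" for k
  using rats_diff[OF rfam_coeff[OF assms(1), of k] rfam_coeff[OF assms(2), of k]] by simp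
 ultimately show ?thesis unfolding rfam_def by blast
qed

lemma rfam_add:
 assumes "rfam F P" "rfam F R" shows "rfam F (%x. P x + R x)"
 using rfam_diff[OF assms(1) rfam_diff[OF rfam_const[of _ 0] assms(2)]] by simp

lemma rfam_mult:
 assumes "rfam F P" "rfam F R" shows "rfam F (%x. P x * R x)"
proof -
 obtain d e where "!!x. degree (P x) \<le> d" "!!x. degree (R x) \<le> e" using assms unfolding rfam_def by blast
 then have "degree (P x * R x) \<le> d + e" for x by (meson add_mono degree_mult_le le_trans)
 moreover have "(%x. coeff (P x * R x) k) : rats F" for k
  using assms by (auto simp: coeff_mult intro!: rats_sum rats_mult rfam_coeff)
 ultimately show ?thesis unfolding rfam_def by blast
qed

lemma rfam_power: "rfam F P ==> rfam F (%x. P x ^ n)"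
 by (induction n) (auto intro: rfam_const rfam_mult)

lemma rfam_coord: "f : rats F ==> rfam F (%x. [:f x:])"
 unfolding rfam_def
proof (intro conjI allI)
 fix k assume "f : rats F"
 then show "(%x. coeff [:f x:] k) : rats F" by (cases k) (auto intro: rats_const)
qed (auto intro: exI[of _ 0])

lemma rfam_zero: "rfam F P ==> {x. P x = 0} : constructible F"
proof -
 assume P: "rfam F P"
 then obtain d where d: "!!x. degree (P x) \<le> d" unfolding rfam_def by blast
 have "(P x = 0) = (ALL k:{..d}. coeff (P x) k = 0)" for x
  using leading_coeff_0_iff[of "P x"] d[of x] by (metis atMost_iff coeff_0)
 then show ?thesis using P by (auto intro!: constructible_all constructible_zero rfam_coeff)
qed

lemma rfam_degree: "rfam F P ==> {x. degree (P x) = k} : constructible F"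
proof -
 assume P: "rfam F P"
 then obtain d where d: "!!x. degree (P x) \<le> d" unfolding rfam_def by blast
 have le: "{x. degree (P x) \<le> k} : constructible F" for k
 proof -
  have "(degree (P x) \<le> k) = (ALL j:{k<..d}. coeff (P x) j = 0)" for x
   using d[of x] coeff_eq_0[of "P x"] leading_coeff_0_iff[of "P x"]
   by (metis degree_0 greaterThanAtMost_iff le_less_trans leI not_less_zero)
  then show ?thesis using P by (auto intro!: constructible_all constructible_zero rfam_coeff)
 qed
 show ?thesis
 proof (cases k)
  case 0
  then show ?thesis using le[of 0] by simp
 next
  case (Suc j)
  then have "{x. degree (P x) = k} = {x. degree (P x) \<le> k & \<not> degree (P x) \<le> j}" by auto
  then show ?thesis by (simp add: constructible_conj constructible_not le)
 qed
qed

lemma rfam_lead_coeff: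
 assumes "rfam F P" shows "(%x. lead_coeff (P x)) : rats F"
proof -
 obtain d where d: "!!x. degree (P x) \<le> d" using assms unfolding rfam_def by blast
 have "(%x. \<Sum>k\<le>d. if degree (P x) = k then coeff (P x) k else 0) : rats F"
  using assms by (intro rats_sum rats_if rfam_degree rfam_coeff rats_const)
 moreover have "(\<Sum>k\<le>d. if degree (P x) = k then coeff (P x) k else 0) = lead_coeff (P x)" for x
  using d[of x] by simp ultimately show ?thesis by simp
qed

lemma rfam_degree_le:
 assumes "rfam F P" "rfam F R" shows "{x. degree (R x) \<le> degree (P x)} : constructible F"
proof -
 obtain d where d: "!!x. degree (P x) \<le> d" using assms unfolding rfam_def by blast
 have "(degree (R x) \<le> degree (P x)) = (EX l:{..d}. EX k:{..l}. degree (R x) = k & degree (P x) = l)" for x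
  using d[of x] by auto
 then show ?thesis using assms by (simp only:) (intro constructible_ex constructible_conj rfam_degree finite_atMost)
qed

lemma rfam_monom_diff:
 assumes "rfam F P" "rfam F R" "f : rats F" shows "rfam F (%x. monom (f x) (degree (P x) - degree (R x)))"
proof -
 obtain d where d: "!!x. degree (P x) \<le> d" using assms unfolding rfam_def by blast
 have 1: "{x. degree (P x) - degree (R x) = k} : constructible F" for k
 proof (cases "k = 0")
  case True
  then show ?thesis using rfam_degree_le[OF assms(2,1)] by simp
 next
  case False
  \<comment> \<open>A positive difference \<open>k\<close> forces
    \<open>degree (R x) < degree (P x)\<close>, so both degrees are at most \<open>d\<close>
    although no bound for \<open>R\<close> has been fixed. For \<open>k = 0\<close> the truncated
    difference is a comparison of degrees.\<close>
  have "(degree (P x) - degree (R x) = k) = (EX l:{..d}. EX j:{..d}. degree (P x) = l & degree (R x) = j & l - j = k)" for x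
   using d[of x] False by auto
  moreover have "{x. l - j = k} : constructible F" for l j :: nat
   by (cases "l - j = k") (auto intro: constructible_UNIV constructible_empty) ultimately show ?thesis using assms
   by (simp only:) (intro constructible_ex constructible_conj rfam_degree finite_atMost)
 qed
 have "degree (monom (f x) (degree (P x) - degree (R x))) \<le> d" for x
  using d[of x] degree_monom_le[of "f x" "degree (P x) - degree (R x)"] by simp
 moreover have "(%x. coeff (monom (f x) (degree (P x) - degree (R x))) k) : rats F" for k
  using 1 assms by (auto intro!: rats_if rats_const simp del: coeff_monom simp: coeff_monom)
 ultimately show ?thesis unfolding rfam_def by blast
qed

text \<open>One step of long division lowers the degree, and each case distinction it makes depends
  constructibly on the parameter, including parameters where degrees drop.\<close>

lemma rfam_mod_bounded:
 assumes "rfam F R" shows "rfam F P ==> ALL x. degree (P x) \<le> d ==> rfam F (%x. P x mod R x)"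
proof (induction d arbitrary: P)
 case (0 P)
 let ?C = "%x. R x \<noteq> 0 & degree (R x) \<le> degree (P x)"
 have "P x mod R x = (if ?C x then 0 else P x)" for x
 proof (cases "?C x")
  case True
  then have "is_unit (R x)" using 0(2) by (simp add: is_unit_iff_degree)
  then show ?thesis using True by (simp add: unit_imp_mod_eq_0)
 qed (auto simp: mod_poly_less not_le)
 moreover have "{x. ?C x} : constructible F"
  using assms 0 by (intro constructible_conj constructible_not rfam_zero rfam_degree_le)
 ultimately show ?case using 0 by (simp add: rfam_if rfam_const)
next
 case (Suc d P)
 let ?C = "%x. R x \<noteq> 0 & degree (R x) \<le> degree (P x)"
 let ?M = "%x. monom (lead_coeff (P x) * inverse (lead_coeff (R x))) (degree (P x) - degree (R x)) * R x"
 have C: "{x. ?C x} : constructible F"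
  using assms Suc.prems by (intro constructible_conj constructible_not rfam_zero rfam_degree_le)
 \<comment> \<open>If \<open>?C x\<close> holds and \<open>P x\<close> has degree 0, then
   \<open>R x\<close> is a nonzero constant and the remainder is 0. Outside \<open>?C\<close> the
   value is never read; 0 keeps the degree bound \<open>d\<close>.\<close>
 define P' where "P' x = (if ?C x then (if degree (P x) = 0 then 0 else P x - ?M x) else 0)" for x
 have "rfam F P'" unfolding P'_def[abs_def] using assms Suc.prems C
  by (intro rfam_if rfam_const rfam_degree rfam_diff rfam_mult rfam_monom_diff rats_mult rats_inverse rfam_lead_coeff)
 moreover have "degree (P' x) \<le> d" for x
 proof (cases "?C x & degree (P x) \<noteq> 0")
  case True
  then have P0: "P x \<noteq> 0" by auto
  have deg: "degree (?M x) = degree (P x)"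
   using True P0 by (simp add: degree_mult_eq monom_eq_0_iff degree_monom_eq)
  have "lead_coeff (?M x) = lead_coeff (P x)" unfolding lead_coeff_mult lead_coeff_monom using True by simp
  with deg have lc: "coeff (?M x) (degree (P x)) = lead_coeff (P x)" "degree (?M x) = degree (P x)" by simp_all
  have "degree (P x - ?M x) < degree (P x)"
  proof (rule ccontr)
   assume "\<not> degree (P x - ?M x) < degree (P x)"
   moreover have "degree (P x - ?M x) \<le> degree (P x)" using lc(2) by (intro degree_diff_le) auto
   ultimately have *: "degree (P x - ?M x) = degree (P x)" by simp
   have "coeff (P x - ?M x) (degree (P x)) = 0" unfolding coeff_diff lc by simp
   then have "P x - ?M x = 0" using * leading_coeff_0_iff by metis
   then show False using * True by simp
  qed
  then show ?thesis using True Suc.prems(2)[rule_format, of x] by (simp add: P'_def)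
 qed (auto simp: P'_def)
 ultimately have IH: "rfam F (%x. P' x mod R x)" using Suc.IH by blast
 have "P x mod R x = (if ?C x then P' x mod R x else P x)" for x
 proof (cases "?C x")
  case True
  show ?thesis
   using mod_mult_self2[of "P x - ?M x" "R x" "monom (lead_coeff (P x) * inverse (lead_coeff (R x))) (degree (P x) - degree (R x))"] True by (auto simp: mult.commute is_unit_iff_degree P'_def intro!: unit_imp_mod_eq_0)
 qed (auto simp: mod_poly_less not_le)
 with IH C Suc.prems show ?case by (simp add: rfam_if)
qed

lemma rfam_mod: "rfam F P ==> rfam F R ==> rfam F (%x. P x mod R x)"
 using rfam_mod_bounded unfolding rfam_def by blast

text \<open>Euclid's algorithm with parameters. The result is only required to have the common roots
  of the pair, without control of multiplicities.\<close>

lemma rfam_common_roots_bounded: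
 "rfam F P ==> rfam F R ==> ALL x. degree (R x) \<le> d ==>
   EX G. rfam F G & (ALL x c. poly (G x) c = 0 \<longleftrightarrow> poly (P x) c = 0 & poly (R x) c = 0)"
proof (induction d arbitrary: P R)
 case (0 P R)
 show ?case
 proof (intro exI conjI allI)
  show "rfam F (%x. if R x = 0 then P x else 1)" using 0 by (intro rfam_if rfam_zero rfam_const)
  fix x c
  have "R x = [:coeff (R x) 0:]" using 0(3) degree_0_id[of "R x"] by simp
  then have "poly (R x) c = coeff (R x) 0" "R x = 0 \<longleftrightarrow> coeff (R x) 0 = 0"
   by (metis poly_const_conv, metis pCons_0_0 coeff_0)
  then show "poly (if R x = 0 then P x else 1) c = 0 \<longleftrightarrow> poly (P x) c = 0 & poly (R x) c = 0" by auto
 qed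
next
 case (Suc d P R)
 let ?C = "%x. R x = 0 \<or> degree (R x) = 0"
 \<comment> \<open>\<open>P x mod 0\<close> is \<open>P x\<close>, whose degree is not bounded by
   \<open>d\<close>. Hence the value 0 at such parameters; there \<open>G\<close> is replaced by
   \<open>P\<close> in the end.\<close>
 define R' where "R' x = (if ?C x then 0 else P x mod R x)" for x
 have "rfam F R'" unfolding R'_def[abs_def] using Suc.prems
  by (intro rfam_if rfam_const rfam_mod constructible_disj rfam_zero rfam_degree)
 moreover have "degree (R' x) \<le> d" for x
  using degree_mod_less'[of "R x" "P x"] Suc.prems(3)[rule_format, of x] by (cases "P x mod R x = 0") (auto simp: R'_def)
 ultimately obtain G where G: "rfam F G" "!!x c. poly (G x) c = 0 \<longleftrightarrow> poly (R x) c = 0 & poly (R' x) c = 0"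
  using Suc.IH[OF Suc.prems(2)] by blast
 show ?case
 proof (intro exI conjI allI)
  show "rfam F (%x. if R x = 0 then P x else G x)" using Suc.prems G by (intro rfam_if rfam_zero)
  fix x c
  have const: "poly (R x) c \<noteq> 0" if "R x \<noteq> 0" "degree (R x) = 0"
   using that by (metis degree_0_id pCons_eq_0_iff poly_const_conv)
  have step: "poly (P x) c = poly (P x mod R x) c" if "poly (R x) c = 0"
   using that by (metis add_0 div_mult_mod_eq mult_zero_right poly_add poly_mult)
  show "poly (if R x = 0 then P x else G x) c = 0 \<longleftrightarrow> poly (P x) c = 0 & poly (R x) c = 0"
  proof (cases "R x = 0")
   case False
   show ?thesis using False const step by (auto simp: R'_def if_False G(2))
  qed simp
 qed
qed

lemma rfam_common_roots:
 assumes "finite a" "!!P. P : a ==> rfam F P"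
 obtains G where "rfam F G" "!!x c. poly (G x) c = 0 \<longleftrightarrow> (ALL P:a. poly (P x) c = 0)"
proof -
 have "EX G. rfam F G & (ALL x c. poly (G x) c = 0 \<longleftrightarrow> (ALL P:a. poly (P x) c = 0))" using assms
 proof (induction a rule: finite_induct)
  case empty
  show ?case by (intro exI[of _ "%_. 0"]) (simp add: rfam_const)
 next
  case (insert P a)
  then obtain G where G: "rfam F G" "!!x c. poly (G x) c = 0 \<longleftrightarrow> (ALL P:a. poly (P x) c = 0)" by auto
  have P: "rfam F P" using insert.prems by simp
  obtain d where "ALL x. degree (G x) \<le> d" using G(1) unfolding rfam_def by blast
  from rfam_common_roots_bounded[OF P G(1) this] show ?case by (simp add: G(2))
 qed
 with that show ?thesis by blast
qed

text \<open>The equations are merged into one \<open>G\<close>. If \<open>G x\<close> is nonzero,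
  all its roots are roots of \<open>Q x\<close> exactly when it divides a power of
  \<open>Q x\<close>, and the exponent \<open>Suc d\<close> serves all parameters at once since the
  degrees of \<open>G\<close> are at most \<open>d\<close>. If \<open>G x = 0\<close>, the condition
  is \<open>Q x = 0\<close>.\<close>

lemma constructible_ex_root:
 assumes "finite a" "!!P. P : a ==> rfam F P" "rfam F Q"
 shows "{x. EX c. (ALL P:a. poly (P x) c = 0) & poly (Q x) c \<noteq> 0} : constructible F"
proof -
 obtain G where G: "rfam F G" "!!x c. poly (G x) c = 0 \<longleftrightarrow> (ALL P:a. poly (P x) c = 0)"
  using rfam_common_roots[of a F] assms by metis
 obtain d where d: "!!x. degree (G x) \<le> d" using G(1) unfolding rfam_def by blast
 have "(EX c. (ALL P:a. poly (P x) c = 0) & poly (Q x) c \<noteq> 0) \<longleftrightarrow>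
   \<not> ((G x = 0 & Q x = 0) \<or> (\<not> G x = 0 & Q x ^ Suc d mod G x = 0))" (is "?l \<longleftrightarrow> \<not> ?r") for x
 proof -
  have *: "?r \<longleftrightarrow> (ALL c. poly (G x) c = 0 --> poly (Q x) c = 0)"
  proof
   assume ?r
   then show "ALL c. poly (G x) c = 0 --> poly (Q x) c = 0"
   proof (elim disjE conjE)
    assume "Q x ^ Suc d mod G x = 0"
    then obtain K where K: "Q x ^ Suc d = G x * K" by (auto simp: mod_eq_0_iff_dvd)
    show ?thesis
    proof (intro allI impI)
     fix c assume "poly (G x) c = 0"
     then have "poly (Q x ^ Suc d) c = 0" unfolding K by simp
     then show "poly (Q x) c = 0" unfolding poly_power by (rule power_eq_0_iff[THEN iffD1, THEN conjunct1])
    qed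
   qed auto
  next
   assume "ALL c. poly (G x) c = 0 --> poly (Q x) c = 0"
   then have "G x dvd Q x ^ degree (G x) \<or> (G x = 0 & Q x = 0)" by (simp add: nullstellensatz_univariate)
   moreover have "Q x ^ degree (G x) dvd Q x ^ Suc d" using d[of x] by (intro le_imp_power_dvd) simp
   ultimately show ?r using dvd_trans[of "G x"] by (auto simp: mod_eq_0_iff_dvd)
  qed
  have "\<not> ?r \<longleftrightarrow> (EX c. poly (G x) c = 0 & poly (Q x) c \<noteq> 0)" unfolding * by blast
  then show ?thesis unfolding G(2) by (rule sym)
 qed
 then show ?thesis using G(1) assms(3)
  by (simp only:) (intro constructible_not constructible_disj constructible_conj rfam_zero rfam_mod rfam_power)
qed

section \<open>Projections of constructible sets and countable covers\<close>

definition coords :: "'i set => (('i => complex) => complex) set" where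
 "coords I = (%i x. x i) ` I"

lemma rfam_polys:
 assumes "p : polys (coords (insert i I))" shows "EX P. rfam (coords I) P & (ALL x c. poly (P x) c = p (x(i := c)))"
 using assms
proof (induction rule: polys.induct)
 case (polys_const c)
 show ?case by (intro exI[of _ "%_. [:c:]"]) (simp add: rfam_const)
next
 case (polys_coord f)
 then obtain j where j: "f = (%x. x j)" "j = i \<or> j : I" by (auto simp: coords_def)
 show ?case
 proof (cases "j = i")
  case True
  then show ?thesis by (intro exI[of _ "%_. [:0, 1:]"]) (simp add: rfam_const j)
 next
  case False
  then have "f : rats (coords I)" using j by (auto simp: coords_def intro: rats_coord)
  with False show ?thesis by (intro exI[of _ "%x. [:f x:]"]) (simp add: rfam_coord j)
 qed
next
 case (polys_add p q)
 then obtain P Q where "rfam (coords I) P" "ALL x c. poly (P x) c = p (x(i := c))"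
  "rfam (coords I) Q" "ALL x c. poly (Q x) c = q (x(i := c))" by blast
 then show ?case by (intro exI[of _ "%x. P x + Q x"]) (simp add: rfam_add del: fun_upd_apply)
next
 case (polys_mult p q)
 then obtain P Q where "rfam (coords I) P" "ALL x c. poly (P x) c = p (x(i := c))"
  "rfam (coords I) Q" "ALL x c. poly (Q x) c = q (x(i := c))" by blast
 then show ?case by (intro exI[of _ "%x. P x * Q x"]) (simp add: rfam_mult del: fun_upd_apply)
qed

text \<open>Chevalley's theorem for one coordinate: on a locally closed piece the question is
  whether some common root of the equations avoids the zeros of \<open>q\<close>.\<close>

theorem constructible_project:
 assumes "S : constructible (coords (insert i I))" shows "{x. EX c. x(i := c) : S} : constructible (coords I)"
proof -
 obtain a where B: "finite a" "S = \<Union>a" "!!B. B : a ==> locally_closed (coords (insert i I)) B"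
  using constructible_locally_closed[OF assms] by metis
 have "{x. EX c. x(i := c) : B} : constructible (coords I)" if BB: "B : a" for B
 proof -
  obtain P q where P: "finite P" "P \<subseteq> polys (coords (insert i I))" "q : polys (coords (insert i I))"
   "B = {x. (ALL p:P. p x = 0) & q x \<noteq> 0}" using B(3)[OF BB] unfolding locally_closed_def by blast
  have "ALL p:P. EX R. rfam (coords I) R & (ALL x c. poly (R x) c = p (x(i := c)))"
  using P(2) by (blast intro: subsetD[rotated] rfam_polys)
  then obtain R where R: "!!p. p : P ==> rfam (coords I) (R p) & (ALL x c. poly (R p x) c = p (x(i := c)))" by metis
  obtain Q where Q: "rfam (coords I) Q" "!!x c. poly (Q x) c = q (x(i := c))"
   using rfam_polys[OF P(3)] by (elim exE conjE) metis
  have "{x. EX c. (ALL r:R ` P. poly (r x) c = 0) & poly (Q x) c \<noteq> 0} : constructible (coords I)"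
   using P(1) R Q(1) by (intro constructible_ex_root) auto
  then show ?thesis using R by (simp add: P(4) Q(2))
 qed
 moreover have "{x. EX c. x(i := c) : S} = (\<Union>B\<in>a. {x. EX c. x(i := c) : B})" using B(2) by blast
 ultimately show ?thesis using constructible_UN[OF B(1), of "%B. {x. EX c. x(i := c) : B}"] by simp
qed

corollary constructible_project_finite: assumes "finite J" "S : constructible (coords (I \<union> J))"
 shows "{x. EX y. (%i. if i : J then y i else x i) : S} : constructible (coords I)" using assms
proof (induction J arbitrary: S rule: finite_induct)
 case (insert j J)
 have "{x. EX c. x(j := c) : S} : constructible (coords (I \<union> J))"
  using insert.prems by (intro constructible_project) simp
 from insert.IH[OF this]
 have "{x. EX y c. (%i. if i : J then y i else x i)(j := c) : S} : constructible (coords I)" by simp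
 moreover have "(EX y c. (%i. if i : J then y i else x i)(j := c) : S) \<longleftrightarrow> (EX y. (%i. if i : insert j J then y i else x i) : S)" for x
 proof safe
  fix y c assume "(%i. if i : J then y i else x i)(j := c) : S"
  moreover have "(%i. if i : J then y i else x i)(j := c) = (%i. if i : insert j J then (y(j := c)) i else x i)"
   by (auto simp: fun_eq_iff)
  ultimately show "EX y. (%i. if i : insert j J then y i else x i) : S" by metis
 next
  fix y assume "(%i. if i : insert j J then y i else x i) : S"
  moreover have "(%i. if i : insert j J then y i else x i) = (%i. if i : J then y i else x i)(j := y j)"
   by (auto simp: fun_eq_iff)
  ultimately show "EX y c. (%i. if i : J then y i else x i)(j := c) : S" by metis
 qed
 ultimately show ?case by simp
qed simp

text \<open>Along a coordinate line a polynomial has finitely many zeros or vanishes identically,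
  and this dichotomy passes to finite unions of locally closed sets.\<close>

lemma constructible_line:
 assumes "S : constructible (coords I)" shows "finite {c. x(i := c) : S} \<or> finite {c. x(i := c) \<notin> S}"
proof -
 have zeros: "finite {c. p (x(i := c)) = 0} \<or> (ALL c. p (x(i := c)) = 0)" if "p : polys (coords I)" for p
 proof -
  have "p : polys (coords (insert i I))" using that polys_mono[of "coords I" "coords (insert i I)"] by (auto simp: coords_def)
  from rfam_polys[OF this] obtain P where P: "!!c. poly (P x) c = p (x(i := c))" by metis
  show ?thesis using poly_roots_finite[of "P x"] P poly_0 by (fastforce simp: P)
 qed
 have B: "finite {c. x(i := c) : B} \<or> finite {c. x(i := c) \<notin> B}" if lc: "locally_closed (coords I) B" for B
 proof -
  obtain P q where P: "P \<subseteq> polys (coords I)" "q : polys (coords I)"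
   "B = {x. (ALL p:P. p x = 0) & q x \<noteq> 0}" using lc unfolding locally_closed_def by blast
  show ?thesis
  proof (cases "EX p:P. finite {c. p (x(i := c)) = 0}")
   case True
   then obtain p where "p : P" "finite {c. p (x(i := c)) = 0}" by blast
   moreover from this have "{c. x(i := c) : B} \<subseteq> {c. p (x(i := c)) = 0}" using P(3) by auto
   ultimately show ?thesis using finite_subset by blast
  next
   case False
   then have "ALL p:P. ALL c. p (x(i := c)) = 0" using zeros P(1) by blast
   then show ?thesis using P(3) zeros[OF P(2)] by auto
  qed
 qed
 obtain a where S: "finite a" "S = \<Union>a" "!!B. B : a ==> locally_closed (coords I) B"
  using constructible_locally_closed[OF assms] by metis
 show ?thesis
 proof (cases "EX B:a. finite {c. x(i := c) \<notin> B}")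
  case True
  then obtain B where "B : a" "finite {c. x(i := c) \<notin> B}" by blast
  moreover from this have "{c. x(i := c) \<notin> S} \<subseteq> {c. x(i := c) \<notin> B}" using S(2) by auto
  ultimately show ?thesis using finite_subset by blast
 next
  case False
  then have "finite {c. x(i := c) : B}" if "B : a" for B using that B[OF S(3)] by blast
  then show ?thesis using S(1) S(2) by simp
 qed
qed

text \<open>Uncountability of \<open>\<complex>\<close> makes countable covers by constructible sets finite; this replaces
 the finiteness of the number of irreducible components.\<close>

theorem constructible_countable_cover:
 fixes S :: "nat => ('i => complex) set"
 assumes "finite I" "!!n. S n : constructible (coords I)" "(\<Union>n. S n) = UNIV"
 shows "EX m. (\<Union>n\<le>m. S n) = UNIV" using assms
proof (induction I arbitrary: S rule: finite_induct)
 case empty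
 have "EX c. f = (%_. c)" if "f : rats (coords {})" for f :: "('i => complex) => complex"
  using that by (induction rule: rats.induct) (auto simp: coords_def)
 then have "EX c. (%x. of_bool (x : S n)) = (%_. c :: complex)" for n
  using empty.prems(1)[of n] unfolding constructible_def by blast
 then have const: "EX c. ALL x. of_bool (x : S n) = (c::complex)" for n by (metis (lifting))
 obtain n where "undefined : S n" using empty.prems(2) by blast
 with const[of n] have "S n = UNIV" by (metis UNIV_eq_I of_bool_eq_iff)
 then show ?case by (intro exI[of _ n]) auto
next
 case (insert i I)
 \<comment> \<open>Countably many finite sets cannot cover a line, so some \<open>S n\<close> is
   cofinite on it; one further index for each of the finitely many missing points suffices.\<close>
 have fin: "EX m. ALL c. x(i := c) : (\<Union>n\<le>m. S n)" for x
 proof -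
  have "EX n. finite {c. x(i := c) \<notin> S n}"
  proof (rule ccontr)
   assume "\<nexists>n. finite {c. x(i := c) \<notin> S n}"
   then have "finite {c. x(i := c) : S n}" for n using constructible_line[OF insert.prems(1)] by blast
   then have "countable (\<Union>n. {c. x(i := c) : S n})" by (intro countable_UN) (auto intro: countable_finite)
   moreover have "(\<Union>n. {c. x(i := c) : S n}) = UNIV" using insert.prems(2) by blast
   ultimately show False using uncountable_UNIV_complex by simp
  qed
  then obtain n where n: "finite {c. x(i := c) \<notin> S n}" by blast
  have "EX k. x(i := c) : S k" for c using insert.prems(2) by blast
  then obtain k where k: "!!c. x(i := c) : S (k c)" by metis
  let ?m = "Max (insert n (k ` {c. x(i := c) \<notin> S n}))"
  have "x(i := c) : (\<Union>n\<le>?m. S n)" for c using n k[of c] by (auto intro!: Max_ge)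
  then show ?thesis by blast
 qed
 \<comment> \<open>The points over which the sets up to index \<open>m\<close> cover the whole line.
   The complement is a projection, so the induction hypothesis applies to \<open>T\<close>.\<close>
 define T where "T m = {x. ALL c. x(i := c) : (\<Union>n\<le>m. S n)}" for m
 have T: "T m : constructible (coords I)" for m
 proof -
  have "- (\<Union>n\<le>m. S n) : constructible (coords (insert i I))"
   using insert.prems(1) by (intro constructible_compl constructible_UN) auto
  from constructible_not[OF constructible_project[OF this]] show ?thesis by (simp add: T_def)
 qed
 have "(\<Union>m. T m) = UNIV" using fin by (auto simp: T_def)
 from insert.IH[OF T this] obtain m where m: "(\<Union>n\<le>m. T n) = UNIV" by (elim exE)
 have "x : (\<Union>n\<le>m. S n)" for x
 proof -
  obtain k where k: "k \<le> m" "x : T k" using m by auto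
  then have "x(i := x i) : (\<Union>n\<le>k. S n)" unfolding T_def mem_Collect_eq by (elim conjE allE)
  with k(1) show ?thesis by (auto intro: order_trans)
 qed
 then show ?case by blast
qed

section \<open>Zariski topologies in general\<close>

lemma topspace_zariski: "topspace (zariski S F) = S"
proof -
 have "openin (zariski S F) S" unfolding openin_zariski by (intro exI[of _ "{%_. 1}"]) (auto intro: polys_const)
 moreover have "U \<subseteq> S" if "openin (zariski S F) U" for U using that by (auto simp: openin_zariski)
 ultimately show ?thesis by (intro equalityI) (auto simp: openin_subset topspace_def)
qed

lemma closedin_zariski:
 "closedin (zariski S F) C \<longleftrightarrow> (EX P<=polys F. C = {x : S. ALL p:P. p x = 0})"
proof
 assume "closedin (zariski S F) C"
 then have C: "C \<subseteq> S" and "openin (zariski S F) (S - C)" by (auto simp: closedin_def topspace_zariski)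
 then obtain P where P: "P \<subseteq> polys F" "S - C = {x : S. EX p:P. p x \<noteq> 0}"
  unfolding openin_zariski by (elim exE conjE) 
 have "C = S - (S - C)" using C by auto
 also have "\<dots> = {x : S. ALL p:P. p x = 0}" unfolding P(2) by auto
 finally show "EX P<=polys F. C = {x : S. ALL p:P. p x = 0}" using P(1) by (intro exI[of _ P] conjI)
next
 assume "EX P<=polys F. C = {x : S. ALL p:P. p x = 0}"
 then obtain P where P: "P \<subseteq> polys F" "C = {x : S. ALL p:P. p x = 0}" by (elim exE conjE)
 have "S - C = {x : S. EX p:P. p x \<noteq> 0}" unfolding P(2) by auto
 then show "closedin (zariski S F) C"
  using P unfolding closedin_def topspace_zariski openin_zariski by (intro conjI exI[of _ P]) auto
qed

lemma continuous_map_zariski: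
 assumes "!!x. x : S ==> h x : S'" "!!f. f : F' ==> (%x. f (h x)) : polys F"
 shows "continuous_map (zariski S F) (zariski S' F') h" unfolding continuous_map topspace_zariski
proof (intro conjI allI impI)
 show "h ` S \<subseteq> S'" using assms(1) by blast
 fix U assume "openin (zariski S' F') U"
 then obtain P where P: "P \<subseteq> polys F'" "U = {x : S'. EX p:P. p x \<noteq> 0}"
  unfolding openin_zariski by (elim exE conjE)
 have "(%p x. p (h x)) ` P \<subseteq> polys F" using P(1) polys_subst[of _ F' h F] assms(2) by auto
 moreover have "{x : S. h x : U} = {x : S. EX p:(%p x. p (h x)) ` P. p x \<noteq> 0}"
  unfolding P(2) using assms(1) by auto
 ultimately show "openin (zariski S F) {x : S. h x : U}"
  unfolding openin_zariski by (intro exI[of _ "(%p x. p (h x)) ` P"] conjI)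
qed

lemma closedin_zariski_points:
 assumes "x : S" "!!y. y : S ==> (ALL f:F. f x = f y) ==> x = y" shows "closedin (zariski S F) {x}"
 unfolding closedin_zariski
proof (intro exI conjI)
 show "(%f y. f y - f x) ` F \<subseteq> polys F" by (auto intro!: polys_diff polys_const intro: polys_coord)
 show "{x} = {y : S. ALL p:(%f y. f y - f x) ` F. p y = 0}"
 proof (rule equalityI; rule subsetI)
  fix y assume "y : {y : S. ALL p:(%f y. f y - f x) ` F. p y = 0}"
  then have "y : S" "ALL f:F. f x = f y" by auto
  from assms(2)[OF this] show "y : {x}" by simp
 qed (use assms(1) in simp)
qed

subsection \<open>Constructible subgroups are closed\<close>

text \<open>Induction on the pieces. A piece inside the closure of the others does not change the
  closure; otherwise it has a point off that closure, and removing the closure of the others from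
  \<open>U\<close> isolates a part of the piece.\<close>

lemma locally_closed_union_interior:
 assumes "finite a" "!!B. B : a ==> EX C U. closedin T C & openin T U & B = C \<inter> U" "\<Union>a \<noteq> {}"
 shows "EX W. openin T W & W \<inter> T closure_of (\<Union>a) \<noteq> {} & W \<inter> T closure_of (\<Union>a) \<subseteq> \<Union>a"
 using assms
proof (induction a rule: finite_induct)
 case (insert B a)
 let ?E = "\<Union>a"
 obtain C U where CU: "closedin T C" "openin T U" "B = C \<inter> U" using insert.prems(1)[of B] by auto
 have B: "B \<subseteq> topspace T" "T closure_of B \<subseteq> C"
  using closedin_subset[OF CU(1)] CU(3) closure_of_minimal[OF _ CU(1), of B] by auto
 have cl: "T closure_of \<Union>(insert B a) = T closure_of B \<union> T closure_of ?E" by (simp add: closure_of_Un)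
 show ?case
 proof (cases "B \<subseteq> T closure_of ?E")
  case True
  then have "T closure_of B \<subseteq> T closure_of ?E" by (intro closure_of_minimal) auto
  then have cl': "T closure_of \<Union>(insert B a) = T closure_of ?E" using cl by auto
  have "?E \<noteq> {}"
  proof
   assume "?E = {}"
   then have "T closure_of ?E = {}" by (simp only: closure_of_empty)
   with True have "B = {}" by simp
   with \<open>?E = {}\<close> insert.prems(2) show False by auto
  qed
  with insert obtain W where "openin T W" "W \<inter> T closure_of ?E \<noteq> {}" "W \<inter> T closure_of ?E \<subseteq> ?E" by auto
  then show ?thesis unfolding cl' by auto
 next
  case False
  then obtain x where x: "x : B" "x \<notin> T closure_of ?E" by blast
  let ?W = "U - T closure_of ?E"
  have "openin T ?W" using CU(2) by (intro openin_diff) auto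
  moreover have "x : ?W \<inter> T closure_of \<Union>(insert B a)"
   using x CU(3) closure_of_subset[OF B(1)] cl by auto
  moreover have "?W \<inter> T closure_of \<Union>(insert B a) \<subseteq> \<Union>(insert B a)"
   using cl B(2) CU(3) by auto ultimately show ?thesis by blast
 qed
qed simp

text \<open>Only translations and inversion are required to be continuous, because Zariski
  topologies do not make multiplication continuous for the product topology.\<close>

locale group_topology = group G for G (structure) +
 fixes T assumes topspace_eq: "topspace T = carrier G"
  and left_cont: "g : carrier G ==> continuous_map T T (%x. g \<otimes> x)"
  and right_cont: "g : carrier G ==> continuous_map T T (%x. x \<otimes> g)"
  and inv_cont: "continuous_map T T (m_inv G)"
begin

text \<open>With separately continuous multiplication, a product of two limit points takes two
  passages to the closure, one for each factor.\<close>

lemma closure_of_subgroup: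
 assumes H: "subgroup H G" shows "subgroup (T closure_of H) G"
proof (rule subgroupI)
 have Hc: "H \<subseteq> carrier G" using H by (rule subgroup.subset)
 have Hcl: "H \<subseteq> T closure_of H" using Hc by (intro closure_of_subset) (simp add: topspace_eq)
 show sub: "T closure_of H \<subseteq> carrier G" using closure_of_subset_topspace topspace_eq by metis
 show "T closure_of H \<noteq> {}" using Hcl subgroup.one_closed[OF H] by auto
 have img: "f ` (T closure_of A) \<subseteq> T closure_of H" if "continuous_map T T f" "f ` A \<subseteq> T closure_of H" for f A
 proof -
  have "f ` (T closure_of A) \<subseteq> T closure_of (f ` A)"
   using that(1) continuous_map_image_closure_subset by blast
  also have "\<dots> \<subseteq> T closure_of H" using that(2) by (intro closure_of_minimal) auto
  finally show ?thesis .
 qed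
 show "inv a : T closure_of H" if "a : T closure_of H" for a
  using img[OF inv_cont, of H] that Hcl subgroup.m_inv_closed[OF H] by auto
 show "a \<otimes> b : T closure_of H" if "a : T closure_of H" "b : T closure_of H" for a b
 proof -
  have 1: "a \<otimes> h : T closure_of H" if "h : H" for h
   using img[OF right_cont[of h], of H] that Hcl Hc subgroup.m_closed[OF H] \<open>a : T closure_of H\<close> by auto
  then show ?thesis using img[OF left_cont[of a], of H] sub that by auto
 qed
qed

text \<open>Let \<open>x\<close> be in \<open>W\<close> and \<open>H\<close>. For \<open>y\<close>
  in the closure, the points \<open>z\<close> with \<open>x y^-1 z\<close> in \<open>W\<close> form
  a neighbourhood of \<open>y\<close> and include some \<open>h\<close> in \<open>H\<close>. Then
  \<open>x y^-1 h\<close> lies in \<open>W\<close> and in the closure, hence in \<open>H\<close>,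
  and \<open>y\<close> can be solved for.\<close>

lemma subgroup_closed:
 assumes H: "subgroup H G" and W: "openin T W" "W \<inter> T closure_of H \<noteq> {}" "W \<inter> T closure_of H \<subseteq> H"
 shows "closedin T H"
proof -
 have Hc: "H \<subseteq> carrier G" using H by (rule subgroup.subset)
 have Hcl: "H \<subseteq> T closure_of H" using Hc by (intro closure_of_subset) (simp add: topspace_eq)
 interpret K: subgroup "T closure_of H" G by (rule closure_of_subgroup[OF H])
 obtain x where x: "x : W" "x : H" using W by blast
 have "y : H" if y: "y : T closure_of H" for y
 proof -
  have yc: "y : carrier G" and xc: "x : carrier G" using y x Hc K.subset by auto
  let ?V = "{z : topspace T. (x \<otimes> inv y) \<otimes> z : W}"
  have "openin T ?V" using W(1) by (intro openin_continuous_map_preimage[OF left_cont]) (auto simp: xc yc)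
  moreover have "y : ?V" using x yc xc by (simp add: topspace_eq m_assoc)
  ultimately have "EX h. h : H & h : ?V" using y unfolding in_closure_of by (elim conjE allE[of _ ?V]) simp
  then obtain h where h: "h : H" "h : ?V" by (elim exE conjE)
  have "(x \<otimes> inv y) \<otimes> h : T closure_of H" using x h y Hcl by (intro K.m_closed K.m_inv_closed) auto
  with h W(3) have *: "(x \<otimes> inv y) \<otimes> h : H" by blast
  have hc: "h : carrier G" using h Hc by auto
  have "inv x \<otimes> ((x \<otimes> inv y) \<otimes> h) \<otimes> inv h = inv y" using xc yc hc by (simp add: m_assoc inv_solve_left')
  moreover have "inv x \<otimes> ((x \<otimes> inv y) \<otimes> h) \<otimes> inv h : H"
   by (rule subgroup.m_closed[OF H subgroup.m_closed[OF H subgroup.m_inv_closed[OF H x(2)] *]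
      subgroup.m_inv_closed[OF H h(1)]])
  ultimately have "inv y : H" by simp
  from subgroup.m_inv_closed[OF H this] show ?thesis using yc by simp
 qed
 then have "T closure_of H = H" using Hcl by blast
 then show ?thesis using closedin_closure_of[of T H] by simp
qed

end

subsection \<open>The Zariski topology of \<open>GL\<^sub>n\<close>\<close>

lemma carrier_GLn: "A : carrier GLn \<longleftrightarrow> invertible A"
 and mult_GLn: "A \<otimes>\<^bsub>GLn\<^esub> B = A ** B" and one_GLn: "\<one>\<^bsub>GLn\<^esub> = mat 1"
 by (simp_all add: GLn_def)

lemma matrix_inv_right: "invertible (A::complex^'n^'n) ==> A ** matrix_inv A = mat 1"
 and matrix_inv_left: "invertible A ==> matrix_inv A ** A = mat 1"
 using someI_ex[of "%B. A ** B = mat 1 & B ** A = mat 1"] unfolding invertible_def matrix_inv_def by blast+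

lemma matrix_inv_unique: "A ** B = mat 1 ==> matrix_inv A = (B::complex^'n^'n)"
proof -
 assume AB: "A ** B = mat 1"
 then have "invertible A" using matrix_left_right_inverse[of A B] unfolding invertible_def by blast
 then have "matrix_inv A = matrix_inv A ** (A ** B)" by (simp add: AB)
 also have "\<dots> = B" using \<open>invertible A\<close> by (simp add: matrix_mul_assoc matrix_inv_left)
 finally show ?thesis .
qed

lemma invertible_matrix_inv: "invertible A ==> invertible (matrix_inv (A::complex^'n^'n))"
 unfolding invertible_def using matrix_inv_right[of A] matrix_inv_left[of A] by (auto simp: invertible_def)

lemma matrix_inv_inv: "invertible A ==> matrix_inv (matrix_inv A) = (A::complex^'n^'n)"
 by (intro matrix_inv_unique matrix_inv_left)

lemma matrix_inv_mult: "invertible A ==> invertible B ==> matrix_inv (A ** B) = matrix_inv (B::complex^'n^'n) ** matrix_inv (A::complex^'n^'n)"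
proof (intro matrix_inv_unique)
 assume "invertible A" "invertible B"
 have "A ** B ** (matrix_inv B ** matrix_inv A) = A ** (B ** matrix_inv B) ** matrix_inv A"
  by (simp add: matrix_mul_assoc)
 then show "A ** B ** (matrix_inv B ** matrix_inv A) = mat 1"
  using \<open>invertible A\<close> \<open>invertible B\<close> by (simp add: matrix_inv_right)
qed

lemma inv_GLn: "invertible A ==> inv\<^bsub>GLn\<^esub> A = matrix_inv (A::complex^'n^'n)"
 by (intro group.inv_equality[OF group_GLn])
  (simp_all add: mult_GLn one_GLn carrier_GLn matrix_inv_left invertible_matrix_inv)

lemma invertible_mat1: "invertible (mat 1 :: complex^'n^'n)"
 unfolding invertible_def by (rule exI[of _ "mat 1"]) simp

lemma matrix_inv_mat1: "matrix_inv (mat 1) = (mat 1 :: complex^'n^'n)"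
 by (rule matrix_inv_unique) simp

lemma entry_polys: "(%A. A $ i $ j) : polys entries"
 by (intro polys_coord) (auto simp: entries_def)

lemma det_polys:
 fixes M :: "'x => complex^'m^'m" assumes "!!i j. (%x. M x $ i $ j) : polys F" shows "(%x. det (M x)) : polys F"
 unfolding det_def using assms by (intro polys_sum polys_mult polys_const polys_prod)

text \<open>Generators of the regular functions on the affine variety \<open>GL_n\<close>: the
  entries of the inverse make inversion and \<open>Ad\<close> polynomial. The topology stays the
  same, see \<open>zariski_GLn_regs\<close>.\<close>

definition reg_coords :: "(complex^'n^'n => complex) set" where
 "reg_coords = entries \<union> {(%A. matrix_inv A $ i $ j) | i j. True}"

abbreviation regs :: "(complex^'n^'n => complex) set" where "regs \<equiv> polys reg_coords"

lemma entry_regs: "(%A. A $ i $ j) : regs" and inv_entry_regs: "(%A. matrix_inv A $ i $ j) : regs"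
 by (auto intro!: polys_coord simp: reg_coords_def entries_def)

text \<open>Cramer's rule: replacing column \<open>i\<close> by the \<open>j\<close>-th unit vector
  gives an entry of the adjugate.\<close>

lemma inv_entry_poly:
 "EX q:polys entries. ALL A::complex^'n^'n. invertible A --> q A = det A * matrix_inv A $ i $ j"
proof
 let ?M = "%A::complex^'n^'n. (\<chi> r s. if s = i then (axis j 1 :: complex^'n) $ r else A $ r $ s) :: complex^'n^'n"
 show "(%A. det (?M A)) : polys entries"
 proof (rule det_polys)
  fix r s show "(%A. ?M A $ r $ s) : polys entries" by (cases "s = i") (simp_all add: polys_const entry_polys)
 qed
 show "ALL A. invertible A --> det (?M A) = det A * matrix_inv A $ i $ j"
 proof (intro allI impI)
  fix A :: "complex^'n^'n" assume A: "invertible A"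
  then have d: "det A \<noteq> 0" by (simp add: invertible_det_nz)
  have "A *v (matrix_inv A *v axis j 1) = axis j 1" using A by (simp add: matrix_vector_mul_assoc matrix_inv_right)
  then have "matrix_inv A *v axis j 1 = (\<chi> k. det (\<chi> r s. if s = k then (axis j 1 :: complex^'n) $ r else A $ r $ s) / det A)"
   using cramer[OF d] by blast
  then have "(matrix_inv A *v axis j 1) $ i = det (?M A) / det A" by simp
  then have "matrix_inv A $ i $ j = det (?M A) / det A" by (simp add: matrix_vector_mul_component inner_axis matrix_vector_mult_def axis_def if_distrib cong: if_cong)
  then show "det (?M A) = det A * matrix_inv A $ i $ j" using d by simp
 qed
qed

lemma regs_clear_denominators:
 "p : regs ==> EX q:polys entries. EX m. ALL A::complex^'n^'n. invertible A --> q A = det A ^ m * p A"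
proof (induction rule: polys.induct)
 case (polys_const c)
 show ?case by (intro bexI[of _ "%_. c"] exI[of _ 0]) (auto intro: polys.polys_const)
next
 case (polys_coord f)
 then consider i j where "f = (%A. A $ i $ j)" | i j where "f = (%A. matrix_inv A $ i $ j)"
  by (auto simp: reg_coords_def entries_def)
 then show ?case
 proof cases
  case 1
  then show ?thesis by (intro bexI[of _ f] exI[of _ 0]) (auto simp: entry_polys)
 next
  case 2
  obtain q where "q : polys entries" "ALL A::complex^'n^'n. invertible A --> q A = det A * matrix_inv A $ i $ j"
   using inv_entry_poly[of i j] by (elim bexE)
  with 2 show ?thesis by (intro bexI[of _ q] exI[of _ 1]) auto
 qed
next
 case (polys_add p p')
 then obtain q m q' m' where *: "q : polys entries" "ALL A::complex^'n^'n. invertible A --> q A = det A ^ m * p A"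
  "q' : polys entries" "ALL A::complex^'n^'n. invertible A --> q' A = det A ^ m' * p' A" by (elim bexE exE)
 have d: "(%A::complex^'n^'n. det A) : polys entries" by (intro det_polys entry_polys)
 show ?case
 proof (intro bexI exI allI impI)
  show "(%A. det A ^ m' * q A + det A ^ m * q' A) : polys entries"
   using * d by (intro polys.polys_add polys.polys_mult polys_power)
  fix A :: "complex^'n^'n" assume "invertible A"
  with * show "det A ^ m' * q A + det A ^ m * q' A = det A ^ (m + m') * (p A + p' A)"
   by (simp add: power_add algebra_simps)
 qed
next
 case (polys_mult p p')
 then obtain q m q' m' where *: "q : polys entries" "ALL A::complex^'n^'n. invertible A --> q A = det A ^ m * p A"
  "q' : polys entries" "ALL A::complex^'n^'n. invertible A --> q' A = det A ^ m' * p' A" by (elim bexE exE)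
 show ?case
 proof (intro bexI exI allI impI)
  show "(%A. q A * q' A) : polys entries" using * by (intro polys.polys_mult)
  fix A :: "complex^'n^'n" assume "invertible A"
  with * show "q A * q' A = det A ^ (m + m') * (p A * p' A)" by (simp add: power_add algebra_simps)
 qed
qed

lemma zariski_GLn_regs: "zariski_GLn = (zariski (carrier GLn) reg_coords :: (complex^'n^'n) topology)"
 unfolding topology_eq
proof (intro allI iffI)
 fix U :: "(complex^'n^'n) set"
 assume "openin zariski_GLn U"
 then obtain P where P: "P \<subseteq> polys entries" "U = {x : carrier GLn. EX p:P. p x \<noteq> 0}"
  unfolding zariski_GLn_def openin_zariski by (elim exE conjE)
 have "polys entries \<subseteq> (regs :: (complex^'n^'n => complex) set)" by (intro polys_mono) (auto simp: reg_coords_def)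
 with P show "openin (zariski (carrier GLn) reg_coords) U" unfolding openin_zariski by (intro exI[of _ P]) auto
next
 fix U :: "(complex^'n^'n) set"
 assume "openin (zariski (carrier GLn) reg_coords) U"
 then obtain P where P: "P \<subseteq> regs" "U = {x : carrier GLn. EX p:P. p x \<noteq> 0}"
  unfolding openin_zariski by (elim exE conjE)
 have "ALL p:P. EX q:polys entries. EX m. ALL A::complex^'n^'n. invertible A --> q A = det A ^ m * p A"
  using P(1) by (auto intro!: regs_clear_denominators)
 then obtain q m where q: "!!p. p : P ==> q p : polys entries & (ALL A::complex^'n^'n. invertible A --> q p A = det A ^ m p * p A)"
  by metis
 have "U = {x : carrier GLn. EX r:q ` P. r x \<noteq> 0}"
  unfolding P(2) using q by (auto simp: carrier_GLn invertible_det_nz)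
 moreover have "q ` P \<subseteq> polys entries" using q by auto
 ultimately show "openin zariski_GLn U" unfolding zariski_GLn_def openin_zariski by (intro exI[of _ "q ` P"] conjI)
qed

lemma topspace_GLn: "topspace zariski_GLn = carrier GLn"
 by (simp add: zariski_GLn_def topspace_zariski)

lemma closedin_GLn_regs:
 "P \<subseteq> regs ==> closedin zariski_GLn {A::complex^'n^'n. invertible A & (ALL p:P. p A = 0)}"
 unfolding zariski_GLn_regs closedin_zariski by (intro exI[of _ P]) (auto simp: carrier_GLn)

lemma regs_mult_entry:
 fixes M :: "'x => complex^'m^'k" and N :: "'x => complex^'n^'m"
 assumes "!!i j. (%x. M x $ i $ j) : polys F" "!!i j. (%x. N x $ i $ j) : polys F"
 shows "(%x. (M x ** N x) $ i $ j) : polys F"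
 unfolding matrix_matrix_mult_def using assms by (auto intro!: polys_sum polys_mult)

lemma continuous_map_GLn:
 fixes h :: "'x => complex^'n^'n"
 assumes "!!x. x : S ==> invertible (h x)" "!!i j. EX g:polys F. ALL x:S. g x = h x $ i $ j"
 shows "continuous_map (zariski S F) (zariski_GLn :: (complex^'n^'n) topology) h"
proof -
 obtain g where g: "!!i j. g i j : polys F & (ALL x:S. g i j x = h x $ i $ j)" using assms(2) by metis
 define h' where "h' x = (\<chi> i j. g i j x)" for x
 have h': "h' x = h x" if "x : S" for x using g that by (simp add: h'_def vec_eq_iff)
 have "continuous_map (zariski S F) zariski_GLn h'" unfolding zariski_GLn_def
 proof (rule continuous_map_zariski)
  show "h' x : carrier GLn" if "x : S" for x using assms(1) h' that by (simp add: carrier_GLn)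
  show "(%x. f (h' x)) : polys F" if "f : entries" for f using that g by (auto simp: entries_def h'_def)
 qed
 then show ?thesis by (rule continuous_map_eq) (simp add: h' topspace_zariski)
qed

interpretation GLn_top: group_topology "GLn :: (complex^'n^'n) monoid" zariski_GLn
proof (intro group_topology.intro group_topology_axioms.intro group_GLn)
 show "topspace zariski_GLn = carrier (GLn :: (complex^'n^'n) monoid)" by (rule topspace_GLn)
 have mult_polys: "(%x. M x $ i $ j) : polys F ==> EX g:polys F. ALL x:S. g x = M x $ i $ j"
  for M :: "complex^'n^'n => complex^'n^'n" and i j F S by (auto intro: bexI)
 show "continuous_map zariski_GLn zariski_GLn (%x. A \<otimes>\<^bsub>GLn\<^esub> x)" if A: "A : carrier GLn" for A :: "complex^'n^'n"
  unfolding mult_GLn by (subst zariski_GLn_def, rule continuous_map_GLn)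
   (use A in \<open>auto simp: carrier_GLn intro!: invertible_mult mult_polys regs_mult_entry polys_const entry_polys\<close>)
 show "continuous_map zariski_GLn zariski_GLn (%x. x \<otimes>\<^bsub>GLn\<^esub> A)" if A: "A : carrier GLn" for A :: "complex^'n^'n"
  unfolding mult_GLn by (subst zariski_GLn_def, rule continuous_map_GLn)
   (use A in \<open>auto simp: carrier_GLn intro!: invertible_mult mult_polys regs_mult_entry polys_const entry_polys\<close>)
 have "continuous_map zariski_GLn zariski_GLn (matrix_inv :: complex^'n^'n => _)"
  by (subst zariski_GLn_regs, rule continuous_map_GLn)
   (auto simp: carrier_GLn intro!: invertible_matrix_inv mult_polys inv_entry_regs)
 then show "continuous_map zariski_GLn zariski_GLn (m_inv (GLn :: (complex^'n^'n) monoid))"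
  by (rule continuous_map_eq) (simp add: topspace_GLn carrier_GLn inv_GLn)
qed

definition alg_group :: "(complex^'n^'n) set => bool" where
 "alg_group G \<longleftrightarrow> subgroup G GLn & closedin zariski_GLn G"

lemma connected_algebraic_group_alg: "connected_algebraic_group G ==> alg_group G"
 by (simp add: connected_algebraic_group_def alg_group_def)

lemma alg_group_invertible: "alg_group G ==> A : G ==> invertible A"
 unfolding alg_group_def using subgroup.subset carrier_GLn by blast

lemma alg_group_one: "alg_group G ==> mat 1 : G"
 unfolding alg_group_def using subgroup.one_closed one_GLn by metis

lemma alg_group_mult: "alg_group G ==> A : G ==> B : G ==> A ** B : G"
 unfolding alg_group_def using subgroup.m_closed mult_GLn by metis

lemma alg_group_inv: "alg_group G ==> A : G ==> matrix_inv A : G"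
 using subgroup.m_inv_closed[of G GLn A] inv_GLn[OF alg_group_invertible] unfolding alg_group_def by metis

lemma alg_groupI:
 fixes G :: "(complex^'n^'n) set"
 assumes "closedin zariski_GLn G" "mat 1 : G" "!!A B. A : G ==> B : G ==> A ** B : G"
  "!!A. A : G ==> matrix_inv A : G" shows "alg_group G"
proof -
 have sub: "G \<subseteq> carrier GLn" using closedin_subset[OF assms(1)] by (simp add: topspace_GLn)
 have "subgroup G GLn"
 proof (rule group.subgroupI[OF group_GLn sub])
  show "G \<noteq> {}" using assms(2) by auto
  show "inv\<^bsub>GLn\<^esub> a : G" if "a : G" for a
  using sub that assms(4)[OF that] by (auto simp: carrier_GLn inv_GLn)
  show "a \<otimes>\<^bsub>GLn\<^esub> b : G" if "a : G" "b : G" for a b using assms(3) that by (simp add: mult_GLn)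
 qed
 with assms(1) show ?thesis by (simp add: alg_group_def)
qed

lemma finite_entries: "finite (entries :: (complex^'n^'n => complex) set)"
proof -
 have "entries = (%(i, j) A. (A::complex^'n^'n) $ i $ j) ` UNIV" by (auto simp: entries_def)
 then show ?thesis by (metis finite finite_imageI)
qed

section \<open>Constructible sets of matrices, closed images and covers by cosets\<close>

lemma closedin_GLn_constructible:
 fixes G :: "(complex^'n^'n) set" assumes "closedin zariski_GLn G" shows "G : constructible entries"
proof -
 obtain P where P: "P \<subseteq> polys entries" "G = {A : carrier GLn. ALL p:P. p A = 0}"
  using assms unfolding zariski_GLn_def closedin_zariski by (elim exE conjE)
 obtain P0 where P0: "finite P0" "P0 \<subseteq> P" "!!x. (ALL p:P. p x = 0) \<longleftrightarrow> (ALL p:P0. p x = 0)"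
  using finite_equations[OF finite_entries P(1)] by metis
 show ?thesis
  using P0 P(1) by (auto simp: P(2) P0(3) carrier_GLn invertible_det_nz intro!: constructible_conj constructible_not constructible_zero constructible_all polys_rats det_polys entry_polys)
qed

text \<open>The graph of the map is constructible in the matrix coordinates (tagged
  \<open>Inl\<close>) and the value coordinates (tagged \<open>Inr\<close>) together; the former are
  projected away.\<close>

theorem Chevalley:
 fixes K :: "(complex^'n^'n) set" and r :: "'j => complex^'n^'n => complex"
 assumes K: "K : constructible entries" and J: "finite J" "!!j. j : J ==> r j : rats entries"
 shows "{y. EX A:K. ALL j:J. y j = r j A} : constructible (coords J)"
proof -
 define m where "m z = (\<chi> i k. z (Inl (i, k)))" for z :: "('n \<times> 'n) + 'j => complex"
 let ?L = "range Inl :: (('n \<times> 'n) + 'j) set" and ?R = "Inr ` J :: (('n \<times> 'n) + 'j) set"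
 have coord: "(%z. z i) : rats (coords (?R \<union> ?L))" if "i : ?R \<union> ?L" for i
  using that by (intro rats_coord) (auto simp: coords_def)
 have m: "(%z. f (m z)) : rats (coords (?R \<union> ?L))" if f: "f : entries" for f
 using f coord by (auto simp: entries_def m_def)
 define S where "S = {z. m z : K & (ALL j:J. z (Inr j) - r j (m z) = 0)}"
 have "S : constructible (coords (?R \<union> ?L))" unfolding S_def
 proof (intro constructible_conj constructible_all constructible_zero rats_diff J(1))
  show "{z. m z : K} : constructible (coords (?R \<union> ?L))" using K m by (rule constructible_vimage)
  fix j assume j: "j : J"
  then show "(%z. z (Inr j)) : rats (coords (?R \<union> ?L))" by (intro coord) auto
  show "(%z. r j (m z)) : rats (coords (?R \<union> ?L))" using J(2)[OF j] m by (rule rats_subst)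
 qed
 then have "{z. EX y. (%i. if i : ?L then y i else z i) : S} : constructible (coords ?R)"
  by (intro constructible_project_finite) auto
 then have "{y. (%i. case i of Inl _ => 0 | Inr j => y j) : {z. EX y. (%i. if i : ?L then y i else z i) : S}} : constructible (coords J)"
 by (fastforce simp: coords_def intro: rats_coord constructible_vimage)
 moreover have "(EX w. (%i. if i : ?L then w i else (case i of Inl _ => 0 | Inr j => y j)) : S) \<longleftrightarrow> (EX A:K. ALL j:J. y j = r j A)" for y
 proof -
  have Inr: "Inr j \<notin> ?L" for j by auto
  have m': "m (%i. if i : ?L then w i else z i) = (\<chi> i k. w (Inl (i, k)))" for w z by (simp add: m_def)
  show ?thesis
  proof
   assume "EX w. (%i. if i : ?L then w i else (case i of Inl _ => 0 | Inr j => y j)) : S"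
   then obtain w where w: "(%i. if i : ?L then w i else (case i of Inl _ => 0 | Inr j => y j)) : S" by (elim exE)
   then show "EX A:K. ALL j:J. y j = r j A" unfolding S_def mem_Collect_eq m'
    by (intro bexI[of _ "\<chi> i k. w (Inl (i, k))"]) (simp_all add: Inr)
  next
   assume "EX A:K. ALL j:J. y j = r j A"
   then obtain A where A: "A : K" "ALL j:J. y j = r j A" by (elim bexE)
   define w where "w i = (case i of Inl (k, l) => A $ k $ l | Inr _ => 0)" for i :: "('n \<times> 'n) + 'j"
   show "EX w. (%i. if i : ?L then w i else (case i of Inl _ => 0 | Inr j => y j)) : S"
    using A by (auto simp: w_def vec_eq_iff S_def mem_Collect_eq m' Inr intro!: exI[of _ w])
  qed
 qed
 ultimately show ?thesis by simp
qed

lemma locally_closed_zariski: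
 assumes "locally_closed F B" "B \<subseteq> S"
 shows "EX C U. closedin (zariski S F) C & openin (zariski S F) U & B = C \<inter> U"
proof -
 obtain P q where P: "P \<subseteq> polys F" "q : polys F" "B = {x. (ALL p:P. p x = 0) & q x \<noteq> 0}"
  using assms(1) unfolding locally_closed_def by (elim exE conjE)
 have "closedin (zariski S F) {x : S. ALL p:P. p x = 0}"
  unfolding closedin_zariski using P(1) by (intro exI[of _ P]) simp
 moreover have "openin (zariski S F) {x : S. q x \<noteq> 0}"
  unfolding openin_zariski using P(2) by (intro exI[of _ "{q}"]) simp
 moreover have "B = {x : S. ALL p:P. p x = 0} \<inter> {x : S. q x \<noteq> 0}" using P(3) assms(2) by auto
 ultimately show ?thesis by (intro exI conjI)
qed

lemma constructible_interior:
 assumes "E : constructible F" "E \<subseteq> S" "E \<noteq> {}"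
 shows "EX W. openin (zariski S F) W & W \<inter> zariski S F closure_of E \<noteq> {} & W \<inter> zariski S F closure_of E \<subseteq> E"
proof -
 obtain a where B: "finite a" "E = \<Union>a" "!!B. B : a ==> locally_closed F B"
  using constructible_locally_closed[OF assms(1)] by metis
 show ?thesis unfolding B(2)
 proof (rule locally_closed_union_interior[OF B(1)])
  show "\<Union>a \<noteq> {}" using assms(3) B(2) by simp
  show "EX C U. closedin (zariski S F) C & openin (zariski S F) U & B = C \<inter> U" if "B : a" for B
   using assms(2) B(2) that by (intro locally_closed_zariski B(3)) auto
 qed
qed

lemma regs_rats:
 assumes "p : regs" shows "EX r:rats entries. ALL A::complex^'n^'n. invertible A --> r A = p A"
proof -
 obtain q m where q: "q : polys entries" "ALL A::complex^'n^'n. invertible A --> q A = det A ^ m * p A"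
  using regs_clear_denominators[OF assms] by (elim bexE exE)
 have d: "(%A::complex^'n^'n. det A ^ m) : polys entries" by (intro polys_power det_polys entry_polys)
 show ?thesis
 proof (intro bexI allI impI)
  show "(%A. q A * inverse (det A ^ m)) : rats entries"
   by (rule rats_mult[OF polys_rats[OF q(1)] rats_inverse[OF polys_rats[OF d]]])
  fix A :: "complex^'n^'n" assume "invertible A"
  with q(2) show "q A * inverse (det A ^ m) = p A" by (simp add: invertible_det_nz)
 qed
qed

text \<open>The image is constructible, so it contains a nonempty relatively open part of its
  closure, and translations finish the argument for a subgroup. Through \<open>Ad_on_closed\<close>
  this makes images of stabilisers closed in \<open>GL V\<close>.\<close>

theorem closed_image:
 fixes K :: "(complex^'n^'n) set" and Q :: "complex^'n^'n => complex^'m^'m"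
 assumes K: "alg_group K" and Q: "!!i j. (%A. Q A $ i $ j) : regs" and sub: "subgroup (Q ` K) GLn"
 shows "closedin zariski_GLn (Q ` K)"
proof -
 have "ALL ij. EX r:rats entries. ALL A::complex^'n^'n. invertible A --> r A = Q A $ fst ij $ snd ij"
  using regs_rats[OF Q] by blast
 then obtain r where r: "!!ij. r ij : rats entries & (ALL A::complex^'n^'n. invertible A --> r ij A = Q A $ fst ij $ snd ij)"
  by metis
 let ?E = "{y. EX A:K. ALL ij:UNIV. y ij = r ij A}"
 have "?E : constructible (coords UNIV)"
  using K r by (intro Chevalley closedin_GLn_constructible) (auto simp: alg_group_def)
 then have "{B::complex^'m^'m. (%ij. B $ fst ij $ snd ij) : ?E} : constructible entries"
  by (rule constructible_vimage) (auto simp: coords_def entries_def intro!: rats_coord)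
 also have "{B::complex^'m^'m. (%ij. B $ fst ij $ snd ij) : ?E} = Q ` K"
 proof -
  have "(ALL ij:UNIV. B $ fst ij $ snd ij = r ij A) \<longleftrightarrow> B = Q A" if "A : K" for A B
   using r alg_group_invertible[OF K that] by (simp add: vec_eq_iff)
  then show ?thesis by auto
 qed
 finally have con: "Q ` K : constructible entries" .
 have "Q ` K \<subseteq> carrier GLn" using sub by (rule subgroup.subset)
 moreover have "Q ` K \<noteq> {}" using alg_group_one[OF K] by blast
 ultimately obtain W where "openin zariski_GLn W" "W \<inter> zariski_GLn closure_of (Q ` K) \<noteq> {}"
  "W \<inter> zariski_GLn closure_of (Q ` K) \<subseteq> Q ` K"
  using constructible_interior[OF con] unfolding zariski_GLn_def by metis
 then show ?thesis by (rule GLn_top.subgroup_closed[OF sub])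
qed

text \<open>Adding the complement of \<open>G\<close> to every \<open>S n\<close> turns a cover of
  \<open>G\<close> into one of the whole space.\<close>

lemma constructible_countable_subcover:
 fixes G :: "(complex^'n^'n) set"
 assumes G: "G : constructible entries" and S: "!!n. S n : constructible entries" and cov: "G \<subseteq> (\<Union>n::nat. S n)"
 shows "EX m. G \<subseteq> (\<Union>n\<le>m. S n)"
proof -
 define u where "u y = (\<chi> i j. y (i, j))" for y :: "'n \<times> 'n => complex"
 have u: "{y. u y : X} : constructible (coords UNIV)" if "X : constructible entries" for X :: "(complex^'n^'n) set"
  using that by (rule constructible_vimage) (auto simp: u_def entries_def coords_def intro!: rats_coord)
 define T where "T n = {y. u y : S n \<or> \<not> u y : G}" for n
 have T: "T n : constructible (coords UNIV)" for n
  unfolding T_def using G S by (intro constructible_disj constructible_not u)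
 have "(\<Union>n. T n) = UNIV" using cov by (auto simp: T_def)
 from constructible_countable_cover[OF _ T this]
 obtain m where m: "(\<Union>n\<le>m. T n) = UNIV" by auto
 have "A : (\<Union>n\<le>m. S n)" if A: "A : G" for A
 proof -
  define y where "y = (%(i, j). A $ i $ j)"
  have "u y = A" by (simp add: u_def y_def vec_eq_iff)
  moreover have "y : (\<Union>n\<le>m. T n)" by (simp add: m) ultimately show ?thesis using A by (auto simp: T_def)
 qed
 then show ?thesis by (intro exI[of _ m] subsetI)
qed

text \<open>Cosets are closed; a finite cover by cosets makes the subgroup open, so connectedness applies.\<close>

lemma finite_index_open:
 fixes G H :: "(complex^'n^'n) set" assumes G: "alg_group G" and H: "alg_group H" "H \<subseteq> G"
  and F: "finite F" "F \<subseteq> G" "G \<subseteq> (\<Union>g\<in>F. (%h. g ** h) ` H)" and con: "connectedin zariski_GLn G"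
 shows "H = G"
proof -
 let ?T = "subtopology zariski_GLn G"
 have coset: "closedin zariski_GLn ((%h. g ** h) ` H)" if g: "g : G" for g
 proof -
  have gi: "invertible g" "invertible (matrix_inv g)"
   using alg_group_invertible[OF G g] invertible_matrix_inv by auto
  have "closedin zariski_GLn {x : topspace zariski_GLn. matrix_inv g \<otimes>\<^bsub>GLn\<^esub> x : H}"
   using H(1) gi by (intro closedin_continuous_map_preimage[OF GLn_top.left_cont]) (auto simp: carrier_GLn alg_group_def)
  also have "{x : topspace zariski_GLn. matrix_inv g \<otimes>\<^bsub>GLn\<^esub> x : H} = (%h. g ** h) ` H"
  proof (rule equalityI; rule subsetI)
   fix x assume "x : {x : topspace zariski_GLn. matrix_inv g \<otimes>\<^bsub>GLn\<^esub> x : H}"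
   moreover have "x = g ** (matrix_inv g ** x)" using gi by (simp add: matrix_mul_assoc matrix_inv_right)
   ultimately show "x : (%h. g ** h) ` H" by (auto simp: mult_GLn)
  next
   fix x assume "x : (%h. g ** h) ` H"
   then obtain h where h: "h : H" "x = g ** h" by blast
   then show "x : {x : topspace zariski_GLn. matrix_inv g \<otimes>\<^bsub>GLn\<^esub> x : H}"
    using gi alg_group_invertible[OF H(1) h(1)]
    by (simp add: mult_GLn topspace_GLn carrier_GLn matrix_mul_assoc matrix_inv_left invertible_mult)
  qed
  finally show ?thesis .
 qed
 \<comment> \<open>The union of the cosets in the cover other than \<open>H\<close>; it is closed
   and equals \<open>G - H\<close>.\<close>
 define X where "X = (\<Union>g\<in>{g : F. g \<notin> H}. (%h. g ** h) ` H)"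
 have Xc: "closedin zariski_GLn X" unfolding X_def using F coset by (intro closedin_Union) auto
 have XG: "X \<subseteq> G" unfolding X_def using F(2) H(2) alg_group_mult[OF G] by auto
 have "X = G - H"
 proof (rule equalityI; rule subsetI)
  fix x assume "x : X"
  then obtain g h where gh: "g : F" "g \<notin> H" "h : H" "x = g ** h" by (auto simp: X_def)
  have "x \<notin> H"
  proof
   assume "x : H"
   then have "x ** matrix_inv h : H" using gh H(1) by (intro alg_group_mult alg_group_inv)
   moreover have "x ** matrix_inv h = g"
    using gh alg_group_invertible[OF H(1) gh(3)] by (simp add: matrix_inv_right flip: matrix_mul_assoc)
   ultimately show False using gh by simp
  qed
  then show "x : G - H" using XG \<open>x : X\<close> by auto
 next
  fix x assume x: "x : G - H"
  then obtain g h where gh: "g : F" "h : H" "x = g ** h" using F(3) by blast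
  then show "x : X" using x alg_group_mult[OF H(1)] gh by (auto simp: X_def)
 qed
 have c1: "closedin zariski_GLn H" using H(1) by (simp add: alg_group_def)
 have "\<not> (X \<noteq> {})"
 proof
  assume "X \<noteq> {}"
  have "connectedin zariski_GLn G --> False" unfolding connectedin_closedin
  using c1 Xc \<open>X = G - H\<close> \<open>X \<noteq> {}\<close> H(2) alg_group_one[OF H(1)] conjE notE by (blast intro: exI[of _ H] exI[of _ X] impI)
  with con show False by simp
 qed
 then show ?thesis using \<open>X = G - H\<close> H(2) by blast
qed

subsection \<open>Polynomials in a matrix\<close>

lemma cscale_nth: "cscale c A $ i $ j = c * A $ i $ j"
 by (simp add: cscale_def)

lemma cscale_mult_left: "cscale c A ** B = cscale c (A ** B)"
 and cscale_mult_right: "A ** cscale c B = cscale c (A ** B)" for A B :: "complex^'k^'k"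
 by (simp_all add: vec_eq_iff cscale_nth matrix_matrix_mult_def sum_distrib_left mult_ac)

lemma cscale_simps [simp]: "cscale 0 A = 0" "cscale c 0 = 0" "cscale 1 A = A"
 "cscale a (cscale b A) = cscale (a * b) A" for A :: "complex^'k^'k" by (simp_all add: vec_eq_iff cscale_nth)

lemma cscale_add_left: "cscale (a + b) A = cscale a A + cscale b A"
 and cscale_add_right: "cscale a (A + B) = cscale a A + cscale a B"
 and cscale_diff_right: "cscale a (A - B) = cscale a A - cscale a B"
 and cscale_minus: "cscale (- 1) A = - A" for A B :: "complex^'k^'k"
 by (simp_all add: vec_eq_iff cscale_nth algebra_simps)

lemma matrix_add_rdistrib: "(A + B) ** C = A ** C + B ** C" for A B C :: "complex^'k^'k"
 by (simp add: matrix_matrix_mult_def vec_eq_iff sum.distrib algebra_simps)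

lemma matrix_sum_left: "(\<Sum>i\<in>S. f i) ** B = (\<Sum>i\<in>S. f i ** B)"
 and matrix_sum_right: "B ** (\<Sum>i\<in>S. f i) = (\<Sum>i\<in>S. B ** f i)" for f :: "'i => complex^'k^'k"
 by (induction S rule: infinite_finite_induct) (simp_all add: matrix_add_rdistrib matrix_add_ldistrib)

lemma matrix_zero [simp]: "0 ** (B::complex^'k^'k) = 0" "(B::complex^'k^'k) ** 0 = 0"
 by (simp_all add: matrix_matrix_mult_def vec_eq_iff)

lemma matrix_diff_rdistrib: "(A - B) ** C = A ** C - B ** C"
 and matrix_diff_ldistrib: "C ** (A - B) = C ** A - C ** B" for A B C :: "complex^'k^'k"
 by (simp_all add: matrix_matrix_mult_def vec_eq_iff sum_subtractf algebra_simps)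

lemma cscale_sum: "cscale c (\<Sum>i\<in>S. f i) = (\<Sum>i\<in>S. cscale c (f i))"
 by (rule cmat.scale_sum_right)

definition mpow :: "complex^'k^'k => nat => complex^'k^'k" where
 "mpow X k = (((**) X) ^^ k) (mat 1)"

lemma mpow_simps [simp]: "mpow X 0 = mat 1" "mpow X (Suc k) = X ** mpow X k"
 by (simp_all add: mpow_def)

lemma mpow_add: "mpow X (j + k) = mpow X j ** mpow X k"
 by (induction j) (simp_all add: matrix_mul_assoc)

lemma mpow_commute: "X ** Y = Y ** X ==> mpow X k ** Y = Y ** mpow X k"
 by (induction k) (simp_all, metis matrix_mul_assoc)

lemma mpow_Suc2: "mpow X (Suc k) = mpow X k ** X"
 using mpow_commute[of X X k] by simp

lemma nilpotent_mat_iff: "nilpotent_mat X \<longleftrightarrow> (EX k. mpow X k = 0)"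
 by (simp add: nilpotent_mat_def mpow_def)

definition mpoly :: "complex poly => complex^'k^'k => complex^'k^'k" where
 "mpoly p X = fold_coeffs (%a M. cscale a (mat 1) + X ** M) p 0"

lemma mpoly_0 [simp]: "mpoly 0 X = 0"
 by (simp add: mpoly_def)

lemma mpoly_pCons [simp]: "mpoly (pCons a p) X = cscale a (mat 1) + X ** mpoly p X"
 by (cases "p = 0 & a = 0") (auto simp: mpoly_def)

lemma mpoly_1 [simp]: "mpoly 1 X = mat 1"
 unfolding one_pCons by simp

lemma mpoly_X: "mpoly [:0, 1:] X = X"
 by simp

lemma mpoly_add: "mpoly (p + q) X = mpoly p X + mpoly q X"
proof (induction p arbitrary: q)
 case (pCons a p)
 show ?case by (cases q) (simp add: pCons.IH cscale_add_left matrix_add_ldistrib)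
qed simp

lemma mpoly_smult: "mpoly (smult c p) X = cscale c (mpoly p X)"
 by (induction p) (simp_all add: cscale_add_right cscale_mult_right)

lemma mpoly_minus: "mpoly (- p) X = - mpoly p X"
 using mpoly_smult[of "-1" p X] by (simp add: cscale_minus)

lemma mpoly_diff: "mpoly (p - q) X = mpoly p X - mpoly q X"
 using mpoly_add[of p "- q" X] by (simp add: mpoly_minus)

lemma mpoly_commute: "X ** Y = Y ** X ==> mpoly p X ** Y = Y ** mpoly p X"
proof (induction p)
 case (pCons a p)
 have "X ** mpoly p X ** Y = Y ** (X ** mpoly p X)" using pCons by (metis matrix_mul_assoc)
 then show ?case by (simp add: matrix_add_rdistrib matrix_add_ldistrib cscale_mult_left cscale_mult_right)
qed simp

lemma mpoly_mult: "mpoly (p * q) X = mpoly p X ** mpoly q X"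
 by (induction p)
  (simp_all add: mpoly_add mpoly_smult matrix_add_rdistrib cscale_mult_left matrix_mul_assoc)

lemma mpoly_power: "mpoly (p ^ k) X = mpow (mpoly p X) k"
 by (induction k) (simp_all add: mpoly_mult)

lemma mpoly_sum: "mpoly (\<Sum>i\<in>S. f i) X = (\<Sum>i\<in>S. mpoly (f i) X)"
 by (induction S rule: infinite_finite_induct) (simp_all add: mpoly_add)

lemma mpoly_commute_mpoly: "mpoly p X ** mpoly q X = mpoly q X ** mpoly p X"
 using mpoly_mult[of p q X] mpoly_mult[of q p X] by (simp add: mult.commute)

lemma mpoly_dvd_zero: "p dvd q ==> mpoly p X = 0 ==> mpoly q X = 0"
 by (auto simp: mpoly_mult elim!: dvdE)

text \<open>Among the powers up to the real dimension of the matrix space there is a repetition or a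
  linear dependency. Real coefficients are enough, since no sharp degree is wanted.\<close>

lemma mpoly_annihilator: "EX p. p \<noteq> 0 & mpoly p (X::complex^'k^'k) = 0"
proof -
 let ?N = "DIM(complex^'k^'k)"
 show ?thesis
 proof (cases "inj_on (mpow X) {..?N}")
  case False
  then obtain i j where ij: "i \<noteq> j" "mpow X i = mpow X j" by (auto simp: inj_on_def)
  let ?p = "[:0, 1:] ^ i - [:0, 1:] ^ j :: complex poly"
  have "degree ([:0, 1:] ^ i :: complex poly) = i" for i by (simp add: degree_power_eq)
  then have "?p \<noteq> 0" using ij(1) by (metis eq_iff_diff_eq_0)
  moreover have "mpoly ?p X = 0" using ij(2) by (simp add: mpoly_diff mpoly_power) ultimately show ?thesis by blast
 next
  case True
  have "card (mpow X ` {..?N}) > ?N" using card_image[OF True] by simp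
  then obtain u where u: "(\<Sum>v\<in>mpow X ` {..?N}. u v *\<^sub>R v) = 0" "EX v:mpow X ` {..?N}. u v \<noteq> 0"
   using independent_bound[of "mpow X ` {..?N}"] dependent_finite[of "mpow X ` {..?N}"] by auto
  let ?p = "\<Sum>i\<le>?N. monom (complex_of_real (u (mpow X i))) i"
  have "mpoly ?p X = (\<Sum>i\<le>?N. cscale (complex_of_real (u (mpow X i))) (mpow X i))" unfolding mpoly_sum
  by (simp add: monom_altdef mpoly_smult mpoly_power)
  also have "\<dots> = (\<Sum>i\<le>?N. u (mpow X i) *\<^sub>R mpow X i)"
   by (intro sum.cong) (simp_all add: vec_eq_iff cscale_nth scaleR_conv_of_real[where 'a = complex])
  also have "\<dots> = 0" using u(1) sum.reindex[OF True, of "%v. u v *\<^sub>R v"] by simp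
  finally have "mpoly ?p X = 0" .
  moreover have "?p \<noteq> 0"
  proof -
   obtain i where i: "i \<le> ?N" "u (mpow X i) \<noteq> 0" using u(2) by auto
   have "coeff ?p i = complex_of_real (u (mpow X i))" using i(1) by (simp add: coeff_sum coeff_monom)
   then show ?thesis using i(2) by auto
  qed
  ultimately show ?thesis by blast
 qed
qed

lemma linear_coprime: "k \<noteq> m ==> coprime [:- k, 1:] [:- m, 1 :: complex:]"
proof (rule coprimeI)
 fix d assume "k \<noteq> m" "d dvd [:- k, 1:]" "d dvd [:- m, 1:]"
 then have "d dvd [:- k, 1:] - [:- m, 1:]" by (intro dvd_diff)
 also have "[:- k, 1:] - [:- m, 1:] = [:m - k:]" by simp
 finally show "is_unit d" using \<open>k \<noteq> m\<close> by (metis is_unit_triv dvd_trans right_minus_eq)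
qed

lemma prod_linear_power_dvd:
 assumes "finite L" "!!n. n : L ==> [:- n, 1 :: complex:] ^ m dvd g" shows "(\<Prod>n\<in>L. [:- n, 1:] ^ m) dvd g"
 using assms
proof (induction L rule: finite_induct)
 case (insert n L)
 have "coprime ([:- n, 1:] ^ m) (\<Prod>u\<in>L. [:- u, 1:] ^ m)"
  using insert.hyps by (intro prod_coprime_right) (auto simp: coprime_power_left_iff coprime_power_right_iff intro!: linear_coprime)
 with insert show ?case by (simp add: divides_mult)
qed simp

text \<open>Bezout coefficients for coprime powers, as in the Chinese remainder theorem:
  \<open>e\<close> is 1 modulo the power at \<open>k\<close> and 0 modulo the others.\<close>

lemma spectral_idempotent_poly:
 assumes "finite L" "k : L"
 shows "EX e. (ALL u:L - {k}. [:- u, 1 :: complex:] ^ m dvd e) & [:- k, 1:] ^ m dvd (1 - e)"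
proof -
 let ?p = "[:- k, 1 :: complex:] ^ m" and ?q = "\<Prod>u\<in>L - {k}. [:- u, 1 :: complex:] ^ m"
 have "coprime ?p ?q"
  by (intro prod_coprime_right) (auto simp: coprime_power_left_iff coprime_power_right_iff intro!: linear_coprime)
 then obtain a b where ab: "a * ?p + b * ?q = 1"
  using bezout_coefficients_fst_snd[of ?p ?q] by (metis coprime_imp_gcd_eq_1)
 have "1 - b * ?q = a * ?p" using ab by (metis add_diff_cancel_right')
 moreover have "[:- u, 1:] ^ m dvd b * ?q" if "u : L - {k}" for u
  using that assms(1) dvd_prodI[of "L - {k}" u "%u. [:- u, 1:] ^ m"] by (intro dvd_mult) auto
 ultimately show ?thesis by (intro exI[of _ "b * ?q"]) auto
qed

text \<open>Jordan decomposition data: projections onto generalised eigenspaces and the nilpotent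
  part. A projection may be 0, so \<open>L\<close> can contain numbers that are not
  eigenvalues.\<close>

definition spectral :: "complex set => (complex => complex^'k^'k) => complex^'k^'k => bool" where
 "spectral L E N \<longleftrightarrow> finite L & (\<Sum>c\<in>L. E c) = mat 1 &
   (ALL c:L. ALL m:L. E c ** E m = (if c = m then E c else 0)) &
   (ALL c:L. N ** E c = E c ** N) & nilpotent_mat N"

theorem spectral_decomposition:
 fixes X :: "complex^'k^'k"
 obtains L e n where "spectral L (%c. mpoly (e c) X) (mpoly n X)"
  "X = (\<Sum>c\<in>L. cscale c (mpoly (e c) X)) + mpoly n X"
proof -
 obtain p where p: "p \<noteq> 0" "mpoly p X = 0" using mpoly_annihilator by blast
 define L where "L = {z. poly p z = 0}"
 have fin: "finite L" unfolding L_def using p(1) by (rule poly_roots_finite)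
 \<comment> \<open>The degree alone makes \<open>p\<close> divide that power of the product of the
   linear factors; the successor guarantees a positive exponent, needed for the divisibility of
   \<open>n\<close>.\<close>
 define m where "m = Suc (degree p)"
 let ?f = "\<Prod>v\<in>L. [:- v, 1 :: complex:] ^ m"
 have "poly (\<Prod>v\<in>L. [:- v, 1:]) z = 0" if "poly p z = 0" for z
  using that fin by (auto simp: poly_prod L_def)
 then have "p dvd (\<Prod>v\<in>L. [:- v, 1:]) ^ m"
  using nullstellensatz_univariate[of p "\<Prod>v\<in>L. [:- v, 1:]"] p(1) by (simp add: m_def dvd_mult)
 then have f: "mpoly g X = 0" if "!!v. v : L ==> [:- v, 1:] ^ m dvd g" for g
 proof -
  have "p dvd g"
   using \<open>p dvd (\<Prod>v\<in>L. [:- v, 1:]) ^ m\<close> prod_linear_power_dvd[OF fin that] dvd_trans by (auto simp: prod_power_distrib)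
  then show ?thesis using p(2) by (rule mpoly_dvd_zero)
 qed
 have "ALL c:L. EX e. (ALL u:L - {c}. [:- u, 1:] ^ m dvd e) & [:- c, 1:] ^ m dvd (1 - e)"
  using spectral_idempotent_poly[OF fin] by blast
 then obtain e where e1: "!!c u. c : L ==> u : L ==> u \<noteq> c ==> [:- u, 1:] ^ m dvd e c"
  and e2: "!!c. c : L ==> [:- c, 1:] ^ m dvd (1 - e c)" by (metis DiffI singletonD)
 have e3: "[:- v, 1:] ^ m dvd (1 - (\<Sum>c\<in>L. e c))" if v: "v : L" for v
 proof -
  have "1 - (\<Sum>c\<in>L. e c) = (1 - e v) - (\<Sum>c\<in>L - {v}. e c)" using sum.remove[OF fin v, of e] by simp
  also have "[:- v, 1:] ^ m dvd \<dots>" using e1 v by (intro dvd_diff[OF e2[OF v]] dvd_sum) auto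
  finally show ?thesis .
 qed
 define n where "n = [:0, 1:] - (\<Sum>c\<in>L. smult c (e c))"
 have n: "[:- v, 1:] ^ 1 dvd n" if v: "v : L" for v
 proof -
  have le: "[:- v, 1 :: complex:] ^ 1 dvd [:- v, 1:] ^ m" unfolding m_def by (intro le_imp_power_dvd) simp
  have "n = [:- v, 1:] + smult v (1 - e v) - (\<Sum>c\<in>L - {v}. smult c (e c))"
   using sum.remove[OF fin v, of "%c. smult c (e c)"] by (simp add: n_def smult_diff_right one_pCons)
  also have "[:- v, 1:] ^ 1 dvd \<dots>"
  using v by (fastforce intro: dvd_smult[OF dvd_trans[OF le e2[OF v]]] dvd_smult dvd_trans[OF le e1] dvd_diff[OF dvd_add dvd_sum])
  finally show ?thesis .
 qed
 have "spectral L (%c. mpoly (e c) X) (mpoly n X)" unfolding spectral_def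
 proof (intro conjI ballI fin mpoly_commute_mpoly)
  have "mpoly (1 - (\<Sum>c\<in>L. e c)) X = 0" using e3 by (rule f)
  then show "(\<Sum>c\<in>L. mpoly (e c) X) = mat 1" by (simp add: mpoly_diff mpoly_sum)
  have "mpoly (n ^ m) X = 0"
  proof (rule f)
   show "[:- v, 1:] ^ m dvd n ^ m" if "v : L" for v using n[OF that] dvd_power_same[of "[:- v, 1:]" n m] by simp
  qed
  then show "nilpotent_mat (mpoly n X)" by (auto simp: nilpotent_mat_iff mpoly_power)
  fix c u assume c: "c : L" and u: "u : L"
  show "mpoly (e c) X ** mpoly (e u) X = (if c = u then mpoly (e c) X else 0)"
  proof (cases "c = u")
   case True
   have "mpoly (e c * (1 - e c)) X = 0"
   proof (rule f)
    show "[:- v, 1:] ^ m dvd e c * (1 - e c)" if "v : L" for v using e1[OF c that] e2[OF c] by (cases "v = c") auto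
   qed
   then show ?thesis using True by (simp add: mpoly_mult mpoly_diff matrix_diff_ldistrib)
  next
   case False
   have "mpoly (e c * e u) X = 0"
   proof (rule f)
    show "[:- v, 1:] ^ m dvd e c * e u" if "v : L" for v
     using e1[OF c that] e1[OF u that] False by (cases "v = c") auto
   qed
   then show ?thesis using False by (simp add: mpoly_mult)
  qed
 qed
 moreover have "X = (\<Sum>c\<in>L. cscale c (mpoly (e c) X)) + mpoly n X"
  unfolding n_def mpoly_diff mpoly_sum mpoly_smult mpoly_X by simp ultimately show ?thesis by (rule that)
qed

lemma nilpotent_mpow_mono: "mpow N k = 0 ==> k \<le> l ==> mpow N l = 0"
 using mpow_add[of N k "l - k"] by simp

text \<open>The interpolating polynomial at \<open>c\<close> acts as the identity on the summand of
  \<open>F c\<close> and as 0 on the others, since \<open>T - u\<close> is nilpotent on the summand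
  of \<open>F u\<close>. The generality matters for \<open>adm X\<close>, whose projections are
  constructed by hand.\<close>

lemma spectral_poly:
 assumes S: "spectral L F M" and T: "T = (\<Sum>c\<in>L. cscale c (F c)) + M" and c: "c : L"
 shows "EX p. F c = mpoly p T"
proof -
 have fin: "finite L" and one: "(\<Sum>c\<in>L. F c) = mat 1"
  and orth: "!!c u. c : L ==> u : L ==> F c ** F u = (if c = u then F c else 0)"
  and com: "!!c. c : L ==> M ** F c = F c ** M" using S by (auto simp: spectral_def)
 obtain m where m: "mpow M m = 0" using S by (auto simp: spectral_def nilpotent_mat_iff)
 have lin: "mpoly [:- u, 1:] T ** F u = M ** F u" if u: "u : L" for u
 proof -
  have "(\<Sum>c\<in>L. cscale c (F c)) ** F u = (\<Sum>c\<in>L. if c = u then cscale u (F u) else 0)"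
   unfolding matrix_sum_left by (intro sum.cong) (auto simp: cscale_mult_left orth u)
  also have "\<dots> = cscale u (F u)" using fin u by simp finally show ?thesis
   by (simp add: T matrix_add_rdistrib cscale_add_left[symmetric] matrix_diff_rdistrib cscale_mult_left)
 qed
 have pow: "mpoly ([:- u, 1:] ^ k) T ** F u = mpow M k ** F u" if u: "u : L" for u k
 proof (induction k)
  case (Suc k)
  have "mpoly ([:- u, 1:] ^ Suc k) T ** F u = mpoly [:- u, 1:] T ** (mpoly ([:- u, 1:] ^ k) T ** F u)"
   unfolding power_Suc mpoly_mult matrix_mul_assoc ..
  also have "\<dots> = mpoly [:- u, 1:] T ** F u ** mpow M k"
   unfolding Suc using mpow_commute[OF com[OF u], of k] by (simp add: matrix_mul_assoc)
  also have "\<dots> = M ** (mpow M k ** F u)"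
   unfolding lin[OF u] using mpow_commute[OF com[OF u], of k] by (simp flip: matrix_mul_assoc)
  finally show ?case by (simp add: matrix_mul_assoc)
 qed simp
 have zero: "mpoly g T ** F u = 0" if dvd: "[:- u, 1:] ^ m dvd g" and u: "u : L" for g u
 proof -
  obtain h where h: "g = h * [:- u, 1:] ^ m" using dvd by (auto elim!: dvdE simp: mult.commute)
  have "mpoly g T ** F u = mpoly h T ** (mpow M m ** F u)"
   unfolding h mpoly_mult pow[OF u, symmetric] matrix_mul_assoc ..
  then show ?thesis by (simp add: m)
 qed
 obtain e where e: "ALL u:L - {c}. [:- u, 1:] ^ m dvd e" "[:- c, 1:] ^ m dvd (1 - e)"
  using spectral_idempotent_poly[OF fin c] by blast
 have "mpoly e T = (\<Sum>u\<in>L. mpoly e T ** F u)" by (simp add: one flip: matrix_sum_right)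
 also have "\<dots> = (\<Sum>u\<in>L. if u = c then F c else 0)"
 proof (rule sum.cong)
  fix u assume u: "u : L"
  show "mpoly e T ** F u = (if u = c then F c else 0)"
  using zero e(2) u e(1) by (fastforce simp: mpoly_diff matrix_diff_rdistrib)
 qed simp
 also have "\<dots> = F c" using fin c by simp finally show ?thesis by metis
qed

lemma spectral_poly_nilpotent:
 assumes S: "spectral L F M" and T: "T = (\<Sum>k\<in>L. cscale k (F k)) + M" shows "EX p. M = mpoly p T"
proof -
 obtain e where e: "!!k. k : L ==> F k = mpoly (e k) T" using spectral_poly[OF S T] by metis
 have "(\<Sum>k\<in>L. cscale k (F k)) = (\<Sum>k\<in>L. cscale k (mpoly (e k) T))"
  by (intro sum.cong) (simp_all add: e)
 then have "M = mpoly ([:0, 1:] - (\<Sum>k\<in>L. smult k (e k))) T"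
  unfolding mpoly_diff mpoly_sum mpoly_smult mpoly_X using T by simp
 then show ?thesis by blast
qed

subsection \<open>One-parameter groups\<close>

definition mderiv :: "(complex => complex^'k^'k) => complex^'k^'k => complex => bool" where
 "mderiv F F' t \<longleftrightarrow> (ALL i j. ((%t. F t $ i $ j) has_field_derivative F' $ i $ j) (at t))"

lemma mderiv_const: "mderiv (%_. A) 0 t"
 by (simp add: mderiv_def)

lemma mderiv_mult:
 assumes "mderiv F F' t" "mderiv G G' t" shows "mderiv (%t. F t ** G t) (F' ** G t + F t ** G') t"
 unfolding mderiv_def
proof (intro allI)
 fix i j
 have "((%t. \<Sum>k\<in>UNIV. F t $ i $ k * G t $ k $ j) has_field_derivative
   (\<Sum>k\<in>UNIV. F' $ i $ k * G t $ k $ j + G' $ k $ j * F t $ i $ k)) (at t)"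
  using assms by (intro DERIV_sum DERIV_mult) (auto simp: mderiv_def)
 then show "((%t. (F t ** G t) $ i $ j) has_field_derivative (F' ** G t + F t ** G') $ i $ j) (at t)"
  by (simp add: matrix_matrix_mult_def sum.distrib mult.commute)
qed

lemma mderiv_add: "mderiv F F' t ==> mderiv G G' t ==> mderiv (%t. F t + G t) (F' + G') t"
 by (auto simp: mderiv_def intro!: derivative_eq_intros)

lemma mderiv_sum: "(!!i. i : S ==> mderiv (F i) (F' i) t) ==> mderiv (%t. \<Sum>i\<in>S. F i t) (\<Sum>i\<in>S. F' i) t"
 by (induction S rule: infinite_finite_induct) (simp_all add: mderiv_const mderiv_add)

lemma mderiv_cscale: "(f has_field_derivative f') (at t) ==> mderiv (%t. cscale (f t) A) (cscale f' A) t"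
 unfolding mderiv_def cscale_nth by (auto intro!: derivative_eq_intros)

lemma mderiv_mult_left: "mderiv F F' t ==> mderiv (%t. A ** F t) (A ** F') t"
 and mderiv_mult_right: "mderiv F F' t ==> mderiv (%t. F t ** A) (F' ** A) t"
 using mderiv_mult[OF mderiv_const, of F F' t A] mderiv_mult[OF _ mderiv_const, of F F' t A] by simp_all

lemma mderiv_affine: "mderiv F F' (a * t + b) ==> mderiv (%t. F (a * t + b)) (cscale a F') t"
 unfolding mderiv_def cscale_nth
proof (intro allI)
 fix i j
 assume "ALL i j. ((%t. F t $ i $ j) has_field_derivative F' $ i $ j) (at (a * t + b))"
 then have F: "((%t. F t $ i $ j) has_field_derivative F' $ i $ j) (at (a * t + b))" by blast
 have g: "((%t. a * t + b) has_field_derivative a) (at t)" by (auto intro!: derivative_eq_intros)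
 show "((%t. F (a * t + b) $ i $ j) has_field_derivative a * F' $ i $ j) (at t)"
  using DERIV_chain2[OF F g] by (simp add: mult.commute)
qed

lemma mderiv_zero_const: "(!!t. mderiv F 0 t) ==> F t = F s"
 unfolding vec_eq_iff
proof (intro allI)
 fix i j assume "!!t. mderiv F 0 t"
 then have "((%t. F t $ i $ j) has_field_derivative 0) (at t within UNIV)" for t by (simp add: mderiv_def)
 from has_field_derivative_zero_constant[OF convex_UNIV this] show "F t $ i $ j = F s $ i $ j" by (metis UNIV_I)
qed

definition one_param :: "complex^'k^'k => (complex => complex^'k^'k) => bool" where
 "one_param X F \<longleftrightarrow> F 0 = mat 1 & (ALL t. mderiv F (X ** F t) t) & (ALL t. X ** F t = F t ** X)"

text \<open>The closed form of exp (t X). Its entries are visibly sums of exponentials times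
  polynomials, which the theorem on replicas exploits.\<close>

lemma spectral_one_param:
 assumes S: "spectral L E N" and m: "mpow N m = 0" and X: "X = (\<Sum>z\<in>L. cscale z (E z)) + N"
 shows "one_param X (%t. \<Sum>z\<in>L. \<Sum>j<m. cscale (exp (t * z) * (t ^ j / fact j)) (E z ** mpow N j))"
 (is "one_param X ?F")
proof -
 have fin: "finite L" and one: "(\<Sum>z\<in>L. E z) = mat 1"
  and orth: "!!z u. z : L ==> u : L ==> E z ** E u = (if z = u then E z else 0)"
  and com: "!!z. z : L ==> N ** E z = E z ** N" using S by (auto simp: spectral_def)
 have XE: "X ** E u = cscale u (E u) + E u ** N" "E u ** X = cscale u (E u) + E u ** N" if u: "u : L" for u
 proof -
  have "(\<Sum>z\<in>L. cscale z (E z)) ** E u = (\<Sum>z\<in>L. if z = u then cscale u (E u) else 0)"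
   unfolding matrix_sum_left by (intro sum.cong) (auto simp: cscale_mult_left orth u)
  moreover have "E u ** (\<Sum>z\<in>L. cscale z (E z)) = (\<Sum>z\<in>L. if z = u then cscale u (E u) else 0)"
   unfolding matrix_sum_right by (intro sum.cong) (auto simp: cscale_mult_right orth u)
  ultimately show "X ** E u = cscale u (E u) + E u ** N" "E u ** X = cscale u (E u) + E u ** N"
   using fin u com by (simp_all add: X matrix_add_rdistrib matrix_add_ldistrib)
 qed
 have XEN: "X ** (E u ** mpow N j) = cscale u (E u ** mpow N j) + E u ** mpow N (Suc j)"
  "(E u ** mpow N j) ** X = cscale u (E u ** mpow N j) + E u ** mpow N (Suc j)" if u: "u : L" for u j
 proof -
  show 1: "X ** (E u ** mpow N j) = cscale u (E u ** mpow N j) + E u ** mpow N (Suc j)"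
   by (simp add: matrix_mul_assoc XE u matrix_add_rdistrib cscale_mult_left)
  have XN: "X ** N = N ** X"
  proof -
   have "(\<Sum>z\<in>L. cscale z (E z)) ** N = N ** (\<Sum>z\<in>L. cscale z (E z))"
    unfolding matrix_sum_left matrix_sum_right
    by (intro sum.cong) (simp_all add: cscale_mult_left cscale_mult_right com)
   then show ?thesis by (simp add: X matrix_add_rdistrib matrix_add_ldistrib)
  qed
  have "(E u ** mpow N j) ** X = E u ** X ** mpow N j"
   using mpow_commute[OF XN[symmetric], of j] by (simp flip: matrix_mul_assoc)
  also have "\<dots> = X ** (E u ** mpow N j)" using XE[OF u] by (simp add: matrix_mul_assoc)
  finally show "(E u ** mpow N j) ** X = cscale u (E u ** mpow N j) + E u ** mpow N (Suc j)" using 1 by simp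
 qed
 show ?thesis unfolding one_param_def
 proof (intro conjI allI)
  show "?F 0 = mat 1"
  proof (cases m)
   case 0
   then show ?thesis using m by simp
  next
   case (Suc k)
   have "(\<Sum>j<m. cscale (exp (0 * z) * (0 ^ j / fact j)) (E z ** mpow N j)) = E z" for z
    unfolding Suc by (subst sum.lessThan_Suc_shift) simp
   then show ?thesis by (simp add: one)
  qed
  show "X ** ?F t = ?F t ** X" for t
   by (simp add: matrix_sum_left matrix_sum_right cscale_mult_left cscale_mult_right XEN)
  fix t :: complex
  have "mderiv (%t. \<Sum>j<m. cscale (exp (t * z) * (t ^ j / fact j)) (E z ** mpow N j))
    (\<Sum>j<m. cscale (exp (t * z) * (t ^ j / fact j)) (X ** (E z ** mpow N j))) t" if z: "z : L" for z
  proof -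
   define c where "c j = exp (t * z) * (t ^ j / fact j)" for j :: nat
   \<comment> \<open>The derivative of \<open>t ^ j / fact j\<close> contributes the previous
     coefficient, 0 for \<open>j = 0\<close>. The index shift below matches this with multiplication
     by \<open>N\<close>, the last term vanishing because \<open>mpow N m = 0\<close>.\<close>
   define d where "d j = (if j = 0 then 0 else c (j - 1))" for j
   have der: "((%t. exp (t * z) * (t ^ j / fact j)) has_field_derivative z * c j + d j) (at t)" for j
   proof (cases j)
    case 0
    then show ?thesis by (auto simp: c_def d_def intro!: derivative_eq_intros)
   next
    case (Suc i)
    have "((%t. t ^ Suc i / fact (Suc i)) has_field_derivative of_nat (Suc i) * t ^ i / fact (Suc i)) (at t)"
     using DERIV_cdivide[OF DERIV_power[OF DERIV_ident, of "Suc i" t UNIV], of "fact (Suc i)"] by simp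
    moreover have "of_nat (Suc i) * t ^ i / fact (Suc i) = t ^ i / (fact i :: complex)"
     by (simp add: field_simps del: of_nat_Suc)
    ultimately have p: "((%t. t ^ Suc i / fact (Suc i)) has_field_derivative t ^ i / fact i) (at t)" by simp
    have e: "((%t. exp (t * z)) has_field_derivative exp (t * z) * z) (at t)" by (auto intro!: derivative_eq_intros)
    show ?thesis using DERIV_mult[OF e p] unfolding Suc by (simp add: c_def d_def mult_ac)
   qed
   have "mderiv (%t. \<Sum>j<m. cscale (exp (t * z) * (t ^ j / fact j)) (E z ** mpow N j))
    (\<Sum>j<m. cscale (z * c j + d j) (E z ** mpow N j)) t" by (intro mderiv_sum mderiv_cscale der)
   also have "(\<Sum>j<m. cscale (z * c j + d j) (E z ** mpow N j)) =
     (\<Sum>j<m. cscale (c j) (cscale z (E z ** mpow N j))) + (\<Sum>j<m. cscale (d j) (E z ** mpow N j))"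
    by (simp add: cscale_add_left sum.distrib mult.commute)
   also have "(\<Sum>j<m. cscale (d j) (E z ** mpow N j)) = (\<Sum>j<m. cscale (c j) (E z ** mpow N (Suc j)))"
   proof (cases m)
    case (Suc k)
    have "(\<Sum>j<m. cscale (d j) (E z ** mpow N j)) = (\<Sum>j<k. cscale (c j) (E z ** mpow N (Suc j)))"
     unfolding Suc by (subst sum.lessThan_Suc_shift) (simp add: d_def)
    moreover have "E z ** mpow N (Suc k) = 0" using m Suc by simp
    ultimately show ?thesis unfolding Suc sum.lessThan_Suc by simp
   qed simp
   finally show ?thesis by (simp add: XEN z cscale_add_right sum.distrib c_def)
  qed
  then show "mderiv ?F (X ** ?F t) t" by (fastforce simp: matrix_sum_right cscale_mult_right intro: mderiv_sum)
 qed
qed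

text \<open>The value at \<open>t\<close> is exp (t X). Choosing a solution of the initial value
  problem is unambiguous by \<open>mexp_unique\<close>, and identities are proved by comparing
  differential equations.\<close>

definition mexp :: "complex^'k^'k => complex => complex^'k^'k" where
 "mexp X = (SOME F. one_param X F)"

lemma mexp_one_param: "one_param X (mexp X)"
proof -
 obtain L e n where "spectral L (%k. mpoly (e k) X) (mpoly n X)"
  "X = (\<Sum>k\<in>L. cscale k (mpoly (e k) X)) + mpoly n X" using spectral_decomposition[of X] by metis
 moreover from this obtain m where "mpow (mpoly n X) m = 0" by (auto simp: spectral_def nilpotent_mat_iff)
 ultimately have "EX F. one_param X F" using spectral_one_param by blast
 then show ?thesis unfolding mexp_def by (rule someI_ex)
qed

lemma mexp_0 [simp]: "mexp X 0 = mat 1"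
 and mderiv_mexp: "mderiv (mexp X) (X ** mexp X t) t" and mexp_self_commute: "X ** mexp X t = mexp X t ** X"
 using mexp_one_param[of X] by (auto simp: one_param_def)

lemma mderiv_mexp_minus: "mderiv (%t. mexp X (- t)) (- (X ** mexp X (- t))) t"
 using mderiv_affine[of "mexp X" "X ** mexp X (-1 * t + 0)" "-1" t 0] mderiv_mexp[of X "- t"]
 by (simp add: cscale_minus)

lemma mexp_minus: "mexp X (- t) ** mexp X t = mat 1"
proof -
 have "mderiv (%t. mexp X (- t) ** mexp X t) 0 t" for t
  using mderiv_mult[OF mderiv_mexp_minus[of X t] mderiv_mexp[of X t]] mexp_self_commute[of X "- t"]
  by (simp add: matrix_mul_assoc matrix_diff_rdistrib[of 0, simplified])
 from mderiv_zero_const[of "%t. mexp X (- t) ** mexp X t", OF this, of t 0] show ?thesis by simp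
qed

lemma mexp_unique:
 assumes "!!t. mderiv Y (X ** Y t) t" shows "Y t = mexp X t ** Y 0"
proof -
 have "mderiv (%t. mexp X (- t) ** Y t) 0 t" for t
  using mderiv_mult[OF mderiv_mexp_minus[of X t] assms[of t]] mexp_self_commute[of X "- t"]
  by (simp add: matrix_mul_assoc matrix_diff_rdistrib[of 0, simplified])
 from mderiv_zero_const[of "%t. mexp X (- t) ** Y t", OF this, of t 0]
 have "mexp X t ** (mexp X (- t) ** Y t) = mexp X t ** Y 0" by simp
 then show ?thesis using mexp_minus[of X "- t"] by (simp add: matrix_mul_assoc)
qed

lemma mexp_eqI: "one_param X F ==> mexp X t = F t"
 using mexp_unique[of F X t] unfolding one_param_def by (metis matrix_mul_rid)

lemma invertible_mexp: "invertible (mexp X t)"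
 unfolding invertible_def using mexp_minus[of X t] mexp_minus[of X "- t"] by auto

lemma matrix_inv_mexp: "matrix_inv (mexp X t) = mexp X (- t)"
 using mexp_minus[of X "- t"] by (intro matrix_inv_unique) simp

lemma mexp_commute: "X ** Y = Y ** X ==> mexp X t ** Y = Y ** mexp X t"
proof -
 assume XY: "X ** Y = Y ** X"
 have "mderiv (%t. Y ** mexp X t) (X ** (Y ** mexp X t)) t" for t
  using mderiv_mult_left[OF mderiv_mexp[of X t], of Y] by (simp add: matrix_mul_assoc XY)
 from mexp_unique[of "%t. Y ** mexp X t", OF this, of t] show ?thesis by simp
qed

lemma mexp_conj:
 fixes g h X :: "complex^'k^'k" assumes "g ** h = mat 1" shows "g ** mexp X t ** h = mexp (g ** X ** h) t"
proof -
 have hg: "h ** g = mat 1" using assms by (rule matrix_left_right_inverse[THEN iffD1])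
 have 1: "g ** X ** h ** (g ** mexp X t ** h) = g ** (X ** mexp X t) ** h" for t
 proof -
  have "g ** X ** h ** (g ** mexp X t ** h) = g ** X ** (h ** g) ** mexp X t ** h" by (simp add: matrix_mul_assoc)
  then show ?thesis by (simp add: hg matrix_mul_assoc)
 qed
 have "mderiv (%t. g ** mexp X t ** h) (g ** X ** h ** (g ** mexp X t ** h)) t" for t
  unfolding 1 by (intro mderiv_mult_left mderiv_mult_right mderiv_mexp)
 from mexp_unique[of "%t. g ** mexp X t ** h", OF this, of t] show ?thesis by (simp add: assms)
qed

lemma mexp_spectral:
 assumes "spectral L E N" "mpow N m = 0" "X = (\<Sum>k\<in>L. cscale k (E k)) + N"
 shows "mexp X t = (\<Sum>k\<in>L. \<Sum>j<m. cscale (exp (t * k) * (t ^ j / fact j)) (E k ** mpow N j))"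
 by (rule mexp_eqI[OF spectral_one_param[OF assms]])

subsection \<open>Independence of exponential polynomials\<close>

text \<open>Applying \<open>d/dt - n\<close> lowers the coefficient polynomial at \<open>n\<close>
  and raises no other, so the total weight decreases. The weight separates the zero polynomial from
  nonzero constants.\<close>

lemma exp_poly_independent:
 fixes d :: "complex => complex poly"
 assumes A: "finite A" and zero: "!!t. (\<Sum>m\<in>A. exp (t * m) * poly (d m) t) = 0" shows "ALL m:A. d m = 0"
 using zero
proof (induction "\<Sum>m\<in>A. if d m = 0 then 0 else Suc (degree (d m))" arbitrary: d rule: less_induct)
 case less
 let ?w = "%p::complex poly. if p = 0 then 0 else Suc (degree p)"
 show ?case
 proof (rule ccontr)
  assume "\<not> (ALL m:A. d m = 0)"
  then obtain n where n: "n : A" "d n \<noteq> 0" by blast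
  define d' where "d' m = smult (m - n) (d m) + pderiv (d m)" for m
  have zero': "(\<Sum>m\<in>A. exp (t * m) * poly (d' m) t) = 0" for t
  proof -
   have "((%t. \<Sum>m\<in>A. exp (t * m) * poly (d m) t) has_field_derivative
     (\<Sum>m\<in>A. exp (t * m) * m * poly (d m) t + poly (pderiv (d m)) t * exp (t * m))) (at t)"
    by (intro DERIV_sum DERIV_mult poly_DERIV) (auto intro!: derivative_eq_intros)
   then have "(\<Sum>m\<in>A. exp (t * m) * m * poly (d m) t + poly (pderiv (d m)) t * exp (t * m)) = 0"
    unfolding less.prems by (rule DERIV_unique) simp
   moreover have "n * (\<Sum>m\<in>A. exp (t * m) * poly (d m) t) = 0" by (simp add: less.prems)
   ultimately show ?thesis by (simp add: d'_def sum_distrib_left sum.distrib sum_subtractf algebra_simps)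
  qed
  have le: "?w (d' m) \<le> ?w (d m)" for m
   using degree_add_le[of "smult (m - n) (d m)" "degree (d m)" "pderiv (d m)"] by (auto simp: d'_def degree_pderiv)
  have "?w (d' n) < ?w (d n)" using n(2) pderiv_eq_0_iff[of "d n"] by (auto simp: d'_def degree_pderiv)
  then have "(\<Sum>m\<in>A. ?w (d' m)) < (\<Sum>m\<in>A. ?w (d m))"
   using n(1) le by (intro sum_strict_mono_ex1[OF A] ballI bexI[of _ n])
  from less.hyps[OF this zero'] have d'0: "d' m = 0" if "m : A" for m using that by blast
  \<comment> \<open>For \<open>m \<noteq> n\<close>, the coefficient of \<open>d' m\<close> in the
    degree of \<open>d m\<close> is \<open>m - n\<close> times the leading coefficient of
    \<open>d m\<close>.\<close>
  have "d m = 0" if m: "m : A" "m \<noteq> n" for m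
   using arg_cong[OF d'0[OF m(1)], of "%p. coeff p (degree (d m))"] m(2) by (simp add: d'_def coeff_pderiv coeff_eq_0)
  then have "(\<Sum>m\<in>A. exp (0 * m) * poly (d m) 0) = (\<Sum>m\<in>A. if m = n then poly (d n) 0 else 0)"
   by (intro sum.cong) auto
  then have "poly (d n) 0 = 0" using less.prems[of 0] A n(1) by simp
  moreover have "degree (d n) = 0" using d'0[OF n(1)] by (simp add: d'_def pderiv_eq_0_iff)
  ultimately show False using n(2) by (auto elim: degree_eq_zeroE)
 qed
qed

text \<open>Homomorphisms from the additive group of complex numbers to the multiplicative one.
  Compatibility with sums is the whole requirement, so \<open>k \<mapsto> exp (t * cnj k)\<close>
  qualifies as well as \<open>k \<mapsto> exp (t * k)\<close>.\<close>

definition char_exp :: "(complex => complex) => bool" where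
 "char_exp h \<longleftrightarrow> h 0 = 1 & (ALL a b. h (a + b) = h a * h b)"

text \<open>The curve \<open>t \<mapsto> mexp X t\<close> with the two roles of \<open>t\<close> separated: \<open>h\<close> generalises
 \<open>k \<mapsto> exp (t * k)\<close>.\<close>

definition exp_family :: "complex set => (complex => complex^'k^'k) => complex^'k^'k => nat
  => (complex => complex) => complex => complex^'k^'k" where
 "exp_family L E N m h u = (\<Sum>c\<in>L. \<Sum>j<m. cscale (h c * (u ^ j / fact j)) (E c ** mpow N j))"

text \<open>The point is the order of quantifiers: exponents \<open>A\<close> and polynomials
  \<open>d\<close> are fixed before \<open>h\<close> and \<open>u\<close>, so an identity along the
  one-parameter group can be transferred to other characters. Products add exponents, whence the
  sumset \<open>C\<close>.\<close>

lemma polys_exp_family: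
 assumes "p : polys entries" "finite L" shows "EX A d. finite A & (ALL z. z \<notin> A --> d z = 0) &
  (ALL h u. char_exp h --> p (exp_family L E N m h u) = (\<Sum>z\<in>A. h z * poly (d z) u))" using assms(1)
proof (induction rule: polys.induct)
 case (polys_const c)
 show ?case by (intro exI[of _ "{0}"] exI[of _ "%z. if z = 0 then [:c:] else 0"]) (simp add: char_exp_def)
next
 case (polys_coord f)
 then obtain i k where f: "f = (%A. A $ i $ k)" by (auto simp: entries_def)
 let ?d = "%w. if w : L then \<Sum>j<m. monom ((E w ** mpow N j) $ i $ k / fact j) j else 0"
 have "f (exp_family L E N m h u) = (\<Sum>w\<in>L. h w * poly (?d w) u)" for h u
  by (simp add: f exp_family_def cscale_nth poly_sum poly_monom sum_distrib_left mult_ac)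
 then show ?case using assms(2) by (intro exI[of _ L] exI[of _ ?d]) simp
next
 case (polys_add p q)
 from polys_add.IH obtain A d B e where A: "finite A" "ALL z. z \<notin> A --> d z = 0"
   "ALL h u. char_exp h --> p (exp_family L E N m h u) = (\<Sum>z\<in>A. h z * poly (d z) u)"
  and B: "finite B" "ALL z. z \<notin> B --> e z = 0"
   "ALL h u. char_exp h --> q (exp_family L E N m h u) = (\<Sum>z\<in>B. h z * poly (e z) u)" by (elim exE conjE)
 have 1: "(\<Sum>z\<in>A. h z * poly (d z) u) = (\<Sum>z\<in>A \<union> B. h z * poly (d z) u)" for h u
  using A B by (intro sum.mono_neutral_left) auto
 have 2: "(\<Sum>z\<in>B. h z * poly (e z) u) = (\<Sum>z\<in>A \<union> B. h z * poly (e z) u)" for h u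
  using A B by (intro sum.mono_neutral_left) auto
 show ?case by (intro exI[of _ "A \<union> B"] exI[of _ "%z. d z + e z"])
   (simp add: A B 1 2 sum.distrib ring_distribs)
next
 case (polys_mult p q)
 from polys_mult.IH obtain A d B e where A: "finite A" "ALL z. z \<notin> A --> d z = 0"
   "ALL h u. char_exp h --> p (exp_family L E N m h u) = (\<Sum>z\<in>A. h z * poly (d z) u)"
  and B: "finite B" "ALL z. z \<notin> B --> e z = 0"
   "ALL h u. char_exp h --> q (exp_family L E N m h u) = (\<Sum>z\<in>B. h z * poly (e z) u)" by (elim exE conjE)
 define C where "C = (%(a, b). a + b) ` (A \<times> B)"
 have C: "finite C" unfolding C_def using A(1) B(1) by auto
 let ?c = "%z. if z : C then \<Sum>a\<in>A. d a * e (z - a) else 0"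
 have "p (exp_family L E N m h u) * q (exp_family L E N m h u) = (\<Sum>z\<in>C. h z * poly (?c z) u)"
  if h: "char_exp h" for h u
 proof -
  have "(\<Sum>b\<in>B. h a * poly (d a) u * (h b * poly (e b) u)) = (\<Sum>z\<in>C. h z * poly (d a * e (z - a)) u)"
   if a: "a : A" for a
  proof -
   have "(\<Sum>b\<in>B. h a * poly (d a) u * (h b * poly (e b) u)) =
     (\<Sum>z\<in>(%b. a + b) ` B. h z * poly (d a * e (z - a)) u)"
    using h by (subst sum.reindex) (auto simp: char_exp_def mult_ac)
   also have "\<dots> = (\<Sum>z\<in>C. h z * poly (d a * e (z - a)) u)"
   proof (rule sum.mono_neutral_left[OF C])
    show "(%b. a + b) ` B \<subseteq> C" unfolding C_def using a by auto
    show "ALL z:C - (%b. a + b) ` B. h z * poly (d a * e (z - a)) u = 0"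
    proof
     fix z assume "z : C - (%b. a + b) ` B"
     then have "z - a \<notin> B" by (metis DiffD2 add.commute diff_add_cancel imageI)
     then show "h z * poly (d a * e (z - a)) u = 0" by (simp add: B(2))
    qed
   qed
   finally show ?thesis .
  qed
  then have "(\<Sum>a\<in>A. h a * poly (d a) u) * (\<Sum>b\<in>B. h b * poly (e b) u) =
    (\<Sum>a\<in>A. \<Sum>z\<in>C. h z * poly (d a * e (z - a)) u)"
   unfolding sum_product by (rule sum.cong[OF refl])
  also have "\<dots> = (\<Sum>z\<in>C. h z * poly (?c z) u)"
   by (subst sum.swap) (simp add: poly_sum sum_distrib_left) finally show ?thesis by (simp add: A(3) B(3) h)
 qed
 then show ?case using C by (intro exI[of _ C] exI[of _ ?c]) simp
qed

lemma exp_family_mexp: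
 assumes "spectral L E N" "mpow N m = 0" "X = (\<Sum>k\<in>L. cscale k (E k)) + N"
 shows "mexp X t = exp_family L E N m (%k. exp (t * k)) t" unfolding mexp_spectral[OF assms] exp_family_def ..

text \<open>Along \<open>mexp X t\<close> the hypothesis is a vanishing exponential polynomial, so
  all coefficient polynomials are 0, and these are the same for every character.\<close>

theorem exp_family_zero:
 assumes S: "spectral L E N" "mpow N m = 0" "X = (\<Sum>k\<in>L. cscale k (E k)) + N"
  and p: "p : polys entries" "!!t. p (mexp X t) = 0" and h: "char_exp h" shows "p (exp_family L E N m h u) = 0"
proof -
 have fin: "finite L" using S(1) by (simp add: spectral_def)
 obtain A d where A: "finite A"
  "ALL h u. char_exp h --> p (exp_family L E N m h u) = (\<Sum>z\<in>A. h z * poly (d z) u)"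
  using polys_exp_family[OF p(1) fin, of E N m] by (elim exE conjE)
 have "char_exp (%k. exp (t * k))" for t by (simp add: char_exp_def exp_add ring_distribs)
 then have "(\<Sum>z\<in>A. exp (t * z) * poly (d z) t) = 0" for t
  using A(2)[rule_format, of "%k. exp (t * k)" t] p(2)[of t] unfolding exp_family_mexp[OF S] by simp
 then have "ALL z:A. d z = 0" by (rule exp_poly_independent[OF A(1)])
 then show ?thesis using A(2) h by simp
qed

subsection \<open>The Lie algebra of an algebraic group\<close>

text \<open>One induction delivers the formal derivative with all its properties together. The
  clause on \<open>M\<close> says that polynomial vector fields map polynomials to polynomials, so
  that derivations can be iterated.\<close>

lemma polys_derivative:
 fixes p :: "complex^'k^'k => complex" assumes "p : polys entries"
 shows "EX D. (ALL A X Y c. D A (X + Y) = D A X + D A Y & D A (cscale c X) = c * D A X) &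
  (ALL F F' t. mderiv F F' t --> ((%t. p (F t)) has_field_derivative D (F t) F') (at t)) &
  (ALL M. (ALL i j. (%A. M A $ i $ j) : polys entries) --> (%A. D A (M A)) : polys entries) &
  (ALL A. (p has_derivative D A) (at A))" using assms
proof (induction rule: polys.induct)
 case (polys_const c)
 show ?case by (intro exI[of _ "%_ _. 0"]) (auto intro: polys.polys_const)
next
 case (polys_coord f)
 then obtain i k where f: "f = (%A. A $ i $ k)" by (auto simp: entries_def)
 have "bounded_linear (%X::complex^'k^'k. X $ i $ k)"
  using bounded_linear_compose[OF bounded_linear_vec_nth bounded_linear_vec_nth] .
 then have "((%X::complex^'k^'k. X $ i $ k) has_derivative (%X. X $ i $ k)) (at A)" for A
  by (rule bounded_linear_imp_has_derivative)
 then show ?case by (intro exI[of _ "%_ X. X $ i $ k"]) (auto simp: f mderiv_def cscale_nth)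
next
 case (polys_add p q)
 from polys_add.IH obtain D1 D2 where "ALL A X Y c. D1 A (X + Y) = D1 A X + D1 A Y & D1 A (cscale c X) = c * D1 A X"
  "ALL F F' t. mderiv F F' t --> ((%t. p (F t)) has_field_derivative D1 (F t) F') (at t)"
  "ALL M. (ALL i j. (%A. M A $ i $ j) : polys entries) --> (%A. D1 A (M A)) : polys entries"
  "ALL A. (p has_derivative D1 A) (at A)"
  "ALL A X Y c. D2 A (X + Y) = D2 A X + D2 A Y & D2 A (cscale c X) = c * D2 A X"
  "ALL F F' t. mderiv F F' t --> ((%t. q (F t)) has_field_derivative D2 (F t) F') (at t)"
  "ALL M. (ALL i j. (%A. M A $ i $ j) : polys entries) --> (%A. D2 A (M A)) : polys entries"
  "ALL A. (q has_derivative D2 A) (at A)" by (elim exE conjE)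
 then show ?case
  by (intro exI[of _ "%A X. D1 A X + D2 A X"]) (simp add: ring_distribs DERIV_add polys.polys_add has_derivative_add)
next
 case (polys_mult p q)
 from polys_mult.IH obtain D1 D2 where
  "ALL A X Y c. D1 A (X + Y) = D1 A X + D1 A Y & D1 A (cscale c X) = c * D1 A X"
  "ALL F F' t. mderiv F F' t --> ((%t. p (F t)) has_field_derivative D1 (F t) F') (at t)"
  "ALL M. (ALL i j. (%A. M A $ i $ j) : polys entries) --> (%A. D1 A (M A)) : polys entries"
  "ALL A. (p has_derivative D1 A) (at A)"
  "ALL A X Y c. D2 A (X + Y) = D2 A X + D2 A Y & D2 A (cscale c X) = c * D2 A X"
  "ALL F F' t. mderiv F F' t --> ((%t. q (F t)) has_field_derivative D2 (F t) F') (at t)"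
  "ALL M. (ALL i j. (%A. M A $ i $ j) : polys entries) --> (%A. D2 A (M A)) : polys entries"
  "ALL A. (q has_derivative D2 A) (at A)" by (elim exE conjE)
 note D = this
 show ?case
 proof (intro exI[of _ "%A X. D1 A X * q A + D2 A X * p A"] conjI allI impI)
  fix F F' t assume F: "mderiv (F :: complex => complex^'k^'k) F' t"
  have "((%t. p (F t)) has_field_derivative D1 (F t) F') (at t)"
   "((%t. q (F t)) has_field_derivative D2 (F t) F') (at t)" using D(2,6) F by simp_all
  then show "((%t. p (F t) * q (F t)) has_field_derivative D1 (F t) F' * q (F t) + D2 (F t) F' * p (F t)) (at t)"
   by (rule DERIV_mult)
 next
  fix A :: "complex^'k^'k"
  show "((%A. p A * q A) has_derivative (%X. D1 A X * q A + D2 A X * p A)) (at A)"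
   using has_derivative_mult[OF D(4)[rule_format] D(8)[rule_format], of A] by (simp add: add.commute mult.commute)
 qed (use D(1,3,5,7) polys_mult.hyps in \<open>simp_all add: ring_distribs polys.polys_add polys.polys_mult\<close>)
qed

definition poly_deriv :: "(complex^'k^'k => complex) => complex^'k^'k => complex^'k^'k => complex" where
 "poly_deriv p = (SOME D. (ALL A X Y c. D A (X + Y) = D A X + D A Y & D A (cscale c X) = c * D A X) &
  (ALL F F' t. mderiv F F' t --> ((%t. p (F t)) has_field_derivative D (F t) F') (at t)) &
  (ALL M. (ALL i j. (%A. M A $ i $ j) : polys entries) --> (%A. D A (M A)) : polys entries) &
  (ALL A. (p has_derivative D A) (at A)))"

lemma
 assumes "p : polys entries" shows poly_deriv_add: "poly_deriv p A (X + Y) = poly_deriv p A X + poly_deriv p A Y"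
  and poly_deriv_cscale: "poly_deriv p A (cscale c X) = c * poly_deriv p A X"
  and poly_deriv_chain: "mderiv F F' t ==> ((%t. p (F t)) has_field_derivative poly_deriv p (F t) F') (at t)"
  and poly_deriv_polys: "(!!i j. (%A. M A $ i $ j) : polys entries) ==> (%A. poly_deriv p A (M A)) : polys entries"
  and poly_has_derivative: "(p has_derivative poly_deriv p A) (at A)"
 using someI_ex[OF polys_derivative[OF assms], folded poly_deriv_def] by auto

lemma poly_deriv_zero: "p : polys entries ==> poly_deriv p A 0 = 0"
 using poly_deriv_cscale[of p A 0 0] by simp

lemma mderiv_line: "mderiv (%t. A + cscale t X) X t"
 using mderiv_add[OF mderiv_const[of A t] mderiv_cscale[OF DERIV_ident, where t = t and A = X]] by simp

definition vanishing :: "(complex^'k^'k) set => (complex^'k^'k => complex) set" where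
 "vanishing G = {p : polys entries. ALL A:G. p A = 0}"

lemma lie_algebra_iff: "X : lie_algebra G \<longleftrightarrow> (ALL p:vanishing G. poly_deriv p (mat 1) X = 0)"
proof -
 have "((%t. p (mat 1 + cscale t X)) has_field_derivative 0) (at 0) \<longleftrightarrow> poly_deriv p (mat 1) X = 0"
  if "p : polys entries" for p
  using poly_deriv_chain[OF that mderiv_line[of "mat 1" X 0]] DERIV_unique[of "%t. p (mat 1 + cscale t X)" _ 0] by auto
 then show ?thesis unfolding lie_algebra_def vanishing_def by auto
qed

lemma lie_algebra_subspace: "cmat.subspace (lie_algebra G)"
proof (rule cmat.subspaceI)
 show "0 : lie_algebra G" by (auto simp: lie_algebra_iff vanishing_def poly_deriv_zero)
 show "X + Y : lie_algebra G" if "X : lie_algebra G" "Y : lie_algebra G" for X Y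
  using that by (simp add: lie_algebra_iff vanishing_def poly_deriv_add)
 show "cscale c X : lie_algebra G" if "X : lie_algebra G" for c X
  using that by (simp add: lie_algebra_iff vanishing_def poly_deriv_cscale)
qed

lemma lie_algebra_mono: "G \<subseteq> H ==> lie_algebra G \<subseteq> lie_algebra H"
proof -
 assume "G \<subseteq> H"
 then have "vanishing H \<subseteq> vanishing G" by (auto simp: vanishing_def)
 then show ?thesis unfolding lie_algebra_iff subset_iff by simp
qed

lemma entriesE: "f : entries ==> (!!i j. f = (%A. A $ i $ j) ==> P) ==> P"
 by (auto simp: entries_def)

lemma alg_groupI_vanishing:
 assumes "alg_group G" "invertible A" "!!p. p : vanishing G ==> p A = 0" shows "A : G"
proof -
 obtain P where P: "P \<subseteq> polys entries" "G = {A : carrier GLn. ALL p:P. p A = 0}"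
  using assms(1) unfolding alg_group_def zariski_GLn_def closedin_zariski by (elim conjE exE)
 have "P \<subseteq> vanishing G" unfolding vanishing_def using P by auto
 then show ?thesis using assms(2,3) unfolding P(2) by (auto simp: carrier_GLn)
qed

text \<open>The derivation along the vector field \<open>A \<mapsto> X ** A\<close> maps the ideal
  of \<open>G\<close> into itself, because right translation by elements of \<open>G\<close>
  preserves this ideal. Hence all derivatives of \<open>p (mexp X t)\<close> at 0 vanish, and so
  does this entire function.\<close>

lemma mexp_in_group:
 fixes X :: "complex^'k^'k" assumes G: "alg_group G" and X: "X : lie_algebra G" shows "mexp X t : G"
proof (rule alg_groupI_vanishing[OF G invertible_mexp])
 define L where "L p = (%A. poly_deriv p A (X ** A))" for p
 have L: "L p : vanishing G" if p: "p : vanishing G" for p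
 proof -
  have pp: "p : polys entries" using p by (simp add: vanishing_def)
  have "L p : polys entries" unfolding L_def
   using pp by (intro poly_deriv_polys regs_mult_entry polys_const entry_polys)
  moreover have "L p g = 0" if g: "g : G" for g
  proof -
   let ?q = "%A. p (A ** g)"
   have q: "?q : polys entries"
    by (rule polys_subst[OF pp]) (auto elim!: entriesE intro!: regs_mult_entry polys_const entry_polys)
   then have qv: "?q : vanishing G" using p alg_group_mult[OF G _ g] by (auto simp: vanishing_def)
   have d: "mderiv (%t. (mat 1 + cscale t X) ** g) (X ** g) 0" by (rule mderiv_mult_right[OF mderiv_line])
   have "((%t. ?q (mat 1 + cscale t X)) has_field_derivative poly_deriv ?q (mat 1) X) (at 0)"
    using poly_deriv_chain[OF q mderiv_line[of "mat 1" X 0]] by simp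
   moreover have "((%t. ?q (mat 1 + cscale t X)) has_field_derivative poly_deriv p g (X ** g)) (at 0)"
    using poly_deriv_chain[OF pp d] by simp
   ultimately have "poly_deriv p g (X ** g) = poly_deriv ?q (mat 1) X" by (metis DERIV_unique)
   also have "\<dots> = 0" using X qv by (simp add: lie_algebra_iff) finally show ?thesis by (simp add: L_def)
  qed
  ultimately show ?thesis by (simp add: vanishing_def)
 qed
 fix p assume p: "p : vanishing G"
 define f where "f q = (%t. q (mexp X t))" for q :: "complex^'k^'k => complex"
 have df: "(f q has_field_derivative f (L q) t) (at t)" if "q : vanishing G" for q t
  using poly_deriv_chain[of q, OF _ mderiv_mexp[of X t]] that by (simp add: f_def L_def vanishing_def)
 have "(deriv ^^ n) (f p) = f ((L ^^ n) p)" "(L ^^ n) p : vanishing G" for n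
 proof (induction n)
  case (Suc n)
  { case 1
   have "(deriv ^^ Suc n) (f p) = deriv (f ((L ^^ n) p))" using Suc(1) by simp
   also have "\<dots> = f (L ((L ^^ n) p))" by (rule ext) (rule DERIV_imp_deriv[OF df[OF Suc(2)]])
   finally show ?case by simp }
  { case 2
   show ?case using Suc L by simp }
 qed (simp_all add: p)
 then have "(deriv ^^ n) (f p) 0 = 0" for n using alg_group_one[OF G] by (simp add: f_def vanishing_def)
 moreover have "f p holomorphic_on UNIV"
  using df[OF p] by (metis holomorphic_on_def field_differentiable_def field_differentiable_at_within)
 ultimately have "f p t = 0" using holomorphic_fun_eq_0_on_connected[of "f p" UNIV 0 t] connected_UNIV by simp
 then show "p (mexp X t) = 0" by (simp add: f_def)
qed

lemma curve_in_lie_algebra: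
 assumes "mderiv F X 0" "F 0 = mat 1" "!!t. F t : G" shows "X : lie_algebra G" unfolding lie_algebra_iff
proof
 fix p assume p: "p : vanishing G"
 then have "((%t. p (F t)) has_field_derivative poly_deriv p (F 0) X) (at 0)"
  by (intro poly_deriv_chain assms(1)) (simp add: vanishing_def)
 moreover have "(%t. p (F t)) = (%_. 0)" using p assms(3) by (auto simp: vanishing_def)
 ultimately show "poly_deriv p (mat 1) X = 0" using assms(2) by (metis DERIV_const DERIV_unique)
qed

lemma lie_algebra_mexp: "alg_group G ==> X : lie_algebra G \<longleftrightarrow> (ALL t. mexp X t : G)"
 using mexp_in_group curve_in_lie_algebra[of "mexp X" X G] mderiv_mexp[of X 0] by auto

text \<open>Both one-parameter groups are members of \<open>exp_family\<close>: the character
  \<open>k \<mapsto> exp (t * cnj k)\<close> with second parameter 0 gives the replica, the trivial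
  character with second parameter \<open>t\<close> gives the nilpotent part.\<close>

theorem replica:
 assumes G: "alg_group G" and X: "X : lie_algebra G"
  and S: "spectral L E N" "X = (\<Sum>k\<in>L. cscale k (E k)) + N"
 shows "(\<Sum>k\<in>L. cscale (cnj k) (E k)) : lie_algebra G" "N : lie_algebra G"
proof -
 obtain m0 where "mpow N m0 = 0" using S(1) by (auto simp: spectral_def nilpotent_mat_iff)
 \<comment> \<open>A successor, so that the sum over \<open>j\<close> has a term
   \<open>j = 0\<close>, the only one left when the second parameter is 0.\<close>
 then have m: "mpow N (Suc m0) = 0" by simp
 have fam: "exp_family L E N (Suc m0) h u : G"
  if h: "char_exp h" and inv: "invertible (exp_family L E N (Suc m0) h u)" for h u
 proof (rule alg_groupI_vanishing[OF G inv])
  fix p assume p: "p : vanishing G"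
  show "p (exp_family L E N (Suc m0) h u) = 0"
  proof (rule exp_family_zero[OF S(1) m S(2) _ _ h])
   show "p : polys entries" using p by (simp add: vanishing_def)
   show "p (mexp X t) = 0" for t using p mexp_in_group[OF G X] by (simp add: vanishing_def)
  qed
 qed
 have fin: "finite L" and one: "(\<Sum>k\<in>L. E k) = mat 1"
  and orth: "!!k z. k : L ==> z : L ==> E k ** E z = (if k = z then E k else 0)"
  using S by (auto simp: spectral_def)
 show "(\<Sum>k\<in>L. cscale (cnj k) (E k)) : lie_algebra G" (is "?X : _") unfolding lie_algebra_mexp[OF G]
 proof
  fix t
  have inj: "inj_on cnj L" by (auto simp: inj_on_def)
  have "spectral (cnj ` L) (%z. E (cnj z)) 0" unfolding spectral_def
   using fin one orth by (auto simp: sum.reindex[OF inj] nilpotent_mat_iff intro!: exI[of _ 1])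
  moreover have "?X = (\<Sum>z\<in>cnj ` L. cscale z (E (cnj z))) + 0" by (simp add: sum.reindex[OF inj])
  ultimately have "mexp ?X t = (\<Sum>k\<in>L. cscale (exp (t * cnj k)) (E k))"
   using mexp_spectral[of "cnj ` L" "%z. E (cnj z)" 0 1 ?X t] by (simp add: sum.reindex[OF inj])
  also have "\<dots> = exp_family L E N (Suc m0) (%k. exp (t * cnj k)) 0"
   unfolding exp_family_def by (subst sum.lessThan_Suc_shift) simp
  finally have eq: "mexp ?X t = exp_family L E N (Suc m0) (%k. exp (t * cnj k)) 0" .
  show "mexp ?X t : G" unfolding eq
   by (rule fam) (auto simp: char_exp_def exp_add ring_distribs invertible_mexp simp flip: eq)
 qed
 show "N : lie_algebra G" unfolding lie_algebra_mexp[OF G]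
 proof
  fix t
  have "spectral {0} (%_. mat 1) N" using S(1) by (simp add: spectral_def)
  from mexp_spectral[OF this m, of N t]
  have "mexp N t = (\<Sum>j<Suc m0. cscale (t ^ j / fact j) (mpow N j))" by simp
  also have "\<dots> = (\<Sum>j<Suc m0. \<Sum>k\<in>L. cscale (t ^ j / fact j) (E k ** mpow N j))"
   by (simp add: one flip: cscale_sum matrix_sum_left)
  also have "\<dots> = exp_family L E N (Suc m0) (%_. 1) t" unfolding exp_family_def by (subst sum.swap) simp
  finally have eq: "mexp N t = exp_family L E N (Suc m0) (%_. 1) t" .
  show "mexp N t : G" unfolding eq by (rule fam) (auto simp: char_exp_def invertible_mexp simp flip: eq)
 qed
qed

lemma cscale_of_real: "cscale (complex_of_real r) X = r *\<^sub>R X"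
 by (simp add: vec_eq_iff cscale_nth scaleR_conv_of_real[where 'a = complex])

lemma subspace_cmat: "cmat.subspace W ==> subspace W"
 by (auto intro!: subspaceI cmat.subspace_0 cmat.subspace_add simp flip: cscale_of_real intro: cmat.subspace_scale)

lemma closed_cmat: "cmat.subspace W ==> closed W"
 by (intro closed_subspace subspace_cmat)

lemma mderiv_seq:
 assumes d: "mderiv F F' t"
 shows "(%n. cscale (1 / of_real (inverse (real (Suc n)))) (F (t + of_real (inverse (real (Suc n)))) - F t)) \<longlonglongrightarrow> F'"
proof -
 have h: "filterlim (%n. complex_of_real (inverse (real (Suc n)))) (at 0) sequentially"
  unfolding filterlim_at using tendsto_of_real[OF LIMSEQ_inverse_real_of_nat, where 'a = complex]
  by (auto simp del: of_nat_Suc)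
 show ?thesis
 proof (intro vec_tendstoI)
  fix i j
  have "((%t. F t $ i $ j) has_field_derivative F' $ i $ j) (at t)" using d by (simp add: mderiv_def)
  then have "((%h. (F (t + h) $ i $ j - F t $ i $ j) / h) \<longlongrightarrow> F' $ i $ j) (at 0)" unfolding DERIV_def .
  from filterlim_compose[OF this h]
  show "(%n. cscale (1 / of_real (inverse (real (Suc n)))) (F (t + of_real (inverse (real (Suc n)))) - F t) $ i $ j) \<longlonglongrightarrow> F' $ i $ j"
   by (simp add: cscale_nth)
 qed
qed

lemma mderiv_subspace:
 assumes W: "cmat.subspace W" and F: "!!t. F t : W" and d: "mderiv F F' t" shows "F' : W"
 by (rule closed_sequentially[OF closed_cmat[OF W] _ mderiv_seq[OF d]])
  (intro cmat.subspace_scale[OF W] cmat.subspace_diff[OF W] F)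

lemma Ad_lie_algebra: "alg_group G ==> g : G ==> X : lie_algebra G ==> Ad g X : lie_algebra G"
proof -
 assume G: "alg_group G" and g: "g : G" and X: "X : lie_algebra G"
 have "mexp (Ad g X) t = g ** mexp X t ** matrix_inv g" for t
  unfolding Ad_def by (rule mexp_conj[symmetric, OF matrix_inv_right[OF alg_group_invertible[OF G g]]])
 then show ?thesis unfolding lie_algebra_mexp[OF G]
  using alg_group_mult[OF G] alg_group_inv[OF G] g mexp_in_group[OF G X] by simp
qed

lemma mderiv_Ad_mexp: "mderiv (%t. Ad (mexp X t) Y) (bracket X (Ad (mexp X t) Y)) t"
 using mderiv_mult[OF mderiv_mult_right[OF mderiv_mexp[of X t], of Y] mderiv_mexp_minus[of X t]]
  mexp_self_commute[of X "- t"]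
 by (simp add: Ad_def matrix_inv_mexp bracket_def matrix_mul_assoc matrix_diff_ldistrib[of _ 0, simplified])

lemma Ad_mexp_0: "Ad (mexp X 0) Y = Y"
 by (simp add: Ad_def matrix_inv_mat1)

lemma bracket_subspace:
 assumes "cmat.subspace W" "!!t. Ad (mexp X t) Y : W" shows "bracket X Y : W"
 using mderiv_subspace[OF assms mderiv_Ad_mexp[of X Y 0]] by (simp add: Ad_mexp_0 matrix_inv_mat1 Ad_def)

lemma bracket_lie_algebra:
 "alg_group G ==> X : lie_algebra G ==> Y : lie_algebra G ==> bracket X Y : lie_algebra G"
 by (intro bracket_subspace lie_algebra_subspace Ad_lie_algebra mexp_in_group)

subsection \<open>The trace form\<close>

interpretation complex_fun: vector_space "(*) :: complex => complex => complex"
 by unfold_locales (simp_all add: algebra_simps)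

interpretation cmat_functional: vector_space_pair "cscale :: complex => complex^'n^'n => complex^'n^'n"
 "(*) :: complex => complex => complex" by unfold_locales

definition elem :: "'n => 'n => complex^'n^'n" where
 "elem k l = (\<chi> i j. if i = k & j = l then 1 else 0)"

lemma matrix_elem_sum: "A = (\<Sum>k\<in>UNIV. \<Sum>l\<in>UNIV. cscale (A $ k $ l) (elem k l))"
proof -
 have "(\<Sum>k\<in>UNIV. \<Sum>l\<in>UNIV. A $ k $ l * (if i = k & j = l then 1 else 0)) = A $ i $ j" for i j
 proof -
  have "(\<Sum>k\<in>UNIV. \<Sum>l\<in>UNIV. A $ k $ l * (if i = k & j = l then 1 else 0)) =
    (\<Sum>k\<in>UNIV. if k = i then (\<Sum>l\<in>UNIV. if l = j then A $ i $ j else 0) else 0)"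
  proof (intro sum.cong refl)
   fix k
   show "(\<Sum>l\<in>UNIV. A $ k $ l * (if i = k & j = l then 1 else 0)) =
     (if k = i then (\<Sum>l\<in>UNIV. if l = j then A $ i $ j else 0) else 0)"
   proof (cases "k = i")
    case True
    then show ?thesis by (simp only: True simp_thms if_True) (intro sum.cong refl, auto)
   next
    case False
    then show ?thesis by auto
   qed
  qed
  then show ?thesis by (simp add: sum.delta)
 qed
 then show ?thesis by (simp only: vec_eq_iff elem_def cscale_nth sum_component vec_lambda_beta simp_thms)
qed

lemma trace_cscale: "trace (cscale c A) = c * trace A"
 by (simp add: trace_def cscale_nth sum_distrib_left)

lemma trace_zero [simp]: "trace (0 :: complex^'n^'n) = 0"
 by (simp add: trace_def)

lemma trace_sum: "trace (\<Sum>i\<in>S. f i) = (\<Sum>i\<in>S. trace (f i :: complex^'n^'n))"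
 by (induction S rule: infinite_finite_induct) (simp_all add: trace_add)

lemma linear_functional_trace:
 assumes x: "Vector_Spaces.linear cscale (*) (x :: complex^'n^'n => complex)"
 shows "EX B. ALL Y. x Y = trace (B ** Y)"
proof (intro exI allI)
 interpret l: Vector_Spaces.linear cscale "(*)" x by fact
 fix Y :: "complex^'n^'n"
 let ?B = "\<chi> i j. x (elem j i)"
 have "x Y = x (\<Sum>k\<in>UNIV. \<Sum>l\<in>UNIV. cscale (Y $ k $ l) (elem k l))" using matrix_elem_sum[of Y] by simp
 also have "\<dots> = (\<Sum>k\<in>UNIV. \<Sum>l\<in>UNIV. Y $ k $ l * x (elem k l))" by (simp add: l.sum l.scale)
 also have "\<dots> = trace (?B ** Y)"
  unfolding trace_def matrix_matrix_mult_def by (subst sum.swap) (simp add: mult.commute)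
 finally show "x Y = trace (?B ** Y)" .
qed

lemma functional_extend:
 assumes W: "cmat.subspace W" and b: "clinear_on W (*) b" shows "EX B. ALL Y:W. b Y = trace (B ** Y)"
proof -
 obtain S where S: "S \<subseteq> W" "cmat.independent S" "W \<subseteq> cmat.span S"
  using cmat.maximal_independent_subset[of W] by metis
 obtain z where z: "Vector_Spaces.linear cscale (*) z" "ALL x:S. z x = b x"
  using cmat_functional.linear_independent_extend[OF S(2), of b] by blast
 interpret l: Vector_Spaces.linear cscale "(*)" z by fact
 have "z Y = b Y" if "Y : W" for Y
 proof -
  have "Y : cmat.span S" using S(3) that by blast
  then have "Y : W & z Y = b Y"
  proof (induction rule: cmat.span_induct_alt)
   case base
   have "b (cscale 0 0) = 0 * b 0" using b cmat.subspace_0[OF W] unfolding clinear_on_def by blast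
   then show ?case using cmat.subspace_0[OF W] by simp
  next
   case (step c x y)
   then have x: "x : W" "z x = b x" using S(1) z(2) by auto
   then have "cscale c x : W" "b (cscale c x) = c * b x"
    using b cmat.subspace_scale[OF W] unfolding clinear_on_def by auto
   then show ?case using step x b cmat.subspace_add[OF W] unfolding clinear_on_def by (simp add: l.add l.scale)
  qed
  then show ?thesis by simp
 qed
 then show ?thesis using linear_functional_trace[OF z(1)] by metis
qed

lemma separate_subspace:
 assumes W: "cmat.subspace W" and X: "X \<notin> W"
 shows "EX B. (ALL Y:W. trace (B ** Y) = 0) & trace (B ** X) \<noteq> 0"
proof -
 obtain S where S: "S \<subseteq> W" "cmat.independent S" "W \<subseteq> cmat.span S"
  using cmat.maximal_independent_subset[of W] by metis
 have "cmat.span S \<subseteq> W" using S(1) W by (rule cmat.span_minimal)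
 then have "X \<notin> cmat.span S" using X by blast
 then have ind: "cmat.independent (insert X S)" using S(2) by (rule cmat.independent_insertI)
 obtain z where z: "Vector_Spaces.linear cscale (*) z" "ALL x:insert X S. z x = (if x = X then 1 else 0)"
  using cmat_functional.linear_independent_extend[OF ind, of "%x. if x = X then 1 else 0"] by blast
 interpret l: Vector_Spaces.linear cscale "(*)" z by fact
 have "z Y = 0" if "Y : W" for Y
 proof -
  have "Y : cmat.span S" using S(3) that by blast
  then show ?thesis
  proof (induction rule: cmat.span_induct_alt)
   case (step c x y)
   then have "x \<noteq> X" using \<open>X \<notin> cmat.span S\<close> cmat.span_base by blast
   with step z(2) show ?case by (simp add: l.add l.scale)
  qed (simp add: l.zero)
 qed
 moreover have "z X = 1" using z(2) by simp
 moreover obtain B where "!!Y. z Y = trace (B ** Y)" using linear_functional_trace[OF z(1)] by metis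
 ultimately show ?thesis by (metis zero_neq_one)
qed

lemma trace_right_add: "trace (A ** (B + C)) = trace (A ** B) + trace (A ** (C :: complex^'n^'n))"
 and trace_left_add: "trace ((A + B) ** C) = trace (A ** C) + trace (B ** (C :: complex^'n^'n))"
 and trace_right_scale: "trace (A ** cscale c B) = c * trace (A ** (B :: complex^'n^'n))"
 and trace_left_scale: "trace (cscale c A ** B) = c * trace (A ** (B :: complex^'n^'n))"
 and trace_right_diff: "trace (A ** (B - C)) = trace (A ** B) - trace (A ** (C :: complex^'n^'n))"
 and trace_left_diff: "trace ((A - B) ** C) = trace (A ** C) - trace (B ** (C :: complex^'n^'n))"
 by (simp_all add: matrix_add_ldistrib matrix_add_rdistrib matrix_diff_ldistrib matrix_diff_rdistrib
   trace_add trace_sub cscale_mult_left cscale_mult_right trace_cscale)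

definition form_on :: "(complex^'n^'n) set => (complex^'n^'n) set => (complex^'n^'n => complex^'n^'n => complex) => bool" where
 "form_on V W b \<longleftrightarrow> (ALL Y:W. clinear_on V (*) (%X. b X Y)) & (ALL X:V. clinear_on W (*) (b X))"

text \<open>A matrix \<open>Z\<close> separating the functional from the representable ones lies in
  \<open>V\<close>, because the annihilator of \<open>V\<close> is representable, and it lies in the
  left kernel of \<open>b\<close>, where \<open>y\<close> vanishes. This duality supplies most
  auxiliary elements below.\<close>

lemma pairing_represents:
 assumes V: "cmat.subspace V" and W: "cmat.subspace W" and b: "form_on V W b"
  and y: "clinear_on V (*) y" and ker: "!!X. X : V ==> ALL Y:W. b X Y = 0 ==> y X = 0"
 shows "EX Y:W. ALL X:V. y X = b X Y"
proof -
 let ?U = "{M. EX Y:W. ALL X:V. trace (M ** X) = b X Y}"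
 have bW: "b X (Y + Z) = b X Y + b X Z" "b X (cscale c Y) = c * b X Y" if "X : V" "Y : W" "Z : W" for X Y Z c
  using b that unfolding form_on_def clinear_on_def by blast+
 have b0: "b X 0 = 0" if "X : V" for X using bW(2)[OF that cmat.subspace_0[OF W] cmat.subspace_0[OF W], of 0] by simp
 have U: "cmat.subspace ?U"
 proof (rule cmat.subspaceI)
  show "0 : ?U" using b0 cmat.subspace_0[OF W] by (intro CollectI bexI[of _ 0]) simp_all
  fix M N assume "M : ?U" "N : ?U"
  then obtain Y Z where "Y : W" "ALL X:V. trace (M ** X) = b X Y" "Z : W" "ALL X:V. trace (N ** X) = b X Z" by blast
  then have "ALL X:V. trace ((M + N) ** X) = b X (Y + Z)" "Y + Z : W"
   using bW(1) cmat.subspace_add[OF W] by (simp_all add: trace_left_add)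
  then show "M + N : ?U" by (intro CollectI bexI)
 next
  fix c M assume "M : ?U"
  then obtain Y where "Y : W" "ALL X:V. trace (M ** X) = b X Y" by blast
  then have "ALL X:V. trace (cscale c M ** X) = b X (cscale c Y)" "cscale c Y : W"
   using bW(2) cmat.subspace_scale[OF W] by (simp_all add: trace_left_scale)
  then show "cscale c M : ?U" by (intro CollectI bexI)
 qed
 obtain M where M: "!!X. X : V ==> y X = trace (M ** X)" using functional_extend[OF V y] by metis
 have "M : ?U"
 proof (rule ccontr)
  assume "M \<notin> ?U"
  from separate_subspace[OF U this] obtain Z where Z: "ALL N:?U. trace (Z ** N) = 0" "trace (Z ** M) \<noteq> 0"
   by (elim exE conjE)
  have "Z : V"
  proof (rule ccontr)
   assume "Z \<notin> V"
   from separate_subspace[OF V this] obtain N where N: "ALL X:V. trace (N ** X) = 0" "trace (N ** Z) \<noteq> 0"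
    by (elim exE conjE)
   have "ALL X:V. trace (N ** X) = b X 0" using N(1) b0 by simp
   then have "N : ?U" using cmat.subspace_0[OF W] by (intro CollectI bexI)
   from bspec[OF Z(1) this] N(2) show False by (simp add: trace_mul_sym[of Z N])
  qed
  have "b Z Y = 0" if "Y : W" for Y
  proof -
   have "clinear_on V (*) (%X. b X Y)" using b that unfolding form_on_def by blast
   from functional_extend[OF V this] obtain N where N: "ALL X:V. b X Y = trace (N ** X)" by (rule exE)
   then have "ALL X:V. trace (N ** X) = b X Y" by simp
   then have "N : ?U" using that by (intro CollectI bexI)
   from bspec[OF Z(1) this] show ?thesis using bspec[OF N \<open>Z : V\<close>] by (simp add: trace_mul_sym[of Z N])
  qed
  then have "y Z = 0" using ker[OF \<open>Z : V\<close>] by blast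
  then show False using M[OF \<open>Z : V\<close>] Z(2) by (simp add: trace_mul_sym[of Z M])
 qed
 then show ?thesis using M by auto
qed

lemma trace_form_on: "form_on V W (%X Y. trace (X ** Y))"
 by (simp add: form_on_def clinear_on_def trace_left_add trace_right_add trace_left_scale trace_right_scale)

subsection \<open>Traces of nilpotent and idempotent matrices\<close>

lemma projection_exists:
 fixes S :: "(complex^'k) set" assumes "vec.subspace S"
 shows "EX e::complex^'k^'k. (ALL x. e *v x : S) & (ALL x:S. e *v x = x)"
proof -
 obtain g where g: "range g \<subseteq> S" "Vector_Spaces.linear (*s) (*s) g" "ALL v:S. g (id v) = v"
  using vec.linear_exists_left_inverse_on[OF vec.linear_id assms] by auto
 have "matrix g *v x = g x" for x using g(2) by (rule matrix_works)
 then show ?thesis using g by (intro exI[of _ "matrix g"]) auto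
qed

lemma matrix_eqI: "(!!x. A *v x = B *v x) ==> A = (B :: complex^'k^'k)"
 by (simp add: matrix_eq)

lemma range_matrix_subspace: "vec.subspace (range ((*v) (A :: complex^'k^'k)))"
 unfolding vec.subspace_def
 by (auto simp: image_iff matrix_vector_right_distrib[symmetric] vector_scalar_commute[symmetric]
   intro: exI[of _ 0]) 

text \<open>With \<open>e\<close> a projection onto the range of \<open>N\<close>, the matrix
  \<open>N ** e\<close> has the same trace as \<open>e ** N = N\<close> and a smaller nilpotency
  exponent.\<close>

lemma trace_nilpotent: "mpow N k = 0 ==> trace (N :: complex^'k^'k) = 0"
proof (induction k arbitrary: N rule: less_induct)
 case (less k)
 show ?case
 proof (cases "k \<le> 1")
  case True
  then have "N = 0" using nilpotent_mpow_mono[OF less.prems, of 1] by simp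
  then show ?thesis by simp
 next
  case False
  then obtain j where j: "k = Suc (Suc j)" by (metis Suc_le_eq One_nat_def not_le less_imp_Suc_add add_Suc)
  obtain e where e: "!!x. e *v x : range ((*v) N)" "!!x. x : range ((*v) N) ==> e *v x = x"
   using projection_exists[OF range_matrix_subspace[of N]] by metis
  have eN: "e ** N = N" by (rule matrix_eqI) (simp add: e flip: matrix_vector_mul_assoc)
  have pow: "mpow (N ** e) (Suc i) = mpow N (Suc i) ** e" for i
  proof (induction i)
   case (Suc i)
   have "mpow (N ** e) (Suc (Suc i)) = N ** e ** (N ** mpow N i ** e)" using Suc by simp
   also have "\<dots> = N ** (e ** N) ** mpow N i ** e" by (simp add: matrix_mul_assoc)
   finally show ?case by (simp add: eN matrix_mul_assoc)
  qed simp
  have "mpow (N ** e) (Suc j) = 0" unfolding pow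
  proof (rule matrix_eqI)
   fix x
   obtain y where "e *v x = N *v y" using e(1)[of x] by auto
   then have "mpow N (Suc j) ** e *v x = (mpow N (Suc j) ** N) *v y"
    by (simp only: matrix_vector_mul_assoc[symmetric])
   also have "mpow N (Suc j) ** N = 0" using less.prems unfolding j by (metis mpow_Suc2)
   finally show "mpow N (Suc j) ** e *v x = 0 *v x" by simp
  qed
  then have "trace (N ** e) = 0" using less.IH[of "Suc j"] j by simp
  then show ?thesis using eN by (metis trace_mul_sym)
 qed
qed

lemma nilpotent_trace: "nilpotent_mat N ==> trace N = 0"
 using trace_nilpotent by (auto simp: nilpotent_mat_iff)

lemma nilpotent_mult_commute:
 assumes "nilpotent_mat N" "N ** Y = Y ** N" shows "nilpotent_mat (N ** Y)"
proof -
 obtain k where k: "mpow N k = 0" using assms(1) by (auto simp: nilpotent_mat_iff)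
 have "mpow (N ** Y) j = mpow N j ** mpow Y j" for j
 proof (induction j)
  case (Suc j)
  have "mpow (N ** Y) (Suc j) = N ** (Y ** mpow N j) ** mpow Y j" using Suc by (simp add: matrix_mul_assoc)
  also have "Y ** mpow N j = mpow N j ** Y" using mpow_commute[OF assms(2), of j] by simp
  finally show ?case by (simp add: matrix_mul_assoc)
 qed simp
 then show ?thesis using k by (auto simp: nilpotent_mat_iff intro!: exI[of _ k])
qed

lemma semisimple_mat_eigenvectors:
 fixes X :: "complex^'n^'n" assumes "vec.span {v. EX k. X *v v = k *s v} = UNIV" shows "semisimple_mat X"
proof -
 let ?E = "{v. EX k. X *v v = k *s v}"
 obtain B where B: "B \<subseteq> ?E" "vec.independent B" "?E \<subseteq> vec.span B" "card B = vec.dim ?E"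
  using vec.basis_exists[of ?E] by blast
 have spanB: "vec.span B = UNIV" using assms vec.span_mono[OF B(3)] by (simp add: vec.span_span) blast
 have "card B = CARD('n)" using B(2) spanB vec.dim_eq_card[of B UNIV] by (simp add: card_cart_basis)
 then obtain b where b: "bij_betw b (UNIV :: 'n set) B"
  using finite_same_card_bij[of "UNIV :: 'n set" B] vec.finiteI_independent[OF B(2)] by auto
 obtain k where k: "ALL j. X *v b j = k j *s b j"
 proof -
  have "ALL j. EX k. X *v b j = k *s b j" using b B(1) by (auto simp: bij_betw_def)
  then show ?thesis using that by (rule choice[THEN exE])
 qed
 define P :: "complex^'n^'n" where "P = (\<chi> i j. b j $ i)"
 have col: "column j P = b j" for j by (simp add: column_def P_def vec_eq_iff)
 have "columns P = B" using b by (auto simp: columns_def col bij_betw_def)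
 then have P: "invertible P" using matrix_right_invertible_span_columns[of P] spanB invertible_right_inverse[of P] by simp
 define D :: "complex^'n^'n" where "D = (\<chi> i j. if i = j then k j else 0)"
 have "X ** P = P ** D"
 proof -
  have "(X ** P) $ i $ j = (P ** D) $ i $ j" for i j
  proof -
   have "(X ** P) $ i $ j = (X *v b j) $ i" by (simp add: matrix_matrix_mult_def matrix_vector_mult_def P_def)
   also have "\<dots> = (P ** D) $ i $ j" by (simp add: k matrix_matrix_mult_def P_def D_def if_distrib cong: if_cong)
   finally show ?thesis .
  qed
  then show ?thesis by (simp add: vec_eq_iff)
 qed
 then have "matrix_inv P ** X ** P = D"
  using matrix_inv_left[OF P] by (simp add: matrix_mul_assoc[symmetric]) (simp add: matrix_mul_assoc)
 then show ?thesis unfolding semisimple_mat_def using P by (intro exI[of _ P]) (simp add: D_def)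
qed

text \<open>The number is the rank. That it is a natural number, zero only for the zero matrix, is
  the source of the positivity arguments below.\<close>

lemma trace_idempotent:
 fixes e :: "complex^'k^'k" assumes e: "e ** e = e" shows "EX n::nat. trace e = of_nat n & (n = 0 --> e = 0)"
proof -
 let ?E = "{v. EX c. e *v v = c *s v}"
 have "v : vec.span ?E" for v
 proof -
  have "e *v (e *v v) = 1 *s (e *v v)" "e *v (v - e *v v) = 0 *s (v - e *v v)"
   by (simp_all add: matrix_vector_mul_assoc matrix_vector_mult_diff_distrib e)
  then have "e *v v + (v - e *v v) : vec.span ?E" by (intro vec.span_add vec.span_base) blast+
  then show ?thesis by simp
 qed
 then have "semisimple_mat e" by (intro semisimple_mat_eigenvectors) blast
 then obtain P :: "complex^'k^'k" where P: "invertible P" "ALL i j. i \<noteq> j --> (matrix_inv P ** e ** P) $ i $ j = 0"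
  unfolding semisimple_mat_def by blast
 define D where "D = matrix_inv P ** e ** P"
 have D: "D $ i $ j = 0" if "i \<noteq> j" for i j using P(2) that by (simp add: D_def)
 have eD: "e = P ** D ** matrix_inv P"
  using matrix_inv_right[OF P(1)] by (simp add: D_def matrix_mul_assoc) (simp flip: matrix_mul_assoc)
 have "D ** D = matrix_inv P ** e ** (P ** matrix_inv P) ** e ** P" by (simp add: D_def matrix_mul_assoc)
 also have "\<dots> = D" using e by (simp add: D_def matrix_inv_right[OF P(1)] flip: matrix_mul_assoc)
 finally have DD: "D ** D = D" .
 have "(D ** D) $ i $ i = (\<Sum>k\<in>UNIV. if k = i then D $ i $ i * D $ i $ i else 0)" for i
  unfolding matrix_matrix_mult_def vec_lambda_beta using D by (intro sum.cong) auto
 then have "D $ i $ i = of_bool (D $ i $ i \<noteq> 0)" for i unfolding DD by simp metis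
 then have "trace D = (\<Sum>i\<in>UNIV. of_bool (D $ i $ i \<noteq> 0))" unfolding trace_def by (intro sum.cong refl)
 then have "trace D = of_nat (card {i. D $ i $ i \<noteq> 0})" by simp
 moreover have "trace e = trace D" unfolding eD using trace_mul_sym[of "P ** D" "matrix_inv P"] P(1)
  by (simp add: matrix_mul_assoc matrix_inv_left)
 moreover have "D = 0" if "card {i. D $ i $ i \<noteq> 0} = 0" using D that by (simp add: vec_eq_iff) metis
 ultimately show ?thesis using eD by (intro exI[of _ "card {i. D $ i $ i \<noteq> 0}"]) auto
qed

subsection \<open>Engel's theorem\<close>

definition mprod :: "(complex^'n^'n) list => complex^'n^'n" where
 "mprod xs = foldr (**) xs (mat 1)"

lemma mprod_simps [simp]: "mprod [] = mat 1" "mprod (x # xs) = x ** mprod xs"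
 by (simp_all add: mprod_def)

lemma mprod_append: "mprod (xs @ ys) = mprod xs ** mprod ys"
 by (induction xs) (simp_all add: matrix_mul_assoc)

definition nil_products :: "(complex^'n^'n) set => nat => bool" where
 "nil_products S k \<longleftrightarrow> (ALL xs. length xs = k & set xs \<subseteq> S --> mprod xs = 0)"

lemma nil_products_ge: "nil_products S k ==> k \<le> length xs ==> set xs \<subseteq> S ==> mprod xs = 0"
 using mprod_append[of "take k xs" "drop k xs"] set_take_subset[of k xs] by (force simp: nil_products_def)

text \<open>An ascending filtration of the matrix space, starting at 0, on which left multiplication
  by an element of \<open>S\<close> lowers the index. It stands in for a flag of subspaces.\<close>

definition word_ann :: "(complex^'n^'n) set => nat => (complex^'n^'n) set" where
 "word_ann S j = {a. ALL xs. length xs = j & set xs \<subseteq> S --> mprod xs ** a = 0}"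

lemma word_ann_subspace: "cmat.subspace (word_ann S j)"
 by (intro cmat.subspaceI) (auto simp: word_ann_def matrix_add_ldistrib cscale_mult_right)

lemma word_ann_0: "word_ann S 0 = {0}"
 by (auto simp: word_ann_def)

lemma word_ann_Suc: "a : word_ann S (Suc j) \<longleftrightarrow> (ALL s:S. s ** a : word_ann S j)"
proof (intro iffI ballI)
 fix s assume "a : word_ann S (Suc j)" "s : S"
 then have "mprod (xs @ [s]) ** a = 0" if "length xs = j" "set xs \<subseteq> S" for xs using that by (auto simp: word_ann_def)
 then show "s ** a : word_ann S j" by (simp add: word_ann_def mprod_append matrix_mul_assoc)
next
 assume *: "ALL s:S. s ** a : word_ann S j"
 have "mprod xs ** a = 0" if "length xs = Suc j" "set xs \<subseteq> S" for xs
  using that * by (cases xs rule: rev_cases) (auto simp: word_ann_def mprod_append simp flip: matrix_mul_assoc)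
 then show "a : word_ann S (Suc j)" by (simp add: word_ann_def)
qed

lemma word_ann_mono: "a : word_ann S j ==> a : word_ann S (Suc j)"
 by (auto simp: word_ann_def length_Suc_conv simp flip: matrix_mul_assoc)

lemma word_ann_normalize:
 assumes "!!s. s : S ==> bracket X s : S" "a : word_ann S j" shows "X ** a : word_ann S j" using assms(2)
proof (induction j arbitrary: a)
 case (Suc j)
 have "s ** (X ** a) : word_ann S j" if s: "s : S" for s
 proof -
  have "s ** (X ** a) = X ** (s ** a) - bracket X s ** a"
   by (simp add: bracket_def matrix_diff_rdistrib matrix_mul_assoc)
  then show ?thesis using Suc s assms(1) by (simp add: word_ann_Suc cmat.subspace_diff[OF word_ann_subspace])
 qed
 then show ?case by (simp add: word_ann_Suc)
qed (simp add: word_ann_0)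

lemma word_ann_nil: "nil_products S k ==> a : word_ann S k"
 by (simp add: word_ann_def nil_products_def)

text \<open>Modulo the next lower stage of the filtration, a product of \<open>p\<close> factors
  \<open>s + c X\<close> acts as a multiple of \<open>mpow X p = 0\<close>. So \<open>p\<close>
  factors lower the stage by one, and \<open>p * k\<close> of them annihilate everything.\<close>

lemma nil_products_extend:
 fixes X :: "complex^'n^'n"
 assumes S: "nil_products S k" and X: "!!s. s : S ==> bracket X s : S" and p: "mpow X p = 0"
 shows "EX l. nil_products {s + cscale c X | s c. s : S} l"
proof -
 let ?T = "{s + cscale c X | s c. s : S}"
 note A = word_ann_subspace
 have step: "EX c. mprod ts ** a - cscale c (mpow X (length ts) ** a) : word_ann S j"
  if "set ts \<subseteq> ?T" "a : word_ann S (Suc j)" for ts a j using that(1)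
 proof (induction ts)
  case Nil
  then show ?case using cmat.subspace_0[OF A] by (intro exI[of _ 1]) simp
 next
  case (Cons t ts)
  then obtain s c where t: "t = s + cscale c X" "s : S" by auto
  from Cons obtain c' where c': "mprod ts ** a - cscale c' (mpow X (length ts) ** a) : word_ann S j" (is "?b : _") by auto
  have "mpow X i ** a : word_ann S (Suc j)" for i
   by (induction i) (simp_all add: that(2) word_ann_normalize[OF X] flip: matrix_mul_assoc)
  then have "?b + cscale c' (mpow X (length ts) ** a) : word_ann S (Suc j)"
   by (intro cmat.subspace_add[OF A] cmat.subspace_scale[OF A] word_ann_mono[OF c'])
  then have "s ** (mprod ts ** a) : word_ann S j" using t(2) by (simp add: word_ann_Suc)
  moreover have "mprod (t # ts) ** a - cscale (c * c') (mpow X (length (t # ts)) ** a) =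
    s ** (mprod ts ** a) + cscale c (X ** ?b)"
   by (simp add: t matrix_add_rdistrib cscale_mult_left cscale_mult_right matrix_diff_ldistrib cscale_diff_right
     matrix_mul_assoc) ultimately show ?case using c' by (intro exI[of _ "c * c'"])
    (simp only: cmat.subspace_add[OF A] cmat.subspace_scale[OF A] word_ann_normalize[OF X])
 qed
 have "mprod ts ** a = 0" if "length ts = p * j" "set ts \<subseteq> ?T" "a : word_ann S j" for ts a j using that
 proof (induction j arbitrary: ts a)
  case (Suc j)
  have "mprod (drop (p * j) ts) ** a : word_ann S j"
   using step[OF _ Suc.prems(3), of "drop (p * j) ts"] Suc.prems set_drop_subset[of "p * j" ts] p by auto
  then have "mprod (take (p * j) ts) ** (mprod (drop (p * j) ts) ** a) = 0"
   using Suc.prems set_take_subset[of "p * j" ts] by (intro Suc.IH) auto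
  then show ?case using mprod_append[of "take (p * j) ts" "drop (p * j) ts"] by (simp add: matrix_mul_assoc)
 qed (simp add: word_ann_0)
 from this[OF _ _ word_ann_nil[OF S], of _ "mat 1"] have "nil_products ?T (p * k)"
  unfolding nil_products_def by auto
 then show ?thesis by blast
qed

lemma cmat_dim_bounded: "cmat.independent (S :: (complex^'n^'n) set) ==> finite S & card S \<le> CARD('n) * CARD('n)"
proof -
 assume S: "cmat.independent S"
 let ?B = "range (%(k, l). elem k l :: complex^'n^'n)"
 have span: "X : cmat.span ?B" for X
  by (subst matrix_elem_sum) (intro cmat.span_sum cmat.span_scale cmat.span_base, auto)
 have "finite S & card S \<le> card ?B" using S span by (intro cmat.independent_span_bound) auto
 moreover have "card ?B \<le> CARD('n) * CARD('n)"
  using card_image_le[of "UNIV :: ('n \<times> 'n) set" "%(k, l). elem k l :: complex^'n^'n"] by simp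
 ultimately show ?thesis by linarith
qed

lemma cmat_dim_less:
 assumes "cmat.subspace S" "cmat.subspace T" "S \<subset> (T :: (complex^'n^'n) set)"
 shows "cmat.dim S < cmat.dim T"
proof -
 obtain B where B: "B \<subseteq> S" "cmat.independent B" "S \<subseteq> cmat.span B" "card B = cmat.dim S"
  using cmat.basis_exists[of S] by metis
 obtain x where x: "x : T" "x \<notin> S" using assms(3) by blast
 have "cmat.span B \<subseteq> S" using B(1) assms(1) by (rule cmat.span_minimal)
 then have "x \<notin> cmat.span B" using x by blast
 then have ind: "cmat.independent (insert x B)" using B(2) by (rule cmat.independent_insertI)
 have fin: "finite B" using cmat_dim_bounded[OF B(2)] by simp
 obtain C where C: "C \<subseteq> T" "cmat.independent C" "T \<subseteq> cmat.span C" "card C = cmat.dim T"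
  using cmat.basis_exists[of T] by metis
 have "card (insert x B) \<le> card C" using C(3) x B(1) assms(3) cmat_dim_bounded[OF C(2)] ind
  by (intro cmat.independent_span_bound[THEN conjunct2]) auto
 moreover have "x \<notin> B" using x B(1) by blast ultimately show ?thesis using B(4) C(4) fin by simp
qed

lemma cmat_dim_le: "cmat.dim (S :: (complex^'n^'n) set) \<le> CARD('n) * CARD('n)"
 using cmat.basis_exists[of S] cmat_dim_bounded by metis

text \<open>Let \<open>S\<close> be of maximal dimension among the Lie subalgebras of
  \<open>d\<close> with vanishing long products. If \<open>S \<noteq> d\<close>, some
  \<open>X\<close> in \<open>d - S\<close> normalises \<open>S\<close>, and adjoining it contradicts
  maximality.\<close>

theorem Engel:
 fixes d :: "(complex^'n^'n) set"
 assumes n: "cmat.subspace d" "!!X Y. X : d ==> Y : d ==> bracket X Y : d" "!!X. X : d ==> nilpotent_mat X"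
 shows "EX k. nil_products d k"
proof -
 let ?P = "%S. cmat.subspace S & S \<subseteq> d & (ALL X:S. ALL Y:S. bracket X Y : S) & (EX k. nil_products S k)"
 have "nil_products {0 :: complex^'n^'n} 1" unfolding nil_products_def by (auto simp: length_Suc_conv)
 then have "?P {0}" using cmat.subspace_0[OF n(1)]
  by (intro conjI exI) (simp_all add: bracket_def cmat.subspace_def)
 moreover have "ALL S. ?P S --> cmat.dim S < Suc (CARD('n) * CARD('n))"
  by (intro allI impI le_imp_less_Suc cmat_dim_le)
 ultimately have "EX S. ?P S & (ALL S'. ?P S' --> cmat.dim S' \<le> cmat.dim S)" by (rule ex_has_greatest_nat)
 then obtain S where S': "?P S & (ALL S'. ?P S' --> cmat.dim S' \<le> cmat.dim S)" by (rule exE)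
 note S = conjunct1[OF S'] and max = conjunct2[OF S']
 obtain k where k: "nil_products S k" using S by blast
 have subS: "cmat.subspace S" using S by blast
 have "S = d"
 proof (rule ccontr)
  assume "S \<noteq> d"
  \<comment> \<open>Matrices killed by any \<open>m\<close> factors from \<open>S\<close>
    distributed over both sides. An \<open>X\<close> in \<open>d - S\<close> with minimal
    \<open>m\<close> normalises \<open>S\<close>, since its brackets with \<open>S\<close> need one
    factor less.\<close>
  define N where "N m = {Z. ALL us vs. length us + length vs = m & set us \<subseteq> S & set vs \<subseteq> S --> mprod us ** Z ** mprod vs = 0}" for m
  have "Z : N (k + k)" for Z
  proof -
   have "mprod us ** Z ** mprod vs = 0" if "length us + length vs = k + k" "set us \<subseteq> S" "set vs \<subseteq> S" for us vs
    using nil_products_ge[OF k _ that(2)] nil_products_ge[OF k _ that(3)] that(1) by (cases "k \<le> length us") auto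
   then show ?thesis by (simp add: N_def)
  qed
  then have "EX m. EX Z:d - S. Z : N m" using \<open>S \<noteq> d\<close> S by blast
  then obtain m where m: "EX Z:d - S. Z : N m" and least: "!!j. j < m ==> \<not> (EX Z:d - S. Z : N j)"
   unfolding exists_least_iff[of "%m. EX Z:d - S. Z : N m"] by blast
  obtain X where X: "X : d" "X \<notin> S" "X : N m" using m by blast
  have Xs: "bracket s X : S" if s: "s : S" for s
  proof (cases m)
   case 0
   then have "X = 0" using X(3) by (auto simp: N_def)
   then show ?thesis using X(2) cmat.subspace_0[OF subS] by simp
  next
   case (Suc j)
   have "mprod us ** bracket s X ** mprod vs = 0" if "length us + length vs = j" "set us \<subseteq> S" "set vs \<subseteq> S" for us vs
   proof -
    have "mprod (us @ [s]) ** X ** mprod vs = 0" "mprod us ** X ** mprod (s # vs) = 0"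
     using X(3) s that unfolding N_def Suc by (auto simp del: mprod_simps(2))
    then show ?thesis
     by (simp add: bracket_def mprod_append matrix_diff_ldistrib matrix_diff_rdistrib matrix_mul_assoc)
   qed
   then have "bracket s X : N j" by (simp add: N_def)
   moreover have "bracket s X : d" using n(2) X(1) S s by blast
   ultimately show ?thesis using least[of j] Suc by blast
  qed
  have Xs': "bracket X s : S" if "s : S" for s
   using cmat.subspace_neg[OF subS Xs[OF that]] by (simp add: bracket_def)
  obtain p where p: "mpow X p = 0" using n(3)[OF X(1)] by (auto simp: nilpotent_mat_iff)
  let ?T = "{s + cscale c X | s c. s : S}"
  have T: "?T = {s + x | s x. s : S & x : cmat.span {X}}" by (auto simp: cmat.span_singleton)
  have ST: "S \<subseteq> ?T" "X : ?T"
   unfolding T using cmat.span_zero[of "{X}"] cmat.span_base[of X "{X}"] cmat.subspace_0[OF subS] by force+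
  have "?P ?T"
  proof (intro conjI)
   show "cmat.subspace ?T" unfolding T by (rule cmat.subspace_sums[OF subS cmat.subspace_span])
   show "?T \<subseteq> d" using S X(1) cmat.subspace_add[OF n(1)] cmat.subspace_scale[OF n(1)] by auto
   show "EX l. nil_products ?T l" by (rule nil_products_extend[OF k Xs' p])
   show "ALL a:?T. ALL b:?T. bracket a b : ?T"
   proof (intro ballI)
    fix a b assume "a : ?T" "b : ?T"
    then obtain s c s' c' where ab: "a = s + cscale c X" "s : S" "b = s' + cscale c' X" "s' : S" by blast
    have "bracket a b = bracket s s' + cscale c' (bracket s X) + cscale c (bracket X s')"
     by (simp add: ab bracket_def matrix_add_ldistrib matrix_add_rdistrib cscale_mult_left cscale_mult_right
       cscale_diff_right cscale_add_right mult.commute)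
    also have "\<dots> : S" using S ab Xs Xs' by (intro cmat.subspace_add[OF subS] cmat.subspace_scale[OF subS]) auto
    finally show "bracket a b : ?T" using ST(1) by blast
   qed
  qed
  moreover have "S \<subset> ?T" using ST X(2) by blast
  ultimately show False using spec[OF max, of ?T] cmat_dim_less[of S ?T] subS by auto
 qed
 then show ?thesis using k by blast
qed

text \<open>Left multiplication by \<open>Y\<close> preserves the filtration
  \<open>word_ann n\<close> and that by \<open>X\<close> lowers it, so \<open>X ** Y\<close> is
  nilpotent.\<close>

lemma trace_nil_ideal:
 assumes k: "nil_products n k" and X: "X : n" and Y: "!!Z. Z : n ==> bracket Y Z : n" shows "trace (X ** Y) = 0"
proof -
 have "mpow (X ** Y) j ** a = 0" if "a : word_ann n j" for j a using that
 proof (induction j arbitrary: a)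
  case (Suc j)
  have "X ** (Y ** a) : word_ann n j" using word_ann_normalize[OF Y Suc.prems] X by (simp add: word_ann_Suc)
  from Suc.IH[OF this] show ?case unfolding mpow_Suc2 by (simp add: matrix_mul_assoc)
 qed (simp add: word_ann_0)
 from this[OF word_ann_nil[OF k], of "mat 1"] have "mpow (X ** Y) k = 0" by simp
 then show ?thesis by (rule trace_nilpotent)
qed

theorem trace_nilpotent_ideal:
 assumes n: "cmat.subspace N" "N \<subseteq> m" "!!X Y. X : m ==> Y : N ==> bracket X Y : N"
  "!!X. X : N ==> nilpotent_mat X" and "X : N" "Y : m" shows "trace (X ** Y) = 0"
proof -
 have "EX k. nil_products N k" using n by (intro Engel) auto
 then show ?thesis using trace_nil_ideal[of N _ X Y] assms by blast
qed

subsection \<open>Limits of matrices\<close>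

lemma tendsto_matrix_mult:
 fixes f g :: "'x => complex^'k^'k" assumes "(f \<longlongrightarrow> A) F" "(g \<longlongrightarrow> B) F"
 shows "((%x. f x ** g x) \<longlongrightarrow> A ** B) F"
proof (intro vec_tendstoI)
 fix i j
 show "((%x. (f x ** g x) $ i $ j) \<longlongrightarrow> (A ** B) $ i $ j) F"
  by (auto simp: matrix_matrix_mult_def intro!: tendsto_sum tendsto_mult tendsto_vec_nth assms)
qed

lemma continuous_on_matrix_mult:
 fixes A :: "complex^'k^'k" shows "continuous_on S (%B :: complex^'k^'k. A ** B)"
 unfolding continuous_on_def by (intro ballI tendsto_matrix_mult[OF tendsto_const tendsto_ident_at])

lemma polys_isCont: "p : polys entries ==> isCont p (A :: complex^'k^'k)"
 using has_derivative_continuous[OF poly_has_derivative] by blast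

lemma polys_continuous_on: "p : polys entries ==> continuous_on S (p :: complex^'k^'k => complex)"
 by (intro continuous_at_imp_continuous_on ballI polys_isCont)

lemma open_invertible: "open {A :: complex^'k^'k. invertible A}"
proof -
 have "open ((det :: complex^'k^'k => complex) -` (- {0}))"
  by (auto intro!: polys_continuous_on det_polys entry_polys open_vimage)
 then show ?thesis by (simp add: vimage_def invertible_det_nz)
qed

lemma tendsto_matrix_inv:
 fixes g :: "'x => complex^'k^'k"
 assumes g: "(g \<longlongrightarrow> A) F" and inv: "invertible A" "!!x. invertible (g x)"
 shows "((%x. matrix_inv (g x)) \<longlongrightarrow> matrix_inv A) F"
proof (intro vec_tendstoI)
 fix i j
 obtain q where q: "q : polys entries" "ALL A::complex^'k^'k. invertible A --> q A = det A * matrix_inv A $ i $ j"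
  using inv_entry_poly[where i = i and j = j] by (elim bexE)
 have eq: "matrix_inv B $ i $ j = q B / det B" if "invertible B" for B
  using that q(2) by (simp add: invertible_det_nz)
 show "((%x. matrix_inv (g x) $ i $ j) \<longlongrightarrow> matrix_inv A $ i $ j) F"
  using inv(1) inv by (fastforce simp: invertible_det_nz eq intro: tendsto_divide isCont_tendsto_compose[OF _ g] polys_isCont q(1) det_polys entry_polys)
qed

lemma matrix_scaleR_right: "A ** (c *\<^sub>R B) = c *\<^sub>R (A ** B)" for A B :: "complex^'k^'k"
 by (simp only: cscale_of_real[symmetric] cscale_mult_right)

lemma mderiv_tendsto:
 assumes d: "mderiv F F' t" and h: "filterlim h (at 0) G"
 shows "((%n. cscale (1 / h n) (F (t + h n) - F t)) \<longlongrightarrow> F') G"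
proof (intro vec_tendstoI)
 fix i j
 have "((%h. (F (t + h) $ i $ j - F t $ i $ j) / h) \<longlongrightarrow> F' $ i $ j) (at 0)"
  using d by (simp add: mderiv_def DERIV_def)
 from filterlim_compose[OF this h]
 show "((%n. cscale (1 / h n) (F (t + h n) - F t) $ i $ j) \<longlongrightarrow> F' $ i $ j) G"
  by (simp add: cscale_nth)
qed

subsection \<open>Tangent directions\<close>

text \<open>As \<open>p\<close> vanishes at \<open>k n\<close> and at the identity, its differential
  on the difference quotients has the norm of a scaled Taylor remainder, which tends to 0.\<close>

lemma tangent_limit:
 fixes k :: "nat => complex^'n^'n"
 assumes one: "mat 1 : G" and k: "!!n. k n : G" "k \<longlonglongrightarrow> mat 1"
  and lim: "(%n. inverse (d n) *\<^sub>R (k n - mat 1)) \<longlonglongrightarrow> A" shows "A : lie_algebra G"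
 unfolding lie_algebra_iff
proof
 fix p assume p: "p : vanishing G"
 let ?D = "poly_deriv p (mat 1)" and ?h = "%n. k n - mat 1"
 have pp: "p : polys entries" and z: "!!B. B : G ==> p B = 0" using p by (auto simp: vanishing_def)
 have D: "(p has_derivative ?D) (at (mat 1))" by (rule poly_has_derivative[OF pp])
 then have bl: "bounded_linear ?D" by (rule has_derivative_bounded_linear)
 define q where "q h = norm (p (mat 1 + h) - p (mat 1) - ?D h) / norm h" for h
 have "q \<midarrow>0\<rightarrow> q 0" using D unfolding has_derivative_at by (simp add: q_def[abs_def])
 then have "(%n. q (?h n)) \<longlonglongrightarrow> q 0"
  using tendsto_diff[OF k(2) tendsto_const[of "mat 1"]] isCont_tendsto_compose by (auto simp: isCont_def)
 then have q0: "(%n. q (?h n)) \<longlonglongrightarrow> 0" by (simp add: q_def)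
 have "norm (?D (inverse (d n) *\<^sub>R ?h n)) = q (?h n) * norm (inverse (d n) *\<^sub>R ?h n)" for n
 using z[OF k(1)] z[OF one] by (simp add: q_def linear_scale[OF bounded_linear.linear[OF bl]] linear_0[OF bounded_linear.linear[OF bl]])
 moreover have "(%n. q (?h n) * norm (inverse (d n) *\<^sub>R ?h n)) \<longlonglongrightarrow> 0 * norm A"
  by (intro tendsto_mult q0 tendsto_norm lim)
 ultimately have "(%n. norm (?D (inverse (d n) *\<^sub>R ?h n))) \<longlonglongrightarrow> 0" by simp
 moreover have "(%n. norm (?D (inverse (d n) *\<^sub>R ?h n))) \<longlonglongrightarrow> norm (?D A)"
  by (intro tendsto_norm bounded_linear.tendsto[OF bl] lim)
 ultimately have "norm (?D A) = 0" by (rule LIMSEQ_unique[rotated])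
 then show "?D A = 0" by simp
qed

text \<open>The elements \<open>k n\<close> of the cosets \<open>g n H\<close> are chosen at minimal distance from the identity. If \<open>A\<close>
 were tangent to \<open>H\<close>, multiplying \<open>k n\<close> by \<open>exp (- d n A) \<in> H\<close> would bring it closer to the identity.\<close>

lemma tangent_direction:
 fixes G H :: "(complex^'n^'n) set" assumes G: "alg_group G" and H: "alg_group H" "H \<subseteq> G"
  and g: "!!n. g n : G" "!!n. g n \<notin> H" "g \<longlonglongrightarrow> mat 1"
 shows "EX r k d A. filterlim r sequentially sequentially & (ALL n. EX h:H. k n = g (r n) ** h) & k \<longlonglongrightarrow> mat 1 &
  (ALL n::nat. d n > (0::real)) & (%n. inverse (d n) *\<^sub>R (k n - mat 1)) \<longlonglongrightarrow> A &
  A : lie_algebra G & A \<notin> lie_algebra H"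
proof -
 obtain q where q: "q > 0" "cball (mat 1) q \<subseteq> {A :: complex^'n^'n. invertible A}"
  using open_invertible invertible_mat1 by (auto simp: open_contains_cball)
 \<comment> \<open>The shift puts the representatives themselves into the ball, so that the sets
   \<open>S n\<close> below are nonempty.\<close>
 obtain N where N: "!!n. n \<ge> N ==> dist (g n) (mat 1) < q" using metric_LIMSEQ_D[OF g(3) q(1)] by metis
 \<comment> \<open>The part of the coset of \<open>g (n + N)\<close> in a ball of invertible
   matrices, written with equations so that it is closed in the Euclidean topology.\<close>
 define S where "S n = {B : cball (mat 1) q. ALL p:vanishing H. p (matrix_inv (g (n + N)) ** B) = 0}" for n
 have S_iff: "B : S n \<longleftrightarrow> B : cball (mat 1) q & matrix_inv (g (n + N)) ** B : H" for B n
 using q(2) alg_group_invertible[OF G g(1)] by (auto simp: S_def vanishing_def intro!: alg_groupI_vanishing[OF H(1)] invertible_mult invertible_matrix_inv)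
 have closed: "closed (S n)" for n
 proof -
  have "closed (cball (mat 1) q \<inter> (\<Inter>p\<in>vanishing H. {B. p (matrix_inv (g (n + N)) ** B) = 0}))"
  by (auto simp: vanishing_def intro!: continuous_on_compose2[OF polys_continuous_on continuous_on_matrix_mult] closed_Collect_eq continuous_on_const closed_Int closed_cball closed_INT ballI)
  also have "cball (mat 1) q \<inter> (\<Inter>p\<in>vanishing H. {B. p (matrix_inv (g (n + N)) ** B) = 0}) = S n"
   by (auto simp: S_def) finally show ?thesis .
 qed
 have gS: "g (n + N) : S n" for n using N[of "n + N"] alg_group_one[OF H(1)]
  by (simp add: S_iff matrix_inv_left[OF alg_group_invertible[OF G g(1)]] dist_commute)
 have "ALL n. EX x. x : S n & (ALL y:S n. dist (mat 1) x \<le> dist (mat 1) y)"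
 proof
  fix n
  obtain x where "x : S n" "!!y. y : S n ==> dist (mat 1) x \<le> dist (mat 1) y"
   by (rule distance_attains_inf[OF closed]) (use gS in auto)
  then show "EX x. x : S n & (ALL y:S n. dist (mat 1) x \<le> dist (mat 1) y)" by (intro exI conjI ballI)
 qed
 then obtain k where "ALL n. k n : S n & (ALL y:S n. dist (mat 1) (k n) \<le> dist (mat 1) y)"
  by (rule choice[THEN exE])
 then have k: "k n : S n" "y : S n ==> dist (mat 1) (k n) \<le> dist (mat 1) y" for n y by simp_all
 have kg: "k n = g (n + N) ** (matrix_inv (g (n + N)) ** k n)" for n
  by (simp add: matrix_mul_assoc matrix_inv_right[OF alg_group_invertible[OF G g(1)]])
 have kH: "EX h:H. k n = g (n + N) ** h" for n using kg k(1) S_iff by blast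
 have kG: "k n : G" for n using kH[of n] alg_group_mult[OF G g(1)] H(2) by auto
 have kn: "k n \<noteq> mat 1" for n
 proof
  assume "k n = mat 1"
  then have "matrix_inv (g (n + N)) : H" using k(1)[of n] by (simp add: S_iff)
  then show False by (metis g(2) matrix_inv_inv[OF alg_group_invertible[OF G g(1)]] alg_group_inv[OF H(1)])
 qed
 define d where "d n = norm (k n - mat 1)" for n
 have d: "d n > 0" for n using kn by (simp add: d_def)
 have "(%n. dist (g (n + N)) (mat 1)) \<longlonglongrightarrow> 0"
  by (rule tendsto_dist_iff[THEN iffD1, OF LIMSEQ_ignore_initial_segment[OF g(3)]])
 moreover have "ALL n. norm (d n) \<le> dist (g (n + N)) (mat 1)"
  using k(2)[OF gS] by (simp add: d_def dist_norm norm_minus_commute)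
 ultimately have d0: "d \<longlonglongrightarrow> 0" by (rule Lim_null_comparison[OF always_eventually, rotated])
 let ?A = "%n. inverse (d n) *\<^sub>R (k n - mat 1)"
 have "ALL n. ?A n : sphere 0 1" using kn by (simp add: d_def)
 then obtain A r where A: "A : sphere 0 1" "strict_mono r" "(?A \<circ> r) \<longlonglongrightarrow> A"
  by (rule seq_compactE[OF compact_imp_seq_compact[OF compact_sphere]])
 have lim: "(%n. inverse (d (r n)) *\<^sub>R (k (r n) - mat 1)) \<longlonglongrightarrow> A" using A(3) by (simp add: o_def)
 have dr: "(%n. d (r n)) \<longlonglongrightarrow> 0" using LIMSEQ_subseq_LIMSEQ[OF d0 A(2)] by (simp add: o_def)
 then have kr: "(%n. k (r n)) \<longlonglongrightarrow> mat 1"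
  by (auto simp: d_def intro!: LIM_zero_cancel[OF tendsto_norm_zero_cancel])
 have AG: "A : lie_algebra G" by (rule tangent_limit[OF alg_group_one[OF G] kG kr lim])
 have AH: "A \<notin> lie_algebra H"
 proof
  assume "A : lie_algebra H"
  then have mH: "mexp A t : H" for t by (rule mexp_in_group[OF H(1)])
  let ?h = "%n. - complex_of_real (d (r n))"
  have dn: "d n \<noteq> 0" for n using d[of n] by simp
  have "filterlim ?h (at 0) sequentially"
   unfolding filterlim_at using tendsto_minus[OF tendsto_of_real[OF dr, where 'a = complex]] dn by simp
  from mderiv_tendsto[OF mderiv_mexp[of A 0] this]
  have "(%n. cscale (1 / ?h n) (mexp A (?h n) - mat 1)) \<longlonglongrightarrow> A" by simp
  moreover have "cscale (1 / ?h n) B = - (inverse (d (r n)) *\<^sub>R B)" for n and B :: "complex^'n^'n"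
  proof -
   have "1 / ?h n = complex_of_real (- inverse (d (r n)))" by (simp add: divide_inverse)
   then show ?thesis by (simp only: cscale_of_real scaleR_minus_left)
  qed
  ultimately have "(%n. - (inverse (d (r n)) *\<^sub>R (mexp A (?h n) - mat 1))) \<longlonglongrightarrow> A" by simp
  from tendsto_minus[OF this]
  have "(%n. inverse (d (r n)) *\<^sub>R (k (r n) - mat 1) + k (r n) ** (inverse (d (r n)) *\<^sub>R (mexp A (?h n) - mat 1)))
    \<longlonglongrightarrow> A + mat 1 ** (- A)" by (fastforce intro: tendsto_add lim tendsto_matrix_mult kr)
  moreover have "inverse (d (r n)) *\<^sub>R (k (r n) - mat 1) + k (r n) ** (inverse (d (r n)) *\<^sub>R (mexp A (?h n) - mat 1))
    = inverse (d (r n)) *\<^sub>R (k (r n) ** mexp A (?h n) - mat 1)" for n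
   by (simp add: matrix_scaleR_right matrix_diff_ldistrib algebra_simps)
  ultimately have "(%n. inverse (d (r n)) *\<^sub>R (k (r n) ** mexp A (?h n) - mat 1)) \<longlonglongrightarrow> 0" by simp
  then have "\<forall>\<^sub>F n in sequentially. norm (inverse (d (r n)) *\<^sub>R (k (r n) ** mexp A (?h n) - mat 1)) < 1"
   by (fastforce intro: tendsto_norm_zero order_tendstoD)
  then obtain n where n: "norm (inverse (d (r n)) *\<^sub>R (k (r n) ** mexp A (?h n) - mat 1)) < 1"
   unfolding eventually_sequentially by blast
  let ?y = "k (r n) ** mexp A (?h n)"
  have less: "norm (?y - mat 1) < d (r n)" 
  proof -
   have "inverse (d (r n)) * norm (?y - mat 1) < 1" using n d[of "r n"] by (simp only: norm_scaleR abs_inverse abs_of_pos)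
   then show ?thesis using d[of "r n"] by (simp add: field_simps)
  qed
  have "dist (mat 1) (k (r n)) \<le> q" using k(1) by (simp add: S_def)
  then have "?y : S (r n)" unfolding S_iff
   using less k(1)[of "r n"] alg_group_mult[OF H(1) _ mH, of "matrix_inv (g (r n + N)) ** k (r n)"]
   by (simp add: S_iff matrix_mul_assoc d_def dist_norm norm_minus_commute)
  from k(2)[OF this] less show False by (simp add: d_def dist_norm norm_minus_commute)
 qed
 have r: "filterlim (%n. r n + N) sequentially sequentially"
  using filterlim_compose[OF filterlim_add_const_nat_at_top filterlim_subseq[OF A(2)]] .
 show ?thesis
 proof (intro exI conjI allI)
  show "EX h:H. k (r n) = g (r n + N) ** h" for n by (rule kH)
 qed (use r kr d lim AG AH in auto)
qed

subsection \<open>Groups with the same Lie algebra\<close>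

text \<open>Otherwise elements of \<open>G - H\<close> tend to the identity, and
  \<open>tangent_direction\<close> yields an element of the Lie algebra of \<open>G\<close> outside
  that of \<open>H\<close>.\<close>

lemma same_lie_algebra_local:
 fixes G H :: "(complex^'n^'n) set"
 assumes G: "alg_group G" and H: "alg_group H" "H \<subseteq> G" "lie_algebra G \<subseteq> lie_algebra H"
 shows "EX e>0. G \<inter> ball (mat 1) e \<subseteq> H"
proof (rule ccontr)
 assume none: "\<not> ?thesis"
 have "EX g. g : G & g \<notin> H & dist g (mat 1) < inverse (real (Suc n))" for n
 proof -
  have "\<not> G \<inter> ball (mat 1) (inverse (real (Suc n))) \<subseteq> H" using none by (auto simp del: of_nat_Suc)
  then show ?thesis by (auto simp: dist_commute)
 qed
 then obtain g where g: "!!n. g n : G" "!!n. g n \<notin> H" "!!n. dist (g n) (mat 1) < inverse (real (Suc n))" by metis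
 have "(%n. dist (g n) (mat 1)) \<longlonglongrightarrow> 0"
  by (rule Lim_null_comparison[OF always_eventually[OF allI] LIMSEQ_inverse_real_of_nat])
   (use g(3) in \<open>auto intro: less_imp_le\<close>)
 then have "g \<longlonglongrightarrow> mat 1" by (rule tendsto_dist_iff[THEN iffD2])
 from tangent_direction[OF G H(1,2) g(1,2) this] H(3) show False by blast
qed

lemma closedin_coset:
 fixes H :: "(complex^'n^'n) set" assumes H: "alg_group H" and g: "invertible g"
 shows "closedin zariski_GLn ((%h. g ** h) ` H)"
proof -
 have "closedin zariski_GLn {x : topspace zariski_GLn. matrix_inv g \<otimes>\<^bsub>GLn\<^esub> x : H}"
  using H g invertible_matrix_inv
  by (intro closedin_continuous_map_preimage[OF GLn_top.left_cont]) (auto simp: carrier_GLn alg_group_def)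
 also have "{x : topspace zariski_GLn. matrix_inv g \<otimes>\<^bsub>GLn\<^esub> x : H} = (%h. g ** h) ` H"
 proof (intro equalityI subsetI)
  fix x assume "x : {x : topspace zariski_GLn. matrix_inv g \<otimes>\<^bsub>GLn\<^esub> x : H}"
  then have "matrix_inv g ** x : H" by (simp add: mult_GLn)
  moreover have "x = g ** (matrix_inv g ** x)" by (simp add: matrix_mul_assoc matrix_inv_right[OF g])
  ultimately show "x : (%h. g ** h) ` H" by blast
 next
  fix x assume "x : (%h. g ** h) ` H"
  then obtain h where h: "h : H" "x = g ** h" by blast
  then show "x : {x : topspace zariski_GLn. matrix_inv g \<otimes>\<^bsub>GLn\<^esub> x : H}"
   using g alg_group_invertible[OF H] h by (simp add: invertible_mult mult_GLn topspace_GLn carrier_GLn matrix_mul_assoc matrix_inv_left[OF g])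
 qed
 finally show ?thesis .
qed

text \<open>Lindelof's theorem for the translates of a ball, which form an open cover of
  \<open>G\<close>.\<close>

lemma countable_translates:
 fixes G :: "(complex^'n^'n) set" assumes G: "alg_group G" and e: "e > 0"
 shows "EX c :: nat => complex^'n^'n. (ALL n. c n : G) & (ALL B:G. EX n. matrix_inv (c n) ** B : G \<inter> ball (mat 1) e)"
proof -
 define U where "U g = (%B. matrix_inv g ** B) -` ball (mat 1 :: complex^'n^'n) e" for g :: "complex^'n^'n"
 have op: "open W" if "W : U ` G" for W
 using \<open>W : U ` G\<close> open_vimage[OF open_ball continuous_on_matrix_mult] by (auto simp: U_def)
 obtain a where U: "a \<subseteq> U ` G" "countable a" "\<Union>a = \<Union>(U ` G)" by (rule Lindelof[OF op])
 obtain D where D: "D \<subseteq> G" "countable D" "a = U ` D"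
  using exE conjE iffD1[OF countable_subset_image, OF conjI[OF U(2,1)]] by auto
 have "insert (mat 1) D \<noteq> {}" "countable (insert (mat 1) D)" using D(2) by auto
 then obtain c :: "nat => complex^'n^'n" where c: "range c = insert (mat 1) D" by (metis range_from_nat_into)
 show ?thesis
 proof (rule exI[of _ c], intro conjI allI ballI)
  show "c n : G" for n using rangeI[of c n] D(1) alg_group_one[OF G] unfolding c by auto
  fix B assume B: "B : G"
  have "B : U B" using matrix_inv_left[OF alg_group_invertible[OF G B]] e by (simp add: U_def)
  then obtain g where g: "g : D" "B : U g" using U(3) D(3) B by auto
  have "matrix_inv g ** B : G \<inter> ball (mat 1) e"
   using g(1) D(1) g(2) alg_group_mult[OF G alg_group_inv[OF G] B] by (auto simp: U_def)
  moreover obtain n where "c n = g" using c g(1) by (metis insertI2 rangeE)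
  ultimately show "EX n. matrix_inv (c n) ** B : G \<inter> ball (mat 1) e" by auto
 qed
qed

text \<open>Near the identity \<open>G\<close> lies in \<open>H\<close>, so countably many cosets
  cover \<open>G\<close>; cosets are constructible, so finitely many already do.\<close>

theorem same_lie_algebra_finite_index:
 fixes G H :: "(complex^'n^'n) set"
 assumes G: "alg_group G" and H: "alg_group H" "H \<subseteq> G" "lie_algebra G \<subseteq> lie_algebra H"
 shows "EX F. finite F & F \<subseteq> G & G \<subseteq> (\<Union>g\<in>F. (%h. g ** h) ` H)"
proof -
 obtain e where e: "e > 0" "G \<inter> ball (mat 1) e \<subseteq> H" using same_lie_algebra_local[OF assms] by blast
 obtain c :: "nat => complex^'n^'n" where c: "ALL n. c n : G" "ALL B:G. EX n. matrix_inv (c n) ** B : G \<inter> ball (mat 1) e"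
  using countable_translates[OF G e(1)] by (elim exE conjE)
 have cov: "G \<subseteq> (\<Union>n. (%h. c n ** h) ` H)"
 proof
  fix B assume "B : G"
  then obtain n where "matrix_inv (c n) ** B : H" using c(2) e(2) by blast
  moreover have "B = c n ** (matrix_inv (c n) ** B)"
   using c(1) by (simp add: matrix_mul_assoc matrix_inv_right[OF alg_group_invertible[OF G]])
  ultimately show "B : (\<Union>n. (%h. c n ** h) ` H)" by auto
 qed
 have "EX m. G \<subseteq> (\<Union>n\<le>m. (%h. c n ** h) ` H)"
  using G c(1) by (intro constructible_countable_subcover closedin_GLn_constructible cov
    closedin_coset[OF H(1)] alg_group_invertible[OF G]) (simp_all add: alg_group_def)
 then obtain m where "G \<subseteq> (\<Union>n\<le>m. (%h. c n ** h) ` H)" by blast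
 then show ?thesis using c(1) by (intro exI[of _ "c ` {..m}"]) auto
qed

corollary same_lie_algebra_eq:
 fixes G H :: "(complex^'n^'n) set"
 assumes G: "connected_algebraic_group G" and H: "alg_group H" "H \<subseteq> G" "lie_algebra G \<subseteq> lie_algebra H"
 shows "H = G"
proof -
 have G': "alg_group G" by (rule connected_algebraic_group_alg[OF G])
 obtain F where "finite F" "F \<subseteq> G" "G \<subseteq> (\<Union>g\<in>F. (%h. g ** h) ` H)"
  using same_lie_algebra_finite_index[OF G' H] by blast
 then show ?thesis using G by (intro finite_index_open[OF G' H(1,2)]) (auto simp: connected_algebraic_group_def)
qed

subsection \<open>The connected group generated by a Lie algebra\<close>

inductive_set exp_gen :: "(complex^'n^'n) set => (complex^'n^'n) set" for h where
 exp_gen_one: "mat 1 : exp_gen h"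
| exp_gen_step: "A : exp_gen h ==> X : h ==> A ** mexp X t : exp_gen h"

text \<open>The smallest algebraic group containing all \<open>mexp X t\<close> with
  \<open>X\<close> in \<open>h\<close>. Its Lie algebra contains \<open>h\<close> and can be larger
  when \<open>h\<close> is not algebraic.\<close>

definition exp_closure :: "(complex^'n^'n) set => (complex^'n^'n) set" where
 "exp_closure h = zariski_GLn closure_of exp_gen h"

lemma mexp_exp_gen: "X : h ==> mexp X t : exp_gen h"
 using exp_gen_step[OF exp_gen_one] by simp

lemma exp_gen_mult:
 assumes "A : exp_gen h" "B : exp_gen h" shows "A ** B : exp_gen h" using assms(2)
proof induction
 case (exp_gen_step B X t)
 then show ?case by (auto simp: matrix_mul_assoc intro!: exp_gen.exp_gen_step)
qed (use assms(1) in simp)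

lemma exp_gen_invertible: "A : exp_gen h ==> invertible A"
 by (induction rule: exp_gen.induct) (simp_all add: invertible_mat1 invertible_mult invertible_mexp)

lemma exp_gen_inv: "A : exp_gen h ==> matrix_inv A : exp_gen h"
proof (induction rule: exp_gen.induct)
 case exp_gen_one
 then show ?case by (simp add: matrix_inv_mat1 exp_gen.exp_gen_one)
next
 case (exp_gen_step A X t)
 then show ?case
  by (simp add: matrix_inv_mult exp_gen_invertible invertible_mexp matrix_inv_mexp exp_gen_mult mexp_exp_gen)
qed

lemma exp_gen_carrier: "exp_gen h \<subseteq> carrier GLn"
 using exp_gen_invertible by (auto simp: carrier_GLn)

lemma exp_gen_subgroup: "subgroup (exp_gen h) GLn"
 by (intro group.subgroupI[OF group_GLn] exp_gen_carrier)
  (auto simp: mult_GLn inv_GLn exp_gen_invertible exp_gen_mult exp_gen_inv intro: exp_gen_one)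

lemma alg_group_exp_closure: "alg_group (exp_closure h)"
 unfolding alg_group_def exp_closure_def
 by (intro conjI GLn_top.closure_of_subgroup exp_gen_subgroup closedin_closure_of)

lemma connectedin_mexp_line:
 fixes A X :: "complex^'n^'n" assumes "invertible A" shows "connectedin zariski_GLn (range (%t. A ** mexp X t))"
proof -
 have "continuous_map euclidean zariski_GLn (%t. A ** mexp X t)" unfolding continuous_map_closedin
 proof (intro conjI allI impI ballI)
  show "(%t. A ** mexp X t) : topspace euclidean \<rightarrow> topspace zariski_GLn"
   using assms by (simp add: topspace_GLn carrier_GLn invertible_mult invertible_mexp)
  fix C :: "(complex^'n^'n) set" assume "closedin zariski_GLn C"
  then obtain P where P: "P \<subseteq> polys entries" "C = {B : carrier GLn. ALL p:P. p B = 0}"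
   unfolding zariski_GLn_def closedin_zariski by (elim exE conjE)
  have "closed (\<Inter>p\<in>P. {t. p (A ** mexp X t) = 0})"
  using P(1) by (auto intro!: poly_deriv_chain mderiv_mult_left mderiv_mexp DERIV_continuous_on closed_INT ballI closed_Collect_eq continuous_on_const)
  moreover have "{t : topspace euclidean. A ** mexp X t : C} = (\<Inter>p\<in>P. {t. p (A ** mexp X t) = 0})"
   using assms by (auto simp: P(2) carrier_GLn invertible_mult invertible_mexp)
  ultimately show "closedin euclidean {t : topspace euclidean. A ** mexp X t : C}" by simp
 qed
 then show ?thesis using connectedin_continuous_map_image[of euclidean zariski_GLn _ UNIV] connected_UNIV by auto
qed

lemma exp_gen_connected:
 assumes "A : exp_gen h" shows "EX C. connectedin zariski_GLn C & mat 1 : C & A : C & C \<subseteq> exp_gen h"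
 using assms
proof induction
 case exp_gen_one
 show ?case
  using exp_gen.exp_gen_one by (auto simp: topspace_GLn carrier_GLn invertible_mat1 intro!: exI[of _ "{mat 1}"])
next
 case (exp_gen_step A X t)
 then obtain C where C: "connectedin zariski_GLn C" "mat 1 : C" "A : C" "C \<subseteq> exp_gen h" by (elim exE conjE)
 let ?L = "range (%t. A ** mexp X t)"
 have "A : ?L" by (rule image_eqI[of _ _ 0]) simp_all
 then show ?case
  using C exp_gen_invertible[OF exp_gen_step(1)] exp_gen_step by (auto intro!: connectedin_Un connectedin_mexp_line exp_gen.exp_gen_step exI[of _ "C \<union> ?L"])
qed

lemma connected_exp_closure: "connected_algebraic_group (exp_closure h)"
proof -
 let ?a = "{C. connectedin zariski_GLn C & mat 1 : C & C \<subseteq> exp_gen h}"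
 have "exp_gen h = \<Union>?a" using exp_gen_connected by blast
 moreover have "connectedin zariski_GLn (\<Union>?a)" by (rule connectedin_Union) auto
 ultimately have "connectedin zariski_GLn (exp_gen h)" by simp
 then show ?thesis
  using alg_group_exp_closure by (auto simp: exp_closure_def connected_algebraic_group_def alg_group_def intro!: connectedin_closure_of)
qed

lemma exp_closure_minimal:
 assumes "alg_group G" "!!X t. X : h ==> mexp X t : G" shows "exp_closure h \<subseteq> G"
proof -
 have "A : G" if "A : exp_gen h" for A using that
 proof induction
  case (exp_gen_step A X t)
  then show ?case by (intro alg_group_mult[OF assms(1)] assms(2))
 qed (rule alg_group_one[OF assms(1)])
 then show ?thesis using assms(1) unfolding exp_closure_def alg_group_def by (intro closure_of_minimal) auto
qed

lemma mexp_exp_closure: "X : h ==> mexp X t : exp_closure h"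
 using closure_of_subset[of "exp_gen h" zariski_GLn] mexp_exp_gen exp_gen_carrier
 unfolding exp_closure_def by (metis subsetD topspace_GLn)

lemma lie_algebra_exp_closure: "h \<subseteq> lie_algebra (exp_closure h)"
 using mexp_exp_closure by (auto simp: lie_algebra_mexp[OF alg_group_exp_closure])

lemma group_of_exp_closure:
 assumes "alg_group G" "lie_algebra G = h" shows "group_of h (exp_closure h)" "exp_closure h \<subseteq> G"
proof -
 show "exp_closure h \<subseteq> G" using assms mexp_in_group by (intro exp_closure_minimal) auto
 from lie_algebra_mono[OF this] show "group_of h (exp_closure h)"
  using assms(2) lie_algebra_exp_closure connected_exp_closure unfolding group_of_def by blast
qed

text \<open>\<open>exp_closure h\<close> lies in every algebraic group with Lie algebra
  \<open>h\<close>, and a connected such group cannot be larger.\<close>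

lemma group_of_unique:
 assumes "group_of h Q" shows "Q = exp_closure h"
 using assms group_of_exp_closure[of Q h] connected_algebraic_group_alg[of Q] connected_algebraic_group_alg[of "exp_closure h"]
  same_lie_algebra_eq[of Q "exp_closure h"] unfolding group_of_def by auto

subsection \<open>The adjoint action\<close>

lemma Ad_add: "Ad g (X + Y) = Ad g X + Ad g Y"
 and Ad_diff: "Ad g (X - Y) = Ad g X - Ad g Y" and Ad_cscale: "Ad g (cscale c X) = cscale c (Ad g X)"
 and Ad_zero [simp]: "Ad g 0 = 0" for g X Y :: "complex^'n^'n"
 by (simp_all add: Ad_def matrix_add_ldistrib matrix_add_rdistrib matrix_diff_ldistrib matrix_diff_rdistrib
   cscale_mult_left cscale_mult_right)

lemma Ad_mat1 [simp]: "Ad (mat 1) X = X"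
 by (simp add: Ad_def matrix_inv_mat1)

lemma Ad_mult: "invertible g ==> invertible h ==> Ad (g ** h) X = Ad g (Ad h X)"
 by (simp add: Ad_def matrix_inv_mult matrix_mul_assoc)

lemma Ad_inv_left: "invertible g ==> Ad (matrix_inv g) (Ad g X) = X"
 and Ad_inv_right: "invertible g ==> Ad g (Ad (matrix_inv g) X) = X"
 using Ad_mult[of "matrix_inv g" g X] Ad_mult[of g "matrix_inv g" X]
 by (simp_all add: invertible_matrix_inv matrix_inv_left matrix_inv_right)

lemma Ad_prod: "invertible g ==> Ad g (X ** Y) = Ad g X ** Ad g (Y :: complex^'n^'n)"
proof -
 assume g: "invertible g"
 have "Ad g X ** Ad g Y = g ** X ** (matrix_inv g ** g) ** Y ** matrix_inv g" by (simp add: Ad_def matrix_mul_assoc)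
 then show ?thesis by (simp add: matrix_inv_left[OF g] Ad_def matrix_mul_assoc)
qed

lemma Ad_bracket: "invertible g ==> Ad g (bracket X Y) = bracket (Ad g X) (Ad g Y)"
 by (simp add: bracket_def Ad_diff Ad_prod)

lemma trace_Ad: "invertible g ==> trace (Ad g X) = trace X"
 using trace_mul_sym[of "g ** X" "matrix_inv g"] by (simp add: Ad_def matrix_mul_assoc matrix_inv_left)

lemma trace_Ad_prod: "invertible g ==> trace (Ad g X ** Y) = trace (X ** Ad (matrix_inv g) Y)"
 using trace_Ad[of g "X ** Ad (matrix_inv g) Y"] by (simp add: Ad_prod Ad_inv_right)

lemma bracket_add_left: "bracket (X + Y) Z = bracket X Z + bracket Y Z"
 and bracket_add_right: "bracket X (Y + Z) = bracket X Y + bracket X Z"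
 and bracket_diff_left: "bracket (X - Y) Z = bracket X Z - bracket Y Z"
 and bracket_diff_right: "bracket X (Y - Z) = bracket X Y - bracket X Z"
 and bracket_cscale_left: "bracket (cscale c X) Z = cscale c (bracket X Z)"
 and bracket_cscale_right: "bracket X (cscale c Z) = cscale c (bracket X Z)"
 and bracket_zero [simp]: "bracket X 0 = 0" "bracket 0 X = 0" and bracket_self [simp]: "bracket X X = 0"
 and bracket_minus: "bracket X Y = - bracket Y X" for X Y Z :: "complex^'n^'n"
 by (simp_all add: bracket_def matrix_add_ldistrib matrix_add_rdistrib matrix_diff_ldistrib matrix_diff_rdistrib
   cscale_mult_left cscale_mult_right cscale_diff_right)

lemma jacobi: "bracket X (bracket Y Z) = bracket (bracket X Y) Z + bracket Y (bracket X Z)" for X Y Z :: "complex^'n^'n"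
 by (simp add: bracket_def matrix_diff_ldistrib matrix_diff_rdistrib matrix_mul_assoc)

lemma trace_bracket: "trace (bracket X Y ** Z) = trace (X ** bracket Y Z)" for X Y Z :: "complex^'n^'n"
 using trace_mul_sym[of Y "X ** Z"]
 by (simp add: bracket_def matrix_diff_ldistrib matrix_diff_rdistrib trace_sub matrix_mul_assoc)

lemma regs_Ad: "(%g. Ad g X $ i $ j) : regs"
 unfolding Ad_def by (intro regs_mult_entry entry_regs inv_entry_regs polys_const)

lemma regs_trace:
 fixes M :: "'x => complex^'n^'n" assumes "!!i j. (%x. M x $ i $ j) : polys F" shows "(%x. trace (M x)) : polys F"
 unfolding trace_def using assms by (intro polys_sum)

definition stable :: "(complex^'n^'n) set => (complex^'n^'n) set => bool" where
 "stable G V \<longleftrightarrow> cmat.subspace V & (ALL g:G. ALL Y:V. Ad g Y : V)"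

lemma stableD: "stable G V ==> g : G ==> Y : V ==> Ad g Y : V"
 and stable_subspace: "stable G V ==> cmat.subspace V" by (auto simp: stable_def)

lemma stable_bracket: "alg_group G ==> stable G V ==> X : lie_algebra G ==> Y : V ==> bracket X Y : V"
 by (intro bracket_subspace[of V] stable_subspace[of G] stableD[of G V] mexp_in_group[of G])

lemma stable_lie_algebra: "alg_group G ==> stable G (lie_algebra G)"
 by (simp add: stable_def lie_algebra_subspace Ad_lie_algebra)

lemma stable_mono: "H \<subseteq> G ==> stable G V ==> stable H V"
 by (auto simp: stable_def)

lemma alg_group_conditions:
 fixes G :: "(complex^'n^'n) set"
 assumes G: "alg_group G" and P: "P \<subseteq> regs" and H: "H = {g : G. ALL p:P. p g = 0}"
  and one: "mat 1 : H" "!!g h. g : H ==> h : H ==> g ** h : H" "!!g. g : H ==> matrix_inv g : H" shows "alg_group H"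
proof (rule alg_groupI)
 have "H = G \<inter> {A. invertible A & (ALL p:P. p A = 0)}" using alg_group_invertible[OF G] by (auto simp: H)
 then show "closedin zariski_GLn H"
  using closedin_Int[of zariski_GLn G] closedin_GLn_regs[OF P] G by (simp add: alg_group_def)
qed (use one in auto)

lemma mderiv_trace: "mderiv F F' t ==> ((%t. trace (F t)) has_field_derivative trace F') (at t)"
 unfolding trace_def mderiv_def by (intro DERIV_sum) blast

lemma mderiv_unique: "mderiv F A t ==> mderiv F B t ==> A = B"
 unfolding mderiv_def vec_eq_iff using DERIV_unique by blast

lemma commute_mexp_iff: "(ALL t. A ** mexp X t = mexp X t ** A) \<longleftrightarrow> A ** X = X ** A"
proof
 assume *: "ALL t. A ** mexp X t = mexp X t ** A"
 have "mderiv (%t. A ** mexp X t) (A ** (X ** mexp X 0)) 0" by (intro mderiv_mult_left mderiv_mexp)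
 moreover have "mderiv (%t. A ** mexp X t) (X ** mexp X 0 ** A) 0"
  unfolding *[rule_format] by (intro mderiv_mult_right mderiv_mexp)
 ultimately show "A ** X = X ** A" using mderiv_unique by fastforce
next
 assume "A ** X = X ** A"
 then show "ALL t. A ** mexp X t = mexp X t ** A" using mexp_commute[of X A] by simp
qed

subsection \<open>Linear forms as traces\<close>

definition res :: "(complex^'n^'n) set => complex^'n^'n => complex^'n^'n => complex" where
 "res V M = zero_ext V (%Y. trace (M ** Y))"

lemma res_apply: "Y : V ==> res V M Y = trace (M ** Y)"
 by (simp add: res_def zero_ext_def)

lemma res_eq_iff: "res V M = res V N \<longleftrightarrow> (ALL Y:V. trace (M ** Y) = trace (N ** Y))"
 by (auto simp: res_def zero_ext_def fun_eq_iff)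

lemma res_dual: "cmat.subspace V ==> res V M : dual V"
 by (auto simp: dual_def res_def zero_ext_def clinear_on_def cmat.subspace_add cmat.subspace_scale
   trace_right_add trace_right_scale)

lemma dual_res:
 assumes "cmat.subspace V" "b : dual V" shows "EX M. b = res V M"
proof -
 obtain M where M: "ALL Y:V. b Y = trace (M ** Y)"
  using functional_extend[OF assms(1)] assms(2) unfolding dual_def by blast
 have "zero_ext V b = b" using assms(2) by (simp add: dual_def)
 moreover have "zero_ext V b = res V M" using M by (auto simp: zero_ext_def res_def fun_eq_iff)
 ultimately show ?thesis by (intro exI[of _ M]) simp
qed

lemma dual_act_res:
 assumes "alg_group G" "stable G V" "g : G" shows "dual_act V g (res V M) = res V (Ad g M)"
proof
 fix Y
 have "Ad (matrix_inv g) Y : V" if "Y : V" using stableD[OF assms(2) alg_group_inv[OF assms(1,3)] that] .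
 then show "dual_act V g (res V M) Y = res V (Ad g M) Y"
  by (simp add: dual_act_def zero_ext_def res_def trace_Ad_prod[OF alg_group_invertible[OF assms(1,3)]])
qed

lemma res_Ad_cong:
 assumes "alg_group G" "stable G V" "g : G" "res V M = res V N" shows "res V (Ad g M) = res V (Ad g N)"
 using dual_act_res[OF assms(1-3)] assms(4) by metis

subsection \<open>Stabilisers\<close>

lemma group_stab_res:
 assumes "alg_group G" "stable G V"
 shows "group_stab G V (res V M) = {g : G. ALL Y:V. trace (Ad g M ** Y) = trace (M ** Y)}"
 using dual_act_res[OF assms] by (auto simp: group_stab_def res_eq_iff)

lemma alg_group_stab:
 assumes G: "alg_group G" and V: "stable G V" and c: "c : dual V" shows "alg_group (group_stab G V c)"
proof -
 obtain M where M: "c = res V M" using dual_res[OF stable_subspace[OF V] c] by blast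
 let ?P = "(%Y g. trace (Ad g M ** Y) + (- trace (M ** Y))) ` V"
 let ?H = "group_stab G V c"
 have inv: "g : G ==> invertible g" for g by (rule alg_group_invertible[OF G])
 have H: "g : ?H \<longleftrightarrow> g : G & res V (Ad g M) = res V M" for g
  using dual_act_res[OF G V] by (auto simp: group_stab_def M)
 show ?thesis
 proof (rule alg_group_conditions[OF G, of ?P])
  show "?P \<subseteq> regs" by (intro image_subsetI polys_add polys_const regs_trace regs_mult_entry regs_Ad)
  show "?H = {g : G. ALL p:?P. p g = 0}" unfolding M group_stab_res[OF G V] by simp
  show "mat 1 : ?H" unfolding H using alg_group_one[OF G] by simp
  show "g ** h : ?H" if "g : ?H" "h : ?H" for g h
   using that alg_group_mult[OF G] res_Ad_cong[OF G V, of g "Ad h M" M] unfolding H by (simp add: Ad_mult inv)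
  show "matrix_inv g : ?H" if "g : ?H" for g
   using that alg_group_inv[OF G] res_Ad_cong[OF G V, of "matrix_inv g" "Ad g M" M] unfolding H by (simp add: Ad_inv_left inv)
 qed
qed

text \<open>One inclusion differentiates the invariance at 0. For the other, the pairing of
  \<open>M\<close> with \<open>Ad (mexp X t) Y\<close> has derivative 0 everywhere, since
  \<open>Ad (mexp X t) Y\<close> stays in \<open>V\<close>.\<close>

lemma lie_algebra_stab:
 assumes G: "alg_group G" and V: "stable G V" and g: "g : dual V"
 shows "lie_algebra (group_stab G V g) = lie_stab (lie_algebra G) V g"
proof -
 obtain M where M: "g = res V M" using dual_res[OF stable_subspace[OF V] g] by blast
 have H: "alg_group (group_stab G V g)" by (rule alg_group_stab[OF assms])
 have ls: "X : lie_stab (lie_algebra G) V g \<longleftrightarrow> X : lie_algebra G & (ALL Y:V. trace (M ** bracket X Y) = 0)" for X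
  using stable_bracket[OF G V] by (auto simp: lie_stab_def M res_apply)
 show ?thesis
 proof (intro equalityI subsetI)
  fix X assume X: "X : lie_algebra (group_stab G V g)"
  have "trace (M ** bracket X Y) = 0" if Y: "Y : V" for Y
  proof -
   have "trace (Ad (mexp X t) M ** Y) = trace (M ** Y)" for t
    using mexp_in_group[OF H X] Y unfolding M group_stab_res[OF G V] by blast
   moreover have "((%t. trace (Ad (mexp X t) M ** Y)) has_field_derivative trace (bracket X (Ad (mexp X 0) M) ** Y)) (at 0)"
    by (intro mderiv_trace mderiv_mult_right mderiv_Ad_mexp) ultimately show ?thesis
    using DERIV_unique[OF _ DERIV_const] trace_bracket[of M X Y] bracket_minus[of M X] trace_left_diff[of 0 "bracket X M" Y] by (auto simp: Ad_mexp_0)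
  qed
  moreover have "X : lie_algebra G" using X lie_algebra_mono[of "group_stab G V g" G] by (auto simp: group_stab_def)
  ultimately show "X : lie_stab (lie_algebra G) V g" unfolding ls by blast
 next
  fix X assume X: "X : lie_stab (lie_algebra G) V g"
  have "mexp X t : group_stab G V g" for t
  proof -
   have mG: "mexp X t : G" for t using X mexp_in_group[OF G] unfolding ls by blast
   have "trace (Ad (mexp X t) M ** Y) = trace (M ** Y)" if Y: "Y : V" for Y
   proof -
    have "((%t. trace (M ** Ad (mexp X t) Y)) has_field_derivative trace (M ** bracket X (Ad (mexp X s) Y))) (at s)" for s
     by (intro mderiv_trace mderiv_mult_left mderiv_Ad_mexp)
    moreover have "trace (M ** bracket X (Ad (mexp X s) Y)) = 0" for s
     using X stableD[OF V mG Y] unfolding ls by blast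
    ultimately obtain c where "ALL s. trace (M ** Ad (mexp X s) Y) = c"
     using has_field_derivative_zero_constant[of UNIV "%t. trace (M ** Ad (mexp X t) Y)"] by auto
    then have "trace (M ** Ad (mexp X (- t)) Y) = trace (M ** Ad (mexp X 0) Y)" by (simp only:)
    then show ?thesis by (simp add: trace_Ad_prod invertible_mexp matrix_inv_mexp)
   qed
   then show ?thesis unfolding M group_stab_res[OF G V] using mG by blast
  qed
  then show "X : lie_algebra (group_stab G V g)" unfolding lie_algebra_mexp[OF H] by blast
 qed
qed

lemma alg_group_centraliser:
 assumes G: "alg_group G" shows "alg_group {g : G. ALL A:S. g ** A = A ** (g :: complex^'n^'n)}"
proof (rule alg_group_conditions[OF G, of "\<Union>A\<in>S. range (%(i, j) g. (g ** A) $ i $ j + - 1 * (A ** g) $ i $ j)"])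
 show "(\<Union>A\<in>S. range (%(i, j) g. (g ** A) $ i $ j + - 1 * (A ** g) $ i $ j)) \<subseteq> regs"
  by (intro UN_least image_subsetI) (simp only: case_prod_beta, intro polys_add polys_mult polys_const regs_mult_entry entry_regs)
 show "{g : G. ALL A:S. g ** A = A ** g} = {g : G. ALL p:\<Union>A\<in>S. range (%(i, j) g. (g ** A) $ i $ j + - 1 * (A ** g) $ i $ j). p g = 0}"
  by (auto simp: vec_eq_iff)
 show "mat 1 : {g : G. ALL A:S. g ** A = A ** g}" using alg_group_one[OF G] by simp
 show "g ** h : {g : G. ALL A:S. g ** A = A ** g}"
  if "g : {g : G. ALL A:S. g ** A = A ** g}" "h : {g : G. ALL A:S. g ** A = A ** g}" for g h
 proof -
  have "g ** h ** A = A ** (g ** h)" if "A : S" for A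
  proof -
   have "g ** h ** A = g ** A ** h" using \<open>h : _\<close> that by (simp flip: matrix_mul_assoc)
   then show ?thesis using \<open>g : _\<close> that by (simp add: matrix_mul_assoc)
  qed
  then show ?thesis using that alg_group_mult[OF G] by simp
 qed
 show "matrix_inv g : {g : G. ALL A:S. g ** A = A ** g}" if g: "g : {g : G. ALL A:S. g ** A = A ** g}" for g
 proof -
  have inv: "invertible g" using g alg_group_invertible[OF G] by blast
  have "matrix_inv g ** A = A ** matrix_inv g" if "A : S" for A
  proof -
   have "matrix_inv g ** A = matrix_inv g ** (A ** g) ** matrix_inv g"
    by (simp add: matrix_mul_assoc[symmetric] matrix_inv_right[OF inv])
   also have "A ** g = g ** A" using g that by simp
   finally show ?thesis by (simp add: matrix_mul_assoc matrix_inv_left[OF inv])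
  qed
  then show ?thesis using g alg_group_inv[OF G] by simp
 qed
qed

text \<open>For \<open>X\<close> in the centre of the Lie algebra, the centraliser of
  \<open>mexp X t\<close> in \<open>Q\<close> has the full Lie algebra and hence equals
  \<open>Q\<close>. This is where connectedness enters.\<close>

lemma lie_algebra_group_centre:
 fixes Q :: "(complex^'n^'n) set" assumes Q: "connected_algebraic_group Q"
 shows "lie_algebra (group_centre Q) = lie_centre (lie_algebra Q)"
proof -
 have G: "alg_group Q" by (rule connected_algebraic_group_alg[OF Q])
 have Z: "alg_group (group_centre Q)" unfolding group_centre_def by (rule alg_group_centraliser[OF G])
 have br: "bracket X Y = 0 \<longleftrightarrow> X ** Y = Y ** X" for X Y :: "complex^'n^'n" by (simp add: bracket_def)
 show ?thesis
 proof (intro equalityI subsetI)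
  fix X assume X: "X : lie_algebra (group_centre Q)"
  have "X ** Y = Y ** X" if Y: "Y : lie_algebra Q" for Y
  proof -
   have "mexp X t ** mexp Y s = mexp Y s ** mexp X t" for t s
    using mexp_in_group[OF Z X] mexp_in_group[OF G Y] unfolding group_centre_def by blast
   then have "mexp X t ** Y = Y ** mexp X t" for t using commute_mexp_iff by blast
   then show ?thesis using commute_mexp_iff[of Y X] by simp
  qed
  moreover have "X : lie_algebra Q" using X lie_algebra_mono[of "group_centre Q" Q] by (auto simp: group_centre_def)
  ultimately show "X : lie_centre (lie_algebra Q)" by (simp add: lie_centre_def br)
 next
  fix X assume X: "X : lie_centre (lie_algebra Q)"
  have "mexp X t : group_centre Q" for t
  proof -
   let ?C = "{g : Q. ALL A:{mexp X t}. g ** A = A ** g}"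
   have C: "alg_group ?C" by (rule alg_group_centraliser[OF G])
   have "Y : lie_algebra ?C" if Y: "Y : lie_algebra Q" for Y
   proof -
    have "X ** Y = Y ** X" using X Y by (simp add: lie_centre_def br)
    then have "ALL s. mexp X t ** mexp Y s = mexp Y s ** mexp X t"
     by (auto simp: commute_mexp_iff intro!: mexp_commute)
    then show ?thesis using mexp_in_group[OF G Y] unfolding lie_algebra_mexp[OF C] by simp
   qed
   then have eq: "?C = Q" using C by (intro same_lie_algebra_eq[OF Q]) auto
   have "g ** mexp X t = mexp X t ** g" if "g : Q" for g using eq by (auto intro!: that)
   then show ?thesis using mexp_in_group[OF G, of X t] X by (auto simp: group_centre_def lie_centre_def)
  qed
  then show "X : lie_algebra (group_centre Q)" by (simp add: lie_algebra_mexp[OF Z])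
 qed
qed

subsection \<open>Open orbits on dual spaces\<close>

lemma polys_line:
 assumes "p : polys entries" shows "EX P. ALL s. p (M + cscale s B) = poly P s" using assms
proof induction
 case (polys_const c)
 then show ?case by (intro exI[of _ "[:c:]"]) simp
next
 case (polys_coord f)
 then obtain i j where "f = (%A. A $ i $ j)" by (rule entriesE)
 then show ?case by (intro exI[of _ "[:M $ i $ j, B $ i $ j:]"]) (simp add: cscale_nth)
next
 case (polys_add p q)
 from polys_add.IH obtain P P' where "ALL s. p (M + cscale s B) = poly P s" "ALL s. q (M + cscale s B) = poly P' s"
  by (elim exE)
 then show ?case by (intro exI[of _ "P + P'"]) simp
next
 case (polys_mult p q)
 from polys_mult.IH obtain P P' where "ALL s. p (M + cscale s B) = poly P s" "ALL s. q (M + cscale s B) = poly P' s"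
  by (elim exE)
 then show ?case by (intro exI[of _ "P * P'"]) simp
qed

text \<open>Irreducibility of the matrix space: on the line joining a point of each set, the two
  defining polynomials restrict to nonzero polynomials in one variable, and so does their
  product.\<close>

lemma openin_matrices_Int:
 fixes U W :: "(complex^'n^'n) set"
 assumes "openin (zariski UNIV entries) U" "U \<noteq> {}" "openin (zariski UNIV entries) W" "W \<noteq> {}"
 shows "U \<inter> W \<noteq> {}"
proof -
 obtain P P' where P: "P \<subseteq> polys entries" "U = {x : UNIV. EX p:P. p x \<noteq> 0}"
  "P' \<subseteq> polys entries" "W = {x : UNIV. EX p:P'. p x \<noteq> 0}"
  using assms(1,3) unfolding openin_zariski by (elim exE conjE)
 obtain M p where p: "p : P" "p M \<noteq> 0" using assms(2) unfolding P(2) by blast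
 obtain N q where q: "q : P'" "q N \<noteq> 0" using assms(4) unfolding P(4) by blast
 obtain R where R: "ALL s. p (M + cscale s (N - M)) = poly R s" using polys_line p(1) P(1) by blast
 obtain S where S: "ALL s. q (M + cscale s (N - M)) = poly S s" using polys_line q(1) P(3) by blast
 have "R * S \<noteq> 0" using p q R[rule_format, of 0] S[rule_format, of 1] by auto
 then obtain s where "poly (R * S) s \<noteq> 0"
  using ex_new_if_finite[OF infinite_UNIV_char_0] by (blast intro: poly_roots_finite)
 then have "p (M + cscale s (N - M)) \<noteq> 0" "q (M + cscale s (N - M)) \<noteq> 0" using R S by auto
 then show ?thesis using p(1) q(1) unfolding P(2,4) by blast
qed

text \<open>With \<open>B\<close> dual to a basis \<open>S\<close> of \<open>V\<close>, the section
  is the sum of the \<open>cscale (g Y) (B Y)\<close>. Being polynomial, it transfers topological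
  questions on the dual space to matrices.\<close>

lemma dual_section:
 fixes V :: "(complex^'n^'n) set" assumes V: "cmat.subspace V"
 shows "EX s. (ALL g:dual V. res V (s g) = g) & (ALL i j. (%g. s g $ i $ j) : polys ((%X g. g X) ` V))"
proof -
 obtain S where S: "S \<subseteq> V" "cmat.independent S" "V \<subseteq> cmat.span S"
  using cmat.maximal_independent_subset[of V] by metis
 have fin: "finite S" using cmat_dim_bounded[OF S(2)] by blast
 have "ALL Y. EX B. ALL Y':S. trace (B ** Y') = (if Y' = Y then 1 else 0)"
 proof
  fix Y
  obtain y where y: "Vector_Spaces.linear cscale (*) y" "ALL x:S. y x = (if x = Y then 1 else 0)"
   using cmat_functional.linear_independent_extend[OF S(2), of "%x. if x = Y then 1 else 0"] by blast
  obtain B where "ALL x. y x = trace (B ** x)" using linear_functional_trace[OF y(1)] by blast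
  then show "EX B. ALL Y':S. trace (B ** Y') = (if Y' = Y then 1 else 0)" using y(2) by (intro exI[of _ B]) simp
 qed
 then obtain B where B: "ALL Y. ALL Y':S. trace (B Y ** Y') = (if Y' = Y then 1 else 0)" by (rule choice[THEN exE])
 define s where "s g = (\<Sum>Y\<in>S. cscale (g Y) (B Y))" for g :: "complex^'n^'n => complex"
 have "res V (s g) = g" if g: "g : dual V" for g
 proof -
  obtain N where N: "g = res V N" using dual_res[OF V g] by blast
  have eq: "trace ((s g - N) ** Y') = 0" if Y': "Y' : S" for Y'
  proof -
   have "trace (s g ** Y') = (\<Sum>Y\<in>S. if Y' = Y then g Y else 0)"
    unfolding s_def matrix_sum_left trace_sum using B Y' by (intro sum.cong) (auto simp: trace_left_scale)
   also have "\<dots> = g Y'" using fin Y' by simp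
   also have "g Y' = trace (N ** Y')" using Y' S(1) by (auto simp: N res_apply)
   finally show ?thesis by (simp add: trace_left_diff)
  qed
  have "cmat.subspace {Y. trace ((s g - N) ** Y) = 0}"
   by (intro cmat.subspaceI) (simp_all add: trace_right_add trace_right_scale)
  then have "cmat.span S \<subseteq> {Y. trace ((s g - N) ** Y) = 0}" using eq by (intro cmat.span_minimal) auto
  then show ?thesis using S(3) unfolding N res_eq_iff by (auto simp: trace_left_diff)
 qed
 moreover have "(%g. s g $ i $ j) : polys ((%X g. g X) ` V)" for i j
  unfolding s_def sum_component cscale_nth using S(1) by (intro polys_sum polys_mult polys_const polys_coord) auto
 ultimately show ?thesis by blast
qed

lemma openin_zariski_dual_iff:
 fixes V :: "(complex^'n^'n) set" assumes V: "cmat.subspace V"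
 shows "openin (zariski_dual V) U \<longleftrightarrow> U \<subseteq> dual V & openin (zariski UNIV entries) {M. res V M : U}"
proof (intro iffI conjI)
 assume U: "openin (zariski_dual V) U"
 then show "U \<subseteq> dual V" using openin_subset by (fastforce simp: zariski_dual_def topspace_zariski)
 have "continuous_map (zariski UNIV entries) (zariski_dual V) (res V)" unfolding zariski_dual_def
 by (auto simp: res_apply intro!: res_dual[OF V] regs_trace regs_mult_entry entry_polys polys_const continuous_map_zariski)
 from openin_continuous_map_preimage[OF this U] show "openin (zariski UNIV entries) {M. res V M : U}"
  by (simp add: topspace_zariski)
next
 assume U: "U \<subseteq> dual V & openin (zariski UNIV entries) {M. res V M : U}"
 obtain s where s: "ALL g:dual V. res V (s g) = g" "ALL i j. (%g. s g $ i $ j) : polys ((%X g. g X) ` V)"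
  using dual_section[OF V] by (elim exE conjE)
 have "continuous_map (zariski_dual V) (zariski UNIV entries) s"
  unfolding zariski_dual_def by (rule continuous_map_zariski) (use s(2) in \<open>auto simp: entries_def\<close>)
 from openin_continuous_map_preimage[OF this] U
 have "openin (zariski_dual V) {g : topspace (zariski_dual V). s g : {M. res V M : U}}" by blast
 also have "{g : topspace (zariski_dual V). s g : {M. res V M : U}} = U"
  using U s(1) by (auto simp: zariski_dual_def topspace_zariski)
 finally show "openin (zariski_dual V) U" .
qed

lemma openin_zariski_dual_Int:
 assumes V: "cmat.subspace V" and U: "openin (zariski_dual V) U" "U \<noteq> {}" and W: "openin (zariski_dual V) W" "W \<noteq> {}"
 shows "U \<inter> W \<noteq> {}"
proof -
 have "{M. res V M : X} \<noteq> {}" if X: "openin (zariski_dual V) X" "X \<noteq> {}" for X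
 proof -
  obtain g where "g : X" using X(2) by blast
  moreover have "X \<subseteq> dual V" using X(1) openin_zariski_dual_iff[OF V] by blast
  ultimately obtain M where "g = res V M" using dual_res[OF V] by blast
  then show ?thesis using \<open>g : X\<close> by blast
 qed
 then have "{M. res V M : U} \<inter> {M. res V M : W} \<noteq> {}"
  using U W openin_zariski_dual_iff[OF V] by (intro openin_matrices_Int) auto
 then show ?thesis by blast
qed

text \<open>The preimage of the orbit under \<open>res V\<close>. It is closed under adding matrices
  that annihilate \<open>V\<close>, and lets orbits be studied inside the matrix space.\<close>

definition orbit_matrices :: "(complex^'n^'n) set => (complex^'n^'n) set => complex^'n^'n => (complex^'n^'n) set" where
 "orbit_matrices G V M = {N. EX g:G. res V N = res V (Ad g M)}"

lemma dual_orbit_res: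
 assumes "alg_group G" "stable G V"
 shows "dual_orbit G V (res V M) \<subseteq> dual V" "{N. res V N : dual_orbit G V (res V M)} = orbit_matrices G V M"
 using dual_act_res[OF assms] res_dual[OF stable_subspace[OF assms(2)]]
 by (auto simp: dual_orbit_def orbit_matrices_def)

lemma orbit_matrices_Ad:
 assumes G: "alg_group G" and V: "stable G V" and g: "g : G" and N: "N : orbit_matrices G V M"
 shows "Ad g N : orbit_matrices G V M"
proof -
 obtain h where h: "h : G" "res V N = res V (Ad h M)" using N by (auto simp: orbit_matrices_def)
 then have "res V (Ad g N) = res V (Ad (g ** h) M)"
  using res_Ad_cong[OF G V g h(2)] g h(1) by (simp add: Ad_mult alg_group_invertible[OF G])
 then show ?thesis using alg_group_mult[OF G g h(1)] by (auto simp: orbit_matrices_def)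
qed

lemma orbit_matrices_trans:
 assumes G: "alg_group G" and V: "stable G V" and N: "N : orbit_matrices G V M" "N' : orbit_matrices G V M"
 shows "EX g:G. res V N' = res V (Ad g N)"
proof -
 obtain h where h: "h : G" "res V N = res V (Ad h M)" using N by (auto simp: orbit_matrices_def)
 obtain h' where h': "h' : G" "res V N' = res V (Ad h' M)" using N by (auto simp: orbit_matrices_def)
 let ?g = "h' ** matrix_inv h"
 have g: "?g : G" using alg_group_mult[OF G h'(1) alg_group_inv[OF G h(1)]] .
 show ?thesis
  using h(1) h'(1) g h'(2) res_Ad_cong[OF G V g h(2)] bexI[of _ ?g] by (auto simp: Ad_mult alg_group_invertible[OF G] invertible_matrix_inv Ad_inv_left)
qed

text \<open>The annihilator in \<open>V\<close> of the tangent space to the orbit at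
  \<open>g\<close>; that it is 0 means that the infinitesimal action fills the dual space.\<close>

definition orbit_annihilator :: "(complex^'n^'n) set => (complex^'n^'n) set => (complex^'n^'n => complex) => (complex^'n^'n) set" where
 "orbit_annihilator h V g = {Y : V. ALL X:h. g (bracket X Y) = 0}"

lemma compact_group_ball:
 fixes G :: "(complex^'n^'n) set"
 assumes G: "alg_group G" and r: "cball (mat 1) r \<subseteq> {A :: complex^'n^'n. invertible A}"
 shows "compact (G \<inter> cball (mat 1) r)"
proof -
 have "closed (cball (mat 1) r \<inter> (\<Inter>p\<in>vanishing G. {B :: complex^'n^'n. p B = 0}))"
  by (intro closed_Int closed_cball closed_INT ballI closed_Collect_eq continuous_on_const polys_continuous_on)
   (simp add: vanishing_def)
 also have "cball (mat 1) r \<inter> (\<Inter>p\<in>vanishing G. {B. p B = 0}) = G \<inter> cball (mat 1) r"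
  using alg_groupI_vanishing[OF G] r by (auto simp: vanishing_def)
 finally show ?thesis unfolding compact_eq_bounded_closed using bounded_subset[OF bounded_cball Int_lower2] by blast
qed

lemma tendsto_Ad:
 assumes "(g \<longlongrightarrow> A) F" "invertible A" "!!x. invertible (g x)"
 shows "((%x. Ad (g x) M) \<longlongrightarrow> Ad A M) F"
 unfolding Ad_def by (intro tendsto_matrix_mult tendsto_matrix_inv tendsto_const assms)

lemma tendsto_trace: "(f \<longlongrightarrow> A) F ==> ((%x. trace (f x)) \<longlongrightarrow> trace (A :: complex^'n^'n)) F"
 unfolding trace_def by (intro tendsto_sum tendsto_vec_nth)

text \<open>By Baire's theorem the orbit map is open at the identity.\<close>

lemma orbit_map_open:
 fixes G V :: "(complex^'n^'n) set"
 assumes G: "alg_group G" and V: "stable G V" and open_orbit: "openin (zariski UNIV entries) (orbit_matrices G V M)"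
  and r: "r > 0" "cball (mat 1) r \<subseteq> {A :: complex^'n^'n. invertible A}"
 shows "EX a:G \<inter> cball (mat 1) r. EX b:G \<inter> cball (mat 1) r. EX s. s \<noteq> 0 &
  res V (M + cscale s B) = res V (Ad (matrix_inv a ** b) M)"
proof -
 let ?N = "G \<inter> cball (mat 1) r" and ?O = "orbit_matrices G V M"
 have inv: "g : G ==> invertible g" for g by (rule alg_group_invertible[OF G])
 obtain c :: "nat => complex^'n^'n" where c: "ALL n. c n : G" "ALL B:G. EX n. matrix_inv (c n) ** B : G \<inter> ball (mat 1) r"
  using countable_translates[OF G r(1)] by (elim exE conjE)
 define N where "N = ?N"
 have NG: "a : G" if "a : N" for a using that by (simp add: N_def)
 \<comment> \<open>A countable cover of the orbit by images of translates of a compact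
   neighbourhood; compactness makes these sets closed, as Baire's theorem requires.\<close>
 define F where "F n = {K. EX a. a : N & res V K = res V (Ad (c n ** a) M)}" for n
 have closed: "closed (F n)" for n unfolding closed_sequential_limits
 proof (intro allI impI, elim conjE)
  fix K l assume K: "ALL j. K j : F n" "K \<longlonglongrightarrow> l"
  then have "ALL j. EX a. a : N & res V (K j) = res V (Ad (c n ** a) M)" unfolding F_def by simp
  then obtain a where a: "ALL j. a j : N & res V (K j) = res V (Ad (c n ** a j) M)" by (rule choice[THEN exE])
  then have aN: "ALL j. a j : N" by simp
  then obtain l' q where l': "l' : N" "strict_mono q" "(a \<circ> q) \<longlonglongrightarrow> l'"
   by (rule seq_compactE[OF compact_imp_seq_compact[OF compact_group_ball[OF G r(2), folded N_def]]])
  have lim: "(%j. Ad (c n ** a (q j)) M) \<longlonglongrightarrow> Ad (c n ** l') M"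
   using l'(3) NG[OF l'(1)] NG[OF spec[OF aN]] c(1)
   by (intro tendsto_Ad tendsto_matrix_mult tendsto_const invertible_mult inv) (simp_all add: o_def)
  have "trace (l ** Y) = trace (Ad (c n ** l') M ** Y)" if Y: "Y : V" for Y
  proof (rule LIMSEQ_unique)
   show "(%j. trace (K (q j) ** Y)) \<longlonglongrightarrow> trace (l ** Y)"
    using LIMSEQ_subseq_LIMSEQ[OF K(2) l'(2)] by (intro tendsto_trace tendsto_matrix_mult tendsto_const) (simp add: o_def)
   have "trace (K (q j) ** Y) = trace (Ad (c n ** a (q j)) M ** Y)" for j using a Y by (simp add: res_eq_iff)
   then show "(%j. trace (K (q j) ** Y)) \<longlonglongrightarrow> trace (Ad (c n ** l') M ** Y)"
    using tendsto_trace[OF tendsto_matrix_mult[OF lim tendsto_const[of Y]]] by simp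
  qed
  then show "l : F n" using l'(1) unfolding F_def res_eq_iff by (intro CollectI exI conjI) auto
 qed
 have F_orbit: "F n \<subseteq> ?O" for n
 using alg_group_mult[OF G spec[OF c(1)] NG] CollectE exE conjE by (auto simp: F_def orbit_matrices_def)
 have orbit_F: "?O \<subseteq> (\<Union>n. F n)"
 proof
  fix K assume "K : ?O"
  then obtain g where g: "g : G" "res V K = res V (Ad g M)" by (auto simp: orbit_matrices_def)
  then obtain n where n: "matrix_inv (c n) ** g : G \<inter> ball (mat 1) r" using c(2) by blast
  have "K : F n" using c(1) n g(2) by (auto simp: matrix_mul_assoc matrix_inv_right[OF inv] F_def N_def)
  then show "K : (\<Union>n. F n)" by (rule UN_I[OF UNIV_I])
 qed
 have "EX n. interior (F n) \<noteq> {}"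
 proof (rule ccontr)
  assume none: "\<nexists>n. interior (F n) \<noteq> {}"
  have "UNIV \<subseteq> closure (\<Inter>(range (%n. - F n)))"
   by (rule Baire) (use none closed in \<open>auto simp: closure_complement open_Compl\<close>)
  moreover have "\<Inter>(range (%n. - F n)) \<subseteq> - ?O" using orbit_F by blast
  ultimately have "closure (- ?O) = UNIV" using closure_mono by blast
  then have "interior ?O = {}" by (auto simp: closure_complement)
  moreover have "open ?O"
  proof -
   obtain P where P: "P \<subseteq> polys entries" "?O = {x : UNIV. EX p:P. p x \<noteq> 0}"
    using open_orbit unfolding openin_zariski by (elim exE conjE)
   have "?O = (\<Union>p\<in>P. p -` (- {0}))" unfolding P(2) by auto
   moreover have "open (\<Union>p\<in>P. p -` (- {0}))"
    using P(1) by (intro open_UN ballI open_vimage polys_continuous_on) auto ultimately show ?thesis by simp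
  qed
  ultimately show False using interior_open alg_group_one[OF G] by (auto simp: orbit_matrices_def)
 qed
 then obtain n K where "K : interior (F n)" by blast
 then obtain e where e: "e > 0" "ball K e \<subseteq> F n" unfolding mem_interior by blast
 have "K : F n" using e by (meson centre_in_ball subsetD)
 then obtain a where a: "a : N" "res V K = res V (Ad (c n ** a) M)" unfolding F_def by (elim CollectE exE conjE)
 have aG: "c n ** a : G" using alg_group_mult[OF G] c(1) NG[OF a(1)] by blast
 \<comment> \<open>Transport from \<open>K\<close> back to \<open>M\<close> by the inverse of
   \<open>c n ** a\<close> turns the direction \<open>D\<close> into \<open>B\<close>.\<close>
 define D where "D = Ad (c n ** a) B"
 have "\<forall>\<^sub>F j in sequentially. K + inverse (real (Suc j)) *\<^sub>R D : ball K e"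
  using e(1) by (fastforce intro: tendsto_add tendsto_scaleR tendsto_const LIMSEQ_inverse_real_of_nat topological_tendstoD)
 then obtain j where j: "K + inverse (real (Suc j)) *\<^sub>R D : ball K e" unfolding eventually_sequentially by blast
 define s where "s = complex_of_real (inverse (real (Suc j)))"
 have s0: "s \<noteq> 0" by (simp add: s_def del: of_nat_Suc)
 have "K + cscale s D : F n" using j e(2) unfolding s_def cscale_of_real by blast
 then obtain b where b: "b : N" "res V (K + cscale s D) = res V (Ad (c n ** b) M)" unfolding F_def by (elim CollectE exE conjE)
 have "res V (Ad (c n ** a) (M + cscale s B)) = res V (Ad (c n ** b) M)"
  using a(2) b(2) by (simp add: res_eq_iff D_def Ad_add Ad_cscale trace_left_add)
 then have "res V (M + cscale s B) = res V (Ad (matrix_inv a ** b) M)"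
  by (metis NG[OF a(1)] NG[OF b(1)] c(1) Ad_mult inv matrix_inv_mult invertible_matrix_inv Ad_inv_left inv[OF aG] res_Ad_cong[OF G V alg_group_inv[OF G aG]])
 then show ?thesis using a(1) b(1) s0 unfolding N_def by (intro bexI exI conjI)
qed

text \<open>Suppose \<open>Y0\<close> is a nonzero annihilator and \<open>B\<close> pairs
  nontrivially with it. Openness gives group elements near the identity that move \<open>M\<close>
  in the direction \<open>B\<close>; they lie outside the stabiliser, so they have a limiting
  tangent direction \<open>A\<close> outside its Lie algebra. Yet pairing with \<open>Y0\<close>
  shows that \<open>A\<close> stabilises the form.\<close>

theorem open_orbit_annihilator:
 fixes G V :: "(complex^'n^'n) set" assumes G: "alg_group G" and V: "stable G V" and c: "c : dual V"
  and op: "openin (zariski_dual V) (dual_orbit G V c)" shows "orbit_annihilator (lie_algebra G) V c = {0}"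
proof -
 have sub: "cmat.subspace V" by (rule stable_subspace[OF V])
 obtain M where M: "c = res V M" using dual_res[OF sub c] by blast
 have open_orbit: "openin (zariski UNIV entries) (orbit_matrices G V M)"
  using op dual_orbit_res(2)[OF G V, of M] unfolding M openin_zariski_dual_iff[OF sub] by simp
 have "Y0 = 0" if Y0: "Y0 : V" "!!X. X : lie_algebra G ==> trace (M ** bracket X Y0) = 0" for Y0
 proof (rule ccontr)
  assume "Y0 \<noteq> 0"
  then have "Y0 \<notin> {0}" by simp
  from separate_subspace[OF cmat.subspace_single_0 this] obtain B where B: "trace (B ** Y0) \<noteq> 0" by (elim exE conjE)
  obtain q where q: "q > 0" "cball (mat 1) q \<subseteq> {A :: complex^'n^'n. invertible A}"
   using open_invertible invertible_mat1 by (auto simp: open_contains_cball)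
  \<comment> \<open>Radii tending to 0, so that the elements supplied by
    \<open>orbit_map_open\<close> tend to the identity.\<close>
  define e where "e n = min q (inverse (real (Suc n)))" for n
  have e: "e n > 0" "cball (mat 1) (e n) \<subseteq> {A :: complex^'n^'n. invertible A}" for n
   using q by (auto simp: e_def)
  have "ALL n. EX abs. fst abs : G \<inter> cball (mat 1) (e n) & fst (snd abs) : G \<inter> cball (mat 1) (e n) & snd (snd abs) \<noteq> 0 &
    res V (M + cscale (snd (snd abs)) B) = res V (Ad (matrix_inv (fst abs) ** fst (snd abs)) M)"
  proof
   fix n
   obtain a b s where "a : G \<inter> cball (mat 1) (e n)" "b : G \<inter> cball (mat 1) (e n)" "s \<noteq> 0"
    "res V (M + cscale s B) = res V (Ad (matrix_inv a ** b) M)"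
    using orbit_map_open[OF G V open_orbit e[of n], of B] by (elim bexE exE conjE)
   then show "EX abs. fst abs : G \<inter> cball (mat 1) (e n) & fst (snd abs) : G \<inter> cball (mat 1) (e n) & snd (snd abs) \<noteq> 0 &
     res V (M + cscale (snd (snd abs)) B) = res V (Ad (matrix_inv (fst abs) ** fst (snd abs)) M)"
    by (intro exI[of _ "(a, b, s)"]) simp
  qed
  then obtain f where f: "ALL n. fst (f n) : G \<inter> cball (mat 1) (e n) & fst (snd (f n)) : G \<inter> cball (mat 1) (e n) &
    snd (snd (f n)) \<noteq> 0 & res V (M + cscale (snd (snd (f n))) B) = res V (Ad (matrix_inv (fst (f n)) ** fst (snd (f n))) M)"
   by (rule choice[THEN exE])
  define a b s where "a n = fst (f n)" and "b n = fst (snd (f n))" and "s n = snd (snd (f n))" for n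
  have ab: "a n : G" "b n : G" "a n : cball (mat 1) (e n)" "b n : cball (mat 1) (e n)" "s n \<noteq> 0"
   "res V (M + cscale (s n) B) = res V (Ad (matrix_inv (a n) ** b n) M)" for n
   using spec[OF f, of n] by (simp_all add: a_def b_def s_def)
  have to_one: "x \<longlonglongrightarrow> mat 1" if x: "!!n. x n : cball (mat 1) (e n)" for x :: "nat => complex^'n^'n"
  proof -
   have "ALL n. norm (dist (x n) (mat 1)) \<le> inverse (real (Suc n))"
    using x by (auto simp: e_def dist_commute simp del: of_nat_Suc)
   from Lim_null_comparison[OF always_eventually[OF this] LIMSEQ_inverse_real_of_nat]
   show ?thesis by (rule tendsto_dist_iff[THEN iffD2])
  qed
  define h where "h n = matrix_inv (a n) ** b n" for n
  have inv: "g : G ==> invertible g" for g by (rule alg_group_invertible[OF G])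
  have hG: "h n : G" for n using ab alg_group_mult[OF G alg_group_inv[OF G]] by (simp add: h_def)
  have "h \<longlonglongrightarrow> matrix_inv (mat 1) ** mat 1" unfolding h_def using ab inv
   by (intro tendsto_matrix_mult tendsto_matrix_inv to_one invertible_mat1) auto
  then have h1: "h \<longlonglongrightarrow> mat 1" by (simp add: matrix_inv_mat1)
  let ?H = "group_stab G V c"
  have H: "alg_group ?H" "?H \<subseteq> G" using alg_group_stab[OF G V c] by (auto simp: group_stab_def)
  have stab: "g : ?H \<longleftrightarrow> g : G & res V (Ad g M) = res V M" for g
   using dual_act_res[OF G V] by (auto simp: group_stab_def M)
  have hH: "h n \<notin> ?H" for n
  using ab(6)[of n] Y0(1) ab(5) B by (fastforce simp: stab h_def res_eq_iff trace_left_add trace_left_scale)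
  obtain r k d A where k: "filterlim r sequentially sequentially" "ALL n. EX h':?H. k n = h (r n) ** h'" "k \<longlonglongrightarrow> mat 1"
   "ALL n::nat. d n > (0::real)" "(%n. inverse (d n) *\<^sub>R (k n - mat 1)) \<longlonglongrightarrow> A"
   "A : lie_algebra G" "A \<notin> lie_algebra ?H" using tangent_direction[OF G H hG hH h1] by (elim exE conjE)
  have kG: "k n : G" for n using spec[OF k(2), of n] hG H(2) alg_group_mult[OF G] by auto
  have kM: "res V (Ad (k n) M) = res V (M + cscale (s (r n)) B)" for n
  proof -
   obtain h' where h': "h' : ?H" "k n = h (r n) ** h'" using spec[OF k(2), of n] by (rule bexE)
   have "res V (Ad (h (r n)) (Ad h' M)) = res V (Ad (h (r n)) M)"
    using h'(1) unfolding stab by (intro res_Ad_cong[OF G V hG]) auto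
   then show ?thesis using ab(6)[of "r n"] h' H(2) by (simp add: Ad_mult inv hG subsetD flip: h_def)
  qed
  \<comment> \<open>The displacement of \<open>M\<close> by \<open>k n\<close>, rescaled by
    \<open>d n\<close> as for the tangent direction, is \<open>i n\<close> times \<open>B\<close> on
    \<open>V\<close>. Its pairing with \<open>Y0\<close> tends to 0, hence so does
    \<open>i\<close>.\<close>
  define i where "i n = complex_of_real (inverse (d n)) * s (r n)" for n
  have lim: "(%n. i n * trace (B ** Y)) \<longlonglongrightarrow> trace (bracket A M ** Y)" if Y: "Y : V" for Y
  proof -
   let ?A = "%n. inverse (d n) *\<^sub>R (k n - mat 1)"
   have "(%n. trace (bracket (?A n) M ** matrix_inv (k n) ** Y)) \<longlonglongrightarrow> trace (bracket A M ** matrix_inv (mat 1) ** Y)"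
    unfolding bracket_def
    by (intro tendsto_trace tendsto_matrix_mult tendsto_diff tendsto_matrix_inv tendsto_const k(3,5) invertible_mat1 inv kG)
   moreover have "trace (bracket (?A n) M ** matrix_inv (k n) ** Y) = i n * trace (B ** Y)" for n
   proof -
    have "bracket (k n - mat 1) M ** matrix_inv (k n) = Ad (k n) M - M ** (k n ** matrix_inv (k n))"
     by (simp add: bracket_def Ad_def matrix_diff_ldistrib matrix_diff_rdistrib matrix_mul_assoc)
    also have "\<dots> = Ad (k n) M - M" by (simp add: matrix_inv_right[OF inv[OF kG]]) finally show ?thesis
     using kM[of n] Y by (simp add: res_eq_iff trace_left_diff trace_left_add trace_left_scale i_def cscale_of_real[symmetric] bracket_cscale_left cscale_mult_left trace_cscale mult.assoc)
   qed
   ultimately show ?thesis by (simp add: matrix_inv_mat1)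
  qed
  have br: "trace (bracket A M ** Y) = - trace (M ** bracket A Y)" for Y
   using trace_bracket[of M A Y] bracket_minus[of A M] trace_left_diff[of 0 "bracket M A" Y] by simp
  have i0: "i \<longlonglongrightarrow> 0" using lim[OF Y0(1)] Y0(2)[OF k(6)] B by (simp add: br)
  have "trace (M ** bracket A Y) = 0" if Y: "Y : V" for Y
   using LIMSEQ_unique[OF lim[OF Y] tendsto_mult_left_zero[OF i0, of "trace (B ** Y)"]] unfolding br by simp
  then show False
   using k(6) stable_bracket[OF G V] k(7) lie_algebra_stab[OF G V c] by (simp add: lie_stab_def M res_apply)
 qed
 then show ?thesis
  using cmat.subspace_0[OF sub] stable_bracket[OF G V] by (auto simp: orbit_annihilator_def M res_apply)
qed

lemma orbit_matrices_cong: "res V N = res V N' ==> N : orbit_matrices G V M \<longleftrightarrow> N' : orbit_matrices G V M"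
 by (simp add: orbit_matrices_def)

lemma orbit_tangent:
 fixes G V :: "(complex^'n^'n) set"
 assumes G: "alg_group G" and V: "stable G V" and ann: "orbit_annihilator (lie_algebra G) V (res V M) = {0}"
  and N: "N : orbit_matrices G V M" shows "EX X:lie_algebra G. ALL Y:V. trace (B ** Y) = trace (N ** bracket X Y)"
proof (rule pairing_represents[where b = "%Y X. trace (N ** bracket X Y)"])
 show "cmat.subspace V" "cmat.subspace (lie_algebra G)" using stable_subspace[OF V] lie_algebra_subspace by auto
 show "form_on V (lie_algebra G) (%Y X. trace (N ** bracket X Y))"
  by (simp add: form_on_def clinear_on_def bracket_add_left bracket_add_right bracket_cscale_left bracket_cscale_right
    trace_right_add trace_right_scale)
 show "clinear_on V (*) (%Y. trace (B ** Y))" by (simp add: clinear_on_def trace_right_add trace_right_scale)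
 fix Y assume Y: "Y : V" and 0: "ALL X:lie_algebra G. trace (N ** bracket X Y) = 0"
 obtain g where g: "g : G" "res V N = res V (Ad g M)" using N by (auto simp: orbit_matrices_def)
 have inv: "invertible g" by (rule alg_group_invertible[OF G g(1)])
 let ?Y = "Ad (matrix_inv g) Y"
 have Y': "?Y : V" by (rule stableD[OF V alg_group_inv[OF G g(1)] Y])
 have "trace (M ** bracket X ?Y) = 0" if X: "X : lie_algebra G" for X
 proof -
  have "trace (M ** bracket X ?Y) = trace (Ad g M ** bracket (Ad g X) Y)"
   by (simp add: Ad_bracket invertible_matrix_inv inv Ad_inv_left trace_Ad_prod)
  also have "\<dots> = trace (N ** bracket (Ad g X) Y)"
   using g(2) stable_bracket[OF G V Ad_lie_algebra[OF G g(1) X] Y] by (simp add: res_eq_iff)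
  also have "\<dots> = 0" using 0 Ad_lie_algebra[OF G g(1) X] by simp finally show ?thesis .
 qed
 then have "?Y = 0" using Y' stable_bracket[OF G V] ann by (auto simp: orbit_annihilator_def res_apply)
 then show "trace (B ** Y) = 0" using Ad_inv_right[OF inv, of Y] by simp
qed

text \<open>Tangent directions fill everything at each point over the orbit, so with
  \<open>p\<close> all its directional derivatives vanish there. Iteration kills all Taylor
  coefficients on every line through \<open>M\<close>.\<close>

lemma orbit_dense:
 fixes G V :: "(complex^'n^'n) set"
 assumes G: "alg_group G" and V: "stable G V" and ann: "orbit_annihilator (lie_algebra G) V (res V M) = {0}"
  and p: "p : polys entries" "!!N. N : orbit_matrices G V M ==> p N = 0" shows "p A = 0"
proof -
 let ?O = "orbit_matrices G V M"
 have deriv0: "poly_deriv p N B = 0" if p: "p : polys entries" "!!N. N : ?O ==> p N = 0" and N: "N : ?O" for p N B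
 proof -
  have curve: "poly_deriv p N F' = 0" if F: "mderiv F F' 0" "F 0 = N" "!!t. F t : ?O" for F F'
  using p(2)[OF F(3)] F(2) DERIV_unique[OF _ DERIV_const] poly_deriv_chain[OF p(1) F(1)] by auto
  obtain X where X: "X : lie_algebra G" "ALL Y:V. trace (B ** Y) = trace (N ** bracket X Y)"
   using orbit_tangent[OF G V ann N, of B] by (rule bexE)
  \<comment> \<open>The direction \<open>B\<close> is split into \<open>?C\<close>, the velocity of
    the curve \<open>Ad (mexp ?X t) N\<close>, and \<open>B - ?C\<close>, which annihilates
    \<open>V\<close> and so stays over the same form.\<close>
  let ?X = "cscale (- 1) X" and ?C = "bracket N X"
  have X': "?X : lie_algebra G" by (rule cmat.subspace_scale[OF lie_algebra_subspace X(1)])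
  have "mderiv (%t. Ad (mexp ?X t) N) (bracket ?X (Ad (mexp ?X 0) N)) 0" by (rule mderiv_Ad_mexp)
  moreover have "bracket ?X (Ad (mexp ?X 0) N) = ?C"
   using bracket_diff_left[of 0 X N] bracket_minus[of X N] by (simp add: cscale_minus Ad_mexp_0)
  ultimately have 1: "poly_deriv p N ?C = 0" using curve orbit_matrices_Ad[OF G V mexp_in_group[OF G X'] N] by auto
  have "res V (N + cscale t (B - ?C)) = res V N" for t
   using X(2) by (simp add: res_eq_iff trace_left_add trace_left_scale trace_left_diff trace_bracket)
  then have "N + cscale t (B - ?C) : ?O" for t by (rule orbit_matrices_cong[THEN iffD2, OF _ N])
  then have 2: "poly_deriv p N (B - ?C) = 0" by (intro curve[OF mderiv_line]) simp_all
  show ?thesis using 1 2 poly_deriv_add[OF p(1), of N "B - ?C" ?C] by simp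
 qed
 have M: "M : ?O" using alg_group_one[OF G] by (auto simp: orbit_matrices_def intro!: bexI[of _ "mat 1"])
 have coeff: "coeff P k = 0"
  if "p : polys entries" "!!N. N : ?O ==> p N = 0" "ALL s. p (M + cscale s B) = poly P s" for p P B k using that
 proof (induction k arbitrary: p P)
  case 0
  have "poly P 0 = 0" using 0(2)[OF M] spec[OF 0(3), of 0] by simp
  then show ?case by (simp add: poly_0_coeff_0)
 next
  case (Suc k)
  let ?q = "%N. poly_deriv p N B"
  have "?q : polys entries" by (intro poly_deriv_polys Suc.prems polys_const)
  moreover have "?q N = 0" if "N : ?O" for N using deriv0[OF Suc.prems(1,2) that] .
  moreover have "ALL s. ?q (M + cscale s B) = poly (pderiv P) s"
  proof
   fix s
   have "((%t. p (M + cscale t B)) has_field_derivative poly_deriv p (M + cscale s B) B) (at s)"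
    by (intro poly_deriv_chain Suc.prems mderiv_line)
   then have "((%t. poly P t) has_field_derivative poly_deriv p (M + cscale s B) B) (at s)" using Suc.prems(3) by simp
   then show "?q (M + cscale s B) = poly (pderiv P) s" using poly_DERIV DERIV_unique by blast
  qed
  ultimately have "coeff (pderiv P) k = 0" by (rule Suc.IH)
  then show ?case using of_nat_neq_0[of k, where 'a = complex] by (simp add: coeff_pderiv del: of_nat_Suc)
 qed
 obtain P where P: "ALL s. p (M + cscale s (A - M)) = poly P s" using polys_line[OF p(1)] by blast
 have "P = 0" using coeff[OF p P] by (simp add: poly_eq_iff)
 then show ?thesis using spec[OF P, of 1] by simp
qed

lemma constructible_orbit:
 fixes G V :: "(complex^'n^'n) set" assumes G: "alg_group G" and V: "cmat.subspace V"
 shows "orbit_matrices G V M : constructible entries"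
proof -
 obtain S where S: "S \<subseteq> V" "cmat.independent S" "V \<subseteq> cmat.span S"
  using cmat.maximal_independent_subset[of V] by metis
 have fin: "finite S" using cmat_dim_bounded[OF S(2)] by blast
 have "ALL Y. EX r. r : rats entries & (ALL A::complex^'n^'n. invertible A --> r A = trace (Ad A M ** Y))"
 proof
  fix Y
  have "(%A. trace (Ad A M ** Y)) : regs" by (intro regs_trace regs_mult_entry regs_Ad polys_const)
  from regs_rats[OF this] show "EX r. r : rats entries & (ALL A::complex^'n^'n. invertible A --> r A = trace (Ad A M ** Y))" by blast
 qed
 then obtain r where r: "ALL Y. r Y : rats entries & (ALL A::complex^'n^'n. invertible A --> r Y A = trace (Ad A M ** Y))"
  by (rule choice[THEN exE])
 have "{N. (%Y. trace (N ** Y)) : {y. EX A:G. ALL Y:S. y Y = r Y A}} : constructible entries"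
  using G r fin by (fastforce simp: alg_group_def coords_def intro: Chevalley closedin_GLn_constructible polys_rats regs_trace regs_mult_entry entry_polys polys_const constructible_vimage)
 also have "{N. (%Y. trace (N ** Y)) : {y. EX A:G. ALL Y:S. y Y = r Y A}} = orbit_matrices G V M"
 proof -
  have "res V N = res V K \<longleftrightarrow> (ALL Y:S. trace (N ** Y) = trace (K ** Y))" for N K
  proof
   assume eq: "ALL Y:S. trace (N ** Y) = trace (K ** Y)"
   have "cmat.subspace {Y. trace ((N - K) ** Y) = 0}"
    by (intro cmat.subspaceI) (simp_all add: trace_right_add trace_right_scale)
   then have "cmat.span S \<subseteq> {Y. trace ((N - K) ** Y) = 0}" using eq by (intro cmat.span_minimal) (auto simp: trace_left_diff)
   then show "res V N = res V K" using S(3) unfolding res_eq_iff by (auto simp: trace_left_diff)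
  qed (use S(1) in \<open>auto simp: res_eq_iff\<close>)
  moreover have "r Y A = trace (Ad A M ** Y)" if "A : G" for A Y using r alg_group_invertible[OF G that] by blast
  ultimately show ?thesis by (auto simp: orbit_matrices_def)
 qed
 finally show ?thesis .
qed

text \<open>The set over the orbit is dense and constructible, so it contains a nonempty open set,
  and pulling this back by group elements gives an open neighbourhood of every point.\<close>

theorem annihilator_open_orbit:
 fixes G V :: "(complex^'n^'n) set" assumes G: "alg_group G" and V: "stable G V" and c: "c : dual V"
  and ann: "orbit_annihilator (lie_algebra G) V c = {0}" shows "openin (zariski_dual V) (dual_orbit G V c)"
proof -
 have sub: "cmat.subspace V" by (rule stable_subspace[OF V])
 obtain M where M: "c = res V M" using dual_res[OF sub c] by blast
 let ?O = "orbit_matrices G V M" and ?T = "zariski UNIV (entries :: (complex^'n^'n => complex) set)"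
 have MO: "M : ?O" using alg_group_one[OF G] by (auto simp: orbit_matrices_def intro!: bexI[of _ "mat 1"])
 have "?T closure_of ?O = UNIV"
 proof -
  obtain P where P: "P \<subseteq> polys entries" "?T closure_of ?O = {x : UNIV. ALL p:P. p x = 0}"
   using closedin_closure_of[of ?T ?O] unfolding closedin_zariski by (elim exE conjE)
  have sub: "?O \<subseteq> ?T closure_of ?O" by (rule closure_of_subset) (simp add: topspace_zariski)
  have "p A = 0" if "p : P" for p A
  proof (rule orbit_dense[OF G V ann[unfolded M]])
   show "p : polys entries" using P(1) that by blast
   show "p N = 0" if "N : ?O" for N using subsetD[OF sub that] \<open>p : P\<close> unfolding P(2) by blast
  qed
  then show ?thesis unfolding P(2) by blast
 qed
 then obtain W where W: "openin ?T W" "W \<noteq> {}" "W \<subseteq> ?O"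
  using constructible_interior[OF constructible_orbit[OF G sub, of M] subset_UNIV] MO by auto
 have "EX U. openin ?T U & N : U & U \<subseteq> ?O" if N: "N : ?O" for N
 proof -
  obtain K where K: "K : W" using W(2) by blast
  then obtain g where g: "g : G" "res V K = res V (Ad g N)" using W(3) orbit_matrices_trans[OF G V N] by auto
  \<comment> \<open>\<open>Ad g N\<close> and \<open>K\<close> agree on \<open>V\<close> only;
    adding \<open>C\<close> makes the map hit \<open>K\<close> and does not change restrictions to
    \<open>V\<close>.\<close>
  define C where "C = K - Ad g N"
  have C: "res V (A + C) = res V A" for A using g(2) by (simp add: res_eq_iff C_def trace_left_add trace_left_diff)
  let ?U = "{A. Ad g A + C : W}"
  have "continuous_map ?T ?T (%A. Ad g A + C)" by (rule continuous_map_zariski)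
    (auto simp: Ad_def elim!: entriesE intro!: polys_add regs_mult_entry polys_const entry_polys)
  from openin_continuous_map_preimage[OF this W(1)] have "openin ?T ?U" by (simp add: topspace_zariski)
  moreover have "N : ?U" using K by (simp add: C_def)
  moreover have "?U \<subseteq> ?O"
  proof
   fix A assume "A : ?U"
   then have "Ad g A : ?O" using W(3) orbit_matrices_cong[OF C] by blast
   then show "A : ?O"
    by (metis Ad_inv_left alg_group_invertible[OF G g(1)] orbit_matrices_Ad[OF G V alg_group_inv[OF G g(1)]])
  qed
  ultimately show ?thesis by blast
 qed
 then show ?thesis by (metis openin_subopen dual_orbit_res[OF G V, of M] M openin_zariski_dual_iff[OF sub])
qed

subsection \<open>Linear operators on matrices\<close>

text \<open>Flattening turns linear operators on matrices into matrices, so that traces, idempotents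
  and spectral decompositions become available for brackets.\<close>

definition vecm :: "complex^'n^'n => complex^('n \<times> 'n)" where
 "vecm X = (\<chi> ij. X $ fst ij $ snd ij)"

definition unvec :: "complex^('n \<times> 'n) => complex^'n^'n" where
 "unvec x = (\<chi> i j. x $ (i, j))"

lemma vecm_unvec [simp]: "vecm (unvec x) = x" and unvec_vecm [simp]: "unvec (vecm X) = X"
 by (simp_all add: vecm_def unvec_def vec_eq_iff)

lemma vecm_add: "vecm (X + Y) = vecm X + vecm Y"
 and vecm_diff: "vecm (X - Y) = vecm X - vecm Y" and vecm_cscale: "vecm (cscale c X) = c *s vecm X"
 and vecm_0 [simp]: "vecm 0 = 0" by (simp_all add: vecm_def vec_eq_iff cscale_nth)

lemma vecm_inj [simp]: "vecm X = vecm Y \<longleftrightarrow> X = Y"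
 by (metis unvec_vecm)

definition lin :: "(complex^'n^'n => complex^'n^'n) => bool" where
 "lin T \<longleftrightarrow> (ALL X Y. T (X + Y) = T X + T Y) & (ALL c X. T (cscale c X) = cscale c (T X))"

definition opm :: "(complex^'n^'n => complex^'n^'n) => complex^('n \<times> 'n)^('n \<times> 'n)" where
 "opm T = (\<chi> ij kl. T (elem (fst kl) (snd kl)) $ fst ij $ snd ij)"

lemma lin_sum:
 assumes "lin T" shows "T (\<Sum>i\<in>S. f i) = (\<Sum>i\<in>S. T (f i))"
proof -
 have "T (cscale 0 0) = cscale 0 (T 0)" using assms unfolding lin_def by blast
 then have "T 0 = 0" by simp
 then show ?thesis using assms by (induction S rule: infinite_finite_induct) (simp_all add: lin_def)
qed

lemma opm_vec:
 assumes "lin T" shows "opm T *v vecm X = vecm (T X)"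
proof -
 have "T X = (\<Sum>k\<in>UNIV. \<Sum>l\<in>UNIV. cscale (X $ k $ l) (T (elem k l)))"
  using assms by (subst matrix_elem_sum[of X]) (simp add: lin_sum lin_def)
 also have "\<dots> = (\<Sum>kl\<in>UNIV. cscale (X $ fst kl $ snd kl) (T (elem (fst kl) (snd kl))))"
  by (simp add: sum.cartesian_product case_prod_beta UNIV_Times_UNIV[symmetric] del: UNIV_Times_UNIV)
 finally have "T X $ i $ j = (\<Sum>kl\<in>UNIV. T (elem (fst kl) (snd kl)) $ i $ j * X $ fst kl $ snd kl)" for i j
  by (simp add: sum_component cscale_nth mult.commute)
 then show ?thesis by (simp add: vec_eq_iff vecm_def opm_def matrix_vector_mult_def)
qed

lemma opm_eqI:
 fixes A B :: "complex^('n::finite \<times> 'n)^('n \<times> 'n)" shows "(!!X. A *v vecm X = B *v vecm X) ==> A = B"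
 by (rule matrix_eqI) (metis vecm_unvec)

lemma opm_eq: "lin T ==> (!!X. A *v vecm X = vecm (T X)) ==> A = opm T"
 by (rule opm_eqI) (simp add: opm_vec)

lemma lin_comp: "lin S ==> lin T ==> lin (%X. S (T X))"
 by (simp add: lin_def)

lemma opm_mult: "lin S ==> lin T ==> opm S ** opm T = opm (%X. S (T X))"
 by (rule opm_eq) (simp_all add: lin_comp opm_vec flip: matrix_vector_mul_assoc)

lemma opm_diff: "opm S - opm T = opm (%X. S X - T X)"
 by (simp add: opm_def vec_eq_iff)

lemma trace_opm: "trace (opm T) = (\<Sum>c\<in>UNIV. \<Sum>b\<in>UNIV. T (elem c b) $ c $ b)"
 by (simp add: trace_def opm_def sum.cartesian_product case_prod_beta UNIV_Times_UNIV[symmetric] del: UNIV_Times_UNIV)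

subsection \<open>The Casimir operator\<close>

definition RED :: "(complex^'n^'n) set => bool" where
 "RED m \<longleftrightarrow> (ALL X:m. (ALL Y:m. trace (X ** Y) = 0) --> X = 0)"

lemma REDD: "RED m ==> X : m ==> (!!Y. Y : m ==> trace (X ** Y) = 0) ==> X = 0"
 by (simp add: RED_def)

lemma matrix_eq_trace:
 assumes "!!T. trace (T ** A) = trace (T ** (B :: complex^'k^'k))" shows "A = B"
proof (rule ccontr)
 assume "A \<noteq> B"
 then have "A - B \<notin> {0}" by simp
 from separate_subspace[OF cmat.subspace_single_0 this] obtain T where "trace (T ** (A - B)) \<noteq> 0" by (elim exE conjE)
 then show False using assms[of T] by (simp add: trace_right_diff)
qed

text \<open>The projection \<open>p\<close> onto \<open>L\<close> along its orthogonal space for the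
  trace form commutes with brackets by \<open>L\<close>. Since a commutator of operators has trace
  0, the element \<open>W\<close> built from \<open>p\<close> commutes with \<open>L\<close>; the
  remaining clauses are read off from its entries.\<close>

lemma Casimir:
 fixes L :: "(complex^'k^'k) set" assumes L: "cmat.subspace L" "ALL X:L. ALL Y:L. bracket X Y : L" and red: "RED L"
 shows "EX W. (ALL Z:L. Z ** W = W ** Z) & (ALL v. (ALL X:L. X *v v = 0) --> W *v v = 0) &
  (ALL R. (ALL X:L. X ** R = X) --> W ** R = W) & (trace W = 0 --> L \<subseteq> {0})"
proof -
 have "ALL E. EX Y. Y : L & (ALL X:L. trace (E ** X) = trace (X ** Y))"
 proof
  fix E
  have "EX Y:L. ALL X:L. trace (E ** X) = trace (X ** Y)"
  proof (rule pairing_represents[OF L(1) L(1) trace_form_on])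
   show "clinear_on L (*) (%X. trace (E ** X))" by (simp add: clinear_on_def trace_right_add trace_right_scale)
   show "trace (E ** X) = 0" if "X : L" "ALL Y:L. trace (X ** Y) = 0" for X
    using REDD[OF red that(1)] that(2) by simp
  qed
  then show "EX Y. Y : L & (ALL X:L. trace (E ** X) = trace (X ** Y))" by blast
 qed
 then obtain p where p': "ALL E. p E : L & (ALL X:L. trace (E ** X) = trace (X ** p E))" by (rule choice[THEN exE])
 have p: "p E : L" "X : L ==> trace (p E ** X) = trace (E ** X)" for E X
 proof -
  show "p E : L" using p' by blast
  show "X : L ==> trace (p E ** X) = trace (E ** X)"
   using bspec[OF conjunct2[OF spec[OF p', of E]], of X] by (simp only: trace_mul_sym[of "p E" X])
 qed
 have unique: "Y = p E" if "Y : L" "!!X. X : L ==> trace (Y ** X) = trace (E ** X)" for Y E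
 proof -
  have "Y - p E = 0" by (rule REDD[OF red]) (simp_all add: cmat.subspace_diff[OF L(1)] p that trace_left_diff)
  then show ?thesis by simp
 qed
 have lin_p: "lin p" unfolding lin_def
 proof (intro conjI allI)
  show "p (X + Y) = p X + p Y" for X Y
   by (rule unique[symmetric]) (simp_all add: cmat.subspace_add[OF L(1)] p trace_left_add)
  show "p (cscale c X) = cscale c (p X)" for c X
   by (rule unique[symmetric]) (simp_all add: cmat.subspace_scale[OF L(1)] p trace_left_scale)
 qed
 have pp: "p (p E) = p E" for E by (rule unique[symmetric]) (simp_all add: p)
 have pL: "p X = X" if "X : L" for X by (rule unique[symmetric]) (simp_all add: that)
 have p_bracket: "bracket Z (p E) = p (bracket Z E)" if Z: "Z : L" for Z E
 proof (rule unique)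
  show "bracket Z (p E) : L" by (rule L(2)[rule_format, OF Z p(1)])
  fix X assume X: "X : L"
  have "trace (bracket Z A ** X) = - trace (A ** bracket Z X)" for A
   using trace_bracket[of A Z X] bracket_minus[of Z A] trace_left_diff[of 0 "bracket A Z" X] by simp
  then show "trace (bracket Z (p E) ** X) = trace (bracket Z E ** X)" using p(2)[OF L(2)[rule_format, OF Z X]] by simp
 qed
 \<comment> \<open>The sum of the products of dual bases of \<open>L\<close>, written without bases;
   the identity \<open>tr\<close> below characterises it.\<close>
 define W where "W = (\<chi> b a. \<Sum>c\<in>UNIV. p (elem c b) $ c $ a)"
 have tr: "trace (T ** W) = trace (opm (%E. p E ** T))" for T
 proof -
  have "trace (T ** W) = (\<Sum>a\<in>UNIV. \<Sum>b\<in>UNIV. \<Sum>c\<in>UNIV. T $ a $ b * p (elem c b) $ c $ a)"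
   by (simp add: trace_def matrix_matrix_mult_def W_def sum_distrib_left)
  also have "\<dots> = (\<Sum>c\<in>UNIV. \<Sum>b\<in>UNIV. \<Sum>a\<in>UNIV. T $ a $ b * p (elem c b) $ c $ a)"
  proof -
   have "(\<Sum>a\<in>UNIV. \<Sum>b\<in>UNIV. \<Sum>c\<in>UNIV. T $ a $ b * p (elem c b) $ c $ a) =
     (\<Sum>b\<in>UNIV. \<Sum>a\<in>UNIV. \<Sum>c\<in>UNIV. T $ a $ b * p (elem c b) $ c $ a)" by (rule sum.swap)
   also have "\<dots> = (\<Sum>b\<in>UNIV. \<Sum>c\<in>UNIV. \<Sum>a\<in>UNIV. T $ a $ b * p (elem c b) $ c $ a)"
    by (intro sum.cong refl sum.swap)
   also have "\<dots> = (\<Sum>c\<in>UNIV. \<Sum>b\<in>UNIV. \<Sum>a\<in>UNIV. T $ a $ b * p (elem c b) $ c $ a)" by (rule sum.swap)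
   finally show ?thesis .
  qed
  finally show ?thesis by (simp add: trace_opm matrix_matrix_mult_def mult.commute)
 qed
 have commute: "Z ** W = W ** Z" if Z: "Z : L" for Z
 proof (rule matrix_eq_trace)
  fix T :: "complex^'k^'k"
  let ?a = "bracket Z"
  have l: "lin ?a" "lin (%E. p E ** T)"
   using lin_p by (simp_all add: lin_def matrix_add_rdistrib cscale_mult_left bracket_add_right bracket_cscale_right)
  have "p E ** (T ** Z) - p E ** (Z ** T) = (%E. p E ** T) (?a E) - ?a ((%E. p E ** T) E)" for E
   unfolding p_bracket[OF Z, symmetric] by (simp add: bracket_def matrix_diff_rdistrib matrix_mul_assoc)
  then have "opm (%E. p E ** (T ** Z)) - opm (%E. p E ** (Z ** T)) =
    opm (%E. p E ** T) ** opm ?a - opm ?a ** opm (%E. p E ** T)" by (simp only: opm_diff opm_mult l)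
  then have "trace (opm (%E. p E ** (T ** Z))) - trace (opm (%E. p E ** (Z ** T))) = 0"
   using trace_mul_sym[of "opm (%E. p E ** T)" "opm ?a"] by (simp add: trace_sub[symmetric]) (simp add: trace_sub)
  then show "trace (T ** (Z ** W)) = trace (T ** (W ** Z))"
   using trace_mul_sym[of Z "T ** W"] by (simp add: tr matrix_mul_assoc)
 qed
 show ?thesis
 proof (intro exI[of _ W] conjI ballI allI impI)
  show "Z ** W = W ** Z" if "Z : L" for Z by (rule commute[OF that])
  show "W *v v = 0" if v: "ALL X:L. X *v v = 0" for v
  proof -
   have "(W *v v) $ b = (\<Sum>c\<in>UNIV. (p (elem c b) *v v) $ c)" for b
    unfolding matrix_vector_mult_def W_def by (simp add: sum_distrib_right) (rule sum.swap)
   then show ?thesis using v p(1) by (simp add: vec_eq_iff)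
  qed
  show "W ** R = W" if R: "ALL X:L. X ** R = X" for R
  proof -
   have "(W ** R) $ b $ a = (\<Sum>c\<in>UNIV. (p (elem c b) ** R) $ c $ a)" for a b
    unfolding matrix_matrix_mult_def W_def by (simp add: sum_distrib_right) (rule sum.swap)
   then show ?thesis using R p(1) by (simp add: vec_eq_iff W_def)
  qed
  show "L \<subseteq> {0}" if "trace W = 0"
  proof -
   \<comment> \<open>The trace of \<open>W\<close> is that of the idempotent \<open>opm p\<close>,
     which is the dimension of \<open>L\<close>.\<close>
   have "opm p = 0" using tr[of "mat 1"] that trace_idempotent[of "opm p"] by (simp add: opm_mult lin_p pp)
   then have "vecm (p X) = 0" for X using opm_vec[OF lin_p, of X] by simp
   then have "p X = 0" for X by (metis vecm_0 vecm_inj)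
   then show ?thesis using pL by force
  qed
 qed
qed

lemma cscale_matrix_vector: "cscale c A *v x = c *s (A *v x)"
 by (simp add: vec_eq_iff matrix_vector_mult_def cscale_nth sum_distrib_left mult.assoc)

lemma matrix_sum_vector: "(\<Sum>i\<in>S. f i) *v x = (\<Sum>i\<in>S. f i *v x)" for f :: "'i => complex^'k^'k"
 by (induction S rule: infinite_finite_induct) (simp_all add: matrix_vector_mult_add_rdistrib)

text \<open>\<open>E\<close> projects onto the generalised kernel of \<open>W\<close>, its Fitting
  null component, and is 0 if 0 is not in the spectral set.\<close>

lemma spectral_zero_idempotent:
 fixes W :: "complex^'k^'k"
 shows "EX E p. E = mpoly p W & E ** E = E & nilpotent_mat (W ** E) & (ALL v. W *v v = 0 --> E *v v = v)"
proof -
 obtain L e n where S: "spectral L (%c. mpoly (e c) W) (mpoly n W)"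
  and T: "W = (\<Sum>c\<in>L. cscale c (mpoly (e c) W)) + mpoly n W" by (rule spectral_decomposition)
 let ?F = "%c. mpoly (e c) W" and ?N = "mpoly n W"
 have fin: "finite L" and one: "(\<Sum>c\<in>L. ?F c) = mat 1"
  and orth: "!!c m. c : L ==> m : L ==> ?F c ** ?F m = (if c = m then ?F c else 0)"
  and N: "nilpotent_mat ?N" using S by (auto simp: spectral_def)
 have WF: "W ** ?F m = cscale m (?F m) + ?N ** ?F m" if "m : L" for m
 proof -
  have "W ** ?F m = (\<Sum>c\<in>L. cscale c (?F c)) ** ?F m + ?N ** ?F m"
   by (subst (1) T) (rule matrix_add_rdistrib)
  also have "(\<Sum>c\<in>L. cscale c (?F c)) ** ?F m = (\<Sum>c\<in>L. if c = m then cscale c (?F m) else 0)"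
   unfolding matrix_sum_left using orth that by (intro sum.cong) (auto simp: cscale_mult_left)
  finally show ?thesis using fin that by simp
 qed
 have zero: "?F m *v v = 0" if v: "W *v v = 0" and m: "m : L" "m \<noteq> 0" for v m
 proof -
  let ?w = "?F m *v v"
  have "W *v ?w = ?F m *v (W *v v)" by (simp add: matrix_vector_mul_assoc mpoly_commute)
  then have "cscale m (?F m) *v v + ?N *v ?w = 0"
   using v by (simp add: matrix_vector_mul_assoc WF[OF m(1)] matrix_vector_mult_add_rdistrib)
  then have Nw: "?N *v ?w = (- m) *s ?w" by (simp add: cscale_matrix_vector vector_smult_lneg add_eq_0_iff)
  have "mpow ?N j *v ?w = (- m) ^ j *s ?w" for j
   by (induction j) (simp_all add: matrix_vector_mul_assoc[symmetric] Nw vector_scalar_commute vector_smult_assoc mult.commute)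
  moreover obtain j where "mpow ?N j = 0" using N by (auto simp: nilpotent_mat_iff)
  ultimately have "(- m) ^ j *s ?w = 0" by (metis matrix_vector_mult_0)
  then show ?thesis using m(2) by (simp add: vector_mul_eq_0)
 qed
 show ?thesis
 proof (cases "0 : L")
  case True
  show ?thesis
  proof (intro exI conjI allI impI)
   show "?F 0 = mpoly (e 0) W" ..
   show "?F 0 ** ?F 0 = ?F 0" using orth True by simp
   show "nilpotent_mat (W ** ?F 0)"
    by (auto simp: WF[OF True] intro!: nilpotent_mult_commute[OF N mpoly_commute_mpoly])
   fix v assume v: "W *v v = 0"
   have "v = (\<Sum>c\<in>L. ?F c) *v v" by (simp add: one)
   also have "\<dots> = (\<Sum>c\<in>L. ?F c *v v)" by (rule matrix_sum_vector)
   also have "\<dots> = (\<Sum>c\<in>L. if c = 0 then ?F 0 *v v else 0)" using zero[OF v] by (intro sum.cong) auto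
   finally show "?F 0 *v v = v" using fin True by simp
  qed
 next
  case False
  show ?thesis
  proof (intro exI conjI allI impI)
   show "0 = mpoly 0 W" by simp
   show "nilpotent_mat (W ** 0)" by (auto simp: nilpotent_mat_iff intro!: exI[of _ 1])
   fix v assume v: "W *v v = 0"
   have "v = (\<Sum>c\<in>L. ?F c) *v v" by (simp add: one)
   also have "\<dots> = (\<Sum>c\<in>L. ?F c *v v)" by (rule matrix_sum_vector)
   also have "\<dots> = (\<Sum>c\<in>L. 0)" using zero[OF v] False by (intro sum.cong) auto
   finally show "0 *v v = v" by simp
  qed simp
 qed
qed

text \<open>Take \<open>R\<close> of minimal rank among the idempotents that commute with \<open>L\<close> and fix \<open>v\<close>. The Casimir operator of
 \<open>R L\<close> is nilpotent on the image of \<open>R\<close>, since otherwise its Fitting null component would be smaller.\<close>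

lemma invariants_not_image:
 fixes P :: "complex^'k^'k"
 assumes P: "P ** P = P" and a: "cmat.subspace a" "!!X. X : a ==> P ** X = X" "!!X. X : a ==> X ** P = X"
  and br: "!!X Y. X : a ==> Y : a ==> bracket X Y : a"
  and red: "!!R. R ** R = R ==> P ** R = R ==> R ** P = R ==> (!!X. X : a ==> R ** X = X ** R) ==> RED ((**) R ` a)"
  and v: "P *v v = v" "!!X. X : a ==> X *v v = 0" "v : vec.span {X *v w | X w. X : a}" shows "v = 0"
proof -
 let ?C = "%R. R ** R = R & P ** R = R & R ** P = R & (ALL X:a. R ** X = X ** R) & R *v v = v"
 \<comment> \<open>The rank of an idempotent, as a natural number to be minimised.\<close>
 define t where "t R = (SOME n::nat. trace R = of_nat n & (n = 0 --> R = 0))" for R :: "complex^'k^'k"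
 have t: "trace R = of_nat (t R) & (t R = 0 --> R = 0)" if "R ** R = R" for R
  unfolding t_def by (rule someI_ex[OF trace_idempotent[OF that]])
 have "?C P" using P a v(1) by simp
 then have "EX R. ?C R & (ALL R'. ?C R' --> t R \<le> t R')" by (rule ex_has_least_nat)
 then obtain R where R': "?C R & (ALL R'. ?C R' --> t R \<le> t R')" by (rule exE)
 then have R: "R ** R = R" "P ** R = R" "R ** P = R" "!!X. X : a ==> R ** X = X ** R" "R *v v = v" by blast+
 let ?L = "(**) R ` a"
 have LR: "X ** R = X" "R ** X = X" if X: "X : ?L" for X
 proof -
  obtain Y where Y: "X = R ** Y" "Y : a" using X by (rule imageE)
  show "R ** X = X" using R(1) by (simp add: Y(1) matrix_mul_assoc)
  show "X ** R = X" by (metis R(4)[OF Y(2)] R(1) Y(1) matrix_mul_assoc)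
 qed
 have subL: "cmat.subspace ?L"
 proof (rule cmat.subspaceI)
  show "0 : ?L" by (rule image_eqI[of _ _ 0]) (simp_all add: cmat.subspace_0[OF a(1)])
 next
  fix X Y assume "X : ?L" "Y : ?L"
  then obtain X' Y' where "X = R ** X'" "Y = R ** Y'" "X' : a" "Y' : a" by blast
  then show "X + Y : ?L"
   by (intro image_eqI[of _ _ "X' + Y'"]) (simp_all add: cmat.subspace_add[OF a(1)] matrix_add_ldistrib)
 next
  fix c X assume "X : ?L"
  then obtain X' where "X = R ** X'" "X' : a" by blast
  then show "cscale c X : ?L"
   by (intro image_eqI[of _ _ "cscale c X'"]) (simp_all add: cmat.subspace_scale[OF a(1)] cscale_mult_right)
 qed
 have brL: "ALL X:?L. ALL Y:?L. bracket X Y : ?L"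
 proof (intro ballI)
  fix X Y assume XY: "X : ?L" "Y : ?L"
  obtain X' where X: "X = R ** X'" "X' : a" using XY(1) by (rule imageE)
  obtain Y' where Y: "Y = R ** Y'" "Y' : a" using XY(2) by (rule imageE)
  have "R ** A ** (R ** B) = R ** (A ** B)" if A: "A : a" for A B :: "complex^'k^'k"
  by (metis R(1) matrix_mul_assoc R(4)[OF A, symmetric])
  then have "bracket X Y = R ** bracket X' Y'" using X Y by (simp add: bracket_def matrix_diff_ldistrib)
  then show "bracket X Y : ?L" using br[OF X(2) Y(2)] by blast
 qed
 have "RED ?L" by (rule red[OF R(1-4)])
 from Casimir[OF subL brL this] obtain W where W: "ALL Z:?L. Z ** W = W ** Z" "ALL v. (ALL X:?L. X *v v = 0) --> W *v v = 0"
  "ALL R. (ALL X:?L. X ** R = X) --> W ** R = W" "trace W = 0 --> ?L \<subseteq> {0}" by (elim exE conjE)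
 have WR: "W ** R = W" using W(3) LR(1) by simp
 have Lv: "X *v v = 0" if "X : ?L" for X using that v(2) by (auto simp flip: matrix_vector_mul_assoc)
 let ?W = "R ** W"
 have RW: "R ** ?W = ?W" "?W ** R = ?W" 
  by (simp add: matrix_mul_assoc R(1)) (simp only: matrix_mul_assoc[symmetric] WR)
 have com: "?W ** X = X ** ?W" if X: "X : a" for X
 proof -
  have RX: "R ** X : ?L" using X by blast
  show ?thesis by (metis WR matrix_mul_assoc bspec[OF W(1) RX] R(1) R(4)[OF X])
 qed
 have Wv: "?W *v v = 0" using W(2) Lv by (fastforce simp: matrix_vector_mul_assoc[symmetric])
 obtain E p where E: "E = mpoly p ?W" "E ** E = E" "nilpotent_mat (?W ** E)" "ALL v. ?W *v v = 0 --> E *v v = v"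
  using spectral_zero_idempotent[of ?W] by (elim exE conjE)
 have ER: "R ** E = E ** R" unfolding E(1) by (rule mpoly_commute[symmetric]) (simp only: RW)
 have RR: "R ** E ** (R ** E) = R ** E" by (metis matrix_mul_assoc ER[symmetric] R(1) E(2))
 have "?C (R ** E)"
 proof (intro conjI ballI)
  show "R ** E ** (R ** E) = R ** E" by (rule RR)
  show "P ** (R ** E) = R ** E" by (simp add: matrix_mul_assoc R(2))
  show "R ** E ** P = R ** E" by (metis ER matrix_mul_assoc R(3))
  show "R ** E *v v = v" using E(4) Wv R(5) by (simp add: matrix_vector_mul_assoc[symmetric])
  fix X assume X: "X : a"
  show "R ** E ** X = X ** (R ** E)"
   by (metis mpoly_commute[OF com[OF X]] E(1) matrix_mul_assoc[symmetric] R(4)[OF X] matrix_mul_assoc)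
 qed
 then have le: "t R \<le> t (R ** E)" using R' by blast
 have idem: "(R - R ** E) ** (R - R ** E) = R - R ** E"
 proof -
  have "R ** (R ** E) = R ** E" "R ** E ** R = R ** E"
   using R(1) by (simp_all add: matrix_mul_assoc) (simp add: ER matrix_mul_assoc[symmetric])
  then show ?thesis using R(1) RR by (simp add: matrix_diff_ldistrib matrix_diff_rdistrib)
 qed
 have "of_nat (t R) = trace (R ** E) + trace (R - R ** E)" using t[OF R(1)] by (simp add: trace_sub)
 also have "\<dots> = of_nat (t (R ** E) + t (R - R ** E))" using t[OF RR] t[OF idem] by simp
 finally have "t R = t (R ** E) + t (R - R ** E)" by (simp only: of_nat_eq_iff)
 then have "R ** E = R" using le t[OF idem] by simp
 then have "?W ** E = ?W" by (metis matrix_mul_assoc[symmetric] RW(2))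
 then have "trace W = 0" using nilpotent_trace[OF E(3)] trace_mul_sym[of R W] WR by simp
 \<comment> \<open>A Casimir element of trace 0 occurs only for \<open>?L = 0\<close>. So
   \<open>R\<close> kills the span containing \<open>v\<close> and at the same time fixes
   \<open>v\<close>.\<close>
 then have L0: "R ** X = 0" if "X : a" for X using W(4) that by blast
 have "R *v x = 0" if "x : vec.span {X *v w | X w. X : a}" for x using that
 proof (induction rule: vec.span_induct_alt)
  case (step c x y)
  then obtain X w where "x = X *v w" "X : a" by blast
  then show ?case
   using L0 step by (simp add: matrix_vector_mul_assoc matrix_vector_right_distrib vector_scalar_commute)
 qed simp
 then show ?thesis using v(3) R(5) by simp
qed

subsection \<open>Replicas and trace forms\<close>

definition rad :: "(complex^'n^'n) set => (complex^'n^'n) set" where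
 "rad m = {X : m. ALL Y:m. trace (X ** Y) = 0}"

lemma RED_rad: "cmat.subspace m ==> RED m \<longleftrightarrow> rad m = {0}"
 by (auto simp: RED_def rad_def cmat.subspace_0)

text \<open>Since \<open>h\<close> is multiplicative on polynomials in \<open>T\<close>, each
  \<open>h (F z)\<close> is idempotent and the nilpotent part contributes trace 0. What remains is
  the sum of the squares of \<open>cmod z\<close> times the rank of \<open>h (F z)\<close>, whose
  terms must all vanish.\<close>

lemma spectral_trace_positive:
 fixes h :: "complex^'k^'k => complex^'j^'j"
 assumes S: "spectral L F M" and T: "T = (\<Sum>z\<in>L. cscale z (F z)) + M"
  and lin: "!!X Y. h (X + Y) = h X + h Y" "!!c X. h (cscale c X) = cscale c (h X)"
  and mult: "!!p q. h (mpoly p T ** mpoly q T) = h (mpoly p T) ** h (mpoly q T)"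
  and zero: "trace (h T ** h (\<Sum>z\<in>L. cscale (cnj z) (F z))) = 0" and z: "z : L" "z \<noteq> 0"
 shows "h (F z) = 0"
proof -
 have fin: "finite L" and orth: "!!z u. z : L ==> u : L ==> F z ** F u = (if z = u then F z else 0)"
  and M: "nilpotent_mat M" using S by (auto simp: spectral_def)
 have h0: "h 0 = 0" using lin(2)[of 0 0] by simp
 have hsum: "h (\<Sum>i\<in>I. f i) = (\<Sum>i\<in>I. h (f i))" for f :: "complex => complex^'k^'k" and I
  by (induction I rule: infinite_finite_induct) (simp_all add: h0 lin(1))
 obtain p where p: "ALL z. z : L --> F z = mpoly (p z) T" by (metis spectral_poly[OF S T] choice[THEN exE])
 obtain m where m: "M = mpoly m T" using spectral_poly_nilpotent[OF S T] by blast
 define S where "S = (\<Sum>z\<in>L. cscale (cnj z) (F z))"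
 define s where "s = (\<Sum>z\<in>L. smult (cnj z) (p z))"
 have s: "S = mpoly s T" using p by (simp add: S_def s_def mpoly_sum mpoly_smult)
 have "h T ** h S = h (T ** S)" using mult[of "[:0, 1:]" s] by (simp only: mpoly_X s)
 moreover have "T ** S = (\<Sum>z\<in>L. cscale (z * cnj z) (F z)) + M ** S"
 proof -
  have "(\<Sum>z\<in>L. cscale z (F z)) ** S = (\<Sum>z\<in>L. \<Sum>u\<in>L. if u = z then cscale (z * cnj z) (F z) else 0)"
   unfolding S_def matrix_sum_left matrix_sum_right
   by (intro sum.cong refl) (auto simp: cscale_mult_left cscale_mult_right orth)
  then show ?thesis using fin by (simp add: T matrix_add_rdistrib)
 qed
 ultimately have "h T ** h S = (\<Sum>z\<in>L. cscale (z * cnj z) (h (F z))) + h (M ** S)" by (simp add: lin hsum)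
 moreover have "trace (h (M ** S)) = 0"
 proof -
  let ?Y = "mpoly (m * s) T"
  have Y: "M ** S = ?Y" by (simp only: m s mpoly_mult)
  obtain k where k: "mpow ?Y k = 0"
   by (metis Y[symmetric] m s mpoly_commute_mpoly nilpotent_mat_iff nilpotent_mult_commute[OF M])
  have "mpow (h ?Y) (Suc j) = h (mpow ?Y (Suc j))" for j
  proof (induction j)
   case (Suc j)
   show ?case by (metis Suc mult[of "m * s" "(m * s) ^ Suc j"] mpoly_power mpow_simps)
  qed simp
  from this[of k] have "mpow (h ?Y) (Suc k) = 0" using k h0 by simp
  then show ?thesis unfolding Y by (rule trace_nilpotent)
 qed
 ultimately have sum0: "(\<Sum>z\<in>L. (z * cnj z) * trace (h (F z))) = 0"
  using zero by (simp add: S_def trace_add trace_sum trace_cscale)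
 have idem: "h (F z) ** h (F z) = h (F z)" if "z : L" for z
  using mult[of "p z" "p z"] orth[OF that that] p that by simp
 have "ALL z. EX n::nat. z : L --> trace (h (F z)) = of_nat n & (n = 0 --> h (F z) = 0)"
  using trace_idempotent[OF idem] by blast
 then obtain n where n: "ALL z. z : L --> trace (h (F z)) = of_nat (n z :: nat) & (n z = 0 --> h (F z) = 0)"
  by (rule choice[THEN exE])
 have "(\<Sum>z\<in>L. (z * cnj z) * trace (h (F z))) = of_real (\<Sum>z\<in>L. (cmod z)\<^sup>2 * real (n z))"
  unfolding of_real_sum
 proof (intro sum.cong refl)
  fix z assume "z : L"
  then show "z * cnj z * trace (h (F z)) = of_real ((cmod z)\<^sup>2 * real (n z))"
   by (metis n of_real_mult complex_norm_square of_real_of_nat_eq)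
 qed
 from trans[OF this[symmetric] sum0] have "(\<Sum>z\<in>L. (cmod z)\<^sup>2 * real (n z)) = 0" by (simp only: of_real_eq_0_iff)
 then have "(cmod z)\<^sup>2 * real (n z) = 0" using fin z(1) by (subst (asm) sum_nonneg_eq_0_iff) auto
 then show ?thesis using z n by simp
qed

lemma nilpotent_if_trace_replica_zero:
 assumes "spectral L E N" "X = (\<Sum>k\<in>L. cscale k (E k)) + N" "trace (X ** (\<Sum>k\<in>L. cscale (cnj k) (E k))) = 0"
 shows "nilpotent_mat X"
proof -
 have "E k = 0" if "k : L" "k \<noteq> 0" for k
  using spectral_trace_positive[OF assms(1,2), of "%X. X" k] assms(3) that by simp
 then have "(\<Sum>k\<in>L. cscale k (E k)) = 0" by (intro sum.neutral ballI) (metis cscale_simps(1,2))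
 then show ?thesis using assms(1,2) by (simp add: spectral_def)
qed

lemma nilpotent_diff:
 assumes com: "A ** B = B ** A" and "nilpotent_mat A" "nilpotent_mat B" shows "nilpotent_mat (A - B)"
proof -
 obtain k l where k: "mpow A k = 0" and l: "mpow B l = 0" using assms(2,3) by (auto simp: nilpotent_mat_iff)
 have "mpow A i ** mpow B j ** mpow (A - B) n = 0" if "i + j + n \<ge> k + l" for i j n using that
 proof (induction n arbitrary: i j)
  case 0
  then have "i \<ge> k \<or> j \<ge> l" by linarith
  then show ?case using nilpotent_mpow_mono[OF k] nilpotent_mpow_mono[OF l] by auto
 next
  case (Suc n)
  have "mpow A i ** mpow B j ** mpow (A - B) (Suc n) =
    mpow A i ** (mpow B j ** A) ** mpow (A - B) n - mpow A i ** (mpow B j ** B) ** mpow (A - B) n"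
   by (simp add: matrix_diff_rdistrib matrix_diff_ldistrib matrix_mul_assoc)
  also have "mpow B j ** A = A ** mpow B j" using mpow_commute[of B A j] com by simp
  also have "mpow A i ** (A ** mpow B j) = mpow A (Suc i) ** mpow B j" by (simp only: mpow_Suc2 matrix_mul_assoc)
  also have "mpow B j ** B = mpow B (Suc j)" by (rule mpow_Suc2[symmetric])
  also have "mpow A (Suc i) ** mpow B j ** mpow (A - B) n = 0" using Suc.prems by (intro Suc.IH) simp
  also have "mpow A i ** mpow B (Suc j) ** mpow (A - B) n = 0" using Suc.prems by (intro Suc.IH) simp
  finally show ?case by simp
 qed
 from this[of 0 0 "k + l"] show ?thesis by (auto simp: nilpotent_mat_iff)
qed

definition adm :: "complex^'n^'n => complex^('n \<times> 'n)^('n \<times> 'n)" where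
 "adm X = opm (bracket X)"

lemma lin_simps: "lin (bracket X)" "lin (%Y. A ** Y)" "lin (%Y. Y ** B)" "lin (%Y. A ** Y ** B)"
 by (simp_all add: lin_def bracket_add_right bracket_cscale_right matrix_add_ldistrib matrix_add_rdistrib
   cscale_mult_left cscale_mult_right)

lemma adm_vec: "adm X *v vecm Y = vecm (bracket X Y)"
 unfolding adm_def by (rule opm_vec[OF lin_simps(1)])

lemma opm_sum: "(\<Sum>i\<in>I. opm (f i)) = opm (%Y. \<Sum>i\<in>I. f i Y)"
 by (simp add: opm_def vec_eq_iff sum_component)

lemma opm_cscale: "cscale c (opm f) = opm (%Y. cscale c (f Y))"
 by (simp add: opm_def vec_eq_iff cscale_nth)

lemma opm_id: "opm (%Y. Y) = mat 1"
 by (rule opm_eq[symmetric]) (simp_all add: lin_def)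

lemma opm_zero: "opm (%Y. 0) = 0"
 by (simp add: opm_def vec_eq_iff)

lemma nilpotent_adm:
 assumes "nilpotent_mat N" shows "nilpotent_mat (adm N)"
proof -
 obtain k where k: "mpow N k = 0" using assms by (auto simp: nilpotent_mat_iff)
 let ?l = "opm (%Y. N ** Y)" and ?r = "opm (%Y. Y ** N)"
 have "mpow ?l j = opm (%Y. mpow N j ** Y)" for j
  by (induction j) (simp_all add: opm_id opm_mult lin_simps matrix_mul_assoc)
 then have l: "nilpotent_mat ?l" using k by (auto simp: nilpotent_mat_iff opm_zero intro!: exI[of _ k])
 have "mpow ?r j = opm (%Y. Y ** mpow N j)" for j
 proof (induction j)
  case (Suc j)
  then have "mpow ?r (Suc j) = opm (%Y. Y ** (mpow N j ** N))" by (simp add: opm_mult lin_simps matrix_mul_assoc)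
  then show ?case by (simp only: mpow_Suc2[symmetric])
 qed (simp add: opm_id)
 then have r: "nilpotent_mat ?r" using k by (auto simp: nilpotent_mat_iff opm_zero intro!: exI[of _ k])
 have "?l ** ?r = ?r ** ?l" by (simp add: opm_mult lin_simps matrix_mul_assoc)
 from nilpotent_diff[OF this l r] show ?thesis by (simp add: opm_diff adm_def bracket_def[abs_def])
qed

lemma matrix_sum_product:
 fixes f g :: "'i => complex^'k^'k"
 shows "(\<Sum>c\<in>A. f c) ** Y ** (\<Sum>n\<in>B. g n) = (\<Sum>x\<in>A \<times> B. f (fst x) ** Y ** g (snd x))"
proof -
 have "(\<Sum>c\<in>A. f c) ** Y ** (\<Sum>n\<in>B. g n) = (\<Sum>c\<in>A. f c ** Y ** (\<Sum>n\<in>B. g n))"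
  by (simp only: matrix_sum_left)
 then show ?thesis by (simp add: matrix_sum_right sum.cartesian_product case_prod_beta)
qed

lemma bracket_spectral:
 assumes "finite L" "(\<Sum>k\<in>L. E k) = mat 1" shows "bracket (\<Sum>k\<in>L. cscale (c k) (E k)) Y =
  (\<Sum>x\<in>L \<times> L. cscale (c (fst x) - c (snd x)) (E (fst x) ** Y ** E (snd x)))"
proof -
 have "(\<Sum>k\<in>L. cscale (c k) (E k)) ** Y = (\<Sum>k\<in>L. cscale (c k) (E k)) ** Y ** (\<Sum>n\<in>L. E n)"
  using assms(2) by simp
 also have "\<dots> = (\<Sum>x\<in>L \<times> L. cscale (c (fst x)) (E (fst x) ** Y ** E (snd x)))"
  by (simp add: matrix_sum_product cscale_mult_left)
 finally have 1: "(\<Sum>k\<in>L. cscale (c k) (E k)) ** Y = (\<Sum>x\<in>L \<times> L. cscale (c (fst x)) (E (fst x) ** Y ** E (snd x)))" .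
 have "Y ** (\<Sum>k\<in>L. cscale (c k) (E k)) = (\<Sum>n\<in>L. E n) ** Y ** (\<Sum>k\<in>L. cscale (c k) (E k))"
  using assms(2) by simp
 also have "\<dots> = (\<Sum>x\<in>L \<times> L. cscale (c (snd x)) (E (fst x) ** Y ** E (snd x)))"
  by (simp add: matrix_sum_product cscale_mult_right)
 finally show ?thesis unfolding bracket_def 1 by (simp add: sum_subtractf cmat.scale_left_diff_distrib)
qed

text \<open>The operators \<open>Y \<mapsto> E c ** Y ** E d\<close>, grouped by the difference
  \<open>c - d\<close>, are the spectral projections of \<open>adm X\<close>. Conjugation respects
  differences, so \<open>adm\<close> carries the conjugate replica of \<open>X\<close> to that of
  \<open>adm X\<close>.\<close>

lemma spectral_adm:
 assumes S: "spectral L E N" and X: "X = (\<Sum>k\<in>L. cscale k (E k)) + N"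
 shows "EX L' F. spectral L' F (adm N) & adm X = (\<Sum>m\<in>L'. cscale m (F m)) + adm N &
  adm (\<Sum>k\<in>L. cscale (cnj k) (E k)) = (\<Sum>m\<in>L'. cscale (cnj m) (F m))"
proof -
 have fin: "finite L" and one: "(\<Sum>k\<in>L. E k) = mat 1"
  and orth: "!!k m. k : L ==> m : L ==> E k ** E m = (if k = m then E k else 0)"
  and com: "!!k. k : L ==> N ** E k = E k ** N" and N: "nilpotent_mat N" using S by (auto simp: spectral_def)
 let ?I = "L \<times> L" and ?g = "%x. fst x - snd x"
 let ?L = "?g ` ?I"
 define e where "e x = opm (%Y. E (fst x) ** Y ** E (snd x))" for x
 define F where "F m = (\<Sum>x\<in>{x:?I. ?g x = m}. e x)" for m
 have group: "(\<Sum>m\<in>?L. cscale (c m) (F m)) = (\<Sum>x\<in>?I. cscale (c (?g x)) (e x))" for c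
 proof -
  have "(\<Sum>m\<in>?L. cscale (c m) (F m)) = (\<Sum>m\<in>?L. \<Sum>x\<in>{x:?I. ?g x = m}. cscale (c (?g x)) (e x))"
   unfolding F_def cscale_sum by (intro sum.cong refl) auto
  also have "\<dots> = (\<Sum>x\<in>?I. cscale (c (?g x)) (e x))" using fin by (intro sum.group) auto
  finally show ?thesis .
 qed
 have diag: "adm (\<Sum>k\<in>L. cscale (c k) (E k)) = (\<Sum>x\<in>?I. cscale (c (fst x) - c (snd x)) (e x))" for c
  unfolding adm_def e_def opm_cscale opm_sum by (rule arg_cong[of _ _ opm], rule ext) (rule bracket_spectral[OF fin one])
 have ee: "e x ** e y = (if x = y then e x else 0)" if "x : ?I" "y : ?I" for x y
 proof -
  have "E (fst x) ** (E (fst y) ** Y ** E (snd y)) ** E (snd x) =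
    (E (fst x) ** E (fst y)) ** Y ** (E (snd y) ** E (snd x))" for Y by (simp add: matrix_mul_assoc)
  moreover have "E (fst x) ** E (fst y) = (if fst x = fst y then E (fst x) else 0)"
   "E (snd y) ** E (snd x) = (if snd x = snd y then E (snd x) else 0)" using that orth by auto
  ultimately show ?thesis by (auto simp: e_def opm_mult lin_simps opm_zero prod_eq_iff)
 qed
 have "spectral ?L F (adm N)" unfolding spectral_def
 proof (intro conjI ballI)
  show "finite ?L" using fin by simp
  have "(\<Sum>m\<in>?L. F m) = (\<Sum>x\<in>?I. e x)" using group[of "%_. 1"] by simp
  also have "\<dots> = opm (%Y. \<Sum>x\<in>?I. E (fst x) ** Y ** E (snd x))" by (simp add: e_def opm_sum)
  also have "(%Y. \<Sum>x\<in>?I. E (fst x) ** Y ** E (snd x)) = (%Y. (\<Sum>k\<in>L. E k) ** Y ** (\<Sum>n\<in>L. E n))"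
   by (simp only: matrix_sum_product)
  finally show "(\<Sum>m\<in>?L. F m) = mat 1" by (simp add: one opm_id)
  show "nilpotent_mat (adm N)" by (rule nilpotent_adm[OF N])
 next
  fix m m' assume "m : ?L" "m' : ?L"
  have fi: "finite {x:?I. ?g x = m}" for m using fin by simp
  have "F m ** F m' = (\<Sum>x\<in>{x:?I. ?g x = m}. e x ** (\<Sum>y\<in>{x:?I. ?g x = m'}. e y))"
   unfolding F_def by (rule matrix_sum_left)
  also have "\<dots> = (\<Sum>x\<in>{x:?I. ?g x = m}. \<Sum>y\<in>{x:?I. ?g x = m'}. if y = x then e x else 0)"
   unfolding matrix_sum_right by (intro sum.cong refl) (auto simp: ee)
  also have "\<dots> = (\<Sum>x\<in>{x:?I. ?g x = m}. if m = m' then e x else 0)"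
   using fi by (intro sum.cong refl) auto
  also have "\<dots> = (if m = m' then F m else 0)" by (simp add: F_def)
  finally show "F m ** F m' = (if m = m' then F m else 0)" .
 next
  fix m assume "m : ?L"
  have "adm N ** e x = e x ** adm N" if "x : ?I" for x
  proof -
   have "bracket N (E (fst x) ** Y ** E (snd x)) = E (fst x) ** bracket N Y ** E (snd x)" for Y
   proof -
    have "N ** E (fst x) = E (fst x) ** N" "E (snd x) ** N = N ** E (snd x)" using com that by auto
    moreover have "E (fst x) ** Y ** E (snd x) ** N = E (fst x) ** Y ** (E (snd x) ** N)" by (simp add: matrix_mul_assoc)
    ultimately show ?thesis by (simp add: bracket_def matrix_diff_ldistrib matrix_diff_rdistrib matrix_mul_assoc)
   qed
   then show ?thesis by (simp add: adm_def e_def opm_mult lin_simps)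
  qed
  then show "adm N ** F m = F m ** adm N" unfolding F_def matrix_sum_left matrix_sum_right by (intro sum.cong) auto
 qed
 moreover have "adm X = (\<Sum>m\<in>?L. cscale m (F m)) + adm N"
 proof -
  have "adm X = adm (\<Sum>k\<in>L. cscale k (E k)) + adm N"
   unfolding X by (rule opm_eqI) (simp add: adm_vec bracket_add_left vecm_add matrix_vector_mult_add_rdistrib)
  then show ?thesis using diag[of "%k. k"] group[of "%k. k"] by simp
 qed
 moreover have "adm (\<Sum>k\<in>L. cscale (cnj k) (E k)) = (\<Sum>m\<in>?L. cscale (cnj m) (F m))"
  using diag[of cnj] group[of cnj] by simp ultimately show ?thesis by (intro exI conjI)
qed

subsection \<open>Coinvariants\<close>

text \<open>Let \<open>k\<close> be the kernel of \<open>f\<close>, and \<open>n\<close> the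
  elements orthogonal to \<open>k\<close> whose images are orthogonal to the image of
  \<open>f\<close>. Conjugate replicas of elements of \<open>n\<close> lie in \<open>k\<close>, so
  \<open>n\<close> is an ideal of nilpotent elements; hence it lies in \<open>rad a\<close> and
  \<open>f\<close> kills it.\<close>

lemma RED_image:
 fixes G :: "(complex^'n^'n) set" and f :: "complex^'n^'n => complex^'j^'j"
 assumes G: "alg_group G" and g: "a = lie_algebra G" and add: "!!X Y. X : a ==> Y : a ==> f (X + Y) = f X + f Y"
  and scale: "!!c X. X : a ==> f (cscale c X) = cscale c (f X)"
  and br: "!!X Y. X : a ==> Y : a ==> f (bracket X Y) = bracket (f X) (f Y)" and rad0: "!!X. X : rad a ==> f X = 0"
  and rep: "!!X L E N. X : a ==> spectral L E N ==> X = (\<Sum>z\<in>L. cscale z (E z)) + N ==>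
   ALL Y:a. trace (f X ** f Y) = 0 ==> f (\<Sum>z\<in>L. cscale (cnj z) (E z)) = 0" shows "RED (f ` a)"
proof -
 have sub: "cmat.subspace a" unfolding g by (rule lie_algebra_subspace)
 have brg: "bracket X Y : a" if "X : a" "Y : a" for X Y using that bracket_lie_algebra[OF G] by (simp add: g)
 have f0: "f 0 = 0" using scale[OF cmat.subspace_0[OF sub], of 0] by simp
 define k where "k = {X : a. f X = 0}"
 define n where "n = {X : a. (ALL Y:a. trace (f X ** f Y) = 0) & (ALL Y:k. trace (X ** Y) = 0)}"
 have kg: "X : a" if "X : k" for X using that by (simp add: k_def)
 have k: "cmat.subspace k"
  by (intro cmat.subspaceI) (auto simp: k_def cmat.subspace_0[OF sub] cmat.subspace_add[OF sub] cmat.subspace_scale[OF sub] f0 add scale)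
 have n: "cmat.subspace n"
  by (intro cmat.subspaceI) (auto simp: n_def cmat.subspace_0[OF sub] cmat.subspace_add[OF sub] cmat.subspace_scale[OF sub] f0 add scale
    trace_left_add trace_left_scale)
 have inv: "trace (bracket Z X ** Y) = - trace (X ** bracket Z Y)" for X Y Z :: "complex^'i^'i"
  using trace_bracket[of X Z Y] bracket_minus[of Z X] trace_left_diff[of 0 "bracket X Z" Y] by simp
 have n_rad: "X : rad a" if X: "X : n" for X
 proof -
  have "trace (X ** Y) = 0" if Y: "Y : a" for Y
  proof (rule trace_nilpotent_ideal[OF n _ _ _ X Y])
   show "n \<subseteq> a" by (auto simp: n_def)
   fix Z W assume Z: "Z : a" and W: "W : n"
   then have W': "W : a" "ALL Y:a. trace (f W ** f Y) = 0" "ALL Y:k. trace (W ** Y) = 0" by (auto simp: n_def)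
   have "trace (f (bracket Z W) ** f Y) = 0" if Y: "Y : a" for Y
   using W'(2) brg[OF Z Y] by (fastforce simp: br Z W' Y inv)
   moreover have "trace (bracket Z W ** Y) = 0" if Y: "Y : k" for Y
   using Y brg[OF Z] br[OF Z] W'(3) by (simp add: k_def inv)
   ultimately show "bracket Z W : n" using brg[OF Z W'(1)] by (simp add: n_def)
  next
   fix W assume W: "W : n"
   then have W': "W : a" "ALL Y:a. trace (f W ** f Y) = 0" "ALL Y:k. trace (W ** Y) = 0" by (auto simp: n_def)
   obtain L e m where S: "spectral L (%z. mpoly (e z) W) (mpoly m W)"
    "W = (\<Sum>z\<in>L. cscale z (mpoly (e z) W)) + mpoly m W" by (rule spectral_decomposition)
   let ?W = "\<Sum>z\<in>L. cscale (cnj z) (mpoly (e z) W)"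
   have "?W : k" using replica(1)[OF G _ S] W'(1) rep[OF W'(1) S W'(2)] by (simp add: g k_def)
   then show "nilpotent_mat W" using W'(3) by (auto intro!: nilpotent_if_trace_replica_zero[OF S])
  qed
  then show ?thesis using X by (simp add: rad_def n_def)
 qed
 show ?thesis unfolding RED_def
 proof (intro ballI impI)
  fix x assume "x : f ` a" and x0: "ALL y:f ` a. trace (x ** y) = 0"
  then obtain X where X: "x = f X" "X : a" by blast
  have "EX Z:k. ALL W:k. trace (X ** W) = trace (W ** Z)"
  proof (rule pairing_represents[OF k k trace_form_on])
   show "clinear_on k (*) (%W. trace (X ** W))" by (simp add: clinear_on_def trace_right_add trace_right_scale)
   fix W assume W: "W : k" "ALL Y:k. trace (W ** Y) = 0"
   then have "W : n" by (simp add: n_def k_def)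
   from n_rad[OF this] X(2) show "trace (X ** W) = 0" by (simp add: rad_def trace_mul_sym[of X W])
  qed
  then obtain Z where Z: "Z : k" "ALL W:k. trace (X ** W) = trace (W ** Z)" by (rule bexE)
  \<comment> \<open>Subtracting the component along the kernel makes the lift of \<open>x\<close>
    orthogonal to the kernel, so it lies in \<open>n\<close>.\<close>
  let ?Y = "X + cscale (- 1) Z"
  have Zg: "cscale (- 1) Z : a" "f (cscale (- 1) Z) = 0"
  proof -
   show "cscale (- 1) Z : a" by (rule cmat.subspace_scale[OF sub kg[OF Z(1)]])
   show "f (cscale (- 1) Z) = 0" using Z(1) scale[OF kg[OF Z(1)], of "- 1"] by (simp add: k_def)
  qed
  have fY: "f ?Y = x" using X(1) add[OF X(2) Zg(1)] Zg(2) by simp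
  have "?Y : n" unfolding n_def
  proof (intro CollectI conjI ballI)
   show "?Y : a" using cmat.subspace_add[OF sub X(2) Zg(1)] .
   show "trace (f ?Y ** f Y) = 0" if "Y : a" for Y unfolding fY using x0 that by blast
   show "trace (?Y ** W) = 0" if "W : k" for W
    using bspec[OF Z(2) that] trace_mul_sym[of W Z] by (simp only: trace_left_add trace_left_scale) simp
  qed
  from rad0[OF n_rad[OF this]] show "x = 0" unfolding fY .
 qed
qed

text \<open>On the quotient of \<open>A\<close> by \<open>B\<close> the radical acts trivially, and
  \<open>RED_image\<close> makes the trace form of every image cut out by an invariant idempotent
  nondegenerate. Then \<open>invariants_not_image\<close> says that an invariant in the span of the
  images of the action is 0.\<close>

theorem coinvariants:
 fixes G A B :: "(complex^'n^'n) set" assumes G: "alg_group G" and g: "d = lie_algebra G"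
  and AB: "cmat.subspace A" "cmat.subspace B" "B \<subseteq> A"
  and gA: "!!X Y. X : d ==> Y : A ==> bracket X Y : A" and gB: "!!X Y. X : d ==> Y : B ==> bracket X Y : B"
  and rad_A: "!!X Y. X : rad d ==> Y : A ==> bracket X Y : B"
  and x: "x : A" "!!X. X : d ==> bracket X x : B" "x : cmat.span ({bracket X Y | X Y. X : d & Y : A} \<union> B)"
 shows "x : B"
proof -
 have sub: "cmat.subspace d" unfolding g by (rule lie_algebra_subspace)
 have brg: "bracket X Y : d" if "X : d" "Y : d" for X Y using that bracket_lie_algebra[OF G] by (simp add: g)
 have vs: "vec.subspace (vecm ` V)" if V: "cmat.subspace V" for V :: "(complex^'n^'n) set"
  unfolding vec.subspace_def
  by (auto simp: cmat.subspace_0[OF V] simp flip: vecm_add vecm_cscale intro!: imageI cmat.subspace_add[OF V] cmat.subspace_scale[OF V]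
    image_eqI[of 0 vecm 0])
 obtain eA where eA: "ALL x. eA *v x : vecm ` A" "ALL x:vecm ` A. eA *v x = x" using projection_exists[OF vs[OF AB(1)]] by (elim exE conjE)
 obtain eB where eB: "ALL x. eB *v x : vecm ` B" "ALL x:vecm ` B. eB *v x = x" using projection_exists[OF vs[OF AB(2)]] by (elim exE conjE)
 \<comment> \<open>A projection onto a complement of \<open>B\<close> in \<open>A\<close>, serving
   as a model of \<open>A / B\<close>.\<close>
 define P where "P = (mat 1 - eB) ** eA"
 have Px: "P *v x = eA *v x - eB *v (eA *v x)" for x
  by (simp add: P_def matrix_vector_mult_diff_rdistrib matrix_diff_rdistrib flip: matrix_vector_mul_assoc)
 have PB: "P *v vecm b = 0" if "b : B" for b using that AB(3) eA(2) eB(2) by (auto simp: Px)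
 have PA: "EX b:B. P *v vecm a = vecm (a - b)" if a: "a : A" for a
 proof -
  obtain b where "eB *v vecm a = vecm b" "b : B" using eB(1) by blast
  then show ?thesis using a eA(2) by (intro bexI[of _ b]) (simp_all add: Px vecm_diff)
 qed
 have P_in: "EX a:A. P *v y = vecm a" for y
 proof -
  obtain a where a: "eA *v y = vecm a" "a : A" using eA(1) by blast
  obtain b where b: "eB *v vecm a = vecm b" "b : B" using eB(1) by blast
  have "P *v y = vecm (a - b)" by (simp add: Px a b vecm_diff)
  then show ?thesis using cmat.subspace_diff[OF AB(1) a(2)] b(2) AB(3) by blast
 qed
 have PP: "P ** P = P"
 proof (rule matrix_eqI)
  fix y
  obtain a where a: "a : A" "P *v y = vecm a" using P_in by blast
  obtain b where b: "b : B" "eA *v y = vecm a + vecm b" using a(2) eB(1) by (metis Px diff_eq_eq imageE)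
  obtain b' where b': "b' : B" "P *v vecm a = vecm (a - b')" using PA[OF a(1)] by blast
  have "vecm b' = vecm 0"
   using b'(2) a(1) eA(2) b(2) a(2) eB(2) b(1) by (simp add: Px vecm_diff matrix_vector_right_distrib)
  then have "b' = 0" by (simp only: vecm_inj)
  then show "P ** P *v y = P *v y" using b'(2) a(2) by (simp flip: matrix_vector_mul_assoc)
 qed
 \<comment> \<open>The operator induced on \<open>A / B\<close>. Compression is multiplicative only
   for operators preserving both \<open>A\<close> and \<open>B\<close>, which is what
   \<open>st\<close> records.\<close>
 define comp where "comp T = P ** T ** P" for T
 define st where "st T \<longleftrightarrow> (ALL a:A. EX a':A. T *v vecm a = vecm a') & (ALL b:B. EX b':B. T *v vecm b = vecm b')" for T
 have comp_add: "comp (T + S) = comp T + comp S" and comp_scale: "comp (cscale c T) = cscale c (comp T)" for T S c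
  by (simp_all add: comp_def matrix_add_ldistrib matrix_add_rdistrib cscale_mult_left cscale_mult_right)
 have comp_diff: "comp (T - S) = comp T - comp S" for T S
  by (simp add: comp_def matrix_diff_ldistrib matrix_diff_rdistrib)
 have comp_mult: "comp (T ** S) = comp T ** comp S" if "st T" "st S" for T S
 proof (rule matrix_eqI)
  fix y
  obtain a where a: "a : A" "P *v y = vecm a" using P_in by blast
  obtain a1 where a1: "a1 : A" "S *v vecm a = vecm a1" using \<open>st S\<close> a(1) unfolding st_def by blast
  obtain b where b: "b : B" "P *v vecm a1 = vecm (a1 - b)" using PA[OF a1(1)] by blast
  obtain b' where b': "b' : B" "T *v vecm b = vecm b'" using \<open>st T\<close> b(1) unfolding st_def by blast
  have "comp T ** comp S *v y = P *v (T *v (P *v (P *v (S *v (P *v y)))))"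
   by (simp add: comp_def flip: matrix_vector_mul_assoc)
  also have "\<dots> = P *v (T *v (P ** P *v vecm a1))" by (simp add: a(2) a1(2) matrix_vector_mul_assoc)
  also have "\<dots> = P *v (T *v vecm a1) - P *v vecm b'"
   by (simp add: PP b(2) vecm_diff matrix_vector_mult_diff_distrib b'(2))
  also have "\<dots> = comp (T ** S) *v y"
   using PB[OF b'(1)] by (simp add: comp_def a(2) a1(2) flip: matrix_vector_mul_assoc)
  finally show "comp (T ** S) *v y = comp T ** comp S *v y" by simp
 qed
 have st_mpoly: "st (mpoly p T)" if T: "st T" for p T
 proof (induction p)
  case 0
  then show ?case using cmat.subspace_0[OF AB(1)] cmat.subspace_0[OF AB(2)] by (auto simp: st_def intro!: bexI[of _ 0])
 next
  case (pCons c p)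
  have *: "EX v':V. mpoly (pCons c p) T *v vecm v = vecm v'"
   if V: "cmat.subspace V" "ALL v:V. EX v':V. T *v vecm v = vecm v'" "ALL v:V. EX v':V. mpoly p T *v vecm v = vecm v'" "v : V" for V v
  proof -
   obtain v' where v': "v' : V" "mpoly p T *v vecm v = vecm v'" using V(3,4) by blast
   obtain w where w: "w : V" "T *v vecm v' = vecm w" using V(2) v'(1) by blast
   have "mpoly (pCons c p) T *v vecm v = vecm (cscale c v + w)"
    by (simp add: matrix_vector_mult_add_rdistrib cscale_matrix_vector vecm_add vecm_cscale v'(2) w(2) flip: matrix_vector_mul_assoc)
   then show ?thesis using cmat.subspace_add[OF V(1) cmat.subspace_scale[OF V(1) V(4)] w(1)] by blast
  qed
  show ?case using *[OF AB(1)] *[OF AB(2)] T pCons.IH unfolding st_def by blast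
 qed
 have st_adm: "st (adm X)" if "X : d" for X using gA[OF that] gB[OF that] unfolding st_def adm_vec by blast
 define r where "r X = comp (adm X)" for X
 have adm_lin: "adm (X + Y) = adm X + adm Y" "adm (cscale c X) = cscale c (adm X)"
  "adm (bracket X Y) = adm X ** adm Y - adm Y ** adm X" for X Y c
  by (rule opm_eqI; simp add: adm_vec bracket_add_left bracket_cscale_left vecm_add vecm_cscale cscale_matrix_vector
    matrix_vector_mult_add_rdistrib matrix_vector_mult_diff_rdistrib jacobi[of X Y] vecm_diff flip: matrix_vector_mul_assoc)+
 have r_add: "r (X + Y) = r X + r Y" and r_scale: "r (cscale c X) = cscale c (r X)" for X Y c
  by (simp_all add: r_def adm_lin comp_add comp_scale)
 have r_br: "r (bracket X Y) = bracket (r X) (r Y)" if "X : d" "Y : d" for X Y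
  using comp_mult[OF st_adm st_adm] that by (simp only: r_def adm_lin comp_diff bracket_def[of "comp (adm X)"])
 have Pr: "P ** r X = r X" "r X ** P = r X" for X
  by (simp add: r_def comp_def matrix_mul_assoc PP) (simp add: r_def comp_def PP flip: matrix_mul_assoc)
 have r_rad: "r X = 0" if "X : rad d" for X
 proof (rule matrix_eqI)
  fix y
  obtain a where a: "a : A" "P *v y = vecm a" using P_in by blast
  show "r X *v y = 0 *v y"
   using PB[OF rad_A[OF that a(1)]] by (simp add: r_def comp_def a(2) adm_vec flip: matrix_vector_mul_assoc)
 qed
 have r_vec: "r X *v (P *v vecm a) = P *v vecm (bracket X a)" if X: "X : d" and a: "a : A" for X a
 proof -
  obtain b where b: "b : B" "P *v vecm a = vecm (a - b)" using PA[OF a] by blast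
  have "r X *v (P *v vecm a) = P *v (adm X *v (P ** P *v vecm a))"
   by (simp add: r_def comp_def matrix_vector_mul_assoc matrix_mul_assoc)
  also have "\<dots> = P *v vecm (bracket X a) - P *v vecm (bracket X b)"
   by (simp add: PP b(2) adm_vec bracket_diff_right vecm_diff matrix_vector_mult_diff_distrib)
  finally show ?thesis using PB[OF gB[OF X b(1)]] by simp
 qed
 have "P *v vecm x = 0"
 proof (rule invariants_not_image[OF PP, of "r ` d"])
  show "cmat.subspace (r ` d)"
  proof (rule cmat.subspaceI)
   show "0 : r ` d" using r_scale[of 0 0] cmat.subspace_0[OF sub] by (intro image_eqI[of _ _ 0]) simp_all
  next
   fix X Y assume "X : r ` d" "Y : r ` d"
   then obtain X' Y' where "X = r X'" "Y = r Y'" "X' : d" "Y' : d" by blast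
   then show "X + Y : r ` d" using cmat.subspace_add[OF sub] by (intro image_eqI[of _ _ "X' + Y'"]) (simp_all add: r_add)
  next
   fix c X assume "X : r ` d"
   then obtain X' where "X = r X'" "X' : d" by blast
   then show "cscale c X : r ` d" using cmat.subspace_scale[OF sub] by (intro image_eqI[of _ _ "cscale c X'"]) (simp_all add: r_scale)
  qed
  show "P ** X = X" "X ** P = X" if "X : r ` d" for X using that Pr by auto
  show "bracket X Y : r ` d" if "X : r ` d" "Y : r ` d" for X Y
  proof -
   obtain X' Y' where "X = r X'" "Y = r Y'" "X' : d" "Y' : d" using \<open>X : r ` d\<close> \<open>Y : r ` d\<close> by blast
   then show ?thesis using brg by (intro image_eqI[of _ _ "bracket X' Y'"]) (simp_all add: r_br)
  qed
  show "P *v (P *v vecm x) = P *v vecm x" by (simp add: matrix_vector_mul_assoc PP)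
  show "X *v (P *v vecm x) = 0" if "X : r ` d" for X
  using \<open>X : r ` d\<close> PB[OF x(2)] by (auto simp: r_vec x(1))
  show "P *v vecm x : vec.span {X *v w | X w. X : r ` d}" using x(3)
  proof (induction rule: cmat.span_induct_alt)
   case (step c y z)
   have "P *v vecm y : vec.span {X *v w | X w. X : r ` d}"
   proof (cases "y : B")
    case True
    then show ?thesis using PB by (simp add: vec.span_zero)
   next
    case False
    then obtain X a where "y = bracket X a" "X : d" "a : A" using step by blast
    then have "P *v vecm y = r X *v (P *v vecm a)" by (simp add: r_vec)
    then show ?thesis using \<open>X : d\<close> by (intro vec.span_base) blast
   qed
   then show ?case using step
    by (simp add: vecm_add vecm_cscale matrix_vector_right_distrib vector_scalar_commute vec.span_add vec.span_scale)
  qed (simp add: vec.span_zero)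
  fix R assume R: "R ** R = R" "P ** R = R" "R ** P = R" and Rcom': "!!X. X : r ` d ==> R ** X = X ** R"
  have Rcom: "R ** r X = r X ** R" if "X : d" for X using Rcom' that by blast
  have Rr: "R ** A ** (R ** B) = R ** (A ** B)" if "R ** A = A ** R" for A B :: "complex^('n \<times> 'n)^('n \<times> 'n)"
  by (metis R(1) matrix_mul_assoc that[symmetric])
  have "RED ((%X. R ** r X) ` d)"
  proof (rule RED_image[OF G g])
   show "R ** r (X + Y) = R ** r X + R ** r Y" for X Y by (simp add: r_add matrix_add_ldistrib)
   show "R ** r (cscale c X) = cscale c (R ** r X)" for c X by (simp add: r_scale cscale_mult_right)
   show "R ** r (bracket X Y) = bracket (R ** r X) (R ** r Y)" if "X : d" "Y : d" for X Y
    unfolding r_br[OF that] unfolding bracket_def by (simp only: matrix_diff_ldistrib Rr[OF Rcom[OF that(1)]] Rr[OF Rcom[OF that(2)]])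
   show "R ** r X = 0" if "X : rad d" for X by (simp add: r_rad[OF that])
   fix X L E N assume X: "X : d" and S: "spectral L E N" "X = (\<Sum>k\<in>L. cscale k (E k)) + N"
    and zero: "ALL Y:d. trace (R ** r X ** (R ** r Y)) = 0"
   let ?S = "\<Sum>k\<in>L. cscale (cnj k) (E k)"
   obtain L' F where F: "spectral L' F (adm N)" "adm X = (\<Sum>m\<in>L'. cscale m (F m)) + adm N"
    "adm ?S = (\<Sum>m\<in>L'. cscale (cnj m) (F m))" using spectral_adm[OF S] by (elim exE conjE)
   have Sg: "?S : d" using replica(1)[OF G _ S] X by (simp add: g)
   \<comment> \<open>Followed by \<open>R\<close>, compression is still multiplicative on
     polynomials in \<open>adm X\<close>, so \<open>spectral_trace_positive\<close> applies on the
     image of \<open>R\<close>.\<close>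
   define h where "h T = R ** comp T" for T
   have h_lin: "h (X + Y) = h X + h Y" "h (cscale c X) = cscale c (h X)" for X Y c
    by (simp_all add: h_def comp_add comp_scale matrix_add_ldistrib cscale_mult_right)
   have com: "R ** comp (mpoly p (adm X)) = comp (mpoly p (adm X)) ** R" for p
   proof (induction p)
    case 0
    then show ?case by (simp add: comp_def)
   next
    case (pCons c p)
    have "comp (mpoly (pCons c p) (adm X)) = cscale c P + r X ** comp (mpoly p (adm X))"
     by (simp add: comp_add comp_mult st_adm[OF X] st_mpoly r_def) (simp add: comp_def PP cscale_mult_left cscale_mult_right)
    moreover have "R ** (r X ** comp (mpoly p (adm X))) = r X ** comp (mpoly p (adm X)) ** R"
    by (metis matrix_mul_assoc Rcom[OF X] pCons.IH) ultimately show ?case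
     by (simp add: matrix_add_ldistrib matrix_add_rdistrib cscale_mult_left cscale_mult_right R)
   qed
   have h_mult: "h (mpoly p (adm X) ** mpoly q (adm X)) = h (mpoly p (adm X)) ** h (mpoly q (adm X))" for p q
    by (simp only: h_def comp_mult[OF st_mpoly st_mpoly] st_adm[OF X] Rr[OF com])
   have "trace (h (adm X) ** h (\<Sum>m\<in>L'. cscale (cnj m) (F m))) = 0"
    using bspec[OF zero Sg] by (simp only: h_def r_def F(3))
   from spectral_trace_positive[OF F(1,2) h_lin h_mult this] have h0: "h (F m) = 0" if "m : L'" "m \<noteq> 0" for m
    using that by blast
   have h_zero: "h 0 = 0" by (simp add: h_def comp_def)
   have hsum: "h (\<Sum>i\<in>I. f i) = (\<Sum>i\<in>I. h (f i))" for f :: "complex => complex^('n \<times> 'n)^('n \<times> 'n)" and I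
    by (induction I rule: infinite_finite_induct) (simp_all add: h_zero h_lin(1))
   have "h (adm ?S) = (\<Sum>m\<in>L'. cscale (cnj m) (h (F m)))" unfolding F(3) hsum by (simp add: h_lin)
   also have "\<dots> = 0" using h0 by (fastforce intro: sum.neutral ballI)
   finally show "R ** r ?S = 0" by (simp only: h_def r_def)
  qed
  then show "RED ((**) R ` r ` d)" by (simp add: image_image)
 qed
 moreover obtain b where "b : B" "P *v vecm x = vecm (x - b)" using PA[OF x(1)] by blast
 ultimately have "vecm (x - b) = vecm 0" by simp
 then have "x - b = 0" by (simp only: vecm_inj)
 then show ?thesis using \<open>b : B\<close> by simp
qed

subsection \<open>The adjoint representation as a morphism of algebraic groups\<close>

lemma polys_pullback:
 assumes "p : polys F'" "!!f. f : F' ==> EX g:polys F. ALL x:S. g x = f (h x)"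
 shows "EX g:polys F. ALL x:S. g x = p (h x)" using assms(1)
proof induction
 case (polys_const c)
 then show ?case by (intro bexI[of _ "%_. c"] polys.polys_const) simp
next
 case (polys_coord f)
 then show ?case by (rule assms(2))
next
 case (polys_add p q)
 from polys_add.IH obtain g g' where "g : polys F" "ALL x:S. g x = p (h x)" "g' : polys F" "ALL x:S. g' x = q (h x)"
  by (elim bexE)
 then show ?case by (intro bexI[of _ "%x. g x + g' x"] polys.polys_add) auto
next
 case (polys_mult p q)
 from polys_mult.IH obtain g g' where "g : polys F" "ALL x:S. g x = p (h x)" "g' : polys F" "ALL x:S. g' x = q (h x)"
  by (elim bexE)
 then show ?case by (intro bexI[of _ "%x. g x * g' x"] polys.polys_mult) auto
qed

lemma closedin_zariski_preimage:
 assumes C: "closedin (zariski S' F') C" and h: "!!x. x : S ==> h x : S'"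
  and F: "!!f. f : F' ==> EX g:polys F. ALL x:S. g x = f (h x)" shows "closedin (zariski S F) {x : S. h x : C}"
proof -
 obtain P where P: "P \<subseteq> polys F'" "C = {x : S'. ALL p:P. p x = 0}"
  using C unfolding closedin_zariski by (elim exE conjE)
 let ?R = "{g : polys F. EX p:P. ALL x:S. g x = p (h x)}"
 have "{x : S. h x : C} = {x : S. ALL g:?R. g x = 0}"
 proof (intro equalityI subsetI)
  fix x assume "x : {x : S. h x : C}"
  then show "x : {x : S. ALL g:?R. g x = 0}" unfolding P(2) by auto
 next
  fix x assume x: "x : {x : S. ALL g:?R. g x = 0}"
  have "p (h x) = 0" if p: "p : P" for p
  proof -
   have "EX g:polys F. ALL x:S. g x = p (h x)"
   proof (rule polys_pullback[where p = p and F' = F' and F = F and S = S and h = h])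
    show "p : polys F'" using P(1) p by blast
    show "EX g:polys F. ALL x:S. g x = f (h x)" if "f : F'" for f by (rule F[OF that])
   qed
   then obtain g where g: "g : polys F" "ALL x:S. g x = p (h x)" by (rule bexE)
   then have "g : ?R" using p by blast
   moreover have xS: "x : S" and "ALL g:?R. g x = 0" using x by simp_all
   ultimately have "g x = 0" by (simp only:)
   then show ?thesis using bspec[OF g(2) xS] by simp
  qed
  moreover have "x : S" using x by simp
  ultimately show "x : {x : S. h x : C}" using h by (simp add: P(2))
 qed
 then show ?thesis unfolding closedin_zariski by (intro exI[of _ ?R] conjI) simp_all
qed

lemma subtopology_zariski: "S \<subseteq> T ==> subtopology (zariski T F) S = zariski S F"
 unfolding topology_eq openin_subtopology openin_zariski
by auto

abbreviation Ad_on :: "(complex^'n^'n) set => complex^'n^'n => complex^'n^'n => complex^'n^'n" where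
 "Ad_on V g \<equiv> zero_ext V (Ad g)"

definition GL_coords :: "(complex^'n^'n) set => ((complex^'n^'n => complex^'n^'n) => complex) set" where
 "GL_coords V = {(%h. f (h v)) | f v. f : dual V & v : V}"

lemma zariski_GL_coords: "zariski_GL V = zariski (carrier (GL V)) (GL_coords V)"
 by (simp add: zariski_GL_def GL_coords_def)

lemma GL_carrierD:
 assumes "f : carrier (GL V)"
 shows "X : V ==> f X : V" "X \<notin> V ==> f X = 0" "X : V ==> Y : V ==> f (X + Y) = f X + f Y"
  "X : V ==> f (cscale c X) = cscale c (f X)"
proof -
 have f: "clinear_on V cscale f" "bij_betw f V V" "zero_ext V f = f" using assms by (simp_all add: GL_def)
 show "X : V ==> f X : V" using f(2) by (auto simp: bij_betw_def)
 show "X \<notin> V ==> f X = 0" using fun_cong[OF f(3), of X] by (simp add: zero_ext_def)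
 show "X : V ==> Y : V ==> f (X + Y) = f X + f Y" "X : V ==> f (cscale c X) = cscale c (f X)"
  using f(1) by (auto simp: clinear_on_def)
qed

lemma Ad_on_GL:
 assumes G: "alg_group G" and V: "stable G V" and g: "g : G" shows "Ad_on V g : carrier (GL V)"
proof -
 have inv: "invertible g" by (rule alg_group_invertible[OF G g])
 have "bij_betw (Ad_on V g) V V"
 using stableD[OF V alg_group_inv[OF G g]] stableD[OF V g] by (fastforce simp: zero_ext_def Ad_inv_left inv Ad_inv_right intro: bij_betw_byWitness[of _ "Ad (matrix_inv g)"])
 then show ?thesis using cmat.subspace_add[OF stable_subspace[OF V]] cmat.subspace_scale[OF stable_subspace[OF V]]
  by (auto simp: GL_def clinear_on_def zero_ext_def Ad_add Ad_cscale)
qed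

lemma Ad_on_mult:
 assumes G: "alg_group G" and V: "stable G V" and g: "g : G" and h: "h : G"
 shows "Ad_on V (g ** h) = Ad_on V g \<circ> Ad_on V h"
 using stableD[OF V h] by (auto simp: fun_eq_iff zero_ext_def Ad_mult alg_group_invertible[OF G] g h)

lemma Ad_on_one: "Ad_on V (mat 1) = \<one>\<^bsub>GL V\<^esub>"
 by (simp add: GL_def zero_ext_def fun_eq_iff)

lemma Ad_on_hom:
 assumes G: "alg_group G" and V: "stable G V" shows "group_hom (GLn\<lparr>carrier := G\<rparr>) (GL V) (Ad_on V)"
proof (intro group_hom.intro group_hom_axioms.intro homI)
 show "group (GLn\<lparr>carrier := G\<rparr>)"
  using G by (intro subgroup.subgroup_is_group[OF _ group_GLn]) (simp add: alg_group_def)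
 show "group (GL V)" by (rule group_GL[OF stable_subspace[OF V]])
 show "Ad_on V g : carrier (GL V)" if "g : carrier (GLn\<lparr>carrier := G\<rparr>)" for g
  using that Ad_on_GL[OF G V] by simp
 show "Ad_on V (g \<otimes>\<^bsub>GLn\<lparr>carrier := G\<rparr>\<^esub> h) = Ad_on V g \<otimes>\<^bsub>GL V\<^esub> Ad_on V h"
  if "g : carrier (GLn\<lparr>carrier := G\<rparr>)" "h : carrier (GLn\<lparr>carrier := G\<rparr>)" for g h
  using that Ad_on_mult[OF G V, of g h] by (simp add: mult_GLn) (simp add: GL_def)
qed

lemma Ad_on_subgroup:
 assumes G: "alg_group G" and V: "stable G V" shows "subgroup (Ad_on V ` G) (GL V)"
 using group_hom.img_is_subgroup[OF Ad_on_hom[OF assms]] by simp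

lemma Ad_on_inv:
 assumes G: "alg_group G" and V: "stable G V" and g: "g : G"
 shows "inv\<^bsub>GL V\<^esub> (Ad_on V g) = Ad_on V (matrix_inv g)"
using Ad_on_GL[OF G V] g alg_group_inv[OF G g] Ad_on_mult[OF G V alg_group_inv[OF G g] g] group.inv_equality[OF group_GL[OF stable_subspace[OF V]]] by (auto simp: matrix_inv_left[OF alg_group_invertible[OF G g]] Ad_on_one GL_def)

lemma Ad_on_coords:
 assumes V: "stable G V" and f: "f : GL_coords V" shows "EX p:regs. ALL g:G. p g = f (Ad_on V g)"
proof -
 obtain b v where f: "f = (%h. b (h v))" "b : dual V" "v : V" using f by (auto simp: GL_coords_def)
 obtain B where B: "b = res V B" using dual_res[OF stable_subspace[OF V] f(2)] by blast
 show ?thesis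
 proof (intro bexI ballI)
  show "(%g. trace (B ** Ad g v)) : regs" by (intro regs_trace regs_mult_entry regs_Ad polys_const)
  show "trace (B ** Ad g v) = f (Ad_on V g)" if "g : G" for g
   using stableD[OF V that f(3)] f(3) by (simp add: f(1) B zero_ext_def res_apply)
 qed
qed

lemma alg_group_zariski:
 assumes G: "alg_group G" and C: "closedin (zariski G reg_coords) C" shows "closedin zariski_GLn C"
by (metis G subgroup.subset C closedin_closed_subtopology[of zariski_GLn G C] alg_group_def zariski_GLn_regs subtopology_zariski)

lemma Ad_on_preimage:
 assumes G: "alg_group G" and V: "stable G V" and N: "subgroup N (GL V)" "closedin (zariski_GL V) N"
 shows "alg_group {g : G. Ad_on V g : N}"
proof (rule alg_groupI)
 have "closedin (zariski G reg_coords) {g : G. Ad_on V g : N}" using N(2) unfolding zariski_GL_coords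
  by (rule closedin_zariski_preimage) (use Ad_on_GL[OF G V] Ad_on_coords[OF V] in auto)
 then show "closedin zariski_GLn {g : G. Ad_on V g : N}" by (rule alg_group_zariski[OF G])
 show "mat 1 : {g : G. Ad_on V g : N}" using alg_group_one[OF G] subgroup.one_closed[OF N(1)] by (simp add: Ad_on_one)
 show "A ** B : {g : G. Ad_on V g : N}" if "A : {g : G. Ad_on V g : N}" "B : {g : G. Ad_on V g : N}" for A B
  using that alg_group_mult[OF G] subgroup.m_closed[OF N(1), of "Ad_on V A" "Ad_on V B"] Ad_on_mult[OF G V, of A B]
  by (simp add: GL_def)
 show "matrix_inv A : {g : G. Ad_on V g : N}" if "A : {g : G. Ad_on V g : N}" for A
  using that alg_group_inv[OF G] subgroup.m_inv_closed[OF N(1), of "Ad_on V A"] Ad_on_inv[OF G V, of A] by simp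
qed

lemma Ad_on_connected:
 assumes G: "alg_group G" and V: "stable G V" and con: "connectedin zariski_GLn G"
 shows "connectedin (zariski_GL V) (Ad_on V ` G)"
proof -
 have "continuous_map (zariski G reg_coords) (zariski_GL V) (Ad_on V)"
  unfolding continuous_map_closedin zariski_GL_coords topspace_zariski
 proof (intro conjI allI impI)
  show "Ad_on V : G \<rightarrow> carrier (GL V)" using Ad_on_GL[OF G V] by blast
  show "closedin (zariski G reg_coords) {g : G. Ad_on V g : C}" if "closedin (zariski (carrier (GL V)) (GL_coords V)) C" for C
   using that by (rule closedin_zariski_preimage) (use Ad_on_GL[OF G V] Ad_on_coords[OF V] in auto)
 qed
 moreover have "connectedin (zariski G reg_coords) G"
 proof -
  have "zariski G reg_coords = subtopology zariski_GLn G"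
   using G subgroup.subset unfolding alg_group_def zariski_GLn_regs by (subst subtopology_zariski) auto
  then show ?thesis using con by (simp add: connectedin_subtopology)
 qed
 ultimately show ?thesis by (rule connectedin_continuous_map_image)
qed

lemma projection_lin:
 assumes V: "cmat.subspace V" shows "EX p. lin p & (ALL Y. p Y : V) & (ALL Y:V. p Y = Y)"
proof -
 have "vec.subspace (vecm ` V)" unfolding vec.subspace_def
  by (auto simp: cmat.subspace_0[OF V] simp flip: vecm_add vecm_cscale intro!: imageI cmat.subspace_add[OF V] cmat.subspace_scale[OF V]
    image_eqI[of 0 vecm 0])
 then obtain e where e: "ALL x. e *v x : vecm ` V" "ALL x:vecm ` V. e *v x = x" using projection_exists by blast
 show ?thesis
 proof (intro exI conjI allI ballI)
  show "lin (%Y. unvec (e *v vecm Y))"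
   by (simp add: lin_def vecm_add vecm_cscale matrix_vector_right_distrib vector_scalar_commute)
    (simp add: unvec_def vec_eq_iff cscale_nth)
  show "unvec (e *v vecm Y) : V" for Y using e(1) by (metis image_iff unvec_vecm)
  show "unvec (e *v vecm Y) = Y" if "Y : V" for Y using e(2) that by simp
 qed
qed

lemma trace_elem: "trace (elem j i ** X) = X $ i $ j"
proof -
 have "trace (elem j i ** X) = (\<Sum>a\<in>UNIV. \<Sum>b\<in>UNIV. if a = j then (if b = i then X $ b $ a else 0) else 0)"
  unfolding trace_def matrix_matrix_mult_def elem_def by (auto intro!: sum.cong)
 also have "\<dots> = (\<Sum>a\<in>UNIV. if a = j then X $ i $ j else 0)" by (intro sum.cong refl) auto
 finally show ?thesis by simp
qed

text \<open>Each operator on \<open>V\<close> is extended by the identity on the kernel of a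
  projection \<open>p\<close> onto \<open>V\<close>. This embeds \<open>GL V\<close> into invertible
  matrices on the flattened matrix space, where \<open>closed_image\<close> is available.\<close>

lemma Ad_on_closed:
 fixes G :: "(complex^'n^'n) set" assumes G: "alg_group G" and V: "stable G V"
 shows "closedin (zariski_GL V) (Ad_on V ` G)"
proof -
 have sub: "cmat.subspace V" by (rule stable_subspace[OF V])
 obtain p where p: "lin p" "ALL Y. p Y : V" "ALL Y:V. p Y = Y" using projection_lin[OF sub] by (elim exE conjE)
 define M where "M h = opm (%Y. h (p Y) + (Y - p Y))" for h
 have lin: "lin (%Y. h (p Y) + (Y - p Y))" if "h : carrier (GL V)" for h
  using p(1,2) GL_carrierD(3,4)[OF that] by (simp add: lin_def cscale_add_right cscale_diff_right)
 have M_vec: "M h *v vecm Y = vecm (h (p Y) + (Y - p Y))" if "h : carrier (GL V)" for h Y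
  unfolding M_def by (rule opm_vec[OF lin[OF that]])
 have p_diff: "p (X - Y) = p X - p Y" for X Y
  using p(1) unfolding lin_def by (metis add_diff_cancel diff_add_cancel)
 have M_mult: "M (h \<circ> q) = M h ** M q" if h: "h : carrier (GL V)" and q: "q : carrier (GL V)" for h q
 proof (rule opm_eqI)
  fix Y
  have "p (q (p Y) + (Y - p Y)) = q (p Y)" using GL_carrierD(1)[OF q] p(2) p p_diff by (simp add: lin_def)
  moreover have "h \<circ> q : carrier (GL V)"
   using group.is_monoid[OF group_GL[OF sub]] monoid.m_closed[of "GL V" h q] h q by (simp add: GL_def)
  ultimately show "M (h \<circ> q) *v vecm Y = M h ** M q *v vecm Y"
   using h q by (simp add: M_vec flip: matrix_vector_mul_assoc)
 qed
 have M_one: "M \<one>\<^bsub>GL V\<^esub> = mat 1"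
  unfolding M_def using p(2) by (simp add: GL_def zero_ext_def opm_id)
 have M_inv: "invertible (M h)" if h: "h : carrier (GL V)" for h
 proof -
  let ?q = "inv\<^bsub>GL V\<^esub> h"
  interpret group "GL V" by (rule group_GL[OF sub])
  have "M (h \<otimes>\<^bsub>GL V\<^esub> ?q) = M h ** M ?q" "M (?q \<otimes>\<^bsub>GL V\<^esub> h) = M ?q ** M h"
   using M_mult h inv_closed[OF h] by (simp_all add: GL_def)
  then show ?thesis using h by (simp add: M_one invertible_def) metis
 qed
 have M_inj: "h = q" if h: "h : carrier (GL V)" and q: "q : carrier (GL V)" and eq: "M h = M q" for h q
 proof
  fix Y
  show "h Y = q Y"
  proof (cases "Y : V")
   case True
   show ?thesis using M_vec[OF h, of Y] M_vec[OF q, of Y] eq True p(3) by simp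
  qed (use GL_carrierD(2)[OF h] GL_carrierD(2)[OF q] in simp)
 qed
 define Q where "Q g = opm (%Y. Ad g (p Y) + (Y - p Y))" for g
 have Q: "Q g = M (Ad_on V g)" for g using p(2) by (simp add: Q_def M_def zero_ext_def)
 have "closedin zariski_GLn (Q ` G)"
 proof (rule closed_image[OF G])
  show "(%g. Q g $ i $ j) : regs" for i j
   by (simp add: Q_def opm_def) (intro polys_add regs_Ad polys_diff polys_const)
  have "group_hom (GL V) GLn M"
  proof (intro group_hom.intro group_hom_axioms.intro homI group_GL[OF sub] group_GLn)
   show "M h : carrier GLn" if "h : carrier (GL V)" for h using M_inv[OF that] by (simp add: carrier_GLn)
   show "M (h \<otimes>\<^bsub>GL V\<^esub> q) = M h \<otimes>\<^bsub>GLn\<^esub> M q" if "h : carrier (GL V)" "q : carrier (GL V)" for h q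
    using M_mult[OF that] unfolding mult_GLn by (simp add: GL_def)
  qed
  from group_hom.subgroup_img_is_subgroup[OF this Ad_on_subgroup[OF G V]]
  show "subgroup (Q ` G) GLn" by (simp add: Q image_image)
 qed
 then have "closedin (zariski (carrier (GL V)) (GL_coords V)) {h : carrier (GL V). M h : Q ` G}"
  unfolding zariski_GLn_def
 proof (rule closedin_zariski_preimage)
  show "M h : carrier GLn" if "h : carrier (GL V)" for h using M_inv[OF that] by (simp add: carrier_GLn)
  fix f :: "complex^('n \<times> 'n)^('n \<times> 'n) => complex" assume "f : entries"
  then obtain i j where f: "f = (%A. A $ i $ j)" by (rule entriesE)
  let ?v = "p (elem (fst j) (snd j))" and ?c = "(elem (fst j) (snd j) - p (elem (fst j) (snd j))) $ fst i $ snd i"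
  have "(%h. res V (elem (snd i) (fst i)) (h ?v) + ?c) : polys (GL_coords V)"
   using res_dual[OF sub] p(2) by (intro polys_add polys_const polys_coord) (auto simp: GL_coords_def)
  moreover have "res V (elem (snd i) (fst i)) (h ?v) + ?c = f (M h)" if "h : carrier (GL V)" for h
   using GL_carrierD(1)[OF that] p(2) by (simp add: res_apply trace_elem f M_def opm_def)
  ultimately show "EX g:polys (GL_coords V). ALL h:carrier (GL V). g h = f (M h)"
   by (intro bexI[of _ "%h. res V (elem (snd i) (fst i)) (h ?v) + ?c"] ballI)
 qed
 moreover have "{h : carrier (GL V). M h : Q ` G} = Ad_on V ` G"
 using M_inj[OF _ Ad_on_GL[OF G V]] Ad_on_GL[OF G V] by (auto simp: Q)
 ultimately show ?thesis by (simp add: zariski_GL_coords)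
qed

subsection \<open>Unipotent groups\<close>

lemma mexp_nilpotent_diff:
 fixes X :: "complex^'n^'n" assumes X: "nilpotent_mat X" "X : S" and a: "a : word_ann S (Suc j)"
 shows "mexp X t ** a - a : word_ann S j"
proof -
 obtain m where m: "mpow X m = 0" using X(1) by (auto simp: nilpotent_mat_iff)
 then have m': "mpow X (Suc m) = 0" by simp
 have "spectral {0} (%_. mat 1) X" using X(1) by (simp add: spectral_def)
 from mexp_spectral[OF this m', of X t]
 have "mexp X t = (\<Sum>i<Suc m. cscale (t ^ i / fact i) (mpow X i))" by simp
 also have "\<dots> = mat 1 + (\<Sum>i<m. cscale (t ^ Suc i / fact (Suc i)) (mpow X (Suc i)))"
  by (subst sum.lessThan_Suc_shift) simp
 finally have "mexp X t ** a - a = (\<Sum>i<m. cscale (t ^ Suc i / fact (Suc i)) (mpow X (Suc i) ** a))"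
  by (simp add: matrix_add_rdistrib matrix_sum_left cscale_mult_left del: mpow_simps(2))
 moreover have "mpow X (Suc i) ** a : word_ann S j" for i
 proof (induction i)
  case 0
  then show ?case using a X(2) by (simp add: word_ann_Suc)
 next
  case (Suc i)
  then show ?case using word_ann_mono[OF Suc] X(2) by (simp add: word_ann_Suc matrix_mul_assoc)
 qed
 ultimately show ?thesis
  by (simp only: cmat.subspace_sum[OF word_ann_subspace] cmat.subspace_scale[OF word_ann_subspace])
qed

text \<open>For every product \<open>A\<close> of exponentials, \<open>A - mat 1\<close> lowers the
  filtration \<open>word_ann r\<close>. The resulting identity \<open>mpow (A - mat 1) k = 0\<close>
  is polynomial and extends to the Zariski closure.\<close>

lemma unipotent_exp_closure:
 fixes r :: "(complex^'n^'n) set"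
 assumes k: "nil_products r k" and nil: "!!X. X : r ==> nilpotent_mat X" and g: "g : exp_closure r"
 shows "mpow (g - mat 1) k = 0"
proof -
 have gen: "A ** a - a : word_ann r j" if "A : exp_gen r" "a : word_ann r (Suc j)" for A a j using that
 proof (induction arbitrary: a)
  case exp_gen_one
  then show ?case by (simp add: cmat.subspace_0[OF word_ann_subspace])
 next
  case (exp_gen_step A X t)
  let ?b = "mexp X t ** a"
  have b: "?b - a : word_ann r j"
   by (rule mexp_nilpotent_diff[OF nil exp_gen_step(2) exp_gen_step(4)]) (rule exp_gen_step(2))
  have "(?b - a) + a : word_ann r (Suc j)"
   by (rule cmat.subspace_add[OF word_ann_subspace word_ann_mono[OF b] exp_gen_step(4)])
  then have "(A ** ?b - ?b) + (?b - a) : word_ann r j"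
   using exp_gen_step(3) b by (intro cmat.subspace_add[OF word_ann_subspace]) simp_all
  then show ?case by (simp add: matrix_mul_assoc)
 qed
 have "mpow (A - mat 1) j ** a = 0" if "A : exp_gen r" "a : word_ann r j" for A j a using that(2)
 proof (induction j arbitrary: a)
  case (Suc j)
  then have "mpow (A - mat 1) j ** ((A - mat 1) ** a) = 0"
   using gen[OF that(1)] by (intro Suc.IH) (simp add: matrix_diff_rdistrib)
  then show ?case unfolding mpow_Suc2 by (simp add: matrix_mul_assoc)
 qed (simp add: word_ann_0)
 from this[OF _ word_ann_nil[OF k], of _ "mat 1"] have exp_gen: "mpow (A - mat 1) k = 0" if "A : exp_gen r" for A
  using that by simp
 let ?P = "range (%(i, j) A. mpow (A - mat 1) k $ i $ j) :: (complex^'n^'n => complex) set"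
 have "(%A::complex^'n^'n. mpow (A - mat 1) m $ i $ j) : regs" for m i j
 proof (induction m arbitrary: i j)
  case (Suc m)
  have "(%A::complex^'n^'n. (A - mat 1) $ i $ j) : regs" for i j
   using polys_add[OF entry_regs polys_const, of i j "- mat 1 $ i $ j"] by simp
  then show ?case unfolding mpow_simps using Suc by (rule regs_mult_entry)
 qed (simp add: polys_const)
 then have "closedin zariski_GLn {A. invertible A & (ALL p:?P. p A = 0)}" by (intro closedin_GLn_regs) auto
 moreover have "exp_gen r \<subseteq> {A. invertible A & (ALL p:?P. p A = 0)}"
  using exp_gen exp_gen_invertible by auto
 ultimately have "exp_closure r \<subseteq> {A. invertible A & (ALL p:?P. p A = 0)}"
  unfolding exp_closure_def by (rule closure_of_minimal[rotated])
 then show ?thesis using g by (auto simp: vec_eq_iff)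
qed

text \<open>\<open>Ad g x - x\<close> is the bracket of \<open>g - 1\<close> with \<open>x\<close>,
  times the inverse of \<open>g\<close>, and these two operations commute. So the iterates are
  governed by powers of \<open>adm (g - mat 1)\<close>, which is nilpotent.\<close>

lemma unipotent_Ad_on:
 fixes G :: "(complex^'n^'n) set"
 assumes G: "alg_group G" and V: "stable G V" and g: "g : G" and nil: "nilpotent_mat (g - mat 1)"
 shows "unipotent_on V (Ad_on V g)"
proof -
 let ?A = "g - mat 1" and ?h = "matrix_inv g"
 have inv: "invertible g" by (rule alg_group_invertible[OF G g])
 have diff: "Ad g x - x = bracket ?A x ** ?h" for x
 proof -
  have "bracket ?A x ** ?h = g ** x ** ?h - x ** (g ** ?h)"
   by (simp add: bracket_def matrix_diff_ldistrib matrix_diff_rdistrib matrix_mul_assoc)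
  then show ?thesis by (simp add: Ad_def matrix_inv_right[OF inv])
 qed
 have br: "bracket ?A (x ** mpow ?h m) = bracket ?A x ** mpow ?h m" for x m
 proof -
  have "?A ** ?h = ?h ** ?A" by (simp add: matrix_diff_ldistrib matrix_diff_rdistrib matrix_inv_left[OF inv] matrix_inv_right[OF inv])
  then have "x ** mpow ?h m ** ?A = x ** ?A ** mpow ?h m"
   using mpow_commute[of ?h ?A m] by (simp add: matrix_mul_assoc[symmetric])
  then show ?thesis by (simp only: bracket_def matrix_diff_rdistrib matrix_mul_assoc)
 qed
 obtain k where k: "mpow (adm ?A) k = 0" using nilpotent_adm[OF nil] by (auto simp: nilpotent_mat_iff)
 have it: "((%x. Ad_on V g x - x) ^^ m) v : V &
   ((%x. Ad_on V g x - x) ^^ m) v = unvec (mpow (adm ?A) m *v vecm v) ** mpow ?h m" if v: "v : V" for m v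
 proof (induction m)
  case 0
  then show ?case using v by simp
 next
  case (Suc m)
  let ?x = "((%x. Ad_on V g x - x) ^^ m) v" and ?y = "unvec (mpow (adm ?A) m *v vecm v)"
  have x: "?x : V" "?x = ?y ** mpow ?h m" using Suc by auto
  have "Ad_on V g ?x - ?x = bracket ?A ?x ** ?h" using x(1) diff by (simp add: zero_ext_def)
  also have "\<dots> = bracket ?A ?y ** mpow ?h (Suc m)" unfolding x(2) br by (simp only: mpow_Suc2 matrix_mul_assoc)
  also have "bracket ?A ?y = unvec (mpow (adm ?A) (Suc m) *v vecm v)"
   using adm_vec[of ?A ?y] by (simp flip: matrix_vector_mul_assoc) finally show ?case
   using stableD[OF V g x(1)] cmat.subspace_diff[OF stable_subspace[OF V]] x(1) by (fastforce simp: zero_ext_def)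
 qed
 have "unvec 0 = (0 :: complex^'n^'n)" by (simp add: unvec_def vec_eq_iff)
 then show ?thesis using it[of _ k] k by (auto simp: unipotent_on_def)
qed

text \<open>Points are closed in \<open>zariski_GL V\<close>, so in a finite set the identity splits
  off from any other elements.\<close>

lemma finite_connected_subgroup:
 assumes fin: "finite N" and con: "connectedin (zariski_GL V) N" and V: "cmat.subspace V"
  and one: "\<one>\<^bsub>GL V\<^esub> : N" shows "N = {\<one>\<^bsub>GL V\<^esub>}"
proof (rule ccontr)
 assume ne: "N \<noteq> {\<one>\<^bsub>GL V\<^esub>}"
 have sub: "N \<subseteq> carrier (GL V)" using connectedin_subset_topspace[OF con] by (simp add: zariski_GL_coords topspace_zariski)
 have pt: "closedin (zariski_GL V) {h}" if "h : N" for h unfolding zariski_GL_coords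
 proof (rule closedin_zariski_points)
  show h: "h : carrier (GL V)" using sub that by blast
  fix g assume g: "g : carrier (GL V)" and eq: "ALL f:GL_coords V. f h = f g"
  show "h = g"
  proof
   fix Y
   show "h Y = g Y"
   proof (cases "Y : V")
    case True
    have "h Y $ i $ j = g Y $ i $ j" for i j
    proof -
     have "(%h. res V (elem j i) (h Y)) : GL_coords V" using True res_dual[OF V] by (auto simp: GL_coords_def)
     from bspec[OF eq this] show ?thesis
      using GL_carrierD(1)[OF h True] GL_carrierD(1)[OF g True] by (simp add: res_apply trace_elem)
    qed
    then show ?thesis by (simp add: vec_eq_iff)
   qed (use GL_carrierD(2)[OF h] GL_carrierD(2)[OF g] in simp)
  qed
 qed
 have "closedin (zariski_GL V) (\<Union>h\<in>N - {\<one>\<^bsub>GL V\<^esub>}. {h})"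
  by (intro closedin_Union) (use fin pt in auto)
 then have 1: "closedin (zariski_GL V) (N - {\<one>\<^bsub>GL V\<^esub>})" by simp
 have "EX E1 E2. closedin (zariski_GL V) E1 & closedin (zariski_GL V) E2 & N \<subseteq> E1 \<union> E2 & E1 \<inter> E2 \<inter> N = {} &
   E1 \<inter> N \<noteq> {} & E2 \<inter> N \<noteq> {}"
  by (rule exI[of _ "{\<one>\<^bsub>GL V\<^esub>}"], rule exI[of _ "N - {\<one>\<^bsub>GL V\<^esub>}"]) (use 1 pt[OF one] ne one in auto)
 then show False using con unfolding connectedin_closedin by blast
qed

subsection \<open>Linear forms of reductive type\<close>

lemma Ad_mpow: "invertible g ==> Ad g (mpow X k) = mpow (Ad g X) k"
proof (induction k)
 case 0
 then show ?case by (simp add: Ad_def matrix_inv_right)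
qed (simp add: Ad_prod)

lemma semisimple_nilpotent_zero:
 fixes X :: "complex^'n^'n" assumes "semisimple_mat X" "nilpotent_mat X" shows "X = 0"
proof -
 obtain P :: "complex^'n^'n" where P: "invertible P" "ALL i j. i \<noteq> j --> (matrix_inv P ** X ** P) $ i $ j = 0"
  using assms(1) unfolding semisimple_mat_def by blast
 define D where "D = Ad (matrix_inv P) X"
 have D: "D $ i $ j = 0" if "i \<noteq> j" for i j using P that by (simp add: D_def Ad_def matrix_inv_inv)
 have pow: "mpow D k $ i $ i = (D $ i $ i) ^ k & (ALL j. j \<noteq> i --> mpow D k $ i $ j = 0)" for k i
 proof (induction k)
  case 0
  then show ?case by (simp add: mat_def)
 next
  case (Suc k)
  have "(D ** mpow D k) $ i $ j = D $ i $ i * mpow D k $ i $ j" for j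
  proof -
   have "(D ** mpow D k) $ i $ j = (\<Sum>l\<in>UNIV. if l = i then D $ i $ i * mpow D k $ i $ j else 0)"
    unfolding matrix_matrix_mult_def vec_lambda_beta
   proof (intro sum.cong refl)
    show "D $ i $ l * mpow D k $ l $ j = (if l = i then D $ i $ i * mpow D k $ i $ j else 0)" for l
     using D[of i l] by (cases "l = i") simp_all
   qed
   then show ?thesis by simp
  qed
  then show ?case using Suc by simp
 qed
 obtain k where "mpow X k = 0" using assms(2) by (auto simp: nilpotent_mat_iff)
 then have "mpow D k = 0" unfolding D_def using Ad_mpow[OF invertible_matrix_inv[OF P(1)], of X k] by simp
 then have "D $ i $ i = 0" for i using pow[of k i] by simp
 then have "D = 0" using D by (metis (no_types, lifting) vec_eq_iff zero_index)
 then show ?thesis using Ad_inv_right[OF P(1), of X] by (simp add: D_def)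
qed

lemma rad_nilpotent:
 assumes H: "alg_group H" and X: "X : rad (lie_algebra H)" shows "nilpotent_mat X"
proof -
 have XH: "X : lie_algebra H" using X by (simp add: rad_def)
 obtain L e n where S: "spectral L (%k. mpoly (e k) X) (mpoly n X)" "X = (\<Sum>k\<in>L. cscale k (mpoly (e k) X)) + mpoly n X"
  by (rule spectral_decomposition)
 show ?thesis using X replica(1)[OF H XH S] by (intro nilpotent_if_trace_replica_zero[OF S]) (simp add: rad_def)
qed

lemma rad_subspace: "cmat.subspace m ==> cmat.subspace (rad m)"
 by (intro cmat.subspaceI)
  (auto simp: rad_def cmat.subspace_0 cmat.subspace_add cmat.subspace_scale trace_left_add trace_left_scale)

lemma rad_stable:
 assumes H: "alg_group H" shows "stable H (rad (lie_algebra H))" unfolding stable_def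
proof (intro conjI ballI)
 show "cmat.subspace (rad (lie_algebra H))" by (intro rad_subspace lie_algebra_subspace)
 fix g X assume g: "g : H" and X: "X : rad (lie_algebra H)"
 have "trace (Ad g X ** Y) = 0" if "Y : lie_algebra H" for Y
  using X Ad_lie_algebra[OF H alg_group_inv[OF H g] that] by (simp add: trace_Ad_prod alg_group_invertible[OF H g] rad_def)
 then show "Ad g X : rad (lie_algebra H)" using X Ad_lie_algebra[OF H g] by (simp add: rad_def)
qed

lemma rad_nil_products:
 assumes H: "alg_group H" shows "EX k. nil_products (rad (lie_algebra H)) k"
proof (rule Engel)
 show "cmat.subspace (rad (lie_algebra H))" by (intro rad_subspace lie_algebra_subspace)
 show "bracket X Y : rad (lie_algebra H)" if "X : rad (lie_algebra H)" "Y : rad (lie_algebra H)" for X Y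
  using stable_bracket[OF H rad_stable[OF H]] that by (simp add: rad_def)
qed (rule rad_nilpotent[OF H])

lemma exp_closure_conj:
 fixes R :: "(complex^'n^'n) set"
 assumes g: "invertible g" and r: "!!X. X : R ==> Ad g X : R" and c: "c : exp_closure R"
 shows "Ad g c : exp_closure R"
proof -
 have "continuous_map zariski_GLn zariski_GLn ((%x. x \<otimes>\<^bsub>GLn\<^esub> matrix_inv g) \<circ> (%x. g \<otimes>\<^bsub>GLn\<^esub> x))"
  using g invertible_matrix_inv
  by (intro continuous_map_compose[OF GLn_top.left_cont GLn_top.right_cont]) (auto simp: carrier_GLn)
 also have "(%x. x \<otimes>\<^bsub>GLn\<^esub> matrix_inv g) \<circ> (%x. g \<otimes>\<^bsub>GLn\<^esub> x) = Ad g" by (auto simp: mult_GLn Ad_def)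
 finally have "Ad g ` (zariski_GLn closure_of exp_gen R) \<subseteq> zariski_GLn closure_of (Ad g ` exp_gen R)"
  by (rule continuous_map_image_closure_subset)
 moreover have "Ad g ` exp_gen R \<subseteq> exp_gen R"
 proof (intro image_subsetI)
  fix A assume "A : exp_gen R"
  then show "Ad g A : exp_gen R"
  proof induction
   case exp_gen_one
   then show ?case using exp_gen.exp_gen_one by (simp add: Ad_def matrix_inv_right[OF g])
  next
   case (exp_gen_step A X t)
   show ?case
    by (metis exp_gen_step r Ad_def Ad_prod[OF g] exp_gen.exp_gen_step mexp_conj[OF matrix_inv_right[OF g]])
  qed
 qed
 then have "zariski_GLn closure_of (Ad g ` exp_gen R) \<subseteq> zariski_GLn closure_of exp_gen R" by (rule closure_of_mono)
 ultimately show ?thesis using c unfolding exp_closure_def by blast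
qed

lemma Ad_on_conj:
 assumes G: "alg_group G" and V: "stable G V" and g: "g : G" "c : G"
 shows "Ad_on V g \<otimes>\<^bsub>GL V\<^esub> Ad_on V c \<otimes>\<^bsub>GL V\<^esub> inv\<^bsub>GL V\<^esub> Ad_on V g = Ad_on V (Ad g c)"
proof -
 have "Ad_on V (Ad g c) = Ad_on V g \<circ> Ad_on V c \<circ> Ad_on V (matrix_inv g)"
  using Ad_on_mult[OF G V alg_group_mult[OF G g] alg_group_inv[OF G g(1)]] Ad_on_mult[OF G V g] by (simp add: Ad_def)
 then show ?thesis by (simp add: Ad_on_inv[OF G V g(1)]) (simp add: GL_def)
qed

text \<open>The group generated by the radical \<open>R\<close> of the trace form maps to a
  connected normal unipotent subgroup, trivial by reductivity. Hence \<open>R\<close> is central in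
  \<open>b\<close>, so its elements are semisimple and nilpotent, that is, 0.\<close>

theorem reductive_imp_RED:
 fixes G :: "(complex^'n^'n) set" assumes G: "alg_group G" and g: "b = lie_algebra G" and d: "d : dual b"
  and red: "reductive_subgroup b (Ad_on b ` group_stab G b d)" and centre: "ALL X:lie_centre b. semisimple_mat X"
 shows "RED (lie_stab b b d)"
proof -
 let ?H = "group_stab G b d"
 have V: "stable G b" unfolding g by (rule stable_lie_algebra[OF G])
 have H: "alg_group ?H" by (rule alg_group_stab[OF G V d])
 have HG: "?H \<subseteq> G" by (auto simp: group_stab_def)
 have VH: "stable ?H b" by (rule stable_mono[OF HG V])
 have h: "lie_algebra ?H = lie_stab b b d" using lie_algebra_stab[OF G V d] by (simp add: g)
 define R where "R = rad (lie_algebra ?H)"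
 have r: "X : lie_algebra ?H" "nilpotent_mat X" if "X : R" for X
  using that rad_nilpotent[OF H] by (auto simp: R_def rad_def)
 let ?C = "exp_closure R"
 have C: "alg_group ?C" by (rule alg_group_exp_closure)
 have CH: "?C \<subseteq> ?H" using r(1) mexp_in_group[OF H] by (intro exp_closure_minimal[OF H]) auto
 have VC: "stable ?C b" by (rule stable_mono[OF CH VH])
 obtain k where k: "nil_products R k" using rad_nil_products[OF H] by (auto simp: R_def)
 let ?N = "Ad_on b ` ?C" and ?I = "Ad_on b ` ?H"
 interpret GL: group "GL b" by (rule group_GL[OF stable_subspace[OF V]])
 have sI: "subgroup ?I (GL b)" by (rule Ad_on_subgroup[OF H VH])
 have sN: "subgroup ?N (GL b)" by (rule Ad_on_subgroup[OF C VC])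
 have normal: "?N \<lhd> (GL b)\<lparr>carrier := ?I\<rparr>"
  unfolding group.normal_inv_iff[OF subgroup.subgroup_is_group[OF sI GL.is_group]]
 proof (intro conjI ballI)
  show "subgroup ?N ((GL b)\<lparr>carrier := ?I\<rparr>)" by (rule GL.subgroup_incl[OF sN sI image_mono[OF CH]])
  fix x n assume "x : carrier ((GL b)\<lparr>carrier := ?I\<rparr>)" and n: "n : ?N"
  then have x: "x : ?I" by simp
  obtain c where c: "n = Ad_on b c" "c : ?C" using n by (rule imageE)
  obtain a where a: "x = Ad_on b a" "a : ?H" using x by (rule imageE)
  have "Ad a c : ?C"
   using stableD[OF rad_stable[OF H] a(2)] c(2) by (intro exp_closure_conj alg_group_invertible[OF H a(2)]) (simp_all add: R_def)
  moreover have "x \<otimes>\<^bsub>GL b\<^esub> n \<otimes>\<^bsub>GL b\<^esub> inv\<^bsub>GL b\<^esub> x = Ad_on b (Ad a c)"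
   unfolding a c using Ad_on_conj[OF H VH a(2)] c(2) CH by blast
  ultimately show "x \<otimes>\<^bsub>(GL b)\<lparr>carrier := ?I\<rparr>\<^esub> n \<otimes>\<^bsub>(GL b)\<lparr>carrier := ?I\<rparr>\<^esub> inv\<^bsub>(GL b)\<lparr>carrier := ?I\<rparr>\<^esub> x : ?N"
   using GL.m_inv_consistent[OF sI x] by simp
 qed
 have "ALL f:?N. unipotent_on b f"
 proof (intro ballI)
  fix f assume "f : ?N"
  then obtain c where c: "f = Ad_on b c" "c : ?C" by (rule imageE)
  show "unipotent_on b f"
   using unipotent_exp_closure[OF k r(2) c(2)] by (auto simp: nilpotent_mat_iff c(1) intro!: unipotent_Ad_on[OF C VC c(2)])
 qed
 moreover have "connectedin (zariski_GL b) ?N"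
  using connected_exp_closure[of R] by (intro Ad_on_connected[OF C VC]) (simp add: connected_algebraic_group_def)
 ultimately have N: "?N = {\<one>\<^bsub>GL b\<^esub>}"
  using red normal Ad_on_closed[OF C VC] unfolding reductive_subgroup_def by blast
 have "X = 0" if X: "X : R" for X
 proof -
  have "bracket X Y = 0" if Y: "Y : b" for Y
  proof -
   have "Y ** mexp X t = mexp X t ** Y" for t
   proof -
    have "Ad_on b (mexp X t) : ?N" using mexp_exp_closure[OF X] by (rule imageI)
    then have "Ad_on b (mexp X t) Y = \<one>\<^bsub>GL b\<^esub> Y" by (simp add: N)
    then have "Y ** mexp X t = mexp X t ** Y ** (matrix_inv (mexp X t) ** mexp X t)"
     using Y by (simp add: GL_def zero_ext_def Ad_def matrix_mul_assoc)
    then show ?thesis by (simp add: matrix_inv_left[OF invertible_mexp])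
   qed
   then show ?thesis using commute_mexp_iff[of Y X] by (simp add: bracket_def)
  qed
  then show ?thesis
   using r(1)[OF X] centre r(2)[OF X] semisimple_nilpotent_zero by (auto simp: lie_centre_def h lie_stab_def)
 qed
 then show ?thesis
  using cmat.subspace_0[OF rad_subspace[OF lie_algebra_subspace]] by (auto simp: R_def h[symmetric] RED_rad[OF lie_algebra_subspace])
qed

lemma Ad_mexp_eigen:
 assumes "bracket X W = cscale c W" shows "Ad (mexp X t) W = cscale (exp (t * c)) W"
proof -
 let ?A = "%t. Ad (mexp X t) W"
 let ?F = "%t. cscale (exp (- (t * c))) (mat 1) ** ?A t"
 have X: "Ad (mexp X t) X = X" for t
  by (simp add: Ad_def matrix_inv_mexp mexp_self_commute[symmetric] mexp_minus matrix_mul_assoc[symmetric])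
   (metis matrix_inv_mexp matrix_inv_right[OF invertible_mexp] matrix_mul_rid)
 have br: "bracket X (?A t) = cscale c (?A t)" for t
  using Ad_bracket[OF invertible_mexp, of X t X W] assms by (simp add: X Ad_cscale)
 have "mderiv ?F 0 t" for t
 proof -
  have "((%t. exp (- (t * c))) has_field_derivative - c * exp (- (t * c))) (at t)"
   by (auto intro!: derivative_eq_intros)
  from mderiv_mult[OF mderiv_cscale[OF this, of "mat 1"] mderiv_Ad_mexp[of X W t]]
  have "mderiv ?F (cscale (- c * exp (- (t * c))) (?A t) + cscale (exp (- (t * c))) (cscale c (?A t))) t"
   unfolding br cscale_mult_left matrix_mul_lid .
  moreover have "cscale (- c * exp (- (t * c))) (?A t) + cscale (exp (- (t * c))) (cscale c (?A t)) = 0"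
   unfolding cmat.scale_scale cmat.scale_left_distrib[symmetric] by (simp add: mult.commute)
  ultimately show ?thesis by (simp only:)
 qed
 then have "?F t = ?F 0" by (rule mderiv_zero_const)
 then have "cscale (exp (t * c)) (cscale (exp (- (t * c))) (?A t)) = cscale (exp (t * c)) W"
  by (simp add: cscale_mult_left)
 then show ?thesis by (simp flip: exp_add)
qed

lemma mpoly_adm_subspace:
 assumes V: "cmat.subspace V" "!!Y. Y : V ==> bracket X Y : V" and Y: "Y : V"
 shows "unvec (mpoly p (adm X) *v vecm Y) : V"
proof -
 have "EX Z:V. mpoly p (adm X) *v vecm Y = vecm Z"
 proof (induction p)
  case 0
  then show ?case using cmat.subspace_0[OF V(1)] by (intro bexI[of _ 0]) simp_all
 next
  case (pCons c p)
  then obtain Z where Z: "Z : V" "mpoly p (adm X) *v vecm Y = vecm Z" by blast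
  have "mpoly (pCons c p) (adm X) *v vecm Y = vecm (cscale c Y + bracket X Z)"
   by (simp add: matrix_vector_mult_add_rdistrib cscale_matrix_vector vecm_add vecm_cscale Z(2) adm_vec flip: matrix_vector_mul_assoc)
  then show ?case using cmat.subspace_add[OF V(1) cmat.subspace_scale[OF V(1) Y] V(2)[OF Z(1)]] by blast
 qed
 then show ?thesis by auto
qed

text \<open>If the bracket with the replica had an eigenvector in \<open>V\<close> with eigenvalue
  \<open>cnj m \<noteq> 0\<close>, exponentials of the replica would act on it by arbitrary nonzero
  scalars, which is not unipotent.\<close>

lemma unipotent_replica_central:
 fixes N :: "(complex^'n^'n) set" assumes N: "alg_group N" and V: "stable N V" and X: "X : lie_algebra N"
  and uni: "!!g. g : N ==> unipotent_on V (Ad_on V g)"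
  and S: "spectral L E M" "X = (\<Sum>c\<in>L. cscale c (E c)) + M" and Y: "Y : V"
 shows "bracket (\<Sum>c\<in>L. cscale (cnj c) (E c)) Y = 0"
proof -
 let ?X = "\<Sum>c\<in>L. cscale (cnj c) (E c)"
 have X': "?X : lie_algebra N" by (rule replica(1)[OF N X S])
 obtain L' F where F: "spectral L' F (adm M)" "adm X = (\<Sum>m\<in>L'. cscale m (F m)) + adm M"
  "adm ?X = (\<Sum>m\<in>L'. cscale (cnj m) (F m))" using spectral_adm[OF S] by (elim exE conjE)
 have fin: "finite L'" and orth: "!!c m. c : L' ==> m : L' ==> F c ** F m = (if c = m then F c else 0)"
  using F(1) by (auto simp: spectral_def)
 have zero: "F m *v vecm Y = 0" if m: "m : L'" "m \<noteq> 0" for m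
 proof (rule ccontr)
  assume ne: "F m *v vecm Y \<noteq> 0"
  obtain p where p: "F m = mpoly p (adm X)" using spectral_poly[OF F(1,2) m(1)] by blast
  define W where "W = unvec (F m *v vecm Y)"
  have WV: "W : V" unfolding W_def p
   using stable_bracket[OF N V X] by (intro mpoly_adm_subspace stable_subspace[OF V] Y)
  have W0: "W \<noteq> 0"
  proof
   assume "W = 0"
   then have "vecm W = 0" by simp
   then show False using ne by (simp add: W_def)
  qed
  have "adm ?X *v vecm W = (\<Sum>w\<in>L'. cscale (cnj w) (F w) *v (F m *v vecm Y))"
   unfolding F(3) by (simp add: W_def matrix_sum_vector)
  also have "\<dots> = (\<Sum>w\<in>L'. if w = m then cnj m *s (F m *v vecm Y) else 0)"
  proof (intro sum.cong refl)
   fix w assume "w : L'"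
   then have "F w *v (F m *v vecm Y) = (if w = m then F m *v vecm Y else 0)"
    using m(1) by (simp add: matrix_vector_mul_assoc orth)
   then show "cscale (cnj w) (F w) *v (F m *v vecm Y) = (if w = m then cnj m *s (F m *v vecm Y) else 0)"
    by (simp only: cscale_matrix_vector) simp
  qed
  also have "\<dots> = vecm (cscale (cnj m) W)" using fin m(1) by (simp add: W_def vecm_cscale)
  finally have "bracket ?X W = cscale (cnj m) W" unfolding adm_vec vecm_inj .
  from Ad_mexp_eigen[OF this] have eig: "Ad (mexp ?X t) W = cscale (exp (t * cnj m)) W" for t .
  \<comment> \<open>Chosen so that the eigenvalue of \<open>Ad (mexp ?X ?t)\<close> on
    \<open>W\<close> is \<open>exp 1\<close>, which differs from 1.\<close>
  let ?t = "1 / cnj m"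
  let ?f = "%x. Ad_on V (mexp ?X ?t) x - x"
  have it: "(?f ^^ k) W = cscale ((exp 1 - 1) ^ k) W" for k
  proof (induction k)
   case (Suc k)
   have "?f (cscale ((exp 1 - 1) ^ k) W) = cscale ((exp 1 - 1) ^ k) (cscale (exp 1) W - W)"
    using eig[of ?t] m(2) by (auto simp: zero_ext_def Ad_cscale cscale_diff_right intro!: cmat.subspace_scale[OF stable_subspace[OF V] WV])
   also have "cscale (exp 1) W - W = cscale (exp 1 - 1) W" by (simp add: cmat.scale_left_diff_distrib)
   finally show ?case using Suc by (simp add: mult.commute)
  qed simp
  obtain k where "(?f ^^ k) W = 0"
   using uni[OF mexp_in_group[OF N X', of ?t]] WV unfolding unipotent_on_def by blast
  then have "cscale ((exp 1 - 1) ^ k) W = 0" unfolding it .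
  then have "exp 1 = (1::complex)" using W0 by simp
  then have "exp (1::real) = 1" by (metis exp_of_real of_real_1 of_real_eq_1_iff)
  then show False by simp
 qed
 have "vecm (bracket ?X Y) = adm ?X *v vecm Y" by (simp add: adm_vec)
 also have "\<dots> = (\<Sum>w\<in>L'. cnj w *s (F w *v vecm Y))" unfolding F(3) by (simp add: matrix_sum_vector cscale_matrix_vector)
 also have "\<dots> = 0" using zero by (fastforce intro: sum.neutral ballI)
 finally have "vecm (bracket ?X Y) = vecm 0" by simp
 then show ?thesis by (simp only: vecm_inj)
qed

lemma stable_normalised:
 assumes N: "alg_group N" and conj: "!!a c. a : H ==> c : N ==> Ad a c : N" and inv: "!!a. a : H ==> invertible a"
 shows "stable H (lie_algebra N)" unfolding stable_def
proof (intro conjI ballI)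
 show "cmat.subspace (lie_algebra N)" by (rule lie_algebra_subspace)
 fix a X assume a: "a : H" and X: "X : lie_algebra N"
 have "mexp (Ad a X) t : N" for t
  using conj[OF a mexp_in_group[OF N X, of t]] mexp_conj[OF matrix_inv_right[OF inv[OF a]], of X t] by (simp add: Ad_def)
 then show "Ad a X : lie_algebra N" by (simp add: lie_algebra_mexp[OF N])
qed

text \<open>The preimage \<open>M\<close> in the stabiliser of a unipotent normal subgroup
  \<open>N\<close> may contain central elements that are not unipotent. Splitting off the central
  part \<open>z\<close> of its Lie algebra leaves an ideal of nilpotent elements, 0 by
  \<open>RED\<close>. So the Lie algebra of \<open>M\<close> is central, and \<open>N\<close> is
  finite and connected.\<close>

theorem RED_imp_reductive:
 fixes G :: "(complex^'n^'n) set" assumes G: "alg_group G" and g: "b = lie_algebra G" and d: "d : dual b"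
  and red: "RED (lie_stab b b d)" shows "reductive_subgroup b (Ad_on b ` group_stab G b d)"
proof -
 let ?H = "group_stab G b d"
 have V: "stable G b" unfolding g by (rule stable_lie_algebra[OF G])
 have H: "alg_group ?H" by (rule alg_group_stab[OF G V d])
 have HG: "?H \<subseteq> G" by (auto simp: group_stab_def)
 have VH: "stable ?H b" by (rule stable_mono[OF HG V])
 have h: "lie_algebra ?H = lie_stab b b d" using lie_algebra_stab[OF G V d] by (simp add: g)
 let ?I = "Ad_on b ` ?H"
 interpret GL: group "GL b" by (rule group_GL[OF stable_subspace[OF V]])
 have sI: "subgroup ?I (GL b)" by (rule Ad_on_subgroup[OF H VH])
 have "N = {\<one>\<^bsub>GL b\<^esub>}"
  if normal: "N \<lhd> (GL b)\<lparr>carrier := ?I\<rparr>" and closed: "closedin (zariski_GL b) N"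
   and con: "connectedin (zariski_GL b) N" and uni: "ALL p:N. unipotent_on b p" for N
 proof -
  have sNI: "subgroup N ((GL b)\<lparr>carrier := ?I\<rparr>)" by (rule normal_imp_subgroup[OF normal])
  have sN: "subgroup N (GL b)" by (rule GL.incl_subgroup[OF sI sNI])
  have NI: "N \<subseteq> ?I" using subgroup.subset[OF sNI] by simp
  define M where "M = {g : ?H. Ad_on b g : N}"
  have M: "alg_group M" unfolding M_def by (rule Ad_on_preimage[OF H VH sN closed])
  have MH: "M \<subseteq> ?H" by (auto simp: M_def)
  have NM: "N = Ad_on b ` M" using NI by (auto simp: M_def)
  have VM: "stable M b" by (rule stable_mono[OF MH VH])
  have conj: "Ad a c : M" if a: "a : ?H" and c: "c : M" for a c
  proof -
   have c': "c : ?H" "Ad_on b c : N" using c by (auto simp: M_def)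
   have ia: "Ad_on b a : ?I" using a by blast
   have "Ad_on b (Ad a c) : N"
    using group.normal_invE(2)[OF subgroup.subgroup_is_group[OF sI GL.is_group] normal, of "Ad_on b a" "Ad_on b c"] ia c'(2) GL.m_inv_consistent[OF sI ia] by (simp add: Ad_on_conj[OF H VH a c'(1)])
   moreover have "Ad a c : ?H" unfolding Ad_def by (intro alg_group_mult[OF H] alg_group_inv[OF H] a c'(1))
   ultimately show ?thesis by (simp add: M_def)
  qed
  have stab: "stable ?H (lie_algebra M)" by (rule stable_normalised[OF M conj alg_group_invertible[OF H]])
  have mh: "lie_algebra M \<subseteq> lie_algebra ?H" by (rule lie_algebra_mono[OF MH])
  have hg: "lie_algebra ?H \<subseteq> b" by (auto simp: h lie_stab_def)
  define z where "z = lie_algebra M \<inter> lie_centre b"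
  have zz: "cmat.subspace z" unfolding z_def lie_centre_def g by (intro cmat.subspaceI)
    (auto simp: cmat.subspace_0 cmat.subspace_add cmat.subspace_scale lie_algebra_subspace bracket_add_left bracket_cscale_left)
  \<comment> \<open>The orthogonal of the central part. Conjugate replicas of its elements are
    central by unipotence of the action, hence orthogonal to these elements, which are therefore
    nilpotent.\<close>
  define r where "r = {X : lie_algebra M. ALL Z:z. trace (X ** Z) = 0}"
  have rr0: "X = 0" if X: "X : r" for X
  proof (rule REDD[OF red])
   have rh: "r \<subseteq> lie_stab b b d" using mh by (auto simp: r_def h)
   then show "X : lie_stab b b d" using X by blast
   have sub: "cmat.subspace r" by (intro cmat.subspaceI)
     (auto simp: r_def cmat.subspace_0 cmat.subspace_add cmat.subspace_scale lie_algebra_subspace trace_left_add trace_left_scale)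
   have ideal: "bracket Y W : r" if Y: "Y : lie_stab b b d" and W: "W : r" for Y W
   proof -
    have WM: "W : lie_algebra M" using W by (simp add: r_def)
    have "bracket Y W : lie_algebra M" using stable_bracket[OF H stab _ WM] Y by (simp add: h)
    moreover have "trace (bracket Y W ** Z) = 0" if Z: "Z : z" for Z
    using Z WM mh hg bracket_minus[of W Z] by (auto simp: z_def lie_centre_def trace_bracket)
    ultimately show ?thesis by (simp add: r_def)
   qed
   have nil: "nilpotent_mat W" if W: "W : r" for W
   proof -
    have WM: "W : lie_algebra M" using W by (simp add: r_def)
    obtain L e n where S: "spectral L (%w. mpoly (e w) W) (mpoly n W)" "W = (\<Sum>w\<in>L. cscale w (mpoly (e w) W)) + mpoly n W"
     by (rule spectral_decomposition)
    let ?W = "\<Sum>w\<in>L. cscale (cnj w) (mpoly (e w) W)"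
    have W': "?W : lie_algebra M" by (rule replica(1)[OF M WM S])
    have "bracket ?W Y = 0" if Y: "Y : b" for Y
     using unipotent_replica_central[OF M VM WM _ S Y] uni by (simp add: M_def)
    then show ?thesis
     using W' mh hg W by (auto simp: z_def lie_centre_def r_def intro!: nilpotent_if_trace_replica_zero[OF S])
   qed
   show "trace (X ** Y) = 0" if Y: "Y : lie_stab b b d" for Y
    by (rule trace_nilpotent_ideal[OF sub rh ideal nil X Y])
  qed
  have central: "X : lie_centre b" if X: "X : lie_algebra M" for X
  proof -
   have "EX Y:z. ALL Z:z. trace (X ** Z) = trace (Z ** Y)"
   proof (rule pairing_represents[OF zz zz trace_form_on])
    show "clinear_on z (*) (%Z. trace (X ** Z))" by (simp add: clinear_on_def trace_right_add trace_right_scale)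
    show "trace (X ** Z) = 0" if "Z : z" "ALL Y:z. trace (Z ** Y) = 0" for Z
     using rr0[of Z] that by (simp add: r_def z_def)
   qed
   then obtain Y where Y: "Y : z" "ALL Z:z. trace (X ** Z) = trace (Z ** Y)" by (elim bexE)
   have "trace ((X - Y) ** Z) = 0" if "Z : z" for Z
    using Y(2) that trace_mul_sym[of Z Y] by (simp add: matrix_diff_rdistrib trace_sub)
   moreover have "X - Y : lie_algebra M" using X Y(1) by (simp add: z_def cmat.subspace_diff[OF lie_algebra_subspace])
   ultimately have "X - Y = 0" by (intro rr0) (simp add: r_def)
   then show ?thesis using Y(1) by (simp add: z_def)
  qed
  \<comment> \<open>Elements of \<open>M\<close> acting trivially on \<open>b\<close>; having the
    same Lie algebra as \<open>M\<close>, they have finite index.\<close>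
  define K where "K = {g : M. ALL A:b. g ** A = A ** g}"
  have K: "alg_group K" unfolding K_def by (rule alg_group_centraliser[OF M])
  have MK: "lie_algebra M \<subseteq> lie_algebra K"
  proof
   fix X assume X: "X : lie_algebra M"
   have "mexp X t ** A = A ** mexp X t" if A: "A : b" for A t
   using central[OF X] A commute_mexp_iff[of A X] by (simp add: lie_centre_def bracket_def)
   then have "mexp X t : K" for t using mexp_in_group[OF M X] by (simp add: K_def)
   then show "X : lie_algebra K" by (simp add: lie_algebra_mexp[OF K])
  qed
  have KM: "K \<subseteq> M" by (auto simp: K_def)
  obtain F where F: "finite F" "F \<subseteq> M" "M \<subseteq> (\<Union>g\<in>F. (%h. g ** h) ` K)"
   using same_lie_algebra_finite_index[OF M K KM MK] by (elim exE conjE)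
  have "N \<subseteq> Ad_on b ` F"
  proof
   fix p assume "p : N"
   then obtain c where c: "p = Ad_on b c" "c : M" unfolding NM by (rule imageE)
   obtain f k where fk: "f : F" "k : K" "c = f ** k" using F(3) c(2) by blast
   have "Ad k Y = Y" if "Y : b" for Y
   proof -
    have "Ad k Y = Y ** (k ** matrix_inv k)" using fk(2) that by (simp add: K_def Ad_def matrix_mul_assoc)
    then show ?thesis by (simp add: matrix_inv_right alg_group_invertible[OF K fk(2)])
   qed
   moreover have "f : M" "k : M" using F(2) fk(1,2) KM by auto
   ultimately show "p : Ad_on b ` F"
    using c(1) fk(1) by (auto simp: fk(3) zero_ext_def fun_eq_iff Ad_mult alg_group_invertible[OF M])
  qed
  then show ?thesis
   using F(1) finite_surj by (auto intro!: finite_connected_subgroup[OF _ con stable_subspace[OF V] subgroup.one_closed[OF sN]])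
 qed
 then show ?thesis unfolding reductive_subgroup_def using sI Ad_on_closed[OF H VH] by blast
qed

corollary reductive_type_iff:
 assumes Q: "connected_algebraic_group Q" and centre: "ALL X:lie_centre (lie_algebra Q). semisimple_mat X"
 shows "reductive_type Q b \<longleftrightarrow> b : dual (lie_algebra Q) & RED (lie_stab (lie_algebra Q) (lie_algebra Q) b)"
proof -
 have G: "alg_group Q" using Q by (rule connected_algebraic_group_alg)
 show ?thesis unfolding reductive_type_def
  using reductive_imp_RED[OF G refl _ _ centre] RED_imp_reductive[OF G refl] by blast
qed

subsection \<open>Existence of forms of reductive and nilpotent type\<close>

definition trace_stab :: "(complex^'n^'n) set => (complex^'n^'n) set => complex^'n^'n => (complex^'n^'n) set" where
 "trace_stab h V M = {X : h. ALL Y:V. trace (M ** bracket X Y) = 0}"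

lemma lie_stab_res:
 assumes "!!X Y. X : h ==> Y : V ==> bracket X Y : V" shows "lie_stab h V (res V M) = trace_stab h V M"
 using assms by (auto simp: lie_stab_def trace_stab_def res_apply)

lemma trace_stab_subspace:
 assumes "cmat.subspace h" shows "cmat.subspace (trace_stab h V M)" by (intro cmat.subspaceI)
  (auto simp: trace_stab_def cmat.subspace_0[OF assms] cmat.subspace_add[OF assms] cmat.subspace_scale[OF assms]
   bracket_zero bracket_add_left bracket_cscale_left trace_right_add trace_right_scale)

lemma trace_stab_bracket:
 assumes "!!X Y. X : h ==> Y : h ==> bracket X Y : h" "!!X Y. X : h ==> Y : V ==> bracket X Y : V"
  and X: "X : trace_stab h V M" and Y: "Y : trace_stab h V M" shows "bracket X Y : trace_stab h V M"
proof -
 have "trace (M ** bracket (bracket X Y) Z) = 0" if Z: "Z : V" for Z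
 proof -
  have "bracket (bracket X Y) Z = bracket X (bracket Y Z) - bracket Y (bracket X Z)"
   by (simp add: bracket_def matrix_diff_ldistrib matrix_diff_rdistrib matrix_mul_assoc)
  then show ?thesis using X Y Z assms(2) by (simp add: matrix_diff_ldistrib trace_sub trace_stab_def)
 qed
 then show ?thesis using X Y assms(1) by (simp add: trace_stab_def)
qed

lemma trace_bracket_swap: "trace (M ** bracket X Y) = - trace (M ** bracket Y X)"
 unfolding bracket_minus[of X Y] using trace_right_diff[of M 0 "bracket Y X"] by simp

text \<open>An element of \<open>P\<close> killed by all forms vanishing on \<open>R\<close> lies in
  \<open>R\<close>, where compatibility applies; the rest is duality.\<close>

lemma functional_glue:
 fixes M :: "complex^'n^'n"
 assumes P: "cmat.subspace P" and R: "cmat.subspace R" and PR: "!!X. X : P ==> X : R ==> trace (M ** X) = 0"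
 shows "EX D. (ALL X:P. trace (D ** X) = trace (M ** X)) & (ALL X:R. trace (D ** X) = 0)"
proof -
 let ?W = "{D. ALL X:R. trace (D ** X) = 0}"
 have W: "cmat.subspace ?W" by (intro cmat.subspaceI) (auto simp: trace_left_add trace_left_scale)
 have "EX D:?W. ALL X:P. trace (M ** X) = trace (X ** D)"
 proof (rule pairing_represents[OF P W trace_form_on])
  show "clinear_on P (*) (%X. trace (M ** X))" by (simp add: clinear_on_def trace_right_add trace_right_scale)
  fix X assume X: "X : P" "ALL D:?W. trace (X ** D) = 0"
  have "X : R"
  proof (rule ccontr)
   assume "X \<notin> R"
   then obtain D where D: "ALL Y:R. trace (D ** Y) = 0" "trace (D ** X) \<noteq> 0" using separate_subspace[OF R] by blast
   then show False using X(2) trace_mul_sym[of D X] by auto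
  qed
  then show "trace (M ** X) = 0" using PR X(1) by blast
 qed
 then obtain D where D: "D : ?W" "ALL X:P. trace (M ** X) = trace (X ** D)" by (elim bexE)
 have "trace (D ** X) = trace (M ** X)" if "X : P" for X using D(2) that trace_mul_sym[of D X] by simp
 then show ?thesis using D(1) by blast
qed

text \<open>The groups \<open>H\<close> of the descending chain leading to the stabiliser: a form agreeing with \<open>M\<close> on \<open>w\<close>
 has its stabiliser in \<open>h = Lie H\<close>, where it is complementary to \<open>c\<close> in the kernel of the form
 restricted to \<open>h\<close>.\<close>

definition reduction ::
 "(complex^'n^'n) set => complex^'n^'n => (complex^'n^'n) set => (complex^'n^'n) set => (complex^'n^'n) set => bool" where
 "reduction g M H w c \<longleftrightarrow> alg_group H & lie_algebra H \<subseteq> g & cmat.subspace w & c \<subseteq> rad (lie_algebra H) &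
   (ALL X:w. ALL Y:lie_algebra H. trace (X ** Y) = 0) &
   (ALL N. (ALL X:w. trace (N ** X) = trace (M ** X)) -->
    trace_stab g g N \<subseteq> lie_algebra H &
    trace_stab (lie_algebra H) (lie_algebra H) N \<subseteq> {X + Y | X Y. X : trace_stab g g N & Y : c} &
    trace_stab g g N \<inter> c \<subseteq> {0})"

lemma reductionD:
 assumes "reduction g M H w c"
 shows "alg_group H" "lie_algebra H \<subseteq> g" "cmat.subspace w" "c \<subseteq> rad (lie_algebra H)"
  "X : w ==> Y : lie_algebra H ==> trace (X ** Y) = 0"
  "(!!X. X : w ==> trace (N ** X) = trace (M ** X)) ==> trace_stab g g N \<subseteq> lie_algebra H"
  "(!!X. X : w ==> trace (N ** X) = trace (M ** X)) ==> Z : trace_stab (lie_algebra H) (lie_algebra H) N ==>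
    EX X Y. X : trace_stab g g N & Y : c & Z = X + Y"
  "(!!X. X : w ==> trace (N ** X) = trace (M ** X)) ==> X : trace_stab g g N ==> X : c ==> X = 0"
 using assms unfolding reduction_def by blast+

lemma rad_bracket: "alg_group H ==> X : lie_algebra H ==> Y : rad (lie_algebra H) ==> bracket X Y : rad (lie_algebra H)"
 by (rule stable_bracket[OF _ rad_stable])

text \<open>Writing \<open>X = S + C\<close> with \<open>S\<close> in the stabiliser of
  \<open>M\<close> and \<open>C\<close> in \<open>c\<close>, the part \<open>S\<close> lies in the
  radical for \<open>h\<close> and is thus orthogonal to the stabiliser, so \<open>RED\<close> makes
  it 0.\<close>

lemma reduction_kernel:
 assumes red: "reduction g M H w c" and RED: "RED (trace_stab g g M)"
  and X: "X : rad (lie_algebra H)" "!!Y. Y : lie_algebra H ==> trace (M ** bracket X Y) = 0" shows "X : c"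
proof -
 note R = reductionD[OF red]
 have "X : trace_stab (lie_algebra H) (lie_algebra H) M" using X by (simp add: trace_stab_def rad_def)
 then obtain S C where SC: "S : trace_stab g g M" "C : c" "X = S + C" using R(7)[of M] by blast
 have "S = X - C" using SC(3) by simp
 moreover have "C : rad (lie_algebra H)" using SC(2) R(4) by blast
 ultimately have "S : rad (lie_algebra H)" using X(1) by (simp add: cmat.subspace_diff[OF rad_subspace[OF lie_algebra_subspace]])
 then have "trace (S ** Y) = 0" if "Y : trace_stab g g M" for Y using R(6)[of M] that unfolding rad_def by blast
 then show ?thesis using SC REDD[OF RED SC(1)] by auto
qed

text \<open>The next group is the stabiliser in \<open>H\<close> of the restriction of
  \<open>M\<close> to the radical \<open>u\<close>. Adding \<open>u\<close> to \<open>w\<close>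
  fixes that restriction for all admissible forms, so they share the new group.\<close>

lemma reduction_step:
 fixes H :: "(complex^'n^'n) set"
 assumes red: "reduction g M H w c" and RED: "RED (trace_stab g g M)" and u: "u = rad (lie_algebra H)"
 shows "EX H'. lie_algebra H' = trace_stab (lie_algebra H) u M &
  reduction g M H' {X + Y | X Y. X : w & Y : u} (u \<inter> trace_stab (lie_algebra H) u M)"
proof (intro exI conjI)
 note R = reductionD[OF red]
 let ?h = "lie_algebra H"
 let ?H = "group_stab H u (res u M)" and ?h' = "trace_stab ?h u M"
 have H: "alg_group H" by (rule R(1))
 have stab: "stable H u" unfolding u by (rule rad_stable[OF H])
 have sub: "cmat.subspace u" by (rule stable_subspace[OF stab])
 have uh: "u \<subseteq> ?h" by (auto simp: u rad_def)
 have br: "bracket X Y : u" if "X : ?h" "Y : u" for X Y by (rule stable_bracket[OF H stab that])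
 show H': "lie_algebra ?H = ?h'"
  using lie_algebra_stab[OF H stab res_dual[OF sub]] lie_stab_res[of ?h u M] br by simp
 have 0: "0 : w" "0 : u" using cmat.subspace_0[OF sub] cmat.subspace_0[OF R(3)] by auto
 have trace_u: "trace (X ** Y) = 0" if "X : u" "Y : ?h" for X Y using that by (simp add: u rad_def)
 show "reduction g M ?H {X + Y | X Y. X : w & Y : u} (u \<inter> ?h')" unfolding reduction_def H'
 proof (intro conjI ballI allI impI)
  show "alg_group ?H" by (rule alg_group_stab[OF H stab res_dual[OF sub]])
  show "?h' \<subseteq> g" using R(2) by (auto simp: trace_stab_def)
  show "cmat.subspace {X + Y | X Y. X : w & Y : u}" by (rule cmat.subspace_sums[OF R(3) sub])
  show "u \<inter> ?h' \<subseteq> rad ?h'" using trace_u by (auto simp: rad_def trace_stab_def)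
  show "trace (X ** Y) = 0" if X: "X : {X + Y | X Y. X : w & Y : u}" and Y: "Y : ?h'" for X Y
  proof -
   obtain A U where "A : w" "U : u" "X = A + U" using X by blast
   then show ?thesis using R(5)[of A Y] trace_u[of U Y] Y by (simp add: trace_stab_def trace_left_add)
  qed
  fix N assume N: "ALL X:{X + Y | X Y. X : w & Y : u}. trace (N ** X) = trace (M ** X)"
  have Nw: "trace (N ** X) = trace (M ** X)" if "X : w" for X
  proof -
   have "X + 0 : {X + Y | X Y. X : w & Y : u}" using that 0(2) by blast
   then show ?thesis using N by auto
  qed
  have Nu: "trace (N ** X) = trace (M ** X)" if "X : u" for X
  proof -
   have "0 + X : {X + Y | X Y. X : w & Y : u}" using that 0(1) by blast
   then show ?thesis using N by auto
  qed
  let ?S = "trace_stab g g N"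
  have Sh: "?S \<subseteq> ?h" by (rule R(6)[OF Nw])
  show Sh': "?S \<subseteq> ?h'"
  proof
   fix X assume X: "X : ?S"
   have "trace (M ** bracket X Y) = 0" if Y: "Y : u" for Y
   proof -
    have "Y : g" using Y uh R(2) by blast
    then show ?thesis using X Sh Y br by (fastforce simp: trace_stab_def Nu)
   qed
   then show "X : ?h'" using X Sh by (auto simp: trace_stab_def)
  qed
  show "trace_stab ?h' ?h' N \<subseteq> {X + Y | X Y. X : ?S & Y : u \<inter> ?h'}"
  proof
   fix X assume X: "X : trace_stab ?h' ?h' N"
   have Xh: "X : ?h'" "X : ?h" using X by (auto simp: trace_stab_def)
   \<comment> \<open>The functional given by bracketing with \<open>X\<close> vanishes on the
     elements of \<open>h\<close> that stabilise the form on \<open>u\<close>, so it is also given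
     by some \<open>U\<close> in \<open>u\<close>. Then \<open>X - U\<close> stabilises
     \<open>N\<close> on all of \<open>h\<close>.\<close>
   have "EX U:u. ALL Y:?h. trace (N ** bracket Y X) = trace (N ** bracket Y U)"
   proof (rule pairing_represents[OF lie_algebra_subspace sub])
    show "form_on ?h u (%Y U. trace (N ** bracket Y U))"
     by (simp add: form_on_def clinear_on_def bracket_add_left bracket_add_right bracket_cscale_left bracket_cscale_right
       trace_right_add trace_right_scale)
    show "clinear_on ?h (*) (%Y. trace (N ** bracket Y X))"
     by (simp add: clinear_on_def bracket_add_left bracket_cscale_left trace_right_add trace_right_scale)
    fix Y assume Y: "Y : ?h" "ALL U:u. trace (N ** bracket Y U) = 0"
    then have "trace (N ** bracket X Y) = 0" using Nu br X by (simp add: trace_stab_def)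
    then show "trace (N ** bracket Y X) = 0" using trace_bracket_swap[of N Y X] by simp
   qed
   then obtain U where U: "U : u" "ALL Y:?h. trace (N ** bracket Y X) = trace (N ** bracket Y U)" by (elim bexE)
   have "trace (N ** bracket (X - U) Y) = 0" if "Y : ?h" for Y
   using U(2) that trace_bracket_swap[of N "X - U" Y] by (simp add: bracket_diff_right trace_right_diff)
   moreover have "X - U : ?h" using Xh(2) U(1) uh by (intro cmat.subspace_diff[OF lie_algebra_subspace]) auto
   ultimately have "X - U : trace_stab ?h ?h N" by (simp add: trace_stab_def)
   then obtain S C where SC: "S : ?S" "C : c" "X - U = S + C" using R(7)[OF Nw] by blast
   have "X = S + (C + U)" using SC(3) by (simp add: algebra_simps)
   moreover have "C + U : u" using SC(2) R(4) U(1) by (auto simp: u[symmetric] intro: cmat.subspace_add[OF sub])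
   moreover have "X - S : ?h'"
    using Xh(1) Sh' SC(1) by (intro cmat.subspace_diff[OF trace_stab_subspace[OF lie_algebra_subspace]]) auto
   ultimately show "X : {X + Y | X Y. X : ?S & Y : u \<inter> ?h'}" using SC(1) by force
  qed
  show "?S \<inter> (u \<inter> ?h') \<subseteq> {0}"
  proof
   fix X assume X: "X : ?S \<inter> (u \<inter> ?h')"
   have "X : c"
   proof (rule reduction_kernel[OF red RED])
    show "X : rad ?h" using X by (simp add: u)
    fix Y assume Y: "Y : ?h"
    then have "trace (M ** bracket Y X) = 0"
     using X R(2) trace_bracket_swap[of N X Y] Y br by (auto simp: trace_stab_def Nu)
    then show "trace (M ** bracket X Y) = 0" using trace_bracket_swap[of M X Y] by simp
   qed
   then show "X : {0}" using R(8)[OF Nw, of X] X by simp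
  qed
 qed
qed

text \<open>At an \<open>H\<close> of minimal dimension the reduction step cannot shrink the Lie
  algebra \<open>h\<close>, so \<open>M\<close> vanishes on \<open>[h, u]\<close> and
  \<open>u \<subseteq> c\<close>. Forms that agree with \<open>M\<close> on \<open>w\<close> and
  vanish on \<open>[h, h]\<close> have stabilisers complementary to \<open>u\<close> in
  \<open>h\<close>; among them one of nilpotent type is found.\<close>

theorem exists_nilpotent_reductive_form:
 fixes G :: "(complex^'n^'n) set"
 assumes G: "alg_group G" and g: "a = lie_algebra G" and RED: "RED (trace_stab a a M)"
 shows "EX N. RED (trace_stab a a N) & (ALL X:trace_stab a a N. trace (N ** X) = 0)"
proof -
 have "reduction a M G {0} {0}"
  unfolding reduction_def using G rad_subspace[OF lie_algebra_subspace, of G, THEN cmat.subspace_0]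
  by (auto simp: g trace_stab_def cmat.subspace_single_0)
 then have "EX w c. reduction a M G w c" by blast
 from ex_has_least_nat[where P = "%H. EX w c. reduction a M H w c" and m = "%H. cmat.dim (lie_algebra H)", OF this]
 obtain H w c where red: "reduction a M H w c"
  and min: "ALL H'. (EX w' c'. reduction a M H' w' c') --> cmat.dim (lie_algebra H) \<le> cmat.dim (lie_algebra H')"
  by (elim exE conjE)
 note R = reductionD[OF red]
 let ?h = "lie_algebra H"
 define u where "u = rad ?h"
 have H: "alg_group H" by (rule R(1))
 have sub: "cmat.subspace u" unfolding u_def by (rule rad_subspace[OF lie_algebra_subspace])
 have uh: "u \<subseteq> ?h" by (auto simp: u_def rad_def)
 have br: "bracket X Y : u" if "X : ?h" "Y : u" for X Y using rad_bracket[OF H] that by (simp add: u_def)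
 have hbr: "bracket X Y : ?h" if "X : ?h" "Y : ?h" for X Y
  by (rule stable_bracket[OF H stable_lie_algebra[OF H] that])
 have trace_u: "trace (X ** Y) = 0" "trace (Y ** X) = 0" if "X : u" "Y : ?h" for X Y
  using that trace_mul_sym[of X Y] by (simp_all add: u_def rad_def)
 have cu: "c \<subseteq> u" using R(4) by (simp add: u_def)
 have hu: "trace (M ** bracket X Y) = 0" if X: "X : ?h" and Y: "Y : u" for X Y
 proof -
  obtain H' where H': "lie_algebra H' = trace_stab ?h u M"
   "reduction a M H' {X + Y | X Y. X : w & Y : u} (u \<inter> trace_stab ?h u M)"
   using reduction_step[OF red RED u_def] by (elim exE conjE)
  have "cmat.dim ?h \<le> cmat.dim (lie_algebra H')" using min H'(2) by blast
  then have "trace_stab ?h u M = ?h"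
   using cmat_dim_less[OF lie_algebra_subspace lie_algebra_subspace, of H' H] by (auto simp: H'(1) trace_stab_def)
  then show ?thesis using X Y by (auto simp: trace_stab_def)
 qed
 have uc: "u \<subseteq> c"
 proof
  fix X assume X: "X : u"
  show "X : c"
   by (rule reduction_kernel[OF red RED]) (use X hu trace_bracket_swap[of M X] in \<open>auto simp: u_def\<close>)
 qed
 let ?B = "cmat.span {bracket X Y | X Y. X : ?h & Y : u}" and ?D = "cmat.span {bracket X Y | X Y. X : ?h & Y : ?h}"
 have MB: "trace (M ** X) = 0" if "X : ?B" for X
 proof -
  have "cmat.subspace {X. trace (M ** X) = 0}" by (intro cmat.subspaceI) (auto simp: trace_right_add trace_right_scale)
  then have "?B \<subseteq> {X. trace (M ** X) = 0}" using hu by (intro cmat.span_minimal) auto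
  then show ?thesis using that by blast
 qed
 have Bu: "?B \<subseteq> u" using br sub by (intro cmat.span_minimal) auto
 have Dh: "?D \<subseteq> ?h" using hbr by (intro cmat.span_minimal lie_algebra_subspace) auto
 \<comment> \<open>Elements of \<open>u\<close> are invariant modulo \<open>[h, u]\<close>. That
   such invariants in \<open>[h, h]\<close> are trivial makes the two conditions on the new form
   \<open>N\<close> compatible.\<close>
 have uD: "X : ?B" if X: "X : u" "X : ?D" for X
 proof (rule coinvariants[OF H refl lie_algebra_subspace[of H] cmat.subspace_span])
  show "?B \<subseteq> ?h" using Bu uh by blast
  show "bracket X Y : ?h" if "X : ?h" "Y : ?h" for X Y by (rule hbr[OF that])
  show "bracket X Y : ?B" if "X : ?h" "Y : ?B" for X Y using that Bu by (intro cmat.span_base) blast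
  show "bracket Y Z : ?B" if Y: "Y : rad ?h" and Z: "Z : ?h" for Y Z
  using Y Z by (auto simp: u_def bracket_minus[of Y Z] intro!: cmat.span_base cmat.span_neg)
  show "X : ?h" using X(1) uh by blast
  show "bracket Y X : ?B" if "Y : ?h" for Y using that X(1) by (intro cmat.span_base) blast
  show "X : cmat.span ({bracket X Y | X Y. X : ?h & Y : ?h} \<union> ?B)" using X(2) cmat.span_mono by blast
 qed
 let ?P = "{X + Y | X Y. X : w & Y : u}"
 have P: "cmat.subspace ?P" by (rule cmat.subspace_sums[OF R(3) sub])
 have "trace (M ** X) = 0" if X: "X : ?P" "X : ?D" for X
 proof -
  obtain A U where AU: "A : w" "U : u" "X = A + U" using X(1) by blast
  have "X - U : ?h" using X(2) Dh AU(2) uh by (intro cmat.subspace_diff[OF lie_algebra_subspace]) auto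
  then have "X : u" using AU(3) R(5)[OF AU(1)] AU(2) cmat.subspace_add[OF sub] by (auto simp: u_def rad_def AU(3))
  then show ?thesis using MB[OF uD] X(2) by blast
 qed
 then have "EX N. (ALL X:?P. trace (N ** X) = trace (M ** X)) & (ALL X:?D. trace (N ** X) = 0)"
  by (rule functional_glue[OF P cmat.subspace_span])
 then obtain N where N: "ALL X:?P. trace (N ** X) = trace (M ** X)" "ALL X:?D. trace (N ** X) = 0"
  by (elim exE conjE)
 have Nw: "trace (N ** X) = trace (M ** X)" if "X : w" for X using that cmat.subspace_0[OF sub] N(1) by fastforce
 have Nh: "trace (N ** bracket X Y) = 0" if "X : ?h" "Y : ?h" for X Y
  using N(2) that by (blast intro: cmat.span_base)
 let ?r = "trace_stab a a N"
 have rh: "?r \<subseteq> ?h" by (rule R(6)[OF Nw])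
 have decomp: "EX X Y. X : trace_stab a a N' & Y : u & Z = X + Y"
  if N': "!!X. X : w ==> trace (N' ** X) = trace (M ** X)" "!!X Y. X : ?h ==> Y : ?h ==> trace (N' ** bracket X Y) = 0"
   and Z: "Z : ?h" for N' Z
 proof -
  have "Z : trace_stab ?h ?h N'" using Z N'(2) by (simp add: trace_stab_def)
  then show ?thesis using R(7)[OF N'(1)] cu by blast
 qed
 have redr: "RED ?r" unfolding RED_def
 proof (intro ballI impI)
  fix X assume X: "X : ?r" "ALL Y:?r. trace (X ** Y) = 0"
  have "trace (X ** Z) = 0" if Z: "Z : ?h" for Z
  proof -
   obtain Y U where "Y : ?r" "U : u" "Z = Y + U" using decomp[OF Nw Nh Z] by blast
   then show ?thesis using X rh trace_u(2)[of U X] by (auto simp: trace_right_add)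
  qed
  then show "X = 0" using X(1) rh R(8)[OF Nw X(1)] uc by (auto simp: u_def rad_def)
 qed
 have rsub: "cmat.subspace ?r" unfolding g by (rule trace_stab_subspace[OF lie_algebra_subspace])
 have gbr: "bracket X Y : a" if "X : a" "Y : a" for X Y
  using stable_bracket[OF G stable_lie_algebra[OF G]] that by (simp add: g)
 have rbr: "bracket X Y : ?r" if "X : ?r" "Y : ?r" for X Y by (rule trace_stab_bracket[OF gbr gbr that])
 have "EX T:?r. ALL X:?r. trace (N ** X) = trace (X ** T)"
 proof (rule pairing_represents[OF rsub rsub trace_form_on])
  show "clinear_on ?r (*) (%X. trace (N ** X))" by (simp add: clinear_on_def trace_right_add trace_right_scale)
  show "trace (N ** X) = 0" if "X : ?r" "ALL Y:?r. trace (X ** Y) = 0" for X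
   using REDD[OF redr that(1)] that(2) by simp
 qed
 then obtain T where T: "T : ?r" "ALL X:?r. trace (N ** X) = trace (X ** T)" by (elim bexE)
 have TN: "trace (T ** X) = trace (N ** X)" if "X : ?r" for X using T(2) that trace_mul_sym[of T X] by simp
 have central: "bracket T X = 0" if X: "X : ?r" for X
 proof (rule REDD[OF redr rbr[OF T(1) X]])
  fix Y assume Y: "Y : ?r"
  show "trace (bracket T X ** Y) = 0" using TN[OF rbr[OF X Y]] X Y rh by (auto simp: trace_bracket intro!: Nh)
 qed
 \<comment> \<open>\<open>T\<close> represents \<open>N\<close> on its stabiliser and is central
   there, so subtracting it gives value 0 on the stabiliser. The values on \<open>w\<close> survive
   because \<open>w\<close> is orthogonal to \<open>h\<close>.\<close>
 let ?N = "N - T"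
 have Nw': "trace (?N ** X) = trace (M ** X)" if "X : w" for X
  using Nw[OF that] R(5)[OF that, of T] T(1) rh trace_mul_sym[of X T] by (auto simp: trace_left_diff)
 have Nh': "trace (?N ** bracket X Y) = 0" if X: "X : ?h" and Y: "Y : ?h" for X Y
 proof -
  obtain S U where SU: "S : ?r" "U : u" "X = S + U" using decomp[OF Nw Nh X] by blast
  have "trace (T ** bracket X Y) = trace (bracket T U ** Y)"
   by (simp add: trace_bracket[symmetric] SU(3) bracket_add_right central[OF SU(1)])
  also have "\<dots> = 0" using br[of T U] T(1) rh SU(2) Y by (intro trace_u(1)) auto
  finally show ?thesis using Nh[OF X Y] by (simp add: trace_left_diff)
 qed
 have "trace_stab a a ?N = ?r"
 proof
  show sup: "?r \<subseteq> trace_stab a a ?N"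
  proof
   fix X assume X: "X : ?r"
   have "trace (T ** bracket X Y) = 0" for Y by (simp add: trace_bracket[symmetric] central[OF X])
   then show "X : trace_stab a a ?N" using X by (simp add: trace_stab_def trace_left_diff)
  qed
  show "trace_stab a a ?N \<subseteq> ?r"
  proof
   fix X assume X: "X : trace_stab a a ?N"
   then obtain S U where SU: "S : ?r" "U : u" "X = S + U" using R(6)[OF Nw'] decomp[OF Nw Nh] by blast
   have "X - S : trace_stab a a ?N"
    using X sup SU(1) unfolding g by (intro cmat.subspace_diff[OF trace_stab_subspace[OF lie_algebra_subspace]]) auto
   then show "X : ?r" using SU(2,3) uc R(8)[OF Nw', of U] SU by auto
  qed
 qed
 moreover have "trace (?N ** X) = 0" if "X : ?r" for X using TN[OF that] by (simp add: trace_left_diff)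
 ultimately show ?thesis using redr by (intro exI[of _ ?N]) simp
qed

subsection \<open>Normalisers and semisimple elements\<close>

text \<open>A form vanishing on \<open>V\<close> pairs with \<open>Ad (mexp X t) Y\<close> to an
  entire function of \<open>t\<close> all of whose derivatives at 0 vanish.\<close>

lemma Ad_mexp_subspace:
 fixes X :: "complex^'n^'n" assumes V: "cmat.subspace V" and X: "!!Y. Y : V ==> bracket X Y : V" and Y: "Y : V"
 shows "Ad (mexp X t) Y : V"
proof (rule ccontr)
 assume "Ad (mexp X t) Y \<notin> V"
 from separate_subspace[OF V this] obtain B where B: "ALL Z:V. trace (B ** Z) = 0" "trace (B ** Ad (mexp X t) Y) \<noteq> 0"
  by (elim exE conjE)
 define f where "f C = (%s. trace (C ** Ad (mexp X s) Y))" for C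
 have df: "(f C has_field_derivative f (bracket C X) s) (at s)" for C s
  using mderiv_trace[OF mderiv_mult_left[OF mderiv_Ad_mexp[of X Y s], of C]] by (simp add: f_def trace_bracket)
 define C where "C k = ((%C. bracket C X) ^^ k) B" for k
 have C: "ALL Z:V. trace (C k ** Z) = 0" for k
  by (induction k) (use B(1) X in \<open>simp_all add: C_def trace_bracket\<close>)
 have "(deriv ^^ k) (f B) = f (C k)" for k
 proof (induction k)
  case (Suc k)
  show ?case using DERIV_imp_deriv[OF df] Suc by (simp add: C_def)
 qed (simp add: C_def)
 then have "(deriv ^^ k) (f B) 0 = 0" for k using C Y by (simp add: f_def Ad_mexp_0)
 moreover have "f B holomorphic_on UNIV" using df by (auto simp: holomorphic_on_open)
 ultimately show False
  using holomorphic_fun_eq_0_on_connected[of "f B" UNIV 0 t] connected_UNIV B(2) by (auto simp: f_def)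
qed

text \<open>Both \<open>g\<close> and its inverse are asked to preserve \<open>V\<close>, which
  makes closure under inversion immediate.\<close>

lemma alg_group_normaliser:
 fixes V :: "(complex^'n^'n) set" assumes G: "alg_group G" and V: "cmat.subspace V"
 shows "alg_group {g : G. (ALL Y:V. Ad g Y : V) & (ALL Y:V. Ad (matrix_inv g) Y : V)}" (is "alg_group ?N")
proof (rule alg_group_conditions[OF G])
 let ?V = "{B. ALL Y:V. trace (B ** Y) = 0}"
 let ?P = "(%(B, Y) g. trace (B ** Ad g Y)) ` (?V \<times> V) \<union> (%(B, Y) g. trace (B ** (matrix_inv g ** Y ** g))) ` (?V \<times> V)"
 show "?P \<subseteq> regs"
  by (auto intro!: regs_trace regs_mult_entry entry_regs inv_entry_regs polys_const regs_Ad)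
 have V_iff: "Z : V \<longleftrightarrow> (ALL B:?V. trace (B ** Z) = 0)" for Z
  using separate_subspace[OF V, of Z] by blast
 have inv: "matrix_inv g ** Y ** g = Ad (matrix_inv g) Y" if "g : G" for g Y
  by (simp add: Ad_def matrix_inv_inv alg_group_invertible[OF G that])
 show "?N = {g : G. ALL p:?P. p g = 0}" using inv unfolding V_iff by (auto simp: ball_Un)
 show "mat 1 : ?N" using alg_group_one[OF G] by (simp add: matrix_inv_mat1)
 show "g ** h : ?N" if "g : ?N" "h : ?N" for g h
 proof -
  have gh: "invertible g" "invertible h" using that alg_group_invertible[OF G] by auto
  have "matrix_inv (g ** h) = matrix_inv h ** matrix_inv g" using gh by (rule matrix_inv_mult)
  then show ?thesis using that alg_group_mult[OF G] gh by (simp add: Ad_mult invertible_matrix_inv)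
 qed
 show "matrix_inv g : ?N" if "g : ?N" for g
  using that alg_group_inv[OF G] alg_group_invertible[OF G] by (simp add: matrix_inv_inv)
qed

text \<open>A connected group is \<open>exp_closure\<close> of its Lie algebra, so it is enough that
  the exponentials lie in the normaliser of \<open>V\<close>.\<close>

lemma stable_connected:
 assumes Q: "connected_algebraic_group Q" and V: "cmat.subspace V"
  and br: "!!X Y. X : lie_algebra Q ==> Y : V ==> bracket X Y : V" shows "stable Q V"
proof -
 let ?N = "{g : Q. (ALL Y:V. Ad g Y : V) & (ALL Y:V. Ad (matrix_inv g) Y : V)}"
 have G: "alg_group Q" by (rule connected_algebraic_group_alg[OF Q])
 have "Q = exp_closure (lie_algebra Q)" using Q by (auto simp: group_of_def intro!: group_of_unique)
 also have "\<dots> \<subseteq> ?N"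
 proof (rule exp_closure_minimal[OF alg_group_normaliser[OF G V]])
  fix X t assume X: "X : lie_algebra Q"
  show "mexp X t : ?N" using mexp_in_group[OF G X] Ad_mexp_subspace[OF V br[OF X]] by (simp add: matrix_inv_mexp)
 qed
 finally show ?thesis using V by (auto simp: stable_def)
qed

lemma spectral_semisimple:
 fixes X :: "complex^'n^'n" assumes S: "spectral L E N" "X = (\<Sum>k\<in>L. cscale k (E k))"
 shows "semisimple_mat X"
proof (rule semisimple_mat_eigenvectors)
 let ?E = "{v. EX k. X *v v = k *s v}"
 have fin: "finite L" and orth: "!!k m. k : L ==> m : L ==> E k ** E m = (if k = m then E k else 0)"
  and one: "(\<Sum>k\<in>L. E k) = mat 1" using S(1) by (auto simp: spectral_def)
 have "v : vec.span ?E" for v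
 proof -
  have "E m *v v : ?E" if m: "m : L" for m
  proof -
   have "X ** E m = (\<Sum>k\<in>L. if k = m then cscale m (E m) else 0)"
    unfolding S(2) matrix_sum_left using m by (intro sum.cong) (auto simp: cscale_mult_left orth)
   then have "X ** E m = cscale m (E m)" using fin m by simp
   then show ?thesis by (simp add: matrix_vector_mul_assoc cscale_matrix_vector)
  qed
  then have "(\<Sum>m\<in>L. E m *v v) : vec.span ?E" by (intro vec.span_sum vec.span_base)
  then show ?thesis by (simp add: one flip: matrix_sum_vector)
 qed
 then show "vec.span ?E = UNIV" by blast
qed

lemma Ad_mexp_shift:
 assumes "bracket X (bracket X Y) = 0" shows "Ad (mexp X t) Y = Y + cscale t (bracket X Y)"
proof -
 let ?W = "bracket X Y"
 have W: "Ad (mexp X s) ?W = ?W" for s using Ad_mexp_eigen[of X ?W 0 s] assms by simp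
 have X: "Ad (mexp X s) X = X" for s using Ad_mexp_eigen[of X X 0 s] by simp
 have "mderiv (%s. Ad (mexp X s) Y - cscale s ?W) 0 s" for s
 proof -
  have "((%s::complex. - s) has_field_derivative - 1) (at s)" by (auto intro!: DERIV_minus)
  from mderiv_add[OF mderiv_Ad_mexp[of X Y s] mderiv_cscale[OF this, of ?W]]
  show ?thesis using Ad_bracket[OF invertible_mexp, of X s X Y] by (simp add: X W)
 qed
 then have "Ad (mexp X t) Y - cscale t ?W = Ad (mexp X 0) Y - cscale 0 ?W" by (rule mderiv_zero_const)
 then show ?thesis by (simp add: Ad_mexp_0 algebra_simps)
qed

subsection \<open>Quasi-reductive Lie algebras\<close>

lemma trace_Ad_Ad: "invertible g ==> trace (Ad g X ** Ad g Y) = trace (X ** Y)"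
 by (simp add: trace_Ad flip: Ad_prod)

lemma RED_Ad:
 assumes g: "invertible g" and red: "RED m" shows "RED (Ad g ` m)" unfolding RED_def
proof (intro ballI impI)
 fix X assume "X : Ad g ` m" and tr: "ALL Y:Ad g ` m. trace (X ** Y) = 0"
 then obtain Z where Z: "X = Ad g Z" "Z : m" by blast
 have "trace (Z ** Y) = 0" if "Y : m" for Y using tr that trace_Ad_Ad[OF g, of Z Y] by (simp add: Z(1))
 then show "X = 0" using REDD[OF red Z(2)] by (auto simp: Z(1) Ad_zero)
qed

lemma trace_stab_Ad:
 assumes G: "alg_group G" and V: "stable G h" "stable G V" and g: "g : G"
 shows "trace_stab h V (Ad g M) = Ad g ` trace_stab h V M"
proof -
 have sub: "Ad g X : trace_stab h V (Ad g M)" if g: "g : G" and X: "X : trace_stab h V M" for g X M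
 proof -
  have inv: "invertible g" by (rule alg_group_invertible[OF G g])
  have "trace (Ad g M ** bracket (Ad g X) Y) = 0" if Y: "Y : V" for Y
  proof -
   have "trace (M ** bracket X (Ad (matrix_inv g) Y)) = 0"
    using X by (auto simp: trace_stab_def intro!: stableD[OF V(2) alg_group_inv[OF G g] Y])
   moreover have "bracket (Ad g X) Y = Ad g (bracket X (Ad (matrix_inv g) Y))"
    by (simp add: Ad_bracket[OF inv] Ad_inv_right[OF inv])
   ultimately show ?thesis by (simp add: trace_Ad_Ad[OF inv])
  qed
  then show ?thesis using stableD[OF V(1) g] X by (simp add: trace_stab_def)
 qed
 have inv: "invertible g" by (rule alg_group_invertible[OF G g])
 show ?thesis
 proof (intro equalityI subsetI)
  fix X assume "X : trace_stab h V (Ad g M)"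
  from sub[OF alg_group_inv[OF G g] this] have "Ad (matrix_inv g) X : trace_stab h V M"
   by (simp add: Ad_inv_left[OF inv])
  moreover have "X = Ad g (Ad (matrix_inv g) X)" by (simp add: Ad_inv_right[OF inv])
  ultimately show "X : Ad g ` trace_stab h V M" by blast
 qed (use sub[OF g] in blast)
qed

text \<open>The nilpotent part of a central \<open>X\<close> is again in \<open>a\<close> and
  central, so it stabilises \<open>M\<close>. Its products with elements of the stabiliser are
  nilpotent, and \<open>RED\<close> makes it 0. This provides the word "strongly" for the
  stabilisers \<open>stab M\<close>.\<close>

lemma semisimple_centre:
 fixes S :: "(complex^'n^'n) set"
 assumes S: "alg_group S" and s: "a = lie_algebra S" and red: "RED (trace_stab a a M)" and X: "X : lie_centre a"
 shows "semisimple_mat X"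
proof -
 have Xs: "X : lie_algebra S" using X by (simp add: lie_centre_def s)
 obtain L e n where D: "spectral L (%k. mpoly (e k) X) (mpoly n X)" "X = (\<Sum>k\<in>L. cscale k (mpoly (e k) X)) + mpoly n X"
  by (rule spectral_decomposition)
 let ?N = "mpoly n X"
 have N: "?N : a" using replica(2)[OF S Xs D] by (simp add: s)
 have comm: "?N ** Y = Y ** ?N" if "Y : a" for Y
 using X that mpoly_commute[of X Y n] by (simp add: lie_centre_def bracket_def)
 have "?N = 0"
 proof (rule REDD[OF red])
  show "?N : trace_stab a a M" using N comm by (simp add: trace_stab_def bracket_def)
  fix Y assume "Y : trace_stab a a M"
  then have "nilpotent_mat (?N ** Y)"
   using D(1) comm by (intro nilpotent_mult_commute) (auto simp: spectral_def trace_stab_def)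
  then show "trace (?N ** Y) = 0" using trace_nilpotent by (auto simp: nilpotent_mat_iff)
 qed
 then show ?thesis using spectral_semisimple[OF D(1)] D(2) by simp
qed

lemma group_of_alg: "group_of h Q ==> alg_group Q"
 by (simp add: group_of_def connected_algebraic_group_alg)

lemma lie_stab_trace_stab:
 assumes Q: "group_of q Q" shows "lie_stab q q (res q M) = trace_stab q q M"
 using bracket_lie_algebra[OF group_of_alg[OF Q]] Q by (intro lie_stab_res) (auto simp: group_of_def)

lemma group_of_subspace: "group_of q Q ==> cmat.subspace q"
 using lie_algebra_subspace by (auto simp: group_of_def)

lemma reductive_type_res:
 assumes Q: "group_of q Q" and centre: "ALL X:lie_centre q. semisimple_mat X"
 shows "reductive_type Q b \<longleftrightarrow> (EX M. b = res q M & RED (trace_stab q q M))"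
by (metis reductive_type_iff[of Q b] assms dual_res[OF group_of_subspace[OF Q]] res_dual[OF group_of_subspace[OF Q]] lie_stab_trace_stab[OF Q] group_of_def)

lemma quasi_reductive_iff:
 assumes Q: "group_of q Q" and centre: "ALL X:lie_centre q. semisimple_mat X"
 shows "quasi_reductive q \<longleftrightarrow> (EX M. RED (trace_stab q q M))"
 using Q group_of_unique[of q] reductive_type_res[OF _ centre] unfolding quasi_reductive_def by metis

lemma strongly_quasi_reductive_iff:
 assumes Q: "group_of q Q" shows "strongly_quasi_reductive q \<longleftrightarrow>
  (ALL X:lie_centre q. semisimple_mat X) & (EX M. RED (trace_stab q q M))"
proof -
 have "lie_algebra (group_centre P) = lie_centre q" if "group_of q P" for P
  using that lie_algebra_group_centre[of P] by (simp add: group_of_def)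
 then have "strongly_quasi_reductive q \<longleftrightarrow>
   (ALL X:lie_centre q. semisimple_mat X) & (EX P. group_of q P & (EX b. reductive_type P b))"
  unfolding strongly_quasi_reductive_def by auto
 moreover have "(EX P. group_of q P & (EX b. reductive_type P b)) \<longleftrightarrow> (EX M. RED (trace_stab q q M))"
  if "ALL X:lie_centre q. semisimple_mat X" using quasi_reductive_iff[OF Q that] by (simp add: quasi_reductive_def)
 ultimately show ?thesis by blast
qed

lemma max_red_stab_eq:
 assumes Q: "group_of q Q" and centre: "ALL X:lie_centre q. semisimple_mat X" shows "max_red_stab q =
  {trace_stab q q M | M. RED (trace_stab q q M) & (ALL X:trace_stab q q M. trace (M ** X) = 0)}"
proof -
 have nil: "nilpotent_type q (res q M) \<longleftrightarrow> (ALL X:trace_stab q q M. trace (M ** X) = 0)" for M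
  unfolding nilpotent_type_def lie_stab_trace_stab[OF Q]
  by (auto simp: res_dual[OF group_of_subspace[OF Q]] res_apply trace_stab_def)
 show ?thesis
 proof (intro equalityI subsetI)
  fix m assume "m : max_red_stab q"
  then obtain b P where P: "m = lie_stab q q b" "group_of q P" "reductive_type P b" "nilpotent_type q b"
   unfolding max_red_stab_def by blast
  obtain M where M: "b = res q M" "RED (trace_stab q q M)" using P(2,3) reductive_type_res[OF P(2) centre] by blast
  then show "m : {trace_stab q q M | M. RED (trace_stab q q M) & (ALL X:trace_stab q q M. trace (M ** X) = 0)}"
   using P(1,4) lie_stab_trace_stab[OF Q] nil by blast
 next
  fix m assume "m : {trace_stab q q M | M. RED (trace_stab q q M) & (ALL X:trace_stab q q M. trace (M ** X) = 0)}"
  then obtain M where M: "m = trace_stab q q M" "RED (trace_stab q q M)" "ALL X:trace_stab q q M. trace (M ** X) = 0"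
   by blast
  then show "m : max_red_stab q"
   using reductive_type_res[OF Q centre] nil lie_stab_trace_stab[OF Q] Q by (fastforce simp: max_red_stab_def M(1))
 qed
qed

subsection \<open>Semi-direct products with an abelian ideal\<close>

locale semidirect_product =
 fixes Q Q0 q q0 b :: "(complex^'n^'n) set" assumes Q: "group_of q Q" and Q0: "group_of q0 Q0" "Q0 \<subseteq> Q"
  and semidirect: "semidirect q q0 b" and nilpotent: "ALL X:b. nilpotent_mat X"
begin

lemma group: "alg_group Q" "alg_group Q0" "lie_algebra Q = q" "lie_algebra Q0 = q0"
 using Q Q0 group_of_alg by (auto simp: group_of_def)

lemma subspaces: "cmat.subspace q" "cmat.subspace q0" "cmat.subspace b"
 using semidirect group_of_subspace[OF Q] by (auto simp: semidirect_def lie_subalgebra_def abelian_ideal_def)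

lemma subsets: "X : q0 ==> X : q" "X : b ==> X : q"
 using semidirect by (auto simp: semidirect_def lie_subalgebra_def abelian_ideal_def)

lemma brackets:
 "X : q ==> Y : q ==> bracket X Y : q" "X : q0 ==> Y : q0 ==> bracket X Y : q0"
 "X : q ==> Y : b ==> bracket X Y : b" "X : b ==> Y : b ==> bracket X Y = 0"
 using semidirect bracket_lie_algebra[OF group(1)]
 by (auto simp: semidirect_def lie_subalgebra_def abelian_ideal_def group)

lemma direct: "X : q0 ==> X : b ==> X = 0"
 using semidirect by (auto simp: semidirect_def)

lemma decompose:
 assumes "Z : q"
 obtains X Y where "X : q0" "Y : b" "Z = X + Y" using semidirect assms unfolding semidirect_def by blast

lemma stable_q: "stable Q q" and stable_q0: "stable Q0 q0"
 using stable_lie_algebra group by metis+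

lemma stable_a: "stable Q0 b"
 using Q0(1) brackets(3) subsets(1) by (intro stable_connected subspaces) (auto simp: group_of_def)

lemma trace_a:
 assumes "X : b" "Y : q" shows "trace (X ** Y) = 0" "trace (Y ** X) = 0"
proof -
 show "trace (X ** Y) = 0"
  by (rule trace_nilpotent_ideal[OF subspaces(3) _ _ _ assms]) (use brackets(3) nilpotent subsets(2) in auto)
 then show "trace (Y ** X) = 0" using trace_mul_sym[of Y X] by simp
qed

abbreviation stab :: "complex^'n^'n => (complex^'n^'n) set" where "stab M \<equiv> trace_stab q0 b M"

lemma stab_group: "alg_group (group_stab Q0 b (res b M))" "lie_algebra (group_stab Q0 b (res b M)) = stab M"
 using alg_group_stab[OF group(2) stable_a res_dual[OF subspaces(3)]]
  lie_algebra_stab[OF group(2) stable_a res_dual[OF subspaces(3)]] lie_stab_res[of q0 b M] brackets(3) subsets(1)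
 by (auto simp: group)

lemma lie_stab_res_a: "lie_stab q0 b (res b M) = stab M"
 using brackets(3) subsets(1) by (intro lie_stab_res) auto

lemma stab_group_of: "group_of (stab M) (exp_closure (stab M))"
 by (rule group_of_exp_closure(1)[OF stab_group])

lemma stab_q0: "X : stab M ==> X : q0"
 by (simp add: trace_stab_def)

lemma stab_bracket: "X : stab M ==> Y : stab M ==> bracket X Y : stab M"
 using brackets(2,3) subsets(1) by (intro trace_stab_bracket) auto

lemma stab_cong:
 assumes "res b N = res b M" shows "stab N = stab M" using assms lie_stab_res_a by metis

text \<open>The infinitesimal form of openness: the tangent space to the orbit of the restriction of
  \<open>M\<close> has zero annihilator in \<open>b\<close>, see
  \<open>free_orbit_iff\<close>.\<close>

definition free_orbit :: "complex^'n^'n => bool" where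
 "free_orbit M \<longleftrightarrow> (ALL Y:b. (ALL X:q0. trace (M ** bracket X Y) = 0) --> Y = 0)"

lemma free_orbitD: "free_orbit M ==> Y : b ==> (!!X. X : q0 ==> trace (M ** bracket X Y) = 0) ==> Y = 0"
 by (simp add: free_orbit_def)

lemma free_orbit_iff: "free_orbit M \<longleftrightarrow> openin (zariski_dual b) (dual_orbit Q0 b (res b M))"
proof -
 have "orbit_annihilator q0 b (res b M) = {Y:b. ALL X:q0. trace (M ** bracket X Y) = 0}"
  using brackets(3) subsets(1) by (auto simp: orbit_annihilator_def res_apply)
 then have "free_orbit M \<longleftrightarrow> orbit_annihilator q0 b (res b M) = {0}"
  using cmat.subspace_0[OF subspaces(3)] by (auto simp: free_orbit_def bracket_zero)
 then show ?thesis using open_orbit_annihilator[OF group(2) stable_a res_dual[OF subspaces(3)]]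
   annihilator_open_orbit[OF group(2) stable_a res_dual[OF subspaces(3)]] by (auto simp: group)
qed

lemma free_orbit_cong:
 assumes "res b N = res b M" shows "free_orbit N \<longleftrightarrow> free_orbit M"
 by (simp add: free_orbit_iff assms)

lemma dual_orbit_iff: "e : dual_orbit Q0 b (res b M) \<longleftrightarrow> (EX g:Q0. e = res b (Ad g M))"
 using dual_act_res[OF group(2) stable_a] by (auto simp: dual_orbit_def)

lemma free_orbit_Ad:
 assumes M: "free_orbit M" and g: "g : Q0" shows "free_orbit (Ad g M)" unfolding free_orbit_def
proof (intro ballI impI)
 fix Y assume Y: "Y : b" "ALL X:q0. trace (Ad g M ** bracket X Y) = 0"
 have inv: "invertible g" by (rule alg_group_invertible[OF group(2) g])
 have "Ad (matrix_inv g) Y = 0"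
 proof (rule free_orbitD[OF M])
  show "Ad (matrix_inv g) Y : b" by (rule stableD[OF stable_a alg_group_inv[OF group(2) g] Y(1)])
  fix X assume X: "X : q0"
  have "Ad g (bracket X (Ad (matrix_inv g) Y)) = bracket (Ad g X) Y"
   by (simp add: Ad_bracket[OF inv] Ad_inv_right[OF inv])
  then have "trace (M ** bracket X (Ad (matrix_inv g) Y)) = trace (Ad g M ** bracket (Ad g X) Y)"
   using trace_Ad_Ad[OF inv, of M "bracket X (Ad (matrix_inv g) Y)"] by simp
  then show "trace (M ** bracket X (Ad (matrix_inv g) Y)) = 0" using Y(2) stableD[OF stable_q0 g X] by simp
 qed
 then have "Ad g (Ad (matrix_inv g) Y) = 0" by (simp add: Ad_zero)
 then show "Y = 0" by (simp add: Ad_inv_right[OF inv])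
qed

lemma RED_free_orbit:
 assumes red: "RED (trace_stab q q M)" shows "free_orbit M" unfolding free_orbit_def
proof (intro ballI impI)
 fix Y assume Y: "Y : b" "ALL X:q0. trace (M ** bracket X Y) = 0"
 show "Y = 0"
 proof (rule REDD[OF red])
  have "trace (M ** bracket Y Z) = 0" if "Z : q" for Z
  proof -
   obtain X A where "X : q0" "A : b" "Z = X + A" using decompose[OF \<open>Z : q\<close>] .
   then show ?thesis using Y brackets(4) trace_bracket_swap[of M Y X] by (simp add: bracket_add_right)
  qed
  then show "Y : trace_stab q q M" using subsets(2)[OF Y(1)] by (simp add: trace_stab_def)
  show "trace (Y ** Z) = 0" if "Z : trace_stab q q M" for Z
   using trace_a(1)[OF Y(1)] that by (simp add: trace_stab_def)
 qed
qed

lemma stab_project: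
 assumes X: "X : q0" "A : b" "X + A : trace_stab q q M" shows "X : trace_stab (stab M) (stab M) M"
proof -
 have 0: "trace (M ** bracket (X + A) Y) = 0" if "Y : q" for Y using X(3) that by (simp add: trace_stab_def)
 have "trace (M ** bracket X Y) = 0" if "Y : b" for Y
  using 0[OF subsets(2)[OF that]] brackets(4)[OF X(2) that] by (simp add: bracket_add_left)
 moreover have "trace (M ** bracket X Y) = 0" if Y: "Y : stab M" for Y
 proof -
  have "trace (M ** bracket Y A) = 0" using Y X(2) by (simp add: trace_stab_def)
  then show ?thesis
   using 0[OF subsets(1)[OF stab_q0[OF Y]]] trace_bracket_swap[of M A Y] by (simp add: bracket_add_left trace_right_add)
 qed
 ultimately show ?thesis using X(1) by (simp add: trace_stab_def)
qed

text \<open>The functional \<open>Y \<mapsto> trace (M ** bracket X Y)\<close> on \<open>q0\<close>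
  vanishes on \<open>stab M\<close>, the left kernel of the pairing of \<open>q0\<close> with
  \<open>b\<close>; so some \<open>A\<close> in \<open>b\<close> represents it and compensates for
  \<open>X\<close>.\<close>

lemma stab_lift:
 assumes X: "X : trace_stab (stab M) (stab M) M" shows "EX A:b. X + A : trace_stab q q M"
proof -
 have X0: "X : q0" "X : stab M" using X by (auto simp: trace_stab_def)
 have "EX A:b. ALL Y:q0. trace (M ** bracket X Y) = trace (M ** bracket Y A)"
 proof (rule pairing_represents[OF subspaces(2,3)])
  show "form_on q0 b (%Y A. trace (M ** bracket Y A))"
   by (simp add: form_on_def clinear_on_def bracket_add_left bracket_add_right bracket_cscale_left bracket_cscale_right
     trace_right_add trace_right_scale)
  show "clinear_on q0 (*) (%Y. trace (M ** bracket X Y))"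
   by (simp add: clinear_on_def bracket_add_right bracket_cscale_right trace_right_add trace_right_scale)
  fix Y assume "Y : q0" "ALL A:b. trace (M ** bracket Y A) = 0"
  then have "Y : stab M" by (simp add: trace_stab_def)
  then show "trace (M ** bracket X Y) = 0" using X by (simp add: trace_stab_def)
 qed
 then obtain A where A: "A : b" "ALL Y:q0. trace (M ** bracket X Y) = trace (M ** bracket Y A)" by (elim bexE)
 have "trace (M ** bracket (X + A) Z) = 0" if "Z : q" for Z
 proof -
  obtain Y B where Z: "Y : q0" "B : b" "Z = Y + B" using decompose[OF \<open>Z : q\<close>] .
  have "trace (M ** bracket X B) = 0" using X0(2) Z(2) by (simp add: trace_stab_def)
  then show ?thesis using A(2) Z(1) brackets(4)[OF A(1) Z(2)] trace_bracket_swap[of M A Y]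
   by (simp add: Z(3) bracket_add_left bracket_add_right trace_right_add)
 qed
 moreover have "X + A : q" using X0(1) A(1) by (intro cmat.subspace_add[OF subspaces(1)] subsets)
 ultimately show ?thesis using A(1) by (auto simp: trace_stab_def)
qed

lemma RED_stab:
 assumes red: "RED (trace_stab q q M)" shows "RED (trace_stab (stab M) (stab M) M)" unfolding RED_def
proof (intro ballI impI)
 fix X assume X: "X : trace_stab (stab M) (stab M) M" "ALL Y:trace_stab (stab M) (stab M) M. trace (X ** Y) = 0"
 obtain A where A: "A : b" "X + A : trace_stab q q M" using stab_lift[OF X(1)] by (elim bexE)
 have X0: "X : q0" using X(1) by (simp add: trace_stab_def)
 have "X + A = 0"
 proof (rule REDD[OF red A(2)])
  fix Z assume Z: "Z : trace_stab q q M"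
  then have Zq: "Z : q" by (simp add: trace_stab_def)
  obtain Y B where YB: "Y : q0" "B : b" "Z = Y + B" using decompose[OF Zq] .
  then have "trace (X ** Y) = 0" using X(2) stab_project[of Y B M] Z by simp
  then show "trace ((X + A) ** Z) = 0" using trace_a(1)[OF A(1) Zq] trace_a(2)[OF YB(2) subsets(1)[OF X0]]
   by (simp add: trace_left_add) (simp add: YB(3) trace_right_add)
 qed
 then have "X = - A" by (simp add: eq_neg_iff_add_eq_0)
 then have "X : b" using cmat.subspace_neg[OF subspaces(3) A(1)] by simp
 then show "X = 0" by (rule direct[OF X0])
qed

text \<open>The extension is zero on \<open>[c, q0]\<close>, which is possible because the coinvariants of the reductive
 algebra \<open>c\<close> on \<open>q0\<close> restrict to those on the stabiliser of \<open>M\<close>.\<close>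

lemma stab_extend:
 assumes M: "free_orbit M" and c: "c = trace_stab (stab M) (stab M) M'" and red: "RED c"
 shows "EX N. res b N = res b M & (ALL X:stab M. trace (N ** X) = trace (M' ** X)) & trace_stab q q N = c"
proof -
 have sub: "cmat.subspace (stab M)" by (rule trace_stab_subspace[OF subspaces(2)])
 let ?S = "exp_closure (stab M)"
 have S: "alg_group ?S" "lie_algebra ?S = stab M" using stab_group_of[of M] group_of_alg by (auto simp: group_of_def)
 have stS: "stable ?S (stab M)" using stable_lie_algebra[OF S(1)] by (simp add: S)
 let ?K = "group_stab ?S (stab M) (res (stab M) M')"
 have K: "alg_group ?K" "lie_algebra ?K = c"
  using alg_group_stab[OF S(1) stS res_dual[OF sub]] lie_algebra_stab[OF S(1) stS res_dual[OF sub]]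
   lie_stab_res[of "stab M" "stab M" M'] stab_bracket by (auto simp: S c)
 have ms: "X : stab M" if "X : c" for X using that by (simp add: c trace_stab_def)
 let ?B = "cmat.span {bracket X Y | X Y. X : c & Y : stab M}" and ?D = "cmat.span {bracket X Y | X Y. X : c & Y : q0}"
 have MB: "trace (M' ** X) = 0" if "X : ?B" for X
 proof -
  have "cmat.subspace {X. trace (M' ** X) = 0}" by (intro cmat.subspaceI) (auto simp: trace_right_add trace_right_scale)
  then have "?B \<subseteq> {X. trace (M' ** X) = 0}" by (intro cmat.span_minimal) (auto simp: c trace_stab_def)
  then show ?thesis using that by blast
 qed
 have Bs: "?B \<subseteq> stab M" using stab_bracket ms by (intro cmat.span_minimal[OF _ sub]) auto
 have SD: "X : ?B" if X: "X : stab M" "X : ?D" for X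
 proof (rule coinvariants[OF K(1) refl subspaces(2) cmat.subspace_span], unfold K(2))
  show "?B \<subseteq> q0" using Bs stab_q0 by blast
  show "bracket Y Z : q0" if "Y : c" "Z : q0" for Y Z using that ms stab_q0 brackets(2) by blast
  show "bracket Y Z : ?B" if "Y : c" "Z : ?B" for Y Z using that Bs by (intro cmat.span_base) blast
  show "bracket Y Z : ?B" if "Y : rad c" for Y Z
  proof -
   have "cmat.subspace c" unfolding c by (rule trace_stab_subspace[OF sub])
   then have "Y = 0" using red RED_rad that by blast
   then show ?thesis using cmat.span_zero by (simp add: bracket_zero)
  qed
  show "X : q0" by (rule stab_q0[OF X(1)])
  show "bracket Y X : ?B" if "Y : c" for Y using that X(1) by (intro cmat.span_base) blast
  show "X : cmat.span ({bracket X Y | X Y. X : c & Y : q0} \<union> ?B)" using X(2) cmat.span_mono by blast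
 qed
 have "EX D. (ALL X:stab M. trace (D ** X) = trace (M' ** X)) & (ALL X:?D. trace (D ** X) = 0)"
  using SD MB by (intro functional_glue sub cmat.subspace_span) blast
 then obtain D where D: "ALL X:stab M. trace (D ** X) = trace (M' ** X)" "ALL X:?D. trace (D ** X) = 0" by (elim exE conjE)
 \<comment> \<open>The new form has to agree with \<open>D\<close> on \<open>q0\<close> and with
   \<open>M\<close> on \<open>b\<close>; the correction to \<open>M\<close> exists because the sum
   is direct.\<close>
 have "EX N. (ALL X:q0. trace (N ** X) = trace ((D - M) ** X)) & (ALL X:b. trace (N ** X) = 0)"
  using direct by (intro functional_glue subspaces) fastforce
 then obtain N' where N': "ALL X:q0. trace (N' ** X) = trace ((D - M) ** X)" "ALL X:b. trace (N' ** X) = 0"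
  by (elim exE conjE)
 define N where "N = M + N'"
 have N0: "trace (N ** X) = trace (D ** X)" if "X : q0" for X
  using N'(1) that by (simp add: N_def trace_left_add trace_left_diff)
 have Na: "res b N = res b M" using N'(2) by (simp add: res_eq_iff N_def trace_left_add)
 have Ns: "trace (N ** X) = trace (M' ** X)" if "X : stab M" for X using that D(1) N0 stab_q0 by simp
 have st: "stab N = stab M" by (rule stab_cong[OF Na])
 have st_eq: "trace_stab (stab N) (stab N) N = c"
  unfolding st c using Ns stab_bracket by (auto simp: trace_stab_def[of "stab M"])
 have mN: "X : trace_stab q q N" if X: "X : c" for X
 proof -
  have "trace (N ** bracket X Z) = 0" if "Z : q" for Z
  proof -
   obtain Y A where Z: "Y : q0" "A : b" "Z = Y + A" using decompose[OF \<open>Z : q\<close>] .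
   have "bracket X Y : ?D" using X Z(1) by (intro cmat.span_base) blast
   then have "trace (N ** bracket X Y) = 0" using N0 brackets(2) stab_q0[OF ms[OF X]] Z(1) D(2) by simp
   moreover have "trace (N ** bracket X A) = 0" using ms[OF X] Z(2) unfolding st[symmetric] by (simp add: trace_stab_def)
   ultimately show ?thesis by (simp add: Z(3) bracket_add_right trace_right_add)
  qed
  then show ?thesis using subsets(1)[OF stab_q0[OF ms[OF X]]] by (simp add: trace_stab_def)
 qed
 have "X : c" if X: "X : trace_stab q q N" for X
 proof -
  have Xq: "X : q" using X by (simp add: trace_stab_def)
  obtain Y A where YA: "Y : q0" "A : b" "X = Y + A" using decompose[OF Xq] .
  have Y: "Y : c" using stab_project[of Y A N] YA X st_eq by simp
  have "A = X - Y" by (simp add: YA(3))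
  also have "\<dots> : trace_stab q q N" by (rule cmat.subspace_diff[OF trace_stab_subspace[OF subspaces(1)] X mN[OF Y]])
  finally have A: "A : trace_stab q q N" .
  have "A = 0"
  proof (rule free_orbitD[OF _ YA(2)])
   show "free_orbit N" using M free_orbit_cong[OF Na] by simp
   show "trace (N ** bracket Z A) = 0" if "Z : q0" for Z
    using A subsets(1)[OF that] trace_bracket_swap[of N Z A] by (simp add: trace_stab_def)
  qed
  then show ?thesis using Y YA(3) by simp
 qed
 then have "trace_stab q q N = c" using mN by blast
 then show ?thesis using Na Ns by (intro exI[of _ N]) blast
qed

text \<open>Duality between \<open>q0\<close> and \<open>b\<close> writes \<open>N - M\<close> on
  \<open>q0\<close> as bracketing with some \<open>A\<close> in \<open>b\<close>. Because
  \<open>b\<close> is an abelian ideal, double brackets with \<open>A\<close> vanish, so the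
  conjugation by \<open>mexp A 1\<close> changes \<open>M\<close> by exactly this amount.\<close>

lemma unipotent_conjugate:
 assumes N: "res b N = res b M" "!!X. X : stab M ==> trace (N ** X) = trace (M ** X)"
 shows "EX g:Q. res q N = res q (Ad g M)"
proof -
 have "EX A:b. ALL X:q0. trace ((N - M) ** X) = trace (M ** bracket X A)"
 proof (rule pairing_represents[OF subspaces(2,3)])
  show "form_on q0 b (%X A. trace (M ** bracket X A))"
   by (simp add: form_on_def clinear_on_def bracket_add_left bracket_add_right bracket_cscale_left bracket_cscale_right
     trace_right_add trace_right_scale)
  show "clinear_on q0 (*) (%X. trace ((N - M) ** X))"
   by (simp add: clinear_on_def trace_right_add trace_right_scale)
  show "trace ((N - M) ** X) = 0" if "X : q0" "ALL A:b. trace (M ** bracket X A) = 0" for X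
   using N(2)[of X] that by (simp add: trace_stab_def trace_left_diff)
 qed
 then obtain A where A: "A : b" "ALL X:q0. trace ((N - M) ** X) = trace (M ** bracket X A)" by (elim bexE)
 let ?g = "mexp A 1"
 have "trace (Ad ?g M ** Z) = trace (N ** Z)" if Z: "Z : q" for Z
 proof -
  obtain X B where XB: "X : q0" "B : b" "Z = X + B" using decompose[OF Z] .
  have "bracket A Z : b" using brackets(3)[OF Z A(1)] cmat.subspace_neg[OF subspaces(3)] by (simp add: bracket_minus[of A Z])
  then have "bracket A (bracket A Z) = 0" by (rule brackets(4)[OF A(1)])
  then have "Ad (mexp A (- 1)) Z = Z + cscale (- 1) (bracket A Z)" by (rule Ad_mexp_shift)
  also have "\<dots> = Z + bracket X A"
   by (simp add: XB(3) bracket_add_right brackets(4)[OF A(1) XB(2)] bracket_minus[of X A])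
  finally have "trace (Ad ?g M ** Z) = trace (M ** Z) + trace (M ** bracket X A)"
   by (simp add: trace_Ad_prod[OF invertible_mexp] matrix_inv_mexp trace_right_add)
  also have "\<dots> = trace (M ** X) + trace ((N - M) ** X) + trace (M ** B)"
   using A(2) XB(1) by (simp add: XB(3) trace_right_add)
  also have "\<dots> = trace (N ** Z)"
   using N(1) XB(2) by (simp add: XB(3) trace_right_add trace_left_diff res_eq_iff) finally show ?thesis .
 qed
 moreover have "?g : Q" using mexp_in_group[OF group(1), of A 1] subsets(2)[OF A(1)] by (simp add: group)
 ultimately show ?thesis by (intro bexI[of _ ?g]) (simp_all add: res_eq_iff)
qed

lemma trace_stab_cong:
 assumes "res q N = res q M" shows "trace_stab q q N = trace_stab q q M"
 using assms lie_stab_trace_stab[OF Q] by metis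

lemma trace_stab_Ad_q: "g : Q ==> trace_stab q q (Ad g M) = Ad g ` trace_stab q q M"
 by (rule trace_stab_Ad[OF group(1) stable_q stable_q])

text \<open>\<open>M\<close> is compared with the extension \<open>N\<close> of its restriction,
  whose stabiliser is \<open>?m\<close> itself. The two forms are conjugate and agree on
  \<open>stab M\<close>, so the value 0 on the stabiliser is carried over to
  \<open>?m\<close>.\<close>

lemma stab_nilpotent:
 assumes red: "RED (trace_stab q q M)" and nil: "!!X. X : trace_stab q q M ==> trace (M ** X) = 0"
 shows "EX g:Q. trace_stab q q M = Ad g ` trace_stab (stab M) (stab M) M"
  and "X : trace_stab (stab M) (stab M) M ==> trace (M ** X) = 0"
proof -
 let ?m = "trace_stab (stab M) (stab M) M"
 obtain N where N: "res b N = res b M" "ALL X:stab M. trace (N ** X) = trace (M ** X)" "trace_stab q q N = ?m"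
  using stab_extend[OF RED_free_orbit[OF red] refl RED_stab[OF red]] by (elim exE conjE)
 obtain g where g: "g : Q" "res q N = res q (Ad g M)" using unipotent_conjugate[OF N(1)] N(2) by blast
 have inv: "invertible g" by (rule alg_group_invertible[OF group(1) g(1)])
 have m: "?m = Ad g ` trace_stab q q M" using trace_stab_cong[OF g(2)] trace_stab_Ad_q[OF g(1)] N(3) by simp
 have "Ad (matrix_inv g) ` ?m = trace_stab q q M" unfolding m image_image by (simp add: Ad_inv_left[OF inv])
 then show "EX g:Q. trace_stab q q M = Ad g ` ?m" using alg_group_inv[OF group(1) g(1)] by blast
 assume X: "X : ?m"
 then have Xs: "X : stab M" by (simp add: trace_stab_def)
 obtain Z where Z: "X = Ad g Z" "Z : trace_stab q q M" using X unfolding m by blast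
 have "trace (M ** X) = trace (N ** X)" using N(2) Xs by simp
 also have "\<dots> = trace (Ad g M ** Ad g Z)"
  using g(2) subsets(1)[OF stab_q0[OF Xs]] by (simp add: res_eq_iff Z(1))
 also have "\<dots> = 0" using nil[OF Z(2)] by (simp add: trace_Ad_Ad[OF inv])
 finally show "trace (M ** X) = 0" .
qed

lemma stab_centre:
 assumes "RED (trace_stab (stab M) (stab M) M')" shows "ALL X:lie_centre (stab M). semisimple_mat X"
 using semisimple_centre[OF group_of_alg[OF stab_group_of[of M]] _ assms] stab_group_of[of M] by (auto simp: group_of_def)

text \<open>A form on \<open>q\<close> can be moved by \<open>Q0\<close> until its restriction to
  \<open>b\<close> is that of \<open>M\<close>, where \<open>stab_nilpotent\<close> applies.
  Conversely \<open>stab_extend\<close> realises each representative for \<open>stab M\<close> as a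
  stabiliser in \<open>q\<close>.\<close>

lemma max_red_stab_conjugate:
 assumes centre: "ALL X:lie_centre q. semisimple_mat X" and red: "RED (trace_stab q q M)"
 shows "max_red_stab (stab M) \<noteq> {}"
  and "max_red_stab q = {Ad g ` c | g c. g : Q & c : max_red_stab (stab M)}"
proof -
 note eq_q = max_red_stab_eq[OF Q centre]
 note eq_s = max_red_stab_eq[OF stab_group_of stab_centre[OF RED_stab[OF red]]]
 have "EX N. RED (trace_stab (stab M) (stab M) N) & (ALL X:trace_stab (stab M) (stab M) N. trace (N ** X) = 0)"
  by (rule exists_nilpotent_reductive_form[OF stab_group(1) _ RED_stab[OF red]]) (simp add: stab_group(2))
 then show "max_red_stab (stab M) \<noteq> {}" unfolding eq_s by blast
 show "max_red_stab q = {Ad g ` c | g c. g : Q & c : max_red_stab (stab M)}"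
 proof (intro equalityI subsetI)
  fix c assume "c : max_red_stab q"
  then obtain N where N: "c = trace_stab q q N" "RED (trace_stab q q N)" "ALL X:trace_stab q q N. trace (N ** X) = 0"
   unfolding eq_q by blast
  \<comment> \<open>Two nonempty open orbits in an irreducible space meet, so the restrictions of
    \<open>M\<close> and \<open>N\<close> are conjugate.\<close>
  have "dual_orbit Q0 b (res b M) \<inter> dual_orbit Q0 b (res b N) \<noteq> {}"
   using RED_free_orbit[OF red] RED_free_orbit[OF N(2)] alg_group_one[OF group(2)] unfolding free_orbit_iff
   by (intro openin_zariski_dual_Int[OF subspaces(3)]) (auto simp: dual_orbit_def)
  then obtain h k where hk: "h : Q0" "k : Q0" "res b (Ad h M) = res b (Ad k N)" by (auto simp: dual_orbit_iff)
  define g where "g = matrix_inv h ** k"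
  have inv: "invertible h" "invertible k" using hk alg_group_invertible[OF group(2)] by auto
  have g0: "g : Q0" unfolding g_def by (intro alg_group_mult[OF group(2)] alg_group_inv[OF group(2)] hk)
  then have gQ: "g : Q" using Q0(2) by blast
  have invg: "invertible g" by (rule alg_group_invertible[OF group(2) g0])
  have "res b (Ad (matrix_inv h) (Ad h M)) = res b (Ad (matrix_inv h) (Ad k N))"
   by (rule res_Ad_cong[OF group(2) stable_a alg_group_inv[OF group(2) hk(1)] hk(3)])
  then have resg: "res b (Ad g N) = res b M"
   by (simp add: g_def Ad_inv_left[OF inv(1)] Ad_mult invertible_matrix_inv inv)
  have stabg: "stab (Ad g N) = stab M" by (rule stab_cong[OF resg])
  have stN: "trace_stab q q (Ad g N) = Ad g ` c" unfolding N(1) by (rule trace_stab_Ad_q[OF gQ])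
  have redg: "RED (trace_stab q q (Ad g N))" unfolding stN N(1) by (rule RED_Ad[OF invg N(2)])
  have nilg: "trace (Ad g N ** X) = 0" if "X : trace_stab q q (Ad g N)" for X
   using that N(1,3) unfolding stN by (auto simp: trace_Ad_Ad[OF invg])
  let ?m = "trace_stab (stab M) (stab M) (Ad g N)"
  obtain a where a: "a : Q" "trace_stab q q (Ad g N) = Ad a ` ?m"
   using stab_nilpotent(1)[OF redg nilg] unfolding stabg by blast
  have m: "?m : max_red_stab (stab M)"
   using stab_nilpotent(2)[OF redg nilg] RED_stab[OF redg] unfolding eq_s stabg by blast
  have "c = Ad (matrix_inv g) ` Ad g ` c" unfolding image_image by (simp add: Ad_inv_left[OF invg])
  also have "\<dots> = Ad (matrix_inv g) ` Ad a ` ?m" using stN a(2) by simp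
  also have "\<dots> = Ad (matrix_inv g ** a) ` ?m"
   unfolding image_image using alg_group_invertible[OF group(1) a(1)] by (simp add: Ad_mult invertible_matrix_inv invg)
  finally have "c = Ad (matrix_inv g ** a) ` ?m" .
  moreover have "matrix_inv g ** a : Q" by (intro alg_group_mult[OF group(1)] alg_group_inv[OF group(1)] gQ a(1))
  ultimately show "c : {Ad g ` c | g c. g : Q & c : max_red_stab (stab M)}" using m by blast
 next
  fix d assume "d : {Ad g ` c | g c. g : Q & c : max_red_stab (stab M)}"
  then obtain g c where g: "d = Ad g ` c" "g : Q" and "c : max_red_stab (stab M)" by blast
  then obtain M' where M': "c = trace_stab (stab M) (stab M) M'" "RED c" "ALL X:c. trace (M' ** X) = 0" unfolding eq_s by blast
  have inv: "invertible g" by (rule alg_group_invertible[OF group(1) g(2)])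
  obtain N where N: "ALL X:stab M. trace (N ** X) = trace (M' ** X)" "trace_stab q q N = c"
   using stab_extend[OF RED_free_orbit[OF red] M'(1,2)] by (elim exE conjE)
  have st: "trace_stab q q (Ad g N) = d" unfolding g(1) trace_stab_Ad_q[OF g(2)] N(2) ..
  have "X : stab M" if "X : c" for X using that unfolding M'(1) trace_stab_def[of "stab M"] by blast
  then have "trace (N ** X) = 0" if "X : c" for X using N(1) M'(3) that by simp
  then have "trace (Ad g N ** X) = 0" if "X : d" for X using that unfolding g(1) by (auto simp: trace_Ad_Ad[OF inv])
  moreover have "RED d" unfolding g(1) by (rule RED_Ad[OF inv M'(2)])
  ultimately show "d : max_red_stab q" unfolding eq_q using st by blast
 qed
qed

end

text \<open>Coincidence of maximal reductive stabilisers is expressed by sets of representatives: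
  those for \<open>\<qq>\<close> are exactly the \<open>Q\<close>-conjugates of those for the
  stabiliser. Nonemptiness rules out a vacuous equality.\<close>

theorem lemma4p3:
 fixes Q Q0 \<qq> \<qq>0 \<aa> :: "(complex^'n^'n) set"
 assumes Q: "connected_algebraic_group Q" and \<qq>: "\<qq> = lie_algebra Q"
  and semidirect: "semidirect \<qq> \<qq>0 \<aa>" and nilpotent: "\<forall>X\<in>\<aa>. nilpotent_mat X"
  and centre: "\<forall>X\<in>lie_centre \<qq>. semisimple_mat X"
  and Q0: "Q0 \<subseteq> Q" "connected_algebraic_group Q0" "lie_algebra Q0 = \<qq>0"
 shows "(quasi_reductive \<qq> \<longleftrightarrow>
      (\<exists>\<gamma>\<in>dual \<aa>. openin (zariski_dual \<aa>) (dual_orbit Q0 \<aa> \<gamma>)) \<and>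
      generic_in_dual \<aa> (\<lambda>\<gamma>. strongly_quasi_reductive (lie_stab \<qq>0 \<aa> \<gamma>))) \<and>
     (quasi_reductive \<qq> \<longrightarrow>
      generic_in_dual \<aa> (\<lambda>\<gamma>.
       max_red_stab (lie_stab \<qq>0 \<aa> \<gamma>) \<noteq> {} \<and>
       max_red_stab \<qq> =
        {Ad g ` M | g M. g \<in> Q \<and> M \<in> max_red_stab (lie_stab \<qq>0 \<aa> \<gamma>)}))"
proof -
 interpret semidirect_product Q Q0 \<qq> \<qq>0 \<aa> using assms by unfold_locales (auto simp: group_of_def)
 have q: "group_of \<qq> Q" using Q \<qq> by (simp add: group_of_def)
 \<comment> \<open>A single form of reductive type produces a whole open orbit of restrictions with
   the same property; this orbit serves as the generic set.\<close>
 have orbit: "EX M0. openin (zariski_dual \<aa>) (dual_orbit Q0 \<aa> (res \<aa> M0)) &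
   (ALL \<gamma>:dual_orbit Q0 \<aa> (res \<aa> M0). EX M. \<gamma> = res \<aa> M & RED (trace_stab \<qq> \<qq> M))"
  if "quasi_reductive \<qq>"
 proof -
  obtain M0 where M0: "RED (trace_stab \<qq> \<qq> M0)" using \<open>quasi_reductive \<qq>\<close> quasi_reductive_iff[OF q centre] by blast
  have "EX M. \<gamma> = res \<aa> M & RED (trace_stab \<qq> \<qq> M)" if \<gamma>: "\<gamma> : dual_orbit Q0 \<aa> (res \<aa> M0)" for \<gamma>
  proof -
   obtain g where g: "g : Q0" "\<gamma> = res \<aa> (Ad g M0)" using \<gamma> by (auto simp: dual_orbit_iff)
   then have "RED (trace_stab \<qq> \<qq> (Ad g M0))"
    using trace_stab_Ad_q[of g M0] RED_Ad[OF alg_group_invertible[OF group(2) g(1)] M0] \<open>Q0 \<subseteq> Q\<close> by auto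
   then show ?thesis using g(2) by blast
  qed
  then show ?thesis using RED_free_orbit[OF M0] by (auto simp: free_orbit_iff)
 qed
 have self: "res \<aa> M : dual_orbit Q0 \<aa> (res \<aa> M)" for M
  using alg_group_one[OF group(2)] by (auto simp: dual_orbit_iff intro!: bexI[of _ "mat 1"])
 have generic: "generic_in_dual \<aa> P" if "quasi_reductive \<qq>" and P: "!!M. RED (trace_stab \<qq> \<qq> M) ==> P (res \<aa> M)" for P
 proof -
  obtain M0 where M0: "openin (zariski_dual \<aa>) (dual_orbit Q0 \<aa> (res \<aa> M0))"
   "ALL \<gamma>:dual_orbit Q0 \<aa> (res \<aa> M0). EX M. \<gamma> = res \<aa> M & RED (trace_stab \<qq> \<qq> M)"
   using orbit[OF \<open>quasi_reductive \<qq>\<close>] by (elim exE conjE)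
  have "ALL \<gamma>:dual_orbit Q0 \<aa> (res \<aa> M0). P \<gamma>" using M0(2) P by metis
  then show ?thesis unfolding generic_in_dual_def using M0(1) self[of M0] by blast
 qed
 have "quasi_reductive \<qq>"
  if \<gamma>0: "\<gamma>0 : dual \<aa>" "openin (zariski_dual \<aa>) (dual_orbit Q0 \<aa> \<gamma>0)"
   and gen: "generic_in_dual \<aa> (%\<gamma>. strongly_quasi_reductive (lie_stab \<qq>0 \<aa> \<gamma>))" for \<gamma>0
 proof -
  obtain M0 where M0: "\<gamma>0 = res \<aa> M0" using dual_res[OF subspaces(3) \<gamma>0(1)] by blast
  obtain U where U: "openin (zariski_dual \<aa>) U" "U \<noteq> {}" "ALL \<gamma>:U. strongly_quasi_reductive (lie_stab \<qq>0 \<aa> \<gamma>)"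
   using gen by (auto simp: generic_in_dual_def)
  \<comment> \<open>The open orbit meets the generic set, so a single point has both an open orbit
    and a strongly quasi-reductive stabiliser.\<close>
  have "dual_orbit Q0 \<aa> \<gamma>0 \<inter> U \<noteq> {}"
   using openin_zariski_dual_Int[OF subspaces(3) \<gamma>0(2) _ U(1,2)] self[of M0] by (auto simp: M0)
  then obtain g where g: "g : Q0" "res \<aa> (Ad g M0) : U" by (auto simp: M0 dual_orbit_iff)
  let ?M = "Ad g M0"
  have free: "free_orbit ?M" using \<gamma>0(2) by (intro free_orbit_Ad g(1)) (simp add: free_orbit_iff M0)
  have "strongly_quasi_reductive (stab ?M)" using U(3) g(2) lie_stab_res_a[of ?M] by metis
  then obtain M' where "RED (trace_stab (stab ?M) (stab ?M) M')"
   using strongly_quasi_reductive_iff[OF stab_group_of[of ?M]] by blast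
  then obtain N where "RED (trace_stab \<qq> \<qq> N)" using stab_extend[OF free refl] by metis
  then show ?thesis using quasi_reductive_iff[OF q centre] by blast
 qed
 moreover have "EX \<gamma>:dual \<aa>. openin (zariski_dual \<aa>) (dual_orbit Q0 \<aa> \<gamma>)" if "quasi_reductive \<qq>"
  using orbit[OF that] res_dual[OF subspaces(3)] by blast
 moreover have "generic_in_dual \<aa> (%\<gamma>. strongly_quasi_reductive (lie_stab \<qq>0 \<aa> \<gamma>))" if "quasi_reductive \<qq>"
 proof (rule generic[OF that])
  fix M assume "RED (trace_stab \<qq> \<qq> M)"
  from RED_stab[OF this] show "strongly_quasi_reductive (lie_stab \<qq>0 \<aa> (res \<aa> M))"
   unfolding lie_stab_res_a strongly_quasi_reductive_iff[OF stab_group_of] using stab_centre by blast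
 qed
 moreover have "generic_in_dual \<aa> (%\<gamma>. max_red_stab (lie_stab \<qq>0 \<aa> \<gamma>) \<noteq> {} &
   max_red_stab \<qq> = {Ad g ` M | g M. g : Q & M : max_red_stab (lie_stab \<qq>0 \<aa> \<gamma>)})" if "quasi_reductive \<qq>"
  using that by (rule generic) (use max_red_stab_conjugate[OF centre] in \<open>simp add: lie_stab_res_a\<close>)
 ultimately show ?thesis by blast
qed

end
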